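(* Let $p$ be a prime number and let $R$ be a $C_p$-Tambara functor such that the transfer $R(C_p/e)\to R(C_p/C_p)$ is not surjective. Then the canonical map $\Gamma(R)\to\mathrm{CoInd}_e^{C_p}R(C_p/e)$ is étale, but the induced map $\mathrm{Spec}(\mathrm{CoInd}_e^{C_p}R(C_p/e))\to\mathrm{Spec}(\Gamma(R))$ on Nakaoka spectra is not open.
   Context: Tambara functors are evaluated on transitive $G$-sets and extended by $R(X \sqcup Y) = R(X) \times R(Y)$. A Tambara ideal $I$ of a $G$-Tambara functor $R$ is a collection of ideals $I(G/H) \subseteq R(G/H)$ closed under all transfers, norms, restrictions and conjugations. The product $I\cdot J$ is the smallest Tambara ideal containing all $I(G/H)\cdot J(G/H)$. A Tambara ideal $\mathfrak{p}$ is prime if $\mathfrak{p}\neq R$ and $I\cdot J\subseteq \mathfrak{p}$ implies $I\subseteq\mathfrak{p}$ or $J\subseteq\mathfrak{p}$. The Nakaoka spectrum $\mathrm{Spec}(R)$ is the set of prime Tambara ideals with closed sets $V(I)=\{\mathfrak{p}: I\subseteq\mathfrak{p}\}$; maps of Tambara functors induce maps of spectra by taking preimages. The ghost $\Gamma(R)$ of a $C_p$-Tambara functor $R$ is the $C_p$-Tambara functor with $\Gamma(R)(C_p/e)=R(C_p/e)$ (same $C_p$-action) and $\Gamma(R)(C_p/C_p)=R(C_p/e)^{C_p}\times R(C_p/C_p)/\mathrm{Tr}$, where $R(C_p/C_p)/\mathrm{Tr}$ is the quotient by the image of the transfer; its restriction is $(a,b)\mapsto a$, its transfer $x\mapsto(\sum_g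 gx,0)$ and its norm $x\mapsto(\prod_g gx,[\mathrm{Nm}(x)])$. For a commutative ring $Q$ (i.e. an $e$-Tambara functor), $\mathrm{CoInd}_e^{C_p}Q$ is the $C_p$-Tambara functor $X\mapsto \prod_{x\in X}Q$; $\mathrm{CoInd}_e^{C_p}$ is right adjoint to $\mathrm{Res}_e^{C_p}:S\mapsto S(C_p/e)$. The canonical map is the adjunction unit $\Gamma(R)\to\mathrm{CoInd}_e^{C_p}\mathrm{Res}_e^{C_p}\Gamma(R)=\mathrm{CoInd}_e^{C_p}R(C_p/e)$. A map $R\to S$ of $G$-Tambara functors is étale if: (a) $S$ is finitely presented as an $R$-algebra in $G$-Tambara functors (a coequalizer of a pair of maps between free Tambara $R$-algebras on finitely many generators, each generator living at some level $G/H$); (b) $S$ is flat as an $R$-module, i.e. the relative box product $S\boxtimes_R -$ is exact on $R$-modules (modules over the underlying Green functor); and (c) the genuine Kähler differentials $\Omega^{1,G}_{S/R}=I/I^{>1}$ vanish, where $I$ is the kernel of the multiplication $S\boxtimes_R S\to S$ and $I^{>1}$ is the Tambara ideal generated by all norms $N_h(a)$ of elements $a\in I(X)$ along maps $h:X\to Y$ of finite $G$-sets all of whose fibers have at least two elements. *)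

theory Defs
  imports
    "HOL-Algebra.Chinese_Remainder"
    "HOL-Algebra.Elementary_Groups"
    "HOL-Algebra.Free_Abelian_Groups"
    "HOL-Algebra.Group_Action"
    "HOL-Algebra.Module"
    "HOL-Computational_Algebra.Primes"
    "HOL-Analysis.Abstract_Topology"
begin

section \<open>Tambara functors for a group of prime order\<close>

text \<open>
  Throughout, \<open>G\<close> is meant to be a group of prime order \<open>p\<close>, written \<open>C_p\<close> on paper. Its
  transitive \<open>G\<close>-sets are \<open>G/e\<close> and \<open>G/G\<close>; a Tambara functor is given by its values \<open>lev_e\<close> and
  \<open>lev_G\<close> there, the conjugation action \<open>act\<close> on \<open>lev_e\<close> (conjugations on \<open>lev_G\<close> are trivial), and
  the restriction, transfer and norm along \<open>G/e \<rightarrow> G/G\<close>. Here \<open>act g\<close> is the restriction along the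
  \<open>G\<close>-map \<open>x \<mapsto> x g\<close> of \<open>G/e\<close>, which makes \<open>act\<close> a left action.

  \<open>lev_e\<close> and \<open>lev_G\<close> may live in different types.
\<close>

record ('c, 'e, 'g) tambara =
  lev_e :: "'e ring"
  lev_G :: "'g ring"
  act :: "'c \<Rightarrow> 'e \<Rightarrow> 'e"
  res :: "'g \<Rightarrow> 'e"
  tr :: "'e \<Rightarrow> 'g"
  nm :: "'e \<Rightarrow> 'g"

text \<open>
  Sets of representatives for the translation action of \<open>G\<close> on its proper nonempty subsets.
  A subset \<open>U\<close> encodes the non-constant function \<open>G \<rightarrow> {a, b}\<close> with value \<open>a\<close> exactly on \<open>U\<close>;
  for \<open>G\<close> of prime order all orbits of such functions are free.
\<close>

definition subset_transversal :: "'c monoid \<Rightarrow> 'c set set \<Rightarrow> bool" where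
  "subset_transversal G \<U> \<longleftrightarrow>
     (\<forall>U\<in>\<U>. U \<noteq> {} \<and> U \<subset> carrier G) \<and>
     (\<forall>U. U \<noteq> {} \<and> U \<subset> carrier G \<longrightarrow> (\<exists>!V. V \<in> \<U> \<and> (\<exists>g\<in>carrier G. V = g <#\<^bsub>G\<^esub> U)))"

text \<open>
  \<open>res_tr\<close> and \<open>res_nm\<close> are the double coset formulas. \<open>nm_add\<close> is Tambara reciprocity for the norm
  of a sum: it is the exponential diagram of the fold map \<open>G/e \<squnion> G/e \<rightarrow> G/e\<close> followed by
  \<open>G/e \<rightarrow> G/G\<close>, whose dependent product is the \<open>G\<close>-set of functions \<open>G \<rightarrow> {a, b}\<close>. Its right-hand
  side does not depend on the transversal because of \<open>tr_act\<close>.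
\<close>

locale tambara_functor =
  fixes G :: "'c monoid" and R :: "('c, 'e, 'g) tambara"
  assumes lev_e_cring: "cring (lev_e R)"
    and lev_G_cring: "cring (lev_G R)"
    and act_hom: "g \<in> carrier G \<Longrightarrow> act R g \<in> ring_hom (lev_e R) (lev_e R)"
    and act_one: "x \<in> carrier (lev_e R) \<Longrightarrow> act R \<one>\<^bsub>G\<^esub> x = x"
    and act_mult: "\<lbrakk>g \<in> carrier G; h \<in> carrier G; x \<in> carrier (lev_e R)\<rbrakk> \<Longrightarrow>
      act R (g \<otimes>\<^bsub>G\<^esub> h) x = act R g (act R h x)"
    and res_hom: "res R \<in> ring_hom (lev_G R) (lev_e R)"
    and tr_closed: "x \<in> carrier (lev_e R) \<Longrightarrow> tr R x \<in> carrier (lev_G R)"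
    and tr_add: "\<lbrakk>x \<in> carrier (lev_e R); x' \<in> carrier (lev_e R)\<rbrakk> \<Longrightarrow>
      tr R (x \<oplus>\<^bsub>lev_e R\<^esub> x') = tr R x \<oplus>\<^bsub>lev_G R\<^esub> tr R x'"
    and nm_closed: "x \<in> carrier (lev_e R) \<Longrightarrow> nm R x \<in> carrier (lev_G R)"
    and nm_zero: "nm R \<zero>\<^bsub>lev_e R\<^esub> = \<zero>\<^bsub>lev_G R\<^esub>"
    and nm_one: "nm R \<one>\<^bsub>lev_e R\<^esub> = \<one>\<^bsub>lev_G R\<^esub>"
    and nm_mult: "\<lbrakk>x \<in> carrier (lev_e R); x' \<in> carrier (lev_e R)\<rbrakk> \<Longrightarrow>
      nm R (x \<otimes>\<^bsub>lev_e R\<^esub> x') = nm R x \<otimes>\<^bsub>lev_G R\<^esub> nm R x'"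
    and act_res: "\<lbrakk>g \<in> carrier G; y \<in> carrier (lev_G R)\<rbrakk> \<Longrightarrow> act R g (res R y) = res R y"
    and tr_act: "\<lbrakk>g \<in> carrier G; x \<in> carrier (lev_e R)\<rbrakk> \<Longrightarrow> tr R (act R g x) = tr R x"
    and nm_act: "\<lbrakk>g \<in> carrier G; x \<in> carrier (lev_e R)\<rbrakk> \<Longrightarrow> nm R (act R g x) = nm R x"
    and frobenius: "\<lbrakk>x \<in> carrier (lev_e R); y \<in> carrier (lev_G R)\<rbrakk> \<Longrightarrow>
      tr R (x \<otimes>\<^bsub>lev_e R\<^esub> res R y) = tr R x \<otimes>\<^bsub>lev_G R\<^esub> y"
    and res_tr: "x \<in> carrier (lev_e R) \<Longrightarrow>
      res R (tr R x) = (\<Oplus>\<^bsub>lev_e R\<^esub>g\<in>carrier G. act R g x)"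
    and res_nm: "x \<in> carrier (lev_e R) \<Longrightarrow>
      res R (nm R x) = (\<Otimes>\<^bsub>lev_e R\<^esub>g\<in>carrier G. act R g x)"
    and nm_add: "\<lbrakk>x \<in> carrier (lev_e R); x' \<in> carrier (lev_e R); subset_transversal G \<U>\<rbrakk> \<Longrightarrow>
      nm R (x \<oplus>\<^bsub>lev_e R\<^esub> x') =
        nm R x \<oplus>\<^bsub>lev_G R\<^esub> nm R x' \<oplus>\<^bsub>lev_G R\<^esub>
        tr R (\<Oplus>\<^bsub>lev_e R\<^esub>U\<in>\<U>.
          \<Otimes>\<^bsub>lev_e R\<^esub>g\<in>carrier G. act R g (if g \<in> U then x else x'))"

definition tambara_hom ::
  "'c monoid \<Rightarrow> ('c, 'e, 'g) tambara \<Rightarrow> ('c, 'a, 'b) tambara \<Rightarrow> ('e \<Rightarrow> 'a) \<times> ('g \<Rightarrow> 'b) \<Rightarrow> bool" where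
  "tambara_hom G R S \<phi> \<longleftrightarrow>
     tambara_functor G R \<and> tambara_functor G S \<and>
     fst \<phi> \<in> ring_hom (lev_e R) (lev_e S) \<and>
     snd \<phi> \<in> ring_hom (lev_G R) (lev_G S) \<and>
     (\<forall>g\<in>carrier G. \<forall>x\<in>carrier (lev_e R). fst \<phi> (act R g x) = act S g (fst \<phi> x)) \<and>
     (\<forall>y\<in>carrier (lev_G R). fst \<phi> (res R y) = res S (snd \<phi> y)) \<and>
     (\<forall>x\<in>carrier (lev_e R). snd \<phi> (tr R x) = tr S (fst \<phi> x)) \<and>
     (\<forall>x\<in>carrier (lev_e R). snd \<phi> (nm R x) = nm S (fst \<phi> x))"

definition map_comp2 ::
  "('a \<Rightarrow> 'b) \<times> ('k \<Rightarrow> 'l) \<Rightarrow> ('e \<Rightarrow> 'a) \<times> ('g \<Rightarrow> 'k) \<Rightarrow> ('e \<Rightarrow> 'b) \<times> ('g \<Rightarrow> 'l)" where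
  "map_comp2 \<psi> \<phi> = (fst \<psi> \<circ> fst \<phi>, snd \<psi> \<circ> snd \<phi>)"

definition maps_agree ::
  "('c, 'e, 'g) tambara \<Rightarrow> ('e \<Rightarrow> 'a) \<times> ('g \<Rightarrow> 'b) \<Rightarrow> ('e \<Rightarrow> 'a) \<times> ('g \<Rightarrow> 'b) \<Rightarrow> bool" where
  "maps_agree R \<phi> \<psi> \<longleftrightarrow>
     (\<forall>x\<in>carrier (lev_e R). fst \<phi> x = fst \<psi> x) \<and> (\<forall>y\<in>carrier (lev_G R). snd \<phi> y = snd \<psi> y)"


section \<open>Tambara ideals and the Nakaoka spectrum\<close>

definition tambara_ideal :: "'c monoid \<Rightarrow> ('c, 'e, 'g) tambara \<Rightarrow> 'e set \<times> 'g set \<Rightarrow> bool" where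
  "tambara_ideal G R I \<longleftrightarrow>
     ideal (fst I) (lev_e R) \<and> ideal (snd I) (lev_G R) \<and>
     (\<forall>g\<in>carrier G. act R g ` fst I \<subseteq> fst I) \<and>
     res R ` snd I \<subseteq> fst I \<and> tr R ` fst I \<subseteq> snd I \<and> nm R ` fst I \<subseteq> snd I"

definition subset2 :: "'e set \<times> 'g set \<Rightarrow> 'e set \<times> 'g set \<Rightarrow> bool" where
  "subset2 I J \<longleftrightarrow> fst I \<subseteq> fst J \<and> snd I \<subseteq> snd J"

definition gen_tambara_ideal ::
  "'c monoid \<Rightarrow> ('c, 'e, 'g) tambara \<Rightarrow> 'e set \<times> 'g set \<Rightarrow> 'e set \<times> 'g set" where
  "gen_tambara_ideal G R A =
     (\<Inter>{fst J | J. tambara_ideal G R J \<and> subset2 A J},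
      \<Inter>{snd J | J. tambara_ideal G R J \<and> subset2 A J})"

definition tambara_ideal_prod ::
  "'c monoid \<Rightarrow> ('c, 'e, 'g) tambara \<Rightarrow> 'e set \<times> 'g set \<Rightarrow> 'e set \<times> 'g set \<Rightarrow> 'e set \<times> 'g set" where
  "tambara_ideal_prod G R I J =
     gen_tambara_ideal G R
       (ideal_prod (lev_e R) (fst I) (fst J), ideal_prod (lev_G R) (snd I) (snd J))"

definition prime_tambara_ideal :: "'c monoid \<Rightarrow> ('c, 'e, 'g) tambara \<Rightarrow> 'e set \<times> 'g set \<Rightarrow> bool" where
  "prime_tambara_ideal G R P \<longleftrightarrow>
     tambara_ideal G R P \<and> P \<noteq> (carrier (lev_e R), carrier (lev_G R)) \<and>
     (\<forall>I J. tambara_ideal G R I \<and> tambara_ideal G R J \<and> subset2 (tambara_ideal_prod G R I J) P \<longrightarrow>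
        subset2 I P \<or> subset2 J P)"

definition vanishing_set ::
  "'c monoid \<Rightarrow> ('c, 'e, 'g) tambara \<Rightarrow> 'e set \<times> 'g set \<Rightarrow> ('e set \<times> 'g set) set" where
  "vanishing_set G R I = {P. prime_tambara_ideal G R P \<and> subset2 I P}"

definition nakaoka_spectrum ::
  "'c monoid \<Rightarrow> ('c, 'e, 'g) tambara \<Rightarrow> ('e set \<times> 'g set) topology" where
  "nakaoka_spectrum G R =
     topology (\<lambda>U. \<exists>I. tambara_ideal G R I \<and>
       U = {P. prime_tambara_ideal G R P} - vanishing_set G R I)"

definition spectrum_map ::
  "('c, 'e, 'g) tambara \<Rightarrow> ('e \<Rightarrow> 'a) \<times> ('g \<Rightarrow> 'b) \<Rightarrow> 'a set \<times> 'b set \<Rightarrow> 'e set \<times> 'g set" where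
  "spectrum_map R \<phi> P =
     ({x \<in> carrier (lev_e R). fst \<phi> x \<in> fst P}, {y \<in> carrier (lev_G R). snd \<phi> y \<in> snd P})"


section \<open>Ghost and coinduction\<close>

definition fixed_ring :: "'c monoid \<Rightarrow> ('c, 'e, 'g) tambara \<Rightarrow> 'e ring" where
  "fixed_ring G R =
     (lev_e R)\<lparr>carrier := {x \<in> carrier (lev_e R). \<forall>g\<in>carrier G. act R g x = x}\<rparr>"

definition transfer_image :: "('c, 'e, 'g) tambara \<Rightarrow> 'g set" where
  "transfer_image R = tr R ` carrier (lev_e R)"

definition ghost :: "'c monoid \<Rightarrow> ('c, 'e, 'g) tambara \<Rightarrow> ('c, 'e, 'e \<times> 'g set) tambara" where
  "ghost G R =
     \<lparr>lev_e = lev_e R,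
      lev_G = RDirProd (fixed_ring G R) (lev_G R Quot transfer_image R),
      act = act R,
      res = (\<lambda>(a, b). a),
      tr = (\<lambda>x. (\<Oplus>\<^bsub>lev_e R\<^esub>g\<in>carrier G. act R g x, \<zero>\<^bsub>lev_G R Quot transfer_image R\<^esub>)),
      nm = (\<lambda>x. (\<Otimes>\<^bsub>lev_e R\<^esub>g\<in>carrier G. act R g x,
                  transfer_image R +>\<^bsub>lev_G R\<^esub> nm R x))\<rparr>"

text \<open>
  Coinduction \<open>X \<mapsto> \<Prod>x\<in>X. Q\<close>, with \<open>\<Prod>x\<in>G. Q\<close> realised as functions on \<open>G\<close> and the product over
  the one-point set \<open>G/G\<close> as \<open>Q\<close>. The action is precomposition with \<open>x \<mapsto> x g\<close>.
\<close>

definition fun_ring :: "'c set \<Rightarrow> 'q ring \<Rightarrow> ('c \<Rightarrow> 'q) ring" where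
  "fun_ring X Q =
     \<lparr>carrier = X \<rightarrow>\<^sub>E carrier Q,
      monoid.mult = (\<lambda>s t. \<lambda>x\<in>X. s x \<otimes>\<^bsub>Q\<^esub> t x), one = (\<lambda>x\<in>X. \<one>\<^bsub>Q\<^esub>),
      ring.zero = (\<lambda>x\<in>X. \<zero>\<^bsub>Q\<^esub>), ring.add = (\<lambda>s t. \<lambda>x\<in>X. s x \<oplus>\<^bsub>Q\<^esub> t x)\<rparr>"

definition coind :: "'c monoid \<Rightarrow> 'q ring \<Rightarrow> ('c, 'c \<Rightarrow> 'q, 'q) tambara" where
  "coind G Q =
     \<lparr>lev_e = fun_ring (carrier G) Q,
      lev_G = Q,
      act = (\<lambda>g s. \<lambda>x\<in>carrier G. s (x \<otimes>\<^bsub>G\<^esub> g)),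
      res = (\<lambda>q. \<lambda>x\<in>carrier G. q),
      tr = (\<lambda>s. \<Oplus>\<^bsub>Q\<^esub>x\<in>carrier G. s x),
      nm = (\<lambda>s. \<Otimes>\<^bsub>Q\<^esub>x\<in>carrier G. s x)\<rparr>"

text \<open>
  The unit \<open>R \<rightarrow> CoInd (Res R)\<close> sends \<open>r \<in> R(X)\<close> to the family of its restrictions along the
  \<open>G\<close>-maps \<open>G/e \<rightarrow> X, g \<mapsto> g x\<close>, for \<open>x \<in> X\<close>.
\<close>

definition coind_unit ::
  "'c monoid \<Rightarrow> ('c, 'e, 'g) tambara \<Rightarrow> ('e \<Rightarrow> 'c \<Rightarrow> 'e) \<times> ('g \<Rightarrow> 'e)" where
  "coind_unit G R = (\<lambda>r. \<lambda>x\<in>carrier G. act R x r, res R)"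


section \<open>Finite presentation\<close>

text \<open>
  The free Tambara \<open>R\<close>-algebra on \<open>m\<close> generators at level \<open>G/e\<close> and \<open>n\<close> generators at level \<open>G/G\<close>
  is the term algebra modulo the least congruence whose quotient is a Tambara functor and receives
  \<open>R\<close> by a map of Tambara functors via the constants.
\<close>

datatype ('c, 'e, 'g) term_e =
    Var_e nat | Const_e 'e
  | Add_e "('c, 'e, 'g) term_e" "('c, 'e, 'g) term_e"
  | Mul_e "('c, 'e, 'g) term_e" "('c, 'e, 'g) term_e"
  | Act 'c "('c, 'e, 'g) term_e"
  | Res "('c, 'e, 'g) term_G"
and ('c, 'e, 'g) term_G =
    Var_G nat | Const_G 'g
  | Add_G "('c, 'e, 'g) term_G" "('c, 'e, 'g) term_G"
  | Mul_G "('c, 'e, 'g) term_G" "('c, 'e, 'g) term_G"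
  | Tr "('c, 'e, 'g) term_e"
  | Nm "('c, 'e, 'g) term_e"

primrec wf_term_e ::
    "'c monoid \<Rightarrow> ('c, 'e, 'g) tambara \<Rightarrow> nat \<Rightarrow> nat \<Rightarrow> ('c, 'e, 'g) term_e \<Rightarrow> bool"
  and wf_term_G ::
    "'c monoid \<Rightarrow> ('c, 'e, 'g) tambara \<Rightarrow> nat \<Rightarrow> nat \<Rightarrow> ('c, 'e, 'g) term_G \<Rightarrow> bool" where
  "wf_term_e G R m n (Var_e i) \<longleftrightarrow> i < m"
| "wf_term_e G R m n (Const_e r) \<longleftrightarrow> r \<in> carrier (lev_e R)"
| "wf_term_e G R m n (Add_e s t) \<longleftrightarrow> wf_term_e G R m n s \<and> wf_term_e G R m n t"
| "wf_term_e G R m n (Mul_e s t) \<longleftrightarrow> wf_term_e G R m n s \<and> wf_term_e G R m n t"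
| "wf_term_e G R m n (Act g t) \<longleftrightarrow> g \<in> carrier G \<and> wf_term_e G R m n t"
| "wf_term_e G R m n (Res u) \<longleftrightarrow> wf_term_G G R m n u"
| "wf_term_G G R m n (Var_G j) \<longleftrightarrow> j < n"
| "wf_term_G G R m n (Const_G r) \<longleftrightarrow> r \<in> carrier (lev_G R)"
| "wf_term_G G R m n (Add_G u v) \<longleftrightarrow> wf_term_G G R m n u \<and> wf_term_G G R m n v"
| "wf_term_G G R m n (Mul_G u v) \<longleftrightarrow> wf_term_G G R m n u \<and> wf_term_G G R m n v"
| "wf_term_G G R m n (Tr t) \<longleftrightarrow> wf_term_e G R m n t"
| "wf_term_G G R m n (Nm t) \<longleftrightarrow> wf_term_e G R m n t"

abbreviation terms_e where "terms_e G R m n \<equiv> {t. wf_term_e G R m n t}"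
abbreviation terms_G where "terms_G G R m n \<equiv> {u. wf_term_G G R m n u}"

definition term_quotient ::
  "'c monoid \<Rightarrow> ('c, 'e, 'g) tambara \<Rightarrow> nat \<Rightarrow> nat \<Rightarrow> ('c, 'e, 'g) term_e rel \<Rightarrow> ('c, 'e, 'g) term_G rel \<Rightarrow>
   ('c, ('c, 'e, 'g) term_e set, ('c, 'e, 'g) term_G set) tambara" where
  "term_quotient G R m n E F =
     \<lparr>lev_e = \<lparr>carrier = terms_e G R m n // E,
               monoid.mult = (\<lambda>A B. \<Union>s\<in>A. \<Union>t\<in>B. E `` {Mul_e s t}),
               one = E `` {Const_e \<one>\<^bsub>lev_e R\<^esub>},
               ring.zero = E `` {Const_e \<zero>\<^bsub>lev_e R\<^esub>},
               ring.add = (\<lambda>A B. \<Union>s\<in>A. \<Union>t\<in>B. E `` {Add_e s t})\<rparr>,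
      lev_G = \<lparr>carrier = terms_G G R m n // F,
               monoid.mult = (\<lambda>A B. \<Union>u\<in>A. \<Union>v\<in>B. F `` {Mul_G u v}),
               one = F `` {Const_G \<one>\<^bsub>lev_G R\<^esub>},
               ring.zero = F `` {Const_G \<zero>\<^bsub>lev_G R\<^esub>},
               ring.add = (\<lambda>A B. \<Union>u\<in>A. \<Union>v\<in>B. F `` {Add_G u v})\<rparr>,
      act = (\<lambda>g A. \<Union>t\<in>A. E `` {Act g t}),
      res = (\<lambda>A. \<Union>u\<in>A. E `` {Res u}),
      tr = (\<lambda>A. \<Union>t\<in>A. F `` {Tr t}),
      nm = (\<lambda>A. \<Union>t\<in>A. F `` {Nm t})\<rparr>"

definition const_map ::
  "('c, 'e, 'g) term_e rel \<Rightarrow> ('c, 'e, 'g) term_G rel \<Rightarrow>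
   ('e \<Rightarrow> ('c, 'e, 'g) term_e set) \<times> ('g \<Rightarrow> ('c, 'e, 'g) term_G set)" where
  "const_map E F = (\<lambda>r. E `` {Const_e r}, \<lambda>r. F `` {Const_G r})"

definition tambara_congruence ::
  "'c monoid \<Rightarrow> ('c, 'e, 'g) tambara \<Rightarrow> nat \<Rightarrow> nat \<Rightarrow>
   ('c, 'e, 'g) term_e rel \<times> ('c, 'e, 'g) term_G rel \<Rightarrow> bool" where
  "tambara_congruence G R m n = (\<lambda>(E, F).
     equiv (terms_e G R m n) E \<and> equiv (terms_G G R m n) F \<and>
     (\<forall>(s, s')\<in>E. \<forall>(t, t')\<in>E. (Add_e s t, Add_e s' t') \<in> E \<and> (Mul_e s t, Mul_e s' t') \<in> E) \<and>
     (\<forall>(u, u')\<in>F. \<forall>(v, v')\<in>F. (Add_G u v, Add_G u' v') \<in> F \<and> (Mul_G u v, Mul_G u' v') \<in> F) \<and>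
     (\<forall>g\<in>carrier G. \<forall>(t, t')\<in>E. (Act g t, Act g t') \<in> E) \<and>
     (\<forall>(u, u')\<in>F. (Res u, Res u') \<in> E) \<and>
     (\<forall>(t, t')\<in>E. (Tr t, Tr t') \<in> F \<and> (Nm t, Nm t') \<in> F) \<and>
     tambara_hom G R (term_quotient G R m n E F) (const_map E F))"

definition free_cong_e ::
  "'c monoid \<Rightarrow> ('c, 'e, 'g) tambara \<Rightarrow> nat \<Rightarrow> nat \<Rightarrow> ('c, 'e, 'g) term_e rel" where
  "free_cong_e G R m n = \<Inter>{fst C | C. tambara_congruence G R m n C}"

definition free_cong_G ::
  "'c monoid \<Rightarrow> ('c, 'e, 'g) tambara \<Rightarrow> nat \<Rightarrow> nat \<Rightarrow> ('c, 'e, 'g) term_G rel" where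
  "free_cong_G G R m n = \<Inter>{snd C | C. tambara_congruence G R m n C}"

definition free_algebra ::
  "'c monoid \<Rightarrow> ('c, 'e, 'g) tambara \<Rightarrow> nat \<Rightarrow> nat \<Rightarrow>
   ('c, ('c, 'e, 'g) term_e set, ('c, 'e, 'g) term_G set) tambara" where
  "free_algebra G R m n = term_quotient G R m n (free_cong_e G R m n) (free_cong_G G R m n)"

definition free_unit ::
  "'c monoid \<Rightarrow> ('c, 'e, 'g) tambara \<Rightarrow> nat \<Rightarrow> nat \<Rightarrow>
   ('e \<Rightarrow> ('c, 'e, 'g) term_e set) \<times> ('g \<Rightarrow> ('c, 'e, 'g) term_G set)" where
  "free_unit G R m n = const_map (free_cong_e G R m n) (free_cong_G G R m n)"

text \<open>A Tambara \<open>R\<close>-algebra is a Tambara functor \<open>A\<close> together with a map \<open>\<alpha>\<close> from \<open>R\<close> to \<open>A\<close>.\<close>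

definition algebra_hom ::
  "'c monoid \<Rightarrow> ('c, 'e, 'g) tambara \<Rightarrow>
   ('c, 'a, 'b) tambara \<Rightarrow> ('e \<Rightarrow> 'a) \<times> ('g \<Rightarrow> 'b) \<Rightarrow>
   ('c, 'k, 'l) tambara \<Rightarrow> ('e \<Rightarrow> 'k) \<times> ('g \<Rightarrow> 'l) \<Rightarrow>
   ('a \<Rightarrow> 'k) \<times> ('b \<Rightarrow> 'l) \<Rightarrow> bool" where
  "algebra_hom G R A \<alpha> B \<beta> f \<longleftrightarrow>
     tambara_hom G R A \<alpha> \<and> tambara_hom G R B \<beta> \<and> tambara_hom G A B f \<and>
     maps_agree R (map_comp2 f \<alpha>) \<beta>"

text \<open>
  HOL cannot quantify over types inside a formula, so the test objects of universal properties live
  in an arbitrary type \<open>'u\<close>, passed as a type argument. A theorem in which \<open>'u\<close> is a free type variable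
  asserts the property for test objects of any size.
\<close>

definition is_coequalizer ::
  "'u itself \<Rightarrow> 'c monoid \<Rightarrow> ('c, 'e, 'g) tambara \<Rightarrow>
   ('c, 'a, 'b) tambara \<Rightarrow> ('e \<Rightarrow> 'a) \<times> ('g \<Rightarrow> 'b) \<Rightarrow>
   ('c, 'k, 'l) tambara \<Rightarrow> ('e \<Rightarrow> 'k) \<times> ('g \<Rightarrow> 'l) \<Rightarrow>
   ('c, 's, 't) tambara \<Rightarrow> ('e \<Rightarrow> 's) \<times> ('g \<Rightarrow> 't) \<Rightarrow>
   ('a \<Rightarrow> 'k) \<times> ('b \<Rightarrow> 'l) \<Rightarrow> ('a \<Rightarrow> 'k) \<times> ('b \<Rightarrow> 'l) \<Rightarrow> ('k \<Rightarrow> 's) \<times> ('l \<Rightarrow> 't) \<Rightarrow> bool" where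
  "is_coequalizer _ G R A \<alpha> B \<beta> S \<sigma> f g q \<longleftrightarrow>
     algebra_hom G R A \<alpha> B \<beta> f \<and> algebra_hom G R A \<alpha> B \<beta> g \<and> algebra_hom G R B \<beta> S \<sigma> q \<and>
     maps_agree A (map_comp2 q f) (map_comp2 q g) \<and>
     (\<forall>(T :: ('c, 'u, 'u) tambara) \<tau> h.
        algebra_hom G R B \<beta> T \<tau> h \<and> maps_agree A (map_comp2 h f) (map_comp2 h g) \<longrightarrow>
          (\<exists>k. algebra_hom G R S \<sigma> T \<tau> k \<and> maps_agree B (map_comp2 k q) h \<and>
            (\<forall>k'. algebra_hom G R S \<sigma> T \<tau> k' \<and> maps_agree B (map_comp2 k' q) h \<longrightarrow>
               maps_agree S k' k)))"

definition finitely_presented ::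
  "'u itself \<Rightarrow> 'c monoid \<Rightarrow> ('c, 'e, 'g) tambara \<Rightarrow>
   ('c, 's, 't) tambara \<Rightarrow> ('e \<Rightarrow> 's) \<times> ('g \<Rightarrow> 't) \<Rightarrow> bool" where
  "finitely_presented U G R S \<phi> \<longleftrightarrow>
     (\<exists>m' n' m n f g q.
        is_coequalizer U G R
          (free_algebra G R m' n') (free_unit G R m' n')
          (free_algebra G R m n) (free_unit G R m n) S \<phi> f g q)"


section \<open>Modules and the relative box product\<close>

record ('c, 'r, 's, 'm, 'n) green_module =
  mlev_e :: "('r, 'm) module"
  mlev_G :: "('s, 'n) module"
  mact :: "'c \<Rightarrow> 'm \<Rightarrow> 'm"
  mres :: "'n \<Rightarrow> 'm"
  mtr :: "'m \<Rightarrow> 'n"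

text \<open>Modules over the underlying Green functor of \<open>R\<close>.\<close>

locale tambara_module = tambara_functor G R
  for G :: "'c monoid" and R :: "('c, 'r, 's) tambara" +
  fixes M :: "('c, 'r, 's, 'm, 'n) green_module"
  assumes mlev_e_module: "Module.module (lev_e R) (mlev_e M)"
    and mlev_G_module: "Module.module (lev_G R) (mlev_G M)"
    and mact_hom: "g \<in> carrier G \<Longrightarrow> mact M g \<in> hom (add_monoid (mlev_e M)) (add_monoid (mlev_e M))"
    and mact_one: "x \<in> carrier (mlev_e M) \<Longrightarrow> mact M \<one>\<^bsub>G\<^esub> x = x"
    and mact_mult: "\<lbrakk>g \<in> carrier G; h \<in> carrier G; x \<in> carrier (mlev_e M)\<rbrakk> \<Longrightarrow>
      mact M (g \<otimes>\<^bsub>G\<^esub> h) x = mact M g (mact M h x)"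
    and mres_hom: "mres M \<in> hom (add_monoid (mlev_G M)) (add_monoid (mlev_e M))"
    and mtr_hom: "mtr M \<in> hom (add_monoid (mlev_e M)) (add_monoid (mlev_G M))"
    and mact_smult: "\<lbrakk>g \<in> carrier G; r \<in> carrier (lev_e R); x \<in> carrier (mlev_e M)\<rbrakk> \<Longrightarrow>
      mact M g (r \<odot>\<^bsub>mlev_e M\<^esub> x) = act R g r \<odot>\<^bsub>mlev_e M\<^esub> mact M g x"
    and mres_smult: "\<lbrakk>s \<in> carrier (lev_G R); y \<in> carrier (mlev_G M)\<rbrakk> \<Longrightarrow>
      mres M (s \<odot>\<^bsub>mlev_G M\<^esub> y) = res R s \<odot>\<^bsub>mlev_e M\<^esub> mres M y"
    and mact_mres: "\<lbrakk>g \<in> carrier G; y \<in> carrier (mlev_G M)\<rbrakk> \<Longrightarrow> mact M g (mres M y) = mres M y"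
    and mtr_mact: "\<lbrakk>g \<in> carrier G; x \<in> carrier (mlev_e M)\<rbrakk> \<Longrightarrow> mtr M (mact M g x) = mtr M x"
    and mres_mtr: "x \<in> carrier (mlev_e M) \<Longrightarrow>
      mres M (mtr M x) = (\<Oplus>\<^bsub>mlev_e M\<^esub>g\<in>carrier G. mact M g x)"
    and frobenius_scalar: "\<lbrakk>s \<in> carrier (lev_G R); x \<in> carrier (mlev_e M)\<rbrakk> \<Longrightarrow>
      mtr M (res R s \<odot>\<^bsub>mlev_e M\<^esub> x) = s \<odot>\<^bsub>mlev_G M\<^esub> mtr M x"
    and frobenius_vector: "\<lbrakk>r \<in> carrier (lev_e R); y \<in> carrier (mlev_G M)\<rbrakk> \<Longrightarrow>
      mtr M (r \<odot>\<^bsub>mlev_e M\<^esub> mres M y) = tr R r \<odot>\<^bsub>mlev_G M\<^esub> y"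

definition tambara_module_hom ::
  "'c monoid \<Rightarrow> ('c, 'r, 's) tambara \<Rightarrow>
   ('c, 'r, 's, 'm, 'n) green_module \<Rightarrow> ('c, 'r, 's, 'a, 'b) green_module \<Rightarrow>
   ('m \<Rightarrow> 'a) \<times> ('n \<Rightarrow> 'b) \<Rightarrow> bool" where
  "tambara_module_hom G R M N f \<longleftrightarrow>
     fst f \<in> hom (add_monoid (mlev_e M)) (add_monoid (mlev_e N)) \<and>
     snd f \<in> hom (add_monoid (mlev_G M)) (add_monoid (mlev_G N)) \<and>
     (\<forall>r\<in>carrier (lev_e R). \<forall>x\<in>carrier (mlev_e M).
        fst f (r \<odot>\<^bsub>mlev_e M\<^esub> x) = r \<odot>\<^bsub>mlev_e N\<^esub> fst f x) \<and>
     (\<forall>r\<in>carrier (lev_G R). \<forall>y\<in>carrier (mlev_G M).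
        snd f (r \<odot>\<^bsub>mlev_G M\<^esub> y) = r \<odot>\<^bsub>mlev_G N\<^esub> snd f y) \<and>
     (\<forall>g\<in>carrier G. \<forall>x\<in>carrier (mlev_e M). fst f (mact M g x) = mact N g (fst f x)) \<and>
     (\<forall>y\<in>carrier (mlev_G M). fst f (mres M y) = mres N (snd f y)) \<and>
     (\<forall>x\<in>carrier (mlev_e M). snd f (mtr M x) = mtr N (fst f x))"

text \<open>Exactness of \<open>0 \<rightarrow> M1 \<rightarrow> M2 \<rightarrow> M3 \<rightarrow> 0\<close>; kernels and images of module maps are levelwise.\<close>

definition short_exact ::
  "('c, 'r, 's, 'm1, 'n1) green_module \<Rightarrow> ('c, 'r, 's, 'm2, 'n2) green_module \<Rightarrow>
   ('c, 'r, 's, 'm3, 'n3) green_module \<Rightarrow>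
   ('m1 \<Rightarrow> 'm2) \<times> ('n1 \<Rightarrow> 'n2) \<Rightarrow> ('m2 \<Rightarrow> 'm3) \<times> ('n2 \<Rightarrow> 'n3) \<Rightarrow> bool" where
  "short_exact M1 M2 M3 f g \<longleftrightarrow>
     inj_on (fst f) (carrier (mlev_e M1)) \<and> inj_on (snd f) (carrier (mlev_G M1)) \<and>
     fst f ` carrier (mlev_e M1) = {x \<in> carrier (mlev_e M2). fst g x = \<zero>\<^bsub>mlev_e M3\<^esub>} \<and>
     snd f ` carrier (mlev_G M1) = {y \<in> carrier (mlev_G M2). snd g y = \<zero>\<^bsub>mlev_G M3\<^esub>} \<and>
     fst g ` carrier (mlev_e M2) = carrier (mlev_e M3) \<and>
     snd g ` carrier (mlev_G M2) = carrier (mlev_G M3)"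

text \<open>
  Abelian groups by generators and relations: cosets of a subgroup \<open>K\<close> of a free abelian group,
  and maps induced on cosets.
\<close>

type_synonym 'x frag = "'x \<Rightarrow>\<^sub>0 int"

definition frag_span :: "'x frag set \<Rightarrow> 'x frag set" where
  "frag_span A = generate (free_Abelian_group UNIV) A"

definition frag_coset :: "'x frag set \<Rightarrow> 'x frag \<Rightarrow> 'x frag set" where
  "frag_coset K x = (\<lambda>k. k + x) ` K"

definition coset_map :: "'y frag set \<Rightarrow> ('x frag \<Rightarrow> 'y frag) \<Rightarrow> 'x frag set \<Rightarrow> 'y frag set" where
  "coset_map K f A = (\<Union>x\<in>A. frag_coset K (f x))"

definition coset_map2 ::
  "'z frag set \<Rightarrow> ('x frag \<Rightarrow> 'y frag \<Rightarrow> 'z frag) \<Rightarrow> 'x frag set \<Rightarrow> 'y frag set \<Rightarrow> 'z frag set" where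
  "coset_map2 K f A B = (\<Union>x\<in>A. \<Union>y\<in>B. frag_coset K (f x y))"

text \<open>The module structure induced on the span of \<open>X\<close> modulo \<open>K\<close>; \<open>sm r\<close> scales generators by \<open>r\<close>.\<close>

definition frag_quotient ::
  "'x frag set \<Rightarrow> 'x set \<Rightarrow> ('r \<Rightarrow> 'x \<Rightarrow> 'x) \<Rightarrow> ('r, 'x frag set) module" where
  "frag_quotient K X sm =
     \<lparr>carrier = frag_coset K ` {x. Poly_Mapping.keys x \<subseteq> X}, monoid.mult = undefined, one = undefined,
      ring.zero = K, ring.add = coset_map2 K (+),
      smult = (\<lambda>r. coset_map K (frag_extend (\<lambda>x. frag_of (sm r x))))\<rparr>"

text \<open>The defining relations of a tensor product over \<open>k\<close>, for generators \<open>t a b\<close>.\<close>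

definition tensor_relations ::
  "'r ring \<Rightarrow> ('r, 'a) module \<Rightarrow> ('r, 'b) module \<Rightarrow> ('a \<Rightarrow> 'b \<Rightarrow> 'x) \<Rightarrow> 'x frag set" where
  "tensor_relations k A B t =
     {frag_of (t (a \<oplus>\<^bsub>A\<^esub> a') b) - frag_of (t a b) - frag_of (t a' b) | a a' b.
        a \<in> carrier A \<and> a' \<in> carrier A \<and> b \<in> carrier B} \<union>
     {frag_of (t a (b \<oplus>\<^bsub>B\<^esub> b')) - frag_of (t a b) - frag_of (t a b') | a b b'.
        a \<in> carrier A \<and> b \<in> carrier B \<and> b' \<in> carrier B} \<union>
     {frag_of (t (r \<odot>\<^bsub>A\<^esub> a) b) - frag_of (t a (r \<odot>\<^bsub>B\<^esub> b)) | r a b.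
        r \<in> carrier k \<and> a \<in> carrier A \<and> b \<in> carrier B}"

text \<open>
  The relative box product over \<open>R\<close>. At level \<open>G/e\<close> it is the tensor product over \<open>R(G/e)\<close>. At level
  \<open>G/G\<close> it is generated by \<open>Ten a b\<close>, the tensors over \<open>R(G/G)\<close>, and \<open>TrTen x y\<close>, the formal transfer
  of \<open>x \<otimes> y\<close>, subject to invariance of transfers and Frobenius reciprocity.
\<close>

datatype ('n, 'b, 'm, 'a) box_gen = Ten 'n 'b | TrTen 'm 'a

definition box_gens_e ::
  "('c, 'r, 's, 'm, 'n) green_module \<Rightarrow> ('c, 'r, 's, 'a, 'b) green_module \<Rightarrow> ('m \<times> 'a) set" where
  "box_gens_e M N = carrier (mlev_e M) \<times> carrier (mlev_e N)"

definition box_gens_G ::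
  "('c, 'r, 's, 'm, 'n) green_module \<Rightarrow> ('c, 'r, 's, 'a, 'b) green_module \<Rightarrow>
   ('n, 'b, 'm, 'a) box_gen set" where
  "box_gens_G M N =
     {Ten a b | a b. a \<in> carrier (mlev_G M) \<and> b \<in> carrier (mlev_G N)} \<union>
     {TrTen x y | x y. x \<in> carrier (mlev_e M) \<and> y \<in> carrier (mlev_e N)}"

definition box_kernel_e ::
  "('c, 'r, 's) tambara \<Rightarrow> ('c, 'r, 's, 'm, 'n) green_module \<Rightarrow> ('c, 'r, 's, 'a, 'b) green_module \<Rightarrow>
   ('m \<times> 'a) frag set" where
  "box_kernel_e R M N = frag_span (tensor_relations (lev_e R) (mlev_e M) (mlev_e N) Pair)"

definition box_kernel_G ::
  "'c monoid \<Rightarrow> ('c, 'r, 's) tambara \<Rightarrow>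
   ('c, 'r, 's, 'm, 'n) green_module \<Rightarrow> ('c, 'r, 's, 'a, 'b) green_module \<Rightarrow>
   ('n, 'b, 'm, 'a) box_gen frag set" where
  "box_kernel_G G R M N = frag_span
     (tensor_relations (lev_G R) (mlev_G M) (mlev_G N) Ten \<union>
      tensor_relations (lev_e R) (mlev_e M) (mlev_e N) TrTen \<union>
      {frag_of (TrTen (mact M g x) (mact N g y)) - frag_of (TrTen x y) | g x y.
         g \<in> carrier G \<and> x \<in> carrier (mlev_e M) \<and> y \<in> carrier (mlev_e N)} \<union>
      {frag_of (Ten (mtr M x) b) - frag_of (TrTen x (mres N b)) | x b.
         x \<in> carrier (mlev_e M) \<and> b \<in> carrier (mlev_G N)} \<union>
      {frag_of (Ten a (mtr N y)) - frag_of (TrTen (mres M a) y) | a y.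
         a \<in> carrier (mlev_G M) \<and> y \<in> carrier (mlev_e N)})"

definition box ::
  "'c monoid \<Rightarrow> ('c, 'r, 's) tambara \<Rightarrow>
   ('c, 'r, 's, 'm, 'n) green_module \<Rightarrow> ('c, 'r, 's, 'a, 'b) green_module \<Rightarrow>
   ('c, 'r, 's, ('m \<times> 'a) frag set, ('n, 'b, 'm, 'a) box_gen frag set) green_module" where
  "box G R M N =
     \<lparr>mlev_e = frag_quotient (box_kernel_e R M N) (box_gens_e M N)
        (\<lambda>r (x, y). (r \<odot>\<^bsub>mlev_e M\<^esub> x, y)),
      mlev_G = frag_quotient (box_kernel_G G R M N) (box_gens_G M N)
        (\<lambda>r u. case u of Ten a b \<Rightarrow> Ten (r \<odot>\<^bsub>mlev_G M\<^esub> a) b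
                       | TrTen x y \<Rightarrow> TrTen (res R r \<odot>\<^bsub>mlev_e M\<^esub> x) y),
      mact = (\<lambda>g. coset_map (box_kernel_e R M N)
        (frag_extend (\<lambda>(x, y). frag_of (mact M g x, mact N g y)))),
      mres = coset_map (box_kernel_e R M N)
        (frag_extend (\<lambda>u. case u of Ten a b \<Rightarrow> frag_of (mres M a, mres N b)
                                  | TrTen x y \<Rightarrow> \<Sum>g\<in>carrier G. frag_of (mact M g x, mact N g y))),
      mtr = coset_map (box_kernel_G G R M N)
        (frag_extend (\<lambda>(x, y). frag_of (TrTen x y)))\<rparr>"

text \<open>The map \<open>M \<boxtimes> f : M \<boxtimes>\<^sub>R N \<rightarrow> M \<boxtimes>\<^sub>R N'\<close> induced by \<open>f : N \<rightarrow> N'\<close>.\<close>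

definition box_map ::
  "'c monoid \<Rightarrow> ('c, 'r, 's) tambara \<Rightarrow>
   ('c, 'r, 's, 'm, 'n) green_module \<Rightarrow> ('c, 'r, 's, 'k, 'l) green_module \<Rightarrow>
   ('a \<Rightarrow> 'k) \<times> ('b \<Rightarrow> 'l) \<Rightarrow>
   (('m \<times> 'a) frag set \<Rightarrow> ('m \<times> 'k) frag set) \<times>
   (('n, 'b, 'm, 'a) box_gen frag set \<Rightarrow> ('n, 'l, 'm, 'k) box_gen frag set)" where
  "box_map G R M N' f =
     (coset_map (box_kernel_e R M N') (frag_extend (\<lambda>(x, y). frag_of (x, fst f y))),
      coset_map (box_kernel_G G R M N')
        (frag_extend (\<lambda>u. case u of Ten a b \<Rightarrow> frag_of (Ten a (snd f b))
                                  | TrTen x y \<Rightarrow> frag_of (TrTen x (fst f y)))))"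

text \<open>A Tambara \<open>R\<close>-algebra \<open>S\<close> as a module over \<open>R\<close>.\<close>

definition algebra_module ::
  "('c, 'a, 'b) tambara \<Rightarrow> ('r \<Rightarrow> 'a) \<times> ('s \<Rightarrow> 'b) \<Rightarrow> ('c, 'r, 's, 'a, 'b) green_module" where
  "algebra_module S \<phi> =
     \<lparr>mlev_e = ring.extend (lev_e S) \<lparr>smult = (\<lambda>r x. fst \<phi> r \<otimes>\<^bsub>lev_e S\<^esub> x)\<rparr>,
      mlev_G = ring.extend (lev_G S) \<lparr>smult = (\<lambda>r x. snd \<phi> r \<otimes>\<^bsub>lev_G S\<^esub> x)\<rparr>,
      mact = act S, mres = res S, mtr = tr S\<rparr>"

definition flat ::
  "'u itself \<Rightarrow> 'c monoid \<Rightarrow> ('c, 'r, 's) tambara \<Rightarrow> ('c, 'r, 's, 'm, 'n) green_module \<Rightarrow> bool" where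
  "flat _ G R M \<longleftrightarrow>
     (\<forall>(N1 :: ('c, 'r, 's, 'u, 'u) green_module) (N2 :: ('c, 'r, 's, 'u, 'u) green_module)
        (N3 :: ('c, 'r, 's, 'u, 'u) green_module) f g.
        tambara_module G R N1 \<and> tambara_module G R N2 \<and> tambara_module G R N3 \<and>
        tambara_module_hom G R N1 N2 f \<and> tambara_module_hom G R N2 N3 g \<and>
        short_exact N1 N2 N3 f g \<longrightarrow>
        short_exact (box G R M N1) (box G R M N2) (box G R M N3)
          (box_map G R M N2 f) (box_map G R M N3 g))"


section \<open>Genuine Kaehler differentials and etale maps\<close>

text \<open>
  The Tambara functor \<open>S \<boxtimes>\<^sub>R S\<close>: the box product of modules with the multiplication determined by
  multiplication of tensors and Frobenius reciprocity.
\<close>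

fun box_mult_e :: "('c, 'a, 'b) tambara \<Rightarrow> 'a \<times> 'a \<Rightarrow> 'a \<times> 'a \<Rightarrow> ('a \<times> 'a) frag" where
  "box_mult_e S (x, y) (x', y') = frag_of (x \<otimes>\<^bsub>lev_e S\<^esub> x', y \<otimes>\<^bsub>lev_e S\<^esub> y')"

fun box_mult_G ::
  "'c monoid \<Rightarrow> ('c, 'a, 'b) tambara \<Rightarrow>
   ('b, 'b, 'a, 'a) box_gen \<Rightarrow> ('b, 'b, 'a, 'a) box_gen \<Rightarrow> ('b, 'b, 'a, 'a) box_gen frag" where
  "box_mult_G G S (Ten a b) (Ten a' b') = frag_of (Ten (a \<otimes>\<^bsub>lev_G S\<^esub> a') (b \<otimes>\<^bsub>lev_G S\<^esub> b'))"
| "box_mult_G G S (Ten a b) (TrTen x y) =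
     frag_of (TrTen (res S a \<otimes>\<^bsub>lev_e S\<^esub> x) (res S b \<otimes>\<^bsub>lev_e S\<^esub> y))"
| "box_mult_G G S (TrTen x y) (Ten a b) =
     frag_of (TrTen (x \<otimes>\<^bsub>lev_e S\<^esub> res S a) (y \<otimes>\<^bsub>lev_e S\<^esub> res S b))"
| "box_mult_G G S (TrTen x y) (TrTen x' y') =
     (\<Sum>g\<in>carrier G. frag_of (TrTen (x \<otimes>\<^bsub>lev_e S\<^esub> act S g x') (y \<otimes>\<^bsub>lev_e S\<^esub> act S g y')))"

definition frag_bilinear :: "('x \<Rightarrow> 'x \<Rightarrow> 'x frag) \<Rightarrow> 'x frag \<Rightarrow> 'x frag \<Rightarrow> 'x frag" where
  "frag_bilinear f x y = frag_extend (\<lambda>i. frag_extend (f i) y) x"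

definition box_with_norm ::
  "'c monoid \<Rightarrow> ('c, 'r, 's) tambara \<Rightarrow> ('c, 'a, 'b) tambara \<Rightarrow> ('r \<Rightarrow> 'a) \<times> ('s \<Rightarrow> 'b) \<Rightarrow>
   (('a \<times> 'a) frag set \<Rightarrow> ('b, 'b, 'a, 'a) box_gen frag set) \<Rightarrow>
   ('c, ('a \<times> 'a) frag set, ('b, 'b, 'a, 'a) box_gen frag set) tambara" where
  "box_with_norm G R S \<phi> \<nu> =
     (let M = algebra_module S \<phi>; B = box G R M M; Ke = box_kernel_e R M M; KG = box_kernel_G G R M M
      in \<lparr>lev_e = (ring.truncate (mlev_e B))
            \<lparr>monoid.mult := coset_map2 Ke (frag_bilinear (box_mult_e S)),
             one := frag_coset Ke (frag_of (\<one>\<^bsub>lev_e S\<^esub>, \<one>\<^bsub>lev_e S\<^esub>))\<rparr>,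
          lev_G = (ring.truncate (mlev_G B))
            \<lparr>monoid.mult := coset_map2 KG (frag_bilinear (box_mult_G G S)),
             one := frag_coset KG (frag_of (Ten \<one>\<^bsub>lev_G S\<^esub> \<one>\<^bsub>lev_G S\<^esub>))\<rparr>,
          act = mact B, res = mres B, tr = mtr B, nm = \<nu>\<rparr>)"

text \<open>
  The norm of \<open>S \<boxtimes>\<^sub>R S\<close> is the one making it a Tambara functor with \<open>Nm (x \<otimes> y) = Nm x \<otimes> Nm y\<close>.
  Since every element at level \<open>G/e\<close> is a sum of tensors, \<open>nm_add\<close> shows that these conditions
  determine it on the carrier.
\<close>

definition box_norm ::
  "'c monoid \<Rightarrow> ('c, 'r, 's) tambara \<Rightarrow> ('c, 'a, 'b) tambara \<Rightarrow> ('r \<Rightarrow> 'a) \<times> ('s \<Rightarrow> 'b) \<Rightarrow>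
   ('a \<times> 'a) frag set \<Rightarrow> ('b, 'b, 'a, 'a) box_gen frag set" where
  "box_norm G R S \<phi> =
     (let M = algebra_module S \<phi>; Ke = box_kernel_e R M M; KG = box_kernel_G G R M M
      in SOME \<nu>. tambara_functor G (box_with_norm G R S \<phi> \<nu>) \<and>
           (\<forall>x\<in>carrier (lev_e S). \<forall>y\<in>carrier (lev_e S).
              \<nu> (frag_coset Ke (frag_of (x, y))) = frag_coset KG (frag_of (Ten (nm S x) (nm S y)))))"

definition box_tambara ::
  "'c monoid \<Rightarrow> ('c, 'r, 's) tambara \<Rightarrow> ('c, 'a, 'b) tambara \<Rightarrow> ('r \<Rightarrow> 'a) \<times> ('s \<Rightarrow> 'b) \<Rightarrow>
   ('c, ('a \<times> 'a) frag set, ('b, 'b, 'a, 'a) box_gen frag set) tambara" where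
  "box_tambara G R S \<phi> = box_with_norm G R S \<phi> (box_norm G R S \<phi>)"

definition frag_eval :: "'a ring \<Rightarrow> ('x \<Rightarrow> 'a) \<Rightarrow> 'x frag \<Rightarrow> 'a" where
  "frag_eval A f x =
     (\<Oplus>\<^bsub>A\<^esub>k\<in>Poly_Mapping.keys x. [Poly_Mapping.lookup x k] \<cdot>\<^bsub>A\<^esub> f k)"

text \<open>The multiplication \<open>S \<boxtimes>\<^sub>R S \<rightarrow> S\<close>; it is constant on the representatives of a class.\<close>

definition box_multiplication ::
  "('c, 'a, 'b) tambara \<Rightarrow>
   (('a \<times> 'a) frag set \<Rightarrow> 'a) \<times> (('b, 'b, 'a, 'a) box_gen frag set \<Rightarrow> 'b)" where
  "box_multiplication S =
     (\<lambda>A. the_elem (frag_eval (lev_e S) (\<lambda>(x, y). x \<otimes>\<^bsub>lev_e S\<^esub> y) ` A),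
      \<lambda>A. the_elem (frag_eval (lev_G S)
        (\<lambda>u. case u of Ten a b \<Rightarrow> a \<otimes>\<^bsub>lev_G S\<^esub> b | TrTen x y \<Rightarrow> tr S (x \<otimes>\<^bsub>lev_e S\<^esub> y)) ` A))"

definition tambara_kernel ::
  "('c, 'e, 'g) tambara \<Rightarrow> ('c, 'a, 'b) tambara \<Rightarrow> ('e \<Rightarrow> 'a) \<times> ('g \<Rightarrow> 'b) \<Rightarrow> 'e set \<times> 'g set" where
  "tambara_kernel R S \<phi> =
     ({x \<in> carrier (lev_e R). fst \<phi> x = \<zero>\<^bsub>lev_e S\<^esub>},
      {y \<in> carrier (lev_G R). snd \<phi> y = \<zero>\<^bsub>lev_G S\<^esub>})"

text \<open>
  Evaluation on an arbitrary finite \<open>G\<close>-set \<open>X\<close> with action \<open>\<alpha>\<close>. An element of \<open>I(X)\<close> assigns to each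
  \<open>x \<in> X\<close> its restriction to the orbit of \<open>x\<close>, identified with \<open>G/Stab(x)\<close> by \<open>g \<mapsto> g x\<close>: an element
  \<open>fst a x\<close> of \<open>I(G/e)\<close> if \<open>x\<close> has trivial stabilizer, and \<open>snd a x\<close> of \<open>I(G/G)\<close> if \<open>x\<close> is fixed (there is
  no other case as \<open>G\<close> has prime order). This is the product of the values of \<open>I\<close> over the orbits
  of \<open>X\<close>. Taking \<open>G\<close>-sets with points in \<open>nat\<close> is no restriction, up to isomorphism.
\<close>

definition fixed_point :: "'c monoid \<Rightarrow> ('c \<Rightarrow> nat \<Rightarrow> nat) \<Rightarrow> nat \<Rightarrow> bool" where
  "fixed_point G \<alpha> x \<longleftrightarrow> stabilizer G \<alpha> x = carrier G"

definition finite_gset :: "'c monoid \<Rightarrow> nat set \<Rightarrow> ('c \<Rightarrow> nat \<Rightarrow> nat) \<Rightarrow> bool" where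
  "finite_gset G X \<alpha> \<longleftrightarrow> finite X \<and> group_action G X \<alpha>"

definition gset_map ::
  "'c monoid \<Rightarrow> nat set \<Rightarrow> ('c \<Rightarrow> nat \<Rightarrow> nat) \<Rightarrow> nat set \<Rightarrow> ('c \<Rightarrow> nat \<Rightarrow> nat) \<Rightarrow> (nat \<Rightarrow> nat) \<Rightarrow> bool" where
  "gset_map G X \<alpha> Y \<beta> h \<longleftrightarrow>
     h \<in> X \<rightarrow> Y \<and> (\<forall>g\<in>carrier G. \<forall>x\<in>X. h (\<alpha> g x) = \<beta> g (h x))"

definition gset_sections ::
  "'c monoid \<Rightarrow> ('c, 'e, 'g) tambara \<Rightarrow> 'e set \<times> 'g set \<Rightarrow> nat set \<Rightarrow> ('c \<Rightarrow> nat \<Rightarrow> nat) \<Rightarrow>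
   ((nat \<Rightarrow> 'e) \<times> (nat \<Rightarrow> 'g)) set" where
  "gset_sections G R I X \<alpha> = {a. \<forall>x\<in>X.
     if fixed_point G \<alpha> x then snd a x \<in> snd I
     else fst a x \<in> fst I \<and> (\<forall>g\<in>carrier G. fst a (\<alpha> g x) = act R g (fst a x))}"

text \<open>
  The value of \<open>N_h(a)\<close> at a point \<open>y\<close> of trivial stabilizer, whose fibre consists of points of trivial
  stabilizer, and at a fixed point \<open>y\<close>, whose fibre \<open>F\<close> is a \<open>G\<close>-set.
\<close>

definition gset_norm_e ::
  "('c, 'e, 'g) tambara \<Rightarrow> nat set \<Rightarrow> (nat \<Rightarrow> nat) \<Rightarrow> (nat \<Rightarrow> 'e) \<times> (nat \<Rightarrow> 'g) \<Rightarrow> nat \<Rightarrow> 'e" where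
  "gset_norm_e R X h a y = (\<Otimes>\<^bsub>lev_e R\<^esub>x\<in>{x \<in> X. h x = y}. fst a x)"

definition gset_norm_G ::
  "'c monoid \<Rightarrow> ('c, 'e, 'g) tambara \<Rightarrow> nat set \<Rightarrow> ('c \<Rightarrow> nat \<Rightarrow> nat) \<Rightarrow> (nat \<Rightarrow> nat) \<Rightarrow>
   (nat \<Rightarrow> 'e) \<times> (nat \<Rightarrow> 'g) \<Rightarrow> nat \<Rightarrow> 'g" where
  "gset_norm_G G R X \<alpha> h a y =
     (let F = {x \<in> X. h x = y} in
      (\<Otimes>\<^bsub>lev_G R\<^esub>x\<in>{x \<in> F. fixed_point G \<alpha> x}. snd a x) \<otimes>\<^bsub>lev_G R\<^esub>
      (\<Otimes>\<^bsub>lev_G R\<^esub>Z\<in>orbits G {x \<in> F. \<not> fixed_point G \<alpha> x} \<alpha>. nm R (fst a (SOME x. x \<in> Z))))"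

text \<open>
  A Tambara ideal contains \<open>N_h(a)\<close>, an element of the product over the orbits of \<open>Y\<close>, if and only if
  it contains the value of \<open>N_h(a)\<close> at each point.
\<close>

definition higher_norms ::
  "'c monoid \<Rightarrow> ('c, 'e, 'g) tambara \<Rightarrow> 'e set \<times> 'g set \<Rightarrow> 'e set \<times> 'g set" where
  "higher_norms G R I =
     ({gset_norm_e R X h a y | X \<alpha> Y \<beta> h a y.
         finite_gset G X \<alpha> \<and> finite_gset G Y \<beta> \<and> gset_map G X \<alpha> Y \<beta> h \<and>
         (\<forall>z\<in>Y. 2 \<le> card {x \<in> X. h x = z}) \<and>
         a \<in> gset_sections G R I X \<alpha> \<and> y \<in> Y \<and> \<not> fixed_point G \<beta> y},
      {gset_norm_G G R X \<alpha> h a y | X \<alpha> Y \<beta> h a y.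
         finite_gset G X \<alpha> \<and> finite_gset G Y \<beta> \<and> gset_map G X \<alpha> Y \<beta> h \<and>
         (\<forall>z\<in>Y. 2 \<le> card {x \<in> X. h x = z}) \<and>
         a \<in> gset_sections G R I X \<alpha> \<and> y \<in> Y \<and> fixed_point G \<beta> y})"

text \<open>\<open>I^{>1}\<close>\<close>

definition higher_ideal ::
  "'c monoid \<Rightarrow> ('c, 'e, 'g) tambara \<Rightarrow> 'e set \<times> 'g set \<Rightarrow> 'e set \<times> 'g set" where
  "higher_ideal G R I = gen_tambara_ideal G R (higher_norms G R I)"

definition kaehler_e ::
  "'c monoid \<Rightarrow> ('c, 'r, 's) tambara \<Rightarrow> ('c, 'a, 'b) tambara \<Rightarrow> ('r \<Rightarrow> 'a) \<times> ('s \<Rightarrow> 'b) \<Rightarrow>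
   ('a \<times> 'a) frag set set monoid" where
  "kaehler_e G R S \<phi> =
     (let B = box_tambara G R S \<phi>; I = tambara_kernel B S (box_multiplication S)
      in (lev_e B)\<lparr>carrier := fst I\<rparr> A_Mod fst (higher_ideal G B I))"

definition kaehler_G ::
  "'c monoid \<Rightarrow> ('c, 'r, 's) tambara \<Rightarrow> ('c, 'a, 'b) tambara \<Rightarrow> ('r \<Rightarrow> 'a) \<times> ('s \<Rightarrow> 'b) \<Rightarrow>
   ('b, 'b, 'a, 'a) box_gen frag set set monoid" where
  "kaehler_G G R S \<phi> =
     (let B = box_tambara G R S \<phi>; I = tambara_kernel B S (box_multiplication S)
      in (lev_G B)\<lparr>carrier := snd I\<rparr> A_Mod snd (higher_ideal G B I))"

definition etale ::
  "'u itself \<Rightarrow> 'c monoid \<Rightarrow> ('c, 'r, 's) tambara \<Rightarrow>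
   ('c, 'a, 'b) tambara \<Rightarrow> ('r \<Rightarrow> 'a) \<times> ('s \<Rightarrow> 'b) \<Rightarrow> bool" where
  "etale U G R S \<phi> \<longleftrightarrow>
     tambara_hom G R S \<phi> \<and>
     finitely_presented U G R S \<phi> \<and>
     flat U G R (algebra_module S \<phi>) \<and>
     trivial_group (kaehler_e G R S \<phi>) \<and> trivial_group (kaehler_G G R S \<phi>)"

end

theory Submission
  imports Defs
begin

text \<open>
  Write \<open>A\<close> for \<open>R(G/e)\<close>. Over the ghost \<open>\<Gamma>\<close>, the coinduced algebra \<open>S\<close> is the universal algebra with an
  element \<open>x\<close> at level \<open>G/e\<close> such that \<open>x \<cdot> g x = \<delta> x\<close> (\<open>\<delta> = 1\<close> if \<open>g = 1\<close> and \<open>0\<close> otherwise) and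
  \<open>Tr x = 1\<close>: \<open>x\<close> is the indicator function of the unit of \<open>G\<close>. This gives finite presentation. It also
  gives \<open>S \<boxtimes> N\<close>: its value at \<open>G/e\<close> is the group of functions \<open>G \<rightarrow> N(G/e)\<close> and its value at \<open>G/G\<close> is
  \<open>N(G/e)\<close>, so \<open>S \<boxtimes> -\<close> is exact. For \<open>N = S\<close> the multiplication becomes evaluation at the unit of \<open>G\<close>;
  its kernel is generated by an idempotent at level \<open>G/G\<close>, and a product of two elements is a norm along
  the fold map, so the Kaehler differentials vanish.

  For the spectra, choose a prime \<open>K\<close> of \<open>Q = R(G/G)/Tr \<noteq> 0\<close> and let \<open>M\<close> be its preimage under the ring
  map \<open>A \<rightarrow> Q\<close>, \<open>x \<mapsto> [Nm x]\<close>. Then \<open>P = (M, M^G \<times> K)\<close> is a prime of \<open>\<Gamma>\<close>. It is not in the image, as it does not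
  contain \<open>(0, 1)\<close>, but it is contained in the image of the prime of \<open>S\<close> of all functions with values in
  \<open>M\<close>, so the image of the whole spectrum is not open.
\<close>

section \<open>Subdirect products\<close>

text \<open>The structures that have to be recognized as Tambara functors, quotients of term
  algebras and \<open>S \<boxtimes> S\<close>, come as raw operations on classes. Apart from the
  existence of negatives all axioms are identities, so they can be read off through any jointly
  injective family of operation-preserving maps into known Tambara functors. For the least
  congruence on terms the family consists of all quotients; for \<open>S \<boxtimes> S\<close> it is
  a single map to the coinduction of the ring of functions \<open>G \<rightarrow> A\<close>, which
  also supplies the norm that \<open>box_norm\<close> selects by choice.

  What makes \<open>S\<close> computable is that the translates of \<open>x\<close> are orthogonal
  idempotents with sum \<open>1\<close>, permuted simply transitively by \<open>G\<close>.
  Everything over \<open>S\<close> splits into pieces indexed by \<open>G\<close>, and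
  \<open>Tr x = 1\<close> with Frobenius reciprocity makes every element of level \<open>G/G\<close>
  a transfer from one piece.

  Open sets of the spectrum are closed under passing to smaller primes; this decides the second
  claim. The norm is additive only modulo transfers, which is why \<open>Q\<close> enters and has to
  be nonzero.\<close>

lemma cring_subdirect:
  fixes T :: "('a, 'm) ring_scheme" and F :: "(('b, 'n) ring_scheme \<times> ('a \<Rightarrow> 'b)) set"
  assumes zero: "\<zero>\<^bsub>T\<^esub> \<in> carrier T" and one: "\<one>\<^bsub>T\<^esub> \<in> carrier T"
    and add: "\<And>x y. \<lbrakk>x \<in> carrier T; y \<in> carrier T\<rbrakk> \<Longrightarrow> x \<oplus>\<^bsub>T\<^esub> y \<in> carrier T"
    and mult: "\<And>x y. \<lbrakk>x \<in> carrier T; y \<in> carrier T\<rbrakk> \<Longrightarrow> x \<otimes>\<^bsub>T\<^esub> y \<in> carrier T"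
    and neg: "\<exists>m\<in>carrier T. \<forall>(S, \<phi>)\<in>F. \<phi> m = \<ominus>\<^bsub>S\<^esub> \<one>\<^bsub>S\<^esub>"
    and fam: "\<And>S \<phi>. (S, \<phi>) \<in> F \<Longrightarrow> cring S \<and> \<phi> \<in> ring_hom T S \<and> \<phi> \<zero>\<^bsub>T\<^esub> = \<zero>\<^bsub>S\<^esub>"
    and inj: "\<And>x y. \<lbrakk>x \<in> carrier T; y \<in> carrier T; \<And>S \<phi>. (S, \<phi>) \<in> F \<Longrightarrow> \<phi> x = \<phi> y\<rbrakk> \<Longrightarrow> x = y"
  shows "cring T"
proof -
  \<comment> \<open>Zero is listed separately: its preservation is not part of
    \<open>ring_hom\<close> and cannot be derived before \<open>T\<close> is a ring.\<close>
  have cr: "cring S" "\<phi> \<zero>\<^bsub>T\<^esub> = \<zero>\<^bsub>S\<^esub>" "\<phi> \<one>\<^bsub>T\<^esub> = \<one>\<^bsub>S\<^esub>"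
    "x \<in> carrier T \<Longrightarrow> \<phi> x \<in> carrier S"
    "\<lbrakk>x \<in> carrier T; y \<in> carrier T\<rbrakk> \<Longrightarrow> \<phi> (x \<otimes>\<^bsub>T\<^esub> y) = \<phi> x \<otimes>\<^bsub>S\<^esub> \<phi> y"
    "\<lbrakk>x \<in> carrier T; y \<in> carrier T\<rbrakk> \<Longrightarrow> \<phi> (x \<oplus>\<^bsub>T\<^esub> y) = \<phi> x \<oplus>\<^bsub>S\<^esub> \<phi> y"
    if "(S, \<phi>) \<in> F" for S \<phi> x y
    using fam[OF that] by (auto simp: ring_hom_memE)
  obtain m where m: "m \<in> carrier T" "\<And>S \<phi>. (S, \<phi>) \<in> F \<Longrightarrow> \<phi> m = \<ominus>\<^bsub>S\<^esub> \<one>\<^bsub>S\<^esub>"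
    using neg by auto
  \<comment> \<open>\<open>m\<close> maps to minus one under every map, so \<open>m\<close> times
    \<open>x\<close> is a common preimage of the negatives of the images of
    \<open>x\<close>.\<close>
  have inv: "\<exists>y\<in>carrier T. y \<oplus>\<^bsub>T\<^esub> x = \<zero>\<^bsub>T\<^esub>" if x: "x \<in> carrier T" for x
  proof (intro bexI inj)
    fix S \<phi> assume S: "(S, \<phi>) \<in> F"
    interpret S: cring S by (rule cr(1)[OF S])
    have "\<phi> x \<in> carrier S" by (rule cr(4)[OF S x])
    then show "\<phi> (m \<otimes>\<^bsub>T\<^esub> x \<oplus>\<^bsub>T\<^esub> x) = \<phi> \<zero>\<^bsub>T\<^esub>"
      using x m(1) by (simp add: cr[OF S] mult m(2)[OF S] S.l_minus S.l_neg)
  qed (use x m mult add zero in auto)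
  show ?thesis
  proof (rule cringI)
    show "abelian_group T"
    proof (rule abelian_groupI)
      fix x y z assume xyz: "x \<in> carrier T" "y \<in> carrier T" "z \<in> carrier T"
      show "x \<oplus>\<^bsub>T\<^esub> y \<oplus>\<^bsub>T\<^esub> z = x \<oplus>\<^bsub>T\<^esub> (y \<oplus>\<^bsub>T\<^esub> z)"
      proof (rule inj)
        fix S \<phi> assume S: "(S, \<phi>) \<in> F"
        interpret S: cring S by (rule cr(1)[OF S])
        show "\<phi> (x \<oplus>\<^bsub>T\<^esub> y \<oplus>\<^bsub>T\<^esub> z) = \<phi> (x \<oplus>\<^bsub>T\<^esub> (y \<oplus>\<^bsub>T\<^esub> z))"
          using xyz by (simp add: cr[OF S] add S.a_assoc)
      qed (use xyz add in auto)
    next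
      fix x y assume xyz: "x \<in> carrier T" "y \<in> carrier T"
      show "x \<oplus>\<^bsub>T\<^esub> y = y \<oplus>\<^bsub>T\<^esub> x"
      proof (rule inj)
        fix S \<phi> assume S: "(S, \<phi>) \<in> F"
        interpret S: cring S by (rule cr(1)[OF S])
        show "\<phi> (x \<oplus>\<^bsub>T\<^esub> y) = \<phi> (y \<oplus>\<^bsub>T\<^esub> x)"
          using xyz by (simp add: cr[OF S] add S.a_comm)
      qed (use xyz add in auto)
    next
      fix x assume xyz: "x \<in> carrier T"
      show "\<zero>\<^bsub>T\<^esub> \<oplus>\<^bsub>T\<^esub> x = x"
      proof (rule inj)
        fix S \<phi> assume S: "(S, \<phi>) \<in> F"
        interpret S: cring S by (rule cr(1)[OF S])
        show "\<phi> (\<zero>\<^bsub>T\<^esub> \<oplus>\<^bsub>T\<^esub> x) = \<phi> x"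
          using xyz by (simp add: cr[OF S] add zero)
      qed (use xyz add zero in auto)
    qed (use zero add inv in auto)
    show "comm_monoid T"
    proof (rule comm_monoidI)
      fix x y z assume xyz: "x \<in> carrier T" "y \<in> carrier T" "z \<in> carrier T"
      show "x \<otimes>\<^bsub>T\<^esub> y \<otimes>\<^bsub>T\<^esub> z = x \<otimes>\<^bsub>T\<^esub> (y \<otimes>\<^bsub>T\<^esub> z)"
      proof (rule inj)
        fix S \<phi> assume S: "(S, \<phi>) \<in> F"
        interpret S: cring S by (rule cr(1)[OF S])
        show "\<phi> (x \<otimes>\<^bsub>T\<^esub> y \<otimes>\<^bsub>T\<^esub> z) = \<phi> (x \<otimes>\<^bsub>T\<^esub> (y \<otimes>\<^bsub>T\<^esub> z))"
          using xyz by (simp add: cr[OF S] mult S.m_assoc)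
      qed (use xyz mult in auto)
    next
      fix x y assume xyz: "x \<in> carrier T" "y \<in> carrier T"
      show "x \<otimes>\<^bsub>T\<^esub> y = y \<otimes>\<^bsub>T\<^esub> x"
      proof (rule inj)
        fix S \<phi> assume S: "(S, \<phi>) \<in> F"
        interpret S: cring S by (rule cr(1)[OF S])
        show "\<phi> (x \<otimes>\<^bsub>T\<^esub> y) = \<phi> (y \<otimes>\<^bsub>T\<^esub> x)"
          using xyz by (simp add: cr[OF S] mult S.m_comm)
      qed (use xyz mult in auto)
    next
      fix x assume xyz: "x \<in> carrier T"
      show "\<one>\<^bsub>T\<^esub> \<otimes>\<^bsub>T\<^esub> x = x"
      proof (rule inj)
        fix S \<phi> assume S: "(S, \<phi>) \<in> F"
        interpret S: cring S by (rule cr(1)[OF S])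
        show "\<phi> (\<one>\<^bsub>T\<^esub> \<otimes>\<^bsub>T\<^esub> x) = \<phi> x"
          using xyz by (simp add: cr[OF S] mult one)
      qed (use xyz mult one in auto)
    qed (use one mult in auto)
    fix x y z assume xyz: "x \<in> carrier T" "y \<in> carrier T" "z \<in> carrier T"
    show "(x \<oplus>\<^bsub>T\<^esub> y) \<otimes>\<^bsub>T\<^esub> z = x \<otimes>\<^bsub>T\<^esub> z \<oplus>\<^bsub>T\<^esub> y \<otimes>\<^bsub>T\<^esub> z"
    proof (rule inj)
      fix S \<phi> assume S: "(S, \<phi>) \<in> F"
      interpret S: cring S by (rule cr(1)[OF S])
      show "\<phi> ((x \<oplus>\<^bsub>T\<^esub> y) \<otimes>\<^bsub>T\<^esub> z) = \<phi> (x \<otimes>\<^bsub>T\<^esub> z \<oplus>\<^bsub>T\<^esub> y \<otimes>\<^bsub>T\<^esub> z)"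
        using xyz by (simp add: cr[OF S] add mult S.l_distr)
    qed (use xyz mult add in auto)
  qed
qed

text \<open>Preservation of the operations by a map out of a raw structure not yet known to be a Tambara functor.\<close>

definition tambara_ops_hom ::
  "'c monoid \<Rightarrow> ('c, 'e, 'g) tambara \<Rightarrow> ('c, 'a, 'b) tambara \<Rightarrow> ('e \<Rightarrow> 'a) \<times> ('g \<Rightarrow> 'b) \<Rightarrow> bool" where
  "tambara_ops_hom G R S \<phi> \<longleftrightarrow>
     tambara_functor G S \<and>
     fst \<phi> \<in> ring_hom (lev_e R) (lev_e S) \<and> fst \<phi> \<zero>\<^bsub>lev_e R\<^esub> = \<zero>\<^bsub>lev_e S\<^esub> \<and>
     snd \<phi> \<in> ring_hom (lev_G R) (lev_G S) \<and> snd \<phi> \<zero>\<^bsub>lev_G R\<^esub> = \<zero>\<^bsub>lev_G S\<^esub> \<and>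
     (\<forall>g\<in>carrier G. \<forall>x\<in>carrier (lev_e R). fst \<phi> (act R g x) = act S g (fst \<phi> x)) \<and>
     (\<forall>y\<in>carrier (lev_G R). fst \<phi> (res R y) = res S (snd \<phi> y)) \<and>
     (\<forall>x\<in>carrier (lev_e R). snd \<phi> (tr R x) = tr S (fst \<phi> x)) \<and>
     (\<forall>x\<in>carrier (lev_e R). snd \<phi> (nm R x) = nm S (fst \<phi> x))"

definition tambara_ops_closed :: "'c monoid \<Rightarrow> ('c, 'e, 'g) tambara \<Rightarrow> bool" where
  "tambara_ops_closed G T \<longleftrightarrow>
     \<zero>\<^bsub>lev_e T\<^esub> \<in> carrier (lev_e T) \<and> \<one>\<^bsub>lev_e T\<^esub> \<in> carrier (lev_e T) \<and>
     \<zero>\<^bsub>lev_G T\<^esub> \<in> carrier (lev_G T) \<and> \<one>\<^bsub>lev_G T\<^esub> \<in> carrier (lev_G T) \<and>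
     (\<forall>x\<in>carrier (lev_e T). \<forall>y\<in>carrier (lev_e T).
        x \<oplus>\<^bsub>lev_e T\<^esub> y \<in> carrier (lev_e T) \<and> x \<otimes>\<^bsub>lev_e T\<^esub> y \<in> carrier (lev_e T)) \<and>
     (\<forall>x\<in>carrier (lev_G T). \<forall>y\<in>carrier (lev_G T).
        x \<oplus>\<^bsub>lev_G T\<^esub> y \<in> carrier (lev_G T) \<and> x \<otimes>\<^bsub>lev_G T\<^esub> y \<in> carrier (lev_G T)) \<and>
     (\<forall>g\<in>carrier G. \<forall>x\<in>carrier (lev_e T). act T g x \<in> carrier (lev_e T)) \<and>
     (\<forall>y\<in>carrier (lev_G T). res T y \<in> carrier (lev_e T)) \<and>
     (\<forall>x\<in>carrier (lev_e T). tr T x \<in> carrier (lev_G T) \<and> nm T x \<in> carrier (lev_G T))"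

lemma tambara_hom_ops:
  assumes "tambara_hom G R S \<phi>"
  shows "tambara_ops_hom G R S \<phi>"
proof -
  interpret R: tambara_functor G R using assms by (simp add: tambara_hom_def)
  interpret S: tambara_functor G S using assms by (simp add: tambara_hom_def)
  show ?thesis
    using assms R.lev_e_cring R.lev_G_cring S.lev_e_cring S.lev_G_cring
    unfolding tambara_hom_def tambara_ops_hom_def cring_def
    by (simp add: ring_hom_zero)
qed

text \<open>Each remaining axiom equates two expressions in operations that the maps preserve. The
  two rings come first, because the preservation of finite sums and products rests on them.\<close>

proposition tambara_functor_subdirect:
  fixes T :: "('c, 'e, 'g) tambara"
    and F :: "(('c, 'a, 'b) tambara \<times> ('e \<Rightarrow> 'a) \<times> ('g \<Rightarrow> 'b)) set"
  assumes grp: "group G" and closed: "tambara_ops_closed G T"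
    and fam: "\<And>S \<phi>. (S, \<phi>) \<in> F \<Longrightarrow> tambara_ops_hom G T S \<phi>"
    and neg_e: "\<exists>m\<in>carrier (lev_e T). \<forall>(S, \<phi>)\<in>F. fst \<phi> m = \<ominus>\<^bsub>lev_e S\<^esub> \<one>\<^bsub>lev_e S\<^esub>"
    and neg_G: "\<exists>m\<in>carrier (lev_G T). \<forall>(S, \<phi>)\<in>F. snd \<phi> m = \<ominus>\<^bsub>lev_G S\<^esub> \<one>\<^bsub>lev_G S\<^esub>"
    and inj_e: "\<And>x y. \<lbrakk>x \<in> carrier (lev_e T); y \<in> carrier (lev_e T);
       \<And>S \<phi>. (S, \<phi>) \<in> F \<Longrightarrow> fst \<phi> x = fst \<phi> y\<rbrakk> \<Longrightarrow> x = y"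
    and inj_G: "\<And>x y. \<lbrakk>x \<in> carrier (lev_G T); y \<in> carrier (lev_G T);
       \<And>S \<phi>. (S, \<phi>) \<in> F \<Longrightarrow> snd \<phi> x = snd \<phi> y\<rbrakk> \<Longrightarrow> x = y"
  shows "tambara_functor G T"
proof -
  interpret group G by fact
  have cl: "\<zero>\<^bsub>lev_e T\<^esub> \<in> carrier (lev_e T)" "\<one>\<^bsub>lev_e T\<^esub> \<in> carrier (lev_e T)"
     "\<zero>\<^bsub>lev_G T\<^esub> \<in> carrier (lev_G T)" "\<one>\<^bsub>lev_G T\<^esub> \<in> carrier (lev_G T)"
     "\<And>x y. \<lbrakk>x \<in> carrier (lev_e T); y \<in> carrier (lev_e T)\<rbrakk> \<Longrightarrow> x \<oplus>\<^bsub>lev_e T\<^esub> y \<in> carrier (lev_e T)"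
     "\<And>x y. \<lbrakk>x \<in> carrier (lev_e T); y \<in> carrier (lev_e T)\<rbrakk> \<Longrightarrow> x \<otimes>\<^bsub>lev_e T\<^esub> y \<in> carrier (lev_e T)"
     "\<And>x y. \<lbrakk>x \<in> carrier (lev_G T); y \<in> carrier (lev_G T)\<rbrakk> \<Longrightarrow> x \<oplus>\<^bsub>lev_G T\<^esub> y \<in> carrier (lev_G T)"
     "\<And>x y. \<lbrakk>x \<in> carrier (lev_G T); y \<in> carrier (lev_G T)\<rbrakk> \<Longrightarrow> x \<otimes>\<^bsub>lev_G T\<^esub> y \<in> carrier (lev_G T)"
     "\<And>g x. \<lbrakk>g \<in> carrier G; x \<in> carrier (lev_e T)\<rbrakk> \<Longrightarrow> act T g x \<in> carrier (lev_e T)"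
     "\<And>y. y \<in> carrier (lev_G T) \<Longrightarrow> res T y \<in> carrier (lev_e T)"
     "\<And>x. x \<in> carrier (lev_e T) \<Longrightarrow> tr T x \<in> carrier (lev_G T)"
     "\<And>x. x \<in> carrier (lev_e T) \<Longrightarrow> nm T x \<in> carrier (lev_G T)"
    using closed unfolding tambara_ops_closed_def by blast+
  let ?Fe = "(\<lambda>(S, \<phi>). (lev_e S, fst \<phi>)) ` F"
  let ?FG = "(\<lambda>(S, \<phi>). (lev_G S, snd \<phi>)) ` F"
  have cre: "cring (lev_e T)"
  proof (rule cring_subdirect[where F = ?Fe])
    fix S \<phi> assume "(S, \<phi>) \<in> ?Fe"
    then obtain S' \<phi>' where *: "(S', \<phi>') \<in> F" "S = lev_e S'" "\<phi> = fst \<phi>'" by auto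
    show "cring S \<and> \<phi> \<in> ring_hom (lev_e T) S \<and> \<phi> \<zero>\<^bsub>lev_e T\<^esub> = \<zero>\<^bsub>S\<^esub>"
      using fam[OF *(1)] tambara_functor.lev_e_cring unfolding tambara_ops_hom_def *(2,3) by blast
  next
    fix x y assume xy: "x \<in> carrier (lev_e T)" "y \<in> carrier (lev_e T)"
      and *: "\<And>S \<phi>. (S, \<phi>) \<in> ?Fe \<Longrightarrow> \<phi> x = \<phi> y"
    show "x = y" by (rule inj_e[OF xy]) (rule *, force)
  qed (use cl neg_e in auto)
  have crG: "cring (lev_G T)"
  proof (rule cring_subdirect[where F = ?FG])
    fix S \<phi> assume "(S, \<phi>) \<in> ?FG"
    then obtain S' \<phi>' where *: "(S', \<phi>') \<in> F" "S = lev_G S'" "\<phi> = snd \<phi>'" by auto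
    show "cring S \<and> \<phi> \<in> ring_hom (lev_G T) S \<and> \<phi> \<zero>\<^bsub>lev_G T\<^esub> = \<zero>\<^bsub>S\<^esub>"
      using fam[OF *(1)] tambara_functor.lev_G_cring unfolding tambara_ops_hom_def *(2,3) by blast
  next
    fix x y assume xy: "x \<in> carrier (lev_G T)" "y \<in> carrier (lev_G T)"
      and *: "\<And>S \<phi>. (S, \<phi>) \<in> ?FG \<Longrightarrow> \<phi> x = \<phi> y"
    show "x = y" by (rule inj_G[OF xy]) (rule *, force)
  qed (use cl neg_G in auto)
  interpret E: cring "lev_e T" by (rule cre)
  interpret H: cring "lev_G T" by (rule crG)
  have fe: "tambara_functor G S" "ring_hom_cring (lev_e T) (lev_e S) (fst \<phi>)"
      "ring_hom_cring (lev_G T) (lev_G S) (snd \<phi>)"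
      "\<And>g x. g \<in> carrier G \<Longrightarrow> x \<in> carrier (lev_e T) \<Longrightarrow> fst \<phi> (act T g x) = act S g (fst \<phi> x)"
      "\<And>y. y\<in>carrier (lev_G T) \<Longrightarrow> fst \<phi> (res T y) = res S (snd \<phi> y)"
      "\<And>x. x\<in>carrier (lev_e T) \<Longrightarrow> snd \<phi> (tr T x) = tr S (fst \<phi> x)"
      "\<And>x. x\<in>carrier (lev_e T) \<Longrightarrow> snd \<phi> (nm T x) = nm S (fst \<phi> x)"
    if "(S, \<phi>) \<in> F" for S \<phi>
    using fam[OF that] cre crG tambara_functor.lev_e_cring[of G S] tambara_functor.lev_G_cring[of G S]
    unfolding tambara_ops_hom_def ring_hom_cring_def ring_hom_cring_axioms_def by blast+
  have acte: "(\<lambda>g. act T g x) \<in> carrier G \<rightarrow> carrier (lev_e T)" if "x \<in> carrier (lev_e T)" for x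
    using cl(9) that by auto
  have eqe: "x = y" if "x \<in> carrier (lev_e T)" "y \<in> carrier (lev_e T)"
    "\<And>S \<phi>. \<lbrakk>(S, \<phi>) \<in> F; tambara_functor G S; ring_hom_cring (lev_e T) (lev_e S) (fst \<phi>);
      ring_hom_cring (lev_G T) (lev_G S) (snd \<phi>)\<rbrakk> \<Longrightarrow> fst \<phi> x = fst \<phi> y" for x y
    using that fe by (intro inj_e) auto
  have eqG: "x = y" if "x \<in> carrier (lev_G T)" "y \<in> carrier (lev_G T)"
    "\<And>S \<phi>. \<lbrakk>(S, \<phi>) \<in> F; tambara_functor G S; ring_hom_cring (lev_e T) (lev_e S) (fst \<phi>);
      ring_hom_cring (lev_G T) (lev_G S) (snd \<phi>)\<rbrakk> \<Longrightarrow> snd \<phi> x = snd \<phi> y" for x y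
    using that fe by (intro inj_G) auto
  have hom_thms: "fst \<phi> \<zero>\<^bsub>lev_e T\<^esub> = \<zero>\<^bsub>lev_e S\<^esub>" "fst \<phi> \<one>\<^bsub>lev_e T\<^esub> = \<one>\<^bsub>lev_e S\<^esub>"
      "snd \<phi> \<zero>\<^bsub>lev_G T\<^esub> = \<zero>\<^bsub>lev_G S\<^esub>" "snd \<phi> \<one>\<^bsub>lev_G T\<^esub> = \<one>\<^bsub>lev_G S\<^esub>"
      "\<And>x. x \<in> carrier (lev_e T) \<Longrightarrow> fst \<phi> x \<in> carrier (lev_e S)"
      "\<And>x. x \<in> carrier (lev_G T) \<Longrightarrow> snd \<phi> x \<in> carrier (lev_G S)"
      "\<And>x y. \<lbrakk>x \<in> carrier (lev_e T); y \<in> carrier (lev_e T)\<rbrakk> \<Longrightarrow> fst \<phi> (x \<otimes>\<^bsub>lev_e T\<^esub> y) = fst \<phi> x \<otimes>\<^bsub>lev_e S\<^esub> fst \<phi> y"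
      "\<And>x y. \<lbrakk>x \<in> carrier (lev_e T); y \<in> carrier (lev_e T)\<rbrakk> \<Longrightarrow> fst \<phi> (x \<oplus>\<^bsub>lev_e T\<^esub> y) = fst \<phi> x \<oplus>\<^bsub>lev_e S\<^esub> fst \<phi> y"
      "\<And>x y. \<lbrakk>x \<in> carrier (lev_G T); y \<in> carrier (lev_G T)\<rbrakk> \<Longrightarrow> snd \<phi> (x \<otimes>\<^bsub>lev_G T\<^esub> y) = snd \<phi> x \<otimes>\<^bsub>lev_G S\<^esub> snd \<phi> y"
      "\<And>x y. \<lbrakk>x \<in> carrier (lev_G T); y \<in> carrier (lev_G T)\<rbrakk> \<Longrightarrow> snd \<phi> (x \<oplus>\<^bsub>lev_G T\<^esub> y) = snd \<phi> x \<oplus>\<^bsub>lev_G S\<^esub> snd \<phi> y"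
    if "(S, \<phi>) \<in> F" for S \<phi>
    using fam[OF that] unfolding tambara_ops_hom_def by (auto simp: ring_hom_def)
  show ?thesis
  proof unfold_locales
    fix g assume g: "g \<in> carrier G"
    show "act T g \<in> ring_hom (lev_e T) (lev_e T)"
    proof (rule ring_hom_memI)
      fix x y assume xy: "x \<in> carrier (lev_e T)" "y \<in> carrier (lev_e T)"
      show "act T g (x \<otimes>\<^bsub>lev_e T\<^esub> y) = act T g x \<otimes>\<^bsub>lev_e T\<^esub> act T g y"
        by (rule eqe) (use xy g in \<open>simp_all add: cl fe(4-) hom_thms
             ring_hom_mult[OF tambara_functor.act_hom]\<close>)
      show "act T g (x \<oplus>\<^bsub>lev_e T\<^esub> y) = act T g x \<oplus>\<^bsub>lev_e T\<^esub> act T g y"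
        by (rule eqe) (use xy g in \<open>simp_all add: cl fe(4-) hom_thms
             ring_hom_add[OF tambara_functor.act_hom]\<close>)
    next
      show "act T g \<one>\<^bsub>lev_e T\<^esub> = \<one>\<^bsub>lev_e T\<^esub>"
        by (rule eqe) (use g in \<open>simp_all add: cl fe(4-) hom_thms
             ring_hom_one[OF tambara_functor.act_hom]\<close>)
    qed (use g cl in auto)
  next
    fix x assume x: "x \<in> carrier (lev_e T)"
    show "act T \<one>\<^bsub>G\<^esub> x = x"
      by (rule eqe) (use x in \<open>simp_all add: cl fe(4-) hom_thms tambara_functor.act_one\<close>)
    show "res T (tr T x) = (\<Oplus>\<^bsub>lev_e T\<^esub>g\<in>carrier G. act T g x)"
    proof (rule eqe)
      fix S \<phi> assume S: "(S, \<phi>) \<in> F" "tambara_functor G S" "ring_hom_cring (lev_e T) (lev_e S) (fst \<phi>)"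
      interpret S: tambara_functor G S by fact
      interpret Se: cring "lev_e S" by (rule S.lev_e_cring)
      have "(\<Oplus>\<^bsub>lev_e S\<^esub>g\<in>carrier G. fst \<phi> (act T g x)) = (\<Oplus>\<^bsub>lev_e S\<^esub>g\<in>carrier G. act S g (fst \<phi> x))"
        using x by (intro Se.add.finprod_cong')
          (auto simp: fe[OF S(1)] ring_hom_closed[OF S.act_hom] hom_thms[OF S(1)])
      then show "fst \<phi> (res T (tr T x)) = fst \<phi> (\<Oplus>\<^bsub>lev_e T\<^esub>g\<in>carrier G. act T g x)"
        using x S(1) by (simp add: cl fe(4-) hom_thms ring_hom_cring.hom_finsum[OF S(3)] acte o_def S.res_tr)
    qed (use x acte in \<open>auto simp: cl intro!: E.finsum_closed\<close>)
    show "res T (nm T x) = (\<Otimes>\<^bsub>lev_e T\<^esub>g\<in>carrier G. act T g x)"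
    proof (rule eqe)
      fix S \<phi> assume S: "(S, \<phi>) \<in> F" "tambara_functor G S" "ring_hom_cring (lev_e T) (lev_e S) (fst \<phi>)"
      interpret S: tambara_functor G S by fact
      interpret Se: cring "lev_e S" by (rule S.lev_e_cring)
      have "(\<Otimes>\<^bsub>lev_e S\<^esub>g\<in>carrier G. fst \<phi> (act T g x)) = (\<Otimes>\<^bsub>lev_e S\<^esub>g\<in>carrier G. act S g (fst \<phi> x))"
        using x by (intro Se.finprod_cong')
          (auto simp: fe[OF S(1)] ring_hom_closed[OF S.act_hom] hom_thms[OF S(1)])
      then show "fst \<phi> (res T (nm T x)) = fst \<phi> (\<Otimes>\<^bsub>lev_e T\<^esub>g\<in>carrier G. act T g x)"
        using x S(1) by (simp add: cl fe(4-) hom_thms ring_hom_cring.hom_finprod[OF S(3)] acte o_def S.res_nm)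
    qed (use x acte in \<open>auto simp: cl intro!: E.finprod_closed\<close>)
  next
    fix g h x assume "g \<in> carrier G" "h \<in> carrier G" "x \<in> carrier (lev_e T)"
    then show "act T (g \<otimes>\<^bsub>G\<^esub> h) x = act T g (act T h x)"
      by (intro eqe) (simp_all add: cl fe(4-) hom_thms tambara_functor.act_mult)
  next
    show "res T \<in> ring_hom (lev_G T) (lev_e T)"
    proof (rule ring_hom_memI)
      fix x y assume xy: "x \<in> carrier (lev_G T)" "y \<in> carrier (lev_G T)"
      show "res T (x \<otimes>\<^bsub>lev_G T\<^esub> y) = res T x \<otimes>\<^bsub>lev_e T\<^esub> res T y"
        by (rule eqe) (use xy in \<open>simp_all add: cl fe(4-) hom_thms
             ring_hom_mult[OF tambara_functor.res_hom]\<close>)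
      show "res T (x \<oplus>\<^bsub>lev_G T\<^esub> y) = res T x \<oplus>\<^bsub>lev_e T\<^esub> res T y"
        by (rule eqe) (use xy in \<open>simp_all add: cl fe(4-) hom_thms
             ring_hom_add[OF tambara_functor.res_hom]\<close>)
    next
      show "res T \<one>\<^bsub>lev_G T\<^esub> = \<one>\<^bsub>lev_e T\<^esub>"
        by (rule eqe) (simp_all add: cl fe(4-) hom_thms ring_hom_one[OF tambara_functor.res_hom])
    qed (use cl in auto)
  next
    fix x y assume "x \<in> carrier (lev_e T)" "y \<in> carrier (lev_e T)"
    then show "tr T (x \<oplus>\<^bsub>lev_e T\<^esub> y) = tr T x \<oplus>\<^bsub>lev_G T\<^esub> tr T y"
      by (intro eqG) (simp_all add: cl fe(4-) hom_thms tambara_functor.tr_add)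
  next
    fix x y assume "x \<in> carrier (lev_e T)" "y \<in> carrier (lev_e T)"
    then show "nm T (x \<otimes>\<^bsub>lev_e T\<^esub> y) = nm T x \<otimes>\<^bsub>lev_G T\<^esub> nm T y"
      by (intro eqG) (simp_all add: cl fe(4-) hom_thms tambara_functor.nm_mult)
  next
    show "nm T \<zero>\<^bsub>lev_e T\<^esub> = \<zero>\<^bsub>lev_G T\<^esub>"
      by (intro eqG) (simp_all add: cl fe(4-) hom_thms tambara_functor.nm_zero)
    show "nm T \<one>\<^bsub>lev_e T\<^esub> = \<one>\<^bsub>lev_G T\<^esub>"
      by (intro eqG) (simp_all add: cl fe(4-) hom_thms tambara_functor.nm_one)
  next
    fix g y assume "g \<in> carrier G" "y \<in> carrier (lev_G T)"
    then show "act T g (res T y) = res T y"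
      by (intro eqe) (simp_all add: cl fe(4-) hom_thms tambara_functor.act_res)
  next
    fix g x assume "g \<in> carrier G" "x \<in> carrier (lev_e T)"
    then show "tr T (act T g x) = tr T x" "nm T (act T g x) = nm T x"
      by (intro eqG; simp add: cl fe(4-) hom_thms tambara_functor.tr_act tambara_functor.nm_act)+
  next
    fix x y assume "x \<in> carrier (lev_e T)" "y \<in> carrier (lev_G T)"
    then show "tr T (x \<otimes>\<^bsub>lev_e T\<^esub> res T y) = tr T x \<otimes>\<^bsub>lev_G T\<^esub> y"
      by (intro eqG) (simp_all add: cl fe(4-) hom_thms tambara_functor.frobenius)
  next
    fix x y \<U> assume xy: "x \<in> carrier (lev_e T)" "y \<in> carrier (lev_e T)"
      and U: "subset_transversal G \<U>"
    have c1: "(\<lambda>g. act T g (if g \<in> U then x else y)) \<in> carrier G \<rightarrow> carrier (lev_e T)" for U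
      using xy cl(9) by auto
    have c2: "(\<lambda>U. \<Otimes>\<^bsub>lev_e T\<^esub>g\<in>carrier G. act T g (if g \<in> U then x else y)) \<in> \<U> \<rightarrow> carrier (lev_e T)"
      using c1 by (auto intro!: E.finprod_closed)
    show "nm T (x \<oplus>\<^bsub>lev_e T\<^esub> y) = nm T x \<oplus>\<^bsub>lev_G T\<^esub> nm T y \<oplus>\<^bsub>lev_G T\<^esub>
        tr T (\<Oplus>\<^bsub>lev_e T\<^esub>U\<in>\<U>. \<Otimes>\<^bsub>lev_e T\<^esub>g\<in>carrier G. act T g (if g \<in> U then x else y))"
      (is "_ = _ \<oplus>\<^bsub>lev_G T\<^esub> tr T ?s")
    proof (rule eqG)
      have s: "?s \<in> carrier (lev_e T)" using c2 by (intro E.finsum_closed)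
      then show "nm T x \<oplus>\<^bsub>lev_G T\<^esub> nm T y \<oplus>\<^bsub>lev_G T\<^esub> tr T ?s \<in> carrier (lev_G T)"
        using xy by (simp add: cl)
      fix S \<phi> assume S: "(S, \<phi>) \<in> F" "tambara_functor G S" "ring_hom_cring (lev_e T) (lev_e S) (fst \<phi>)"
        "ring_hom_cring (lev_G T) (lev_G S) (snd \<phi>)"
      interpret S: tambara_functor G S by fact
      interpret Se: cring "lev_e S" by (rule S.lev_e_cring)
      have c3: "act S g (fst \<phi> z) \<in> carrier (lev_e S)" if "g \<in> carrier G" "z \<in> carrier (lev_e T)" for g z
        using that by (auto simp: ring_hom_closed[OF S.act_hom] hom_thms[OF S(1)])
      \<comment> \<open>Reciprocity holds in \<open>S\<close> for the same transversal, which
        depends on \<open>G\<close> alone; it remains to carry the map through the inner product and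
        the outer sum.\<close>
      have p: "fst \<phi> (\<Otimes>\<^bsub>lev_e T\<^esub>g\<in>carrier G. act T g (if g \<in> U then x else y)) =
        (\<Otimes>\<^bsub>lev_e S\<^esub>g\<in>carrier G. act S g (if g \<in> U then fst \<phi> x else fst \<phi> y))" for U
        unfolding ring_hom_cring.hom_finprod[OF S(3) c1]
        by (rule Se.finprod_cong') (use xy c3 in \<open>auto simp: fe[OF S(1)]\<close>)
      have c4: "(\<Otimes>\<^bsub>lev_e S\<^esub>g\<in>carrier G. act S g (if g \<in> U then fst \<phi> x else fst \<phi> y)) \<in> carrier (lev_e S)" for U
        using xy c3 by (auto intro!: Se.finprod_closed)
      have "fst \<phi> ?s =
        (\<Oplus>\<^bsub>lev_e S\<^esub>U\<in>\<U>. \<Otimes>\<^bsub>lev_e S\<^esub>g\<in>carrier G. act S g (if g \<in> U then fst \<phi> x else fst \<phi> y))"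
        unfolding ring_hom_cring.hom_finsum[OF S(3) c2] by (simp add: o_def p)
      then show "snd \<phi> (nm T (x \<oplus>\<^bsub>lev_e T\<^esub> y)) =
          snd \<phi> (nm T x \<oplus>\<^bsub>lev_G T\<^esub> nm T y \<oplus>\<^bsub>lev_G T\<^esub> tr T ?s)"
        using xy s by (simp add: cl fe[OF S(1)] hom_thms[OF S(1)] S.nm_add[OF _ _ U])
    qed (use xy in \<open>simp add: cl\<close>)
  qed (simp_all add: cl)
qed

section \<open>Groups of prime order\<close>

lemma (in comm_monoid) finprod_product:
  assumes "finite A" "finite B" "\<And>a b. \<lbrakk>a \<in> A; b \<in> B\<rbrakk> \<Longrightarrow> f a b \<in> carrier G"
  shows "(\<Otimes>a\<in>A. \<Otimes>b\<in>B. f a b) = finprod G (\<lambda>(a, b). f a b) (A \<times> B)"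
  using assms(1,3)
proof (induction A rule: finite_induct)
  case (insert a A)
  have "finprod G (\<lambda>(a, b). f a b) (insert a A \<times> B) = finprod G (\<lambda>(a, b). f a b) (Pair a ` B \<union> A \<times> B)"
    by (rule finprod_cong') (use insert in auto)
  also have "\<dots> = finprod G (\<lambda>(a, b). f a b) (Pair a ` B) \<otimes> finprod G (\<lambda>(a, b). f a b) (A \<times> B)"
    by (rule finprod_Un_disjoint) (use insert assms(2) in auto)
  also have "finprod G (\<lambda>(a, b). f a b) (Pair a ` B) = (\<Otimes>b\<in>B. f a b)"
    by (subst finprod_reindex) (use insert in \<open>auto simp: inj_on_def\<close>)
  finally show ?case using insert by (simp add: Pi_def)
qed auto

text \<open>Induction on \<open>S\<close>: the subsets of \<open>insert a S\<close> are those of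
  \<open>S\<close> and those with \<open>a\<close> added, and they carry the factors
  \<open>y a\<close> and \<open>x a\<close>.\<close>

lemma (in cring) finprod_add_expand:
  assumes "finite S" "x \<in> S \<rightarrow> carrier R" "y \<in> S \<rightarrow> carrier R"
  shows "(\<Otimes>g\<in>S. x g \<oplus> y g) = (\<Oplus>V\<in>Pow S. \<Otimes>g\<in>S. if g \<in> V then x g else y g)"
  using assms
proof (induction S rule: finite_induct)
  case empty
  then show ?case by (simp add: finsum_insert)
next
  case (insert a S)
  let ?P = "\<lambda>S V. \<Otimes>g\<in>S. if g \<in> V then x g else y g"
  have xa: "x a \<in> carrier R" "y a \<in> carrier R" and xy: "x \<in> S \<rightarrow> carrier R" "y \<in> S \<rightarrow> carrier R"
    using insert.prems by auto
  have P: "?P T V \<in> carrier R" if "T \<subseteq> insert a S" for V T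
    using insert.prems that by (intro finprod_closed) (auto dest!: subsetD)
  have 1: "?P (insert a S) V = y a \<otimes> ?P S V" if "V \<in> Pow S" for V
    using insert that by (subst finprod_insert) auto
  have 2: "?P (insert a S) (insert a V) = x a \<otimes> ?P S V" if "V \<in> Pow S" for V
  proof -
    have "?P S (insert a V) = ?P S V"
      by (rule finprod_cong') (use insert xy in auto)
    then show ?thesis using insert that by (subst finprod_insert) auto
  qed
  have ins: "i \<subseteq> S \<Longrightarrow> insert a i \<subseteq> insert a S" for i by auto
  have "(\<Oplus>V\<in>Pow (insert a S). ?P (insert a S) V) =
      (\<Oplus>V\<in>Pow S. ?P (insert a S) V) \<oplus> (\<Oplus>V\<in>insert a ` Pow S. ?P (insert a S) V)"
    unfolding Pow_insert by (rule finsum_Un_disjoint) (use insert P in auto)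
  also have "(\<Oplus>V\<in>insert a ` Pow S. ?P (insert a S) V) = (\<Oplus>V\<in>Pow S. ?P (insert a S) (insert a V))"
    using insert.hyps by (intro finsum_reindex) (auto intro!: P inj_onI)
  also have "\<dots> = (\<Oplus>V\<in>Pow S. x a \<otimes> ?P S V)"
    by (rule finsum_cong') (use 2 P xa in \<open>auto simp: Pi_def simp del: insert_iff\<close>)
  also have "(\<Oplus>V\<in>Pow S. ?P (insert a S) V) = (\<Oplus>V\<in>Pow S. y a \<otimes> ?P S V)"
    by (rule finsum_cong') (simp_all add: 1 P xa Pi_def subset_insertI)
  also have "(\<Oplus>V\<in>Pow S. y a \<otimes> ?P S V) \<oplus> (\<Oplus>V\<in>Pow S. x a \<otimes> ?P S V) =
      (x a \<oplus> y a) \<otimes> (\<Oplus>V\<in>Pow S. ?P S V)"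
    using insert.hyps xa P
    by (subst (1 2) finsum_rdistr[symmetric])
      (simp_all add: l_distr a_comm Pi_def subset_insertI del: finsum_rdistr)
  also have "\<dots> = (\<Otimes>g\<in>insert a S. x g \<oplus> y g)"
    using insert xa xy by (subst finprod_insert) auto
  finally show ?case ..
qed

section \<open>Free orbits of proper subsets\<close>

locale prime_order_group = group G for G :: "'c monoid" (structure) +
  assumes prime_order: "prime (order G)"
begin

lemma finite_carrier: "finite (carrier G)"
  using prime_gt_0_nat[OF prime_order] by (simp add: order_gt_0_iff_finite)

text \<open>The stabilizer is a subgroup, so by Lagrange and primality it is trivial or all of
  \<open>G\<close>; in the second case \<open>U\<close>, being nonempty and closed under all
  translations, would be all of \<open>G\<close>.\<close>

lemma stabilizer_proper_subset:
  assumes U: "U \<noteq> {}" "U \<subset> carrier G" and g: "g \<in> carrier G" "g <# U = U"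
  shows "g = \<one>"
proof (rule ccontr)
  assume "g \<noteq> \<one>"
  let ?S = "{g \<in> carrier G. g <# U = U}"
  have Uc: "U \<subseteq> carrier G" using U by auto
  have sub: "subgroup ?S G"
  proof (rule subgroupI)
    fix a assume a: "a \<in> ?S"
    then have "inv a <# (a <# U) = U"
      using Uc lcos_m_assoc[of U "inv a" a] by (simp only: mem_Collect_eq inv_closed l_inv lcos_mult_one)
    then show "inv a \<in> ?S" using a by auto
  next
    fix a b assume "a \<in> ?S" "b \<in> ?S"
    then show "a \<otimes> b \<in> ?S" using Uc by (auto simp: lcos_m_assoc[symmetric])
  qed (use Uc lcos_mult_one in auto)
  have "card ?S dvd order G" unfolding lagrange[OF sub, symmetric] by (rule dvd_triv_right)
  then have "card ?S = 1 \<or> card ?S = order G" using prime_order by (simp add: prime_nat_iff)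
  moreover have "{\<one>, g} \<subseteq> ?S" using g Uc lcos_mult_one by auto
  then have "2 \<le> card ?S"
    using \<open>g \<noteq> \<one>\<close> card_mono[of ?S "{\<one>, g}"] finite_carrier by auto
  ultimately have "?S = carrier G"
    using finite_carrier by (intro card_subset_eq) (auto simp: order_def)
  moreover obtain u where u: "u \<in> U" using U by auto
  ultimately have "carrier G \<subseteq> U"
  proof -
    have "h \<in> U" if "h \<in> carrier G" for h
    proof -
      have "h \<otimes> inv u \<in> ?S" using \<open>?S = carrier G\<close> that u Uc by (metis inv_closed m_closed subsetD)
      then have "(h \<otimes> inv u) <# U = U" by simp
      moreover have "(h \<otimes> inv u) \<otimes> u \<in> (h \<otimes> inv u) <# U" using u by (auto simp: l_coset_def)
      ultimately show ?thesis using that u Uc by (simp add: m_assoc subsetD)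
    qed
    then show ?thesis by auto
  qed
  then show False using U by auto
qed

text \<open>Surjectivity is the existence of representatives. For injectivity, uniqueness gives
  \<open>U1 = U2\<close>, and then triviality of the stabilizer gives equal translations.\<close>

lemma subset_transversal_bij:
  assumes T: "subset_transversal G \<U>"
  shows "bij_betw (\<lambda>(k, U). k <# U) (carrier G \<times> \<U>) (Pow (carrier G) - {{}, carrier G})"
proof -
  have U: "\<And>U. U \<in> \<U> \<Longrightarrow> U \<noteq> {} \<and> U \<subset> carrier G"
    and ex: "\<And>U. U \<noteq> {} \<Longrightarrow> U \<subset> carrier G \<Longrightarrow> (\<exists>!V. V \<in> \<U> \<and> (\<exists>g\<in>carrier G. V = g <# U))"
    using T by (simp_all add: subset_transversal_def)
  have inv1: "inv k <# (k <# U) = U" if "k \<in> carrier G" "U \<subseteq> carrier G" for k U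
    using that by (simp add: lcos_m_assoc lcos_mult_one)
  have proper: "k <# U \<noteq> {} \<and> k <# U \<subset> carrier G"
    if k: "k \<in> carrier G" and U: "U \<noteq> {}" "U \<subset> carrier G" for k U
  proof -
    have "k <# U \<noteq> carrier G"
    proof
      assume "k <# U = carrier G"
      then have "U = inv k <# carrier G" using inv1[of k U] k U by auto
      also have "\<dots> = carrier G"
      proof -
        have "h = inv k \<otimes> (k \<otimes> h)" if "h \<in> carrier G" for h
          using that k by (simp add: m_assoc[symmetric])
        then show ?thesis using k unfolding l_coset_def by (auto; metis m_closed)
      qed
      finally show False using U by auto
    qed
    then show ?thesis using l_coset_subset_G[of U k] U k by (auto simp: l_coset_def)
  qed
  show ?thesis
  proof (rule bij_betwI')
    fix a b assume a: "a \<in> carrier G \<times> \<U>" and b: "b \<in> carrier G \<times> \<U>"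
    obtain k U1 l U2 where ab: "a = (k, U1)" "b = (l, U2)" by fastforce
    have kl: "k \<in> carrier G" "l \<in> carrier G" "U1 \<in> \<U>" "U2 \<in> \<U>" using a b ab by auto
    have "a = b" if eq: "k <# U1 = l <# U2"
    proof -
      have p: "k <# U1 \<noteq> {}" "k <# U1 \<subset> carrier G" using proper[of k U1] U[of U1] kl by auto
      have i: "inv k <# (k <# U1) = U1" "inv l <# (k <# U1) = U2"
        using inv1[of k U1] inv1[of l U2] eq U kl by auto
      have "U1 = U2"
        using ex[OF p] kl i by (metis inv_closed)
      have "(inv l \<otimes> k) <# U1 = U1"
        using i(2) kl U[of U1] \<open>U1 = U2\<close> by (metis inv_closed lcos_m_assoc psubsetE)
      then have "inv l \<otimes> k = \<one>"
        using stabilizer_proper_subset[of U1 "inv l \<otimes> k"] U[OF kl(3)] kl by simp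
      from inv_equality[OF this] have "inv k = inv l" using kl by simp
      from arg_cong[OF this, of "\<lambda>x. inv x"] have "l = k" using kl by simp
      then show ?thesis using ab \<open>U1 = U2\<close> by simp
    qed
    then show "((case a of (k, U) \<Rightarrow> k <# U) = (case b of (k, U) \<Rightarrow> k <# U)) = (a = b)"
      using ab by auto
  next
    fix a assume "a \<in> carrier G \<times> \<U>"
    then show "(case a of (k, U) \<Rightarrow> k <# U) \<in> Pow (carrier G) - {{}, carrier G}"
      using proper[of "fst a" "snd a"] U[of "snd a"] by (auto simp: mem_Times_iff split_beta)
  next
    fix V assume "V \<in> Pow (carrier G) - {{}, carrier G}"
    then have V: "V \<noteq> {}" "V \<subset> carrier G" by auto
    then obtain W g where W: "W \<in> \<U>" "g \<in> carrier G" "W = g <# V" using ex[OF V] by blast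
    then have "V = inv g <# W" using inv1[of g V] V by auto
    then show "\<exists>a\<in>carrier G \<times> \<U>. V = (case a of (k, U) \<Rightarrow> k <# U)"
      using W by (intro bexI[of _ "(inv g, W)"]) auto
  qed
qed

lemma bij_right_mult: "k \<in> carrier G \<Longrightarrow> bij_betw (\<lambda>g. g \<otimes> k) (carrier G) (carrier G)"
  by (rule bij_betwI[where g = "\<lambda>g. g \<otimes> inv k"]) (auto simp: m_assoc)

lemma bij_left_mult: "k \<in> carrier G \<Longrightarrow> bij_betw (\<lambda>g. k \<otimes> g) (carrier G) (carrier G)"
  by (rule bij_betwI[where g = "\<lambda>g. inv k \<otimes> g"]) (auto simp: m_assoc[symmetric])

end

lemma (in comm_monoid) finprod_bij:
  assumes "bij_betw h A B" "f \<in> B \<rightarrow> carrier G"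
  shows "(\<Otimes>a\<in>A. f (h a)) = (\<Otimes>b\<in>B. f b)"
  using assms finprod_reindex[of f h A] by (auto simp: bij_betw_def)

section \<open>Rings of functions\<close>

lemma fun_ring_simps [simp]:
  "carrier (fun_ring X Q) = X \<rightarrow>\<^sub>E carrier Q"
  "s \<otimes>\<^bsub>fun_ring X Q\<^esub> t = (\<lambda>x\<in>X. s x \<otimes>\<^bsub>Q\<^esub> t x)"
  "s \<oplus>\<^bsub>fun_ring X Q\<^esub> t = (\<lambda>x\<in>X. s x \<oplus>\<^bsub>Q\<^esub> t x)"
  "\<one>\<^bsub>fun_ring X Q\<^esub> = (\<lambda>x\<in>X. \<one>\<^bsub>Q\<^esub>)"
  "\<zero>\<^bsub>fun_ring X Q\<^esub> = (\<lambda>x\<in>X. \<zero>\<^bsub>Q\<^esub>)"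
  by (simp_all add: fun_ring_def)

lemma fun_ring_eval_hom: "x \<in> X \<Longrightarrow> (\<lambda>s. s x) \<in> ring_hom (fun_ring X Q) Q"
  by (rule ring_hom_memI) auto

lemma cring_fun_ring:
  fixes Q :: "'q ring"
  assumes "cring Q"
  shows "cring (fun_ring X Q)"
proof -
  interpret cring Q by fact
  show ?thesis
  proof (rule cring_subdirect[where F = "{(Q, \<lambda>s. s x) | x. x \<in> X}"])
    show "\<exists>m\<in>carrier (fun_ring X Q). \<forall>(S, \<phi>)\<in>{(Q, \<lambda>s. s x) |x. x \<in> X}. \<phi> m = \<ominus>\<^bsub>S\<^esub> \<one>\<^bsub>S\<^esub>"
      by (rule bexI[of _ "\<lambda>x\<in>X. \<ominus>\<^bsub>Q\<^esub> \<one>\<^bsub>Q\<^esub>"]) auto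
  next
    fix s t assume st: "s \<in> carrier (fun_ring X Q)" "t \<in> carrier (fun_ring X Q)"
      and *: "\<And>S \<phi>. (S, \<phi>) \<in> {(Q, \<lambda>s. s x) |x. x \<in> X} \<Longrightarrow> \<phi> s = \<phi> t"
    show "s = t"
    proof (rule PiE_ext)
      show "s x = t x" if "x \<in> X" for x using *[of Q "\<lambda>s. s x"] that by auto
    qed (use st in auto)
  qed (use assms fun_ring_eval_hom in auto)
qed

lemma fun_ring_eval_cring_hom:
  assumes "cring Q" "x \<in> X"
  shows "ring_hom_cring (fun_ring X Q) Q (\<lambda>s. s x)"
  using assms cring_fun_ring[OF assms(1), of X] fun_ring_eval_hom[OF assms(2), of Q]
  by (simp add: ring_hom_cring_def ring_hom_cring_axioms_def)

lemma fun_ring_finsum: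
  assumes "cring Q" "x \<in> X" "f \<in> A \<rightarrow> X \<rightarrow>\<^sub>E carrier Q"
  shows "(\<Oplus>\<^bsub>fun_ring X Q\<^esub>i\<in>A. f i) x = (\<Oplus>\<^bsub>Q\<^esub>i\<in>A. f i x)"
  using ring_hom_cring.hom_finsum[OF fun_ring_eval_cring_hom[OF assms(1,2)], of f A] assms(3)
  by (simp add: o_def)

lemma fun_ring_finprod:
  assumes "cring Q" "x \<in> X" "f \<in> A \<rightarrow> X \<rightarrow>\<^sub>E carrier Q"
  shows "(\<Otimes>\<^bsub>fun_ring X Q\<^esub>i\<in>A. f i) x = (\<Otimes>\<^bsub>Q\<^esub>i\<in>A. f i x)"
  using ring_hom_cring.hom_finprod[OF fun_ring_eval_cring_hom[OF assms(1,2)], of f A] assms(3)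
  by (simp add: o_def)

section \<open>Coinduction\<close>

lemma coind_simps [simp]:
  "lev_e (coind G Q) = fun_ring (carrier G) Q"
  "lev_G (coind G Q) = Q"
  "act (coind G Q) g s = (\<lambda>x\<in>carrier G. s (x \<otimes>\<^bsub>G\<^esub> g))"
  "res (coind G Q) q = (\<lambda>x\<in>carrier G. q)"
  "tr (coind G Q) s = (\<Oplus>\<^bsub>Q\<^esub>x\<in>carrier G. s x)"
  "nm (coind G Q) s = (\<Otimes>\<^bsub>Q\<^esub>x\<in>carrier G. s x)"
  by (simp_all add: coind_def)

section \<open>Tambara structure on functions\<close>

context prime_order_group begin

text \<open>Multiplying out gives a sum over all subsets \<open>V\<close>. The subsets
  \<open>carrier G\<close> and \<open>{}\<close> give the two norms; the others are translates
  \<open>k <# U\<close> with \<open>U\<close> in the transversal, and the sum over \<open>k\<close>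
  is the transfer of the reciprocity formula.\<close>

lemma coind_nm_add:
  assumes "cring Q" "x \<in> carrier G \<rightarrow>\<^sub>E carrier Q" "y \<in> carrier G \<rightarrow>\<^sub>E carrier Q"
    and T: "subset_transversal G \<U>"
  shows "(\<Otimes>\<^bsub>Q\<^esub>g\<in>carrier G. x g \<oplus>\<^bsub>Q\<^esub> y g) =
    (\<Otimes>\<^bsub>Q\<^esub>g\<in>carrier G. x g) \<oplus>\<^bsub>Q\<^esub> (\<Otimes>\<^bsub>Q\<^esub>g\<in>carrier G. y g) \<oplus>\<^bsub>Q\<^esub>
      (\<Oplus>\<^bsub>Q\<^esub>k\<in>carrier G. \<Oplus>\<^bsub>Q\<^esub>U\<in>\<U>. \<Otimes>\<^bsub>Q\<^esub>g\<in>carrier G. (if g \<in> U then x else y) (k \<otimes> g))"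
proof -
  interpret Q: cring Q by fact
  let ?P = "\<lambda>V. \<Otimes>\<^bsub>Q\<^esub>g\<in>carrier G. if g \<in> V then x g else y g"
  have xy: "g \<in> carrier G \<Longrightarrow> x g \<in> carrier Q" "g \<in> carrier G \<Longrightarrow> y g \<in> carrier Q" for g
    using assms by auto
  have P: "?P V \<in> carrier Q" for V using xy by (intro Q.finprod_closed) auto
  have U: "U \<subseteq> carrier G" if "U \<in> \<U>" for U
    using T that by (simp add: subset_transversal_def psubset_imp_subset)
  have fU: "finite \<U>"
    using U by (intro finite_subset[of \<U> "Pow (carrier G)"]) (auto simp: finite_carrier)
  \<comment> \<open>The substitution \<open>g \<mapsto> k \<otimes> g\<close> carries the set
    \<open>U\<close> to \<open>k <# U\<close>.\<close>
  have shift: "(\<Otimes>\<^bsub>Q\<^esub>g\<in>carrier G. (if g \<in> U then x else y) (k \<otimes> g)) = ?P (k <# U)"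
    if k: "k \<in> carrier G" and UU: "U \<in> \<U>" for k U
  proof -
    have "?P (k <# U) = (\<Otimes>\<^bsub>Q\<^esub>g\<in>carrier G. if k \<otimes> g \<in> k <# U then x (k \<otimes> g) else y (k \<otimes> g))"
      by (rule Q.finprod_bij[OF bij_left_mult[OF k], symmetric]) (use xy in auto)
    also have "\<dots> = (\<Otimes>\<^bsub>Q\<^esub>g\<in>carrier G. (if g \<in> U then x else y) (k \<otimes> g))"
    proof (rule Q.finprod_cong')
      fix g assume g: "g \<in> carrier G"
      have "k \<otimes> g \<in> k <# U \<longleftrightarrow> g \<in> U"
        using U[OF UU] g k by (auto simp: l_coset_def)
      then show "(if k \<otimes> g \<in> k <# U then x (k \<otimes> g) else y (k \<otimes> g)) = (if g \<in> U then x else y) (k \<otimes> g)"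
        by simp
    qed (use xy k in auto)
    finally show ?thesis ..
  qed
  have "(\<Oplus>\<^bsub>Q\<^esub>k\<in>carrier G. \<Oplus>\<^bsub>Q\<^esub>U\<in>\<U>. \<Otimes>\<^bsub>Q\<^esub>g\<in>carrier G. (if g \<in> U then x else y) (k \<otimes> g)) =
      (\<Oplus>\<^bsub>Q\<^esub>k\<in>carrier G. \<Oplus>\<^bsub>Q\<^esub>U\<in>\<U>. ?P (k <# U))"
    by (intro Q.finsum_cong' refl) (auto simp: shift intro!: Q.finsum_closed P)
  also have "\<dots> = finsum Q (\<lambda>(k, U). ?P (k <# U)) (carrier G \<times> \<U>)"
    by (rule Q.add.finprod_product) (auto intro: finite_carrier fU P)
  also have "\<dots> = (\<Oplus>\<^bsub>Q\<^esub>a\<in>carrier G \<times> \<U>. ?P (case a of (k, U) \<Rightarrow> k <# U))"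
    by (rule Q.finsum_cong') (auto intro: P)
  also have "\<dots> = (\<Oplus>\<^bsub>Q\<^esub>V\<in>Pow (carrier G) - {{}, carrier G}. ?P V)"
    by (rule Q.add.finprod_bij[OF subset_transversal_bij[OF T]]) (auto intro: P)
  finally have m: "(\<Oplus>\<^bsub>Q\<^esub>k\<in>carrier G. \<Oplus>\<^bsub>Q\<^esub>U\<in>\<U>. \<Otimes>\<^bsub>Q\<^esub>g\<in>carrier G. (if g \<in> U then x else y) (k \<otimes> g)) =
      (\<Oplus>\<^bsub>Q\<^esub>V\<in>Pow (carrier G) - {{}, carrier G}. ?P V)" .
  have ne: "carrier G \<noteq> {}" by auto
  have ins2: "finsum Q f (insert a (insert b D)) = f a \<oplus>\<^bsub>Q\<^esub> (f b \<oplus>\<^bsub>Q\<^esub> finsum Q f D)"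
    if "finite D" "a \<notin> insert b D" "b \<notin> D" "\<And>V. f V \<in> carrier Q" for f and a b :: "'c set" and D
    using that by (simp add: Q.finsum_insert Pi_def)
  have "(\<Otimes>\<^bsub>Q\<^esub>g\<in>carrier G. x g \<oplus>\<^bsub>Q\<^esub> y g) = (\<Oplus>\<^bsub>Q\<^esub>V\<in>Pow (carrier G). ?P V)"
    by (rule Q.finprod_add_expand) (use xy finite_carrier in auto)
  also have "Pow (carrier G) = insert (carrier G) (insert {} (Pow (carrier G) - {{}, carrier G}))"
    by auto
  also have "(\<Oplus>\<^bsub>Q\<^esub>V\<in>\<dots>. ?P V) = ?P (carrier G) \<oplus>\<^bsub>Q\<^esub> (?P {} \<oplus>\<^bsub>Q\<^esub>
      (\<Oplus>\<^bsub>Q\<^esub>V\<in>Pow (carrier G) - {{}, carrier G}. ?P V))"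
    by (rule ins2) (use finite_carrier ne P in auto)
  also have "?P (carrier G) = (\<Otimes>\<^bsub>Q\<^esub>g\<in>carrier G. x g)"
    by (rule Q.finprod_cong') (use xy in auto)
  finally show ?thesis
    using m xy P[of "{}"] by (simp add: Q.a_assoc P Q.finprod_closed Pi_def)
qed

text \<open>Invariance of transfer and norm is reindexing by right translations, the double coset
  formulas are reindexing by left ones; the one deeper axiom, \<open>nm_add\<close>, is
  \<open>coind_nm_add\<close>.\<close>

proposition tambara_functor_coind:
  fixes Q :: "'q ring"
  assumes "cring Q"
  shows "tambara_functor G (coind G Q)"
proof -
  interpret Q: cring Q by fact
  interpret F: cring "fun_ring (carrier G) Q" by (rule cring_fun_ring[OF assms])
  have sh: "(\<lambda>x\<in>carrier G. s (x \<otimes> g)) \<in> carrier G \<rightarrow>\<^sub>E carrier Q"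
    if "s \<in> carrier G \<rightarrow>\<^sub>E carrier Q" "g \<in> carrier G" for s g using that by auto
  note fc = finite_carrier
  show ?thesis
  proof (rule tambara_functor.intro, unfold coind_simps)
    fix g assume "g \<in> carrier G"
    then show "(\<lambda>s. \<lambda>x\<in>carrier G. s (x \<otimes> g)) \<in> ring_hom (fun_ring (carrier G) Q) (fun_ring (carrier G) Q)"
      by (intro ring_hom_memI) (auto intro!: restrict_ext)
  next
    fix x assume x: "x \<in> carrier (fun_ring (carrier G) Q)"
    then have xc: "\<And>g. g \<in> carrier G \<Longrightarrow> x g \<in> carrier Q" by auto
    show "(\<lambda>y\<in>carrier G. x (y \<otimes> \<one>)) = x"
      using x by (intro PiE_ext[where s = "\<lambda>_. carrier Q"]) auto
    show "(\<lambda>y\<in>carrier G. \<Oplus>\<^bsub>Q\<^esub>x'\<in>carrier G. x x') =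
      (\<Oplus>\<^bsub>fun_ring (carrier G) Q\<^esub>g\<in>carrier G. (\<lambda>y\<in>carrier G. x (y \<otimes> g)))"
    proof (rule PiE_ext[where s = "\<lambda>_. carrier Q"])
      show "(\<Oplus>\<^bsub>fun_ring (carrier G) Q\<^esub>g\<in>carrier G. (\<lambda>y\<in>carrier G. x (y \<otimes> g))) \<in> carrier G \<rightarrow>\<^sub>E carrier Q"
        using F.finsum_closed[of "\<lambda>g. \<lambda>y\<in>carrier G. x (y \<otimes> g)" "carrier G"] xc by auto
      fix y assume y: "y \<in> carrier G"
      have "(\<Oplus>\<^bsub>Q\<^esub>g\<in>carrier G. x (y \<otimes> g)) = (\<Oplus>\<^bsub>Q\<^esub>g\<in>carrier G. x g)"
        by (rule Q.add.finprod_bij[OF bij_left_mult[OF y]]) (use xc in auto)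
      then show "(\<lambda>y\<in>carrier G. \<Oplus>\<^bsub>Q\<^esub>x'\<in>carrier G. x x') y =
          (\<Oplus>\<^bsub>fun_ring (carrier G) Q\<^esub>g\<in>carrier G. (\<lambda>y\<in>carrier G. x (y \<otimes> g))) y"
        using y by (subst fun_ring_finsum[OF assms y]) (use xc in auto)
    qed (use xc in \<open>auto intro!: Q.finsum_closed\<close>)
    show "(\<lambda>y\<in>carrier G. \<Otimes>\<^bsub>Q\<^esub>x'\<in>carrier G. x x') =
      (\<Otimes>\<^bsub>fun_ring (carrier G) Q\<^esub>g\<in>carrier G. (\<lambda>y\<in>carrier G. x (y \<otimes> g)))"
    proof (rule PiE_ext[where s = "\<lambda>_. carrier Q"])
      show "(\<Otimes>\<^bsub>fun_ring (carrier G) Q\<^esub>g\<in>carrier G. (\<lambda>y\<in>carrier G. x (y \<otimes> g))) \<in> carrier G \<rightarrow>\<^sub>E carrier Q"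
        using F.finprod_closed[of "\<lambda>g. \<lambda>y\<in>carrier G. x (y \<otimes> g)" "carrier G"] xc by auto
      fix y assume y: "y \<in> carrier G"
      have "(\<Otimes>\<^bsub>Q\<^esub>g\<in>carrier G. x (y \<otimes> g)) = (\<Otimes>\<^bsub>Q\<^esub>g\<in>carrier G. x g)"
        by (rule Q.finprod_bij[OF bij_left_mult[OF y]]) (use xc in auto)
      then show "(\<lambda>y\<in>carrier G. \<Otimes>\<^bsub>Q\<^esub>x'\<in>carrier G. x x') y =
          (\<Otimes>\<^bsub>fun_ring (carrier G) Q\<^esub>g\<in>carrier G. (\<lambda>y\<in>carrier G. x (y \<otimes> g))) y"
        using y by (subst fun_ring_finprod[OF assms y]) (use xc in auto)
    qed (use xc in \<open>auto intro!: Q.finprod_closed\<close>)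
  next
    fix g x assume g: "g \<in> carrier G" and x: "x \<in> carrier (fun_ring (carrier G) Q)"
    then have xc: "x \<in> carrier G \<rightarrow> carrier Q" by auto
    show "(\<Oplus>\<^bsub>Q\<^esub>y\<in>carrier G. (\<lambda>y\<in>carrier G. x (y \<otimes> g)) y) = (\<Oplus>\<^bsub>Q\<^esub>y\<in>carrier G. x y)"
      using Q.add.finprod_bij[OF bij_right_mult[OF g] xc] xc g
      by (simp add: Pi_def cong: Q.finsum_cong)
    show "(\<Otimes>\<^bsub>Q\<^esub>y\<in>carrier G. (\<lambda>y\<in>carrier G. x (y \<otimes> g)) y) = (\<Otimes>\<^bsub>Q\<^esub>y\<in>carrier G. x y)"
      using Q.finprod_bij[OF bij_right_mult[OF g] xc] xc g
      by (simp add: Pi_def cong: Q.finprod_cong)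
  next
    fix x y \<U> assume x: "x \<in> carrier (fun_ring (carrier G) Q)" and y: "y \<in> carrier (fun_ring (carrier G) Q)"
      and T: "subset_transversal G \<U>"
    have xy: "g \<in> carrier G \<Longrightarrow> x g \<in> carrier Q" "g \<in> carrier G \<Longrightarrow> y g \<in> carrier Q" for g
      using x y by auto
    let ?s = "\<lambda>U g. \<lambda>k\<in>carrier G. (if g \<in> U then x else y) (k \<otimes> g)"
    have s: "?s U \<in> carrier G \<rightarrow> carrier (fun_ring (carrier G) Q)" for U using xy by auto
    have s': "(\<Otimes>\<^bsub>fun_ring (carrier G) Q\<^esub>g\<in>carrier G. ?s U g) \<in> carrier (fun_ring (carrier G) Q)" for U
      using s by (rule F.finprod_closed)
    have "(\<Oplus>\<^bsub>fun_ring (carrier G) Q\<^esub>U\<in>\<U>. \<Otimes>\<^bsub>fun_ring (carrier G) Q\<^esub>g\<in>carrier G. ?s U g) k =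
        (\<Oplus>\<^bsub>Q\<^esub>U\<in>\<U>. \<Otimes>\<^bsub>Q\<^esub>g\<in>carrier G. (if g \<in> U then x else y) (k \<otimes> g))" if k: "k \<in> carrier G" for k
      using s s' k xy
      by (subst fun_ring_finsum[OF assms k]; (intro Q.finsum_cong' refl Q.finprod_closed)?)
         (auto simp: fun_ring_finprod[OF assms k])
    then have "(\<Oplus>\<^bsub>Q\<^esub>k\<in>carrier G. (\<Oplus>\<^bsub>fun_ring (carrier G) Q\<^esub>U\<in>\<U>. \<Otimes>\<^bsub>fun_ring (carrier G) Q\<^esub>g\<in>carrier G. ?s U g) k) =
      (\<Oplus>\<^bsub>Q\<^esub>k\<in>carrier G. \<Oplus>\<^bsub>Q\<^esub>U\<in>\<U>. \<Otimes>\<^bsub>Q\<^esub>g\<in>carrier G. (if g \<in> U then x else y) (k \<otimes> g))"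
      using xy by (intro Q.finsum_cong') (auto intro!: Q.finsum_closed Q.finprod_closed)
    moreover have "(\<Otimes>\<^bsub>Q\<^esub>g\<in>carrier G. (x \<oplus>\<^bsub>fun_ring (carrier G) Q\<^esub> y) g) = (\<Otimes>\<^bsub>Q\<^esub>g\<in>carrier G. x g \<oplus>\<^bsub>Q\<^esub> y g)"
      using xy by (intro Q.finprod_cong') auto
    ultimately show "(\<Otimes>\<^bsub>Q\<^esub>g\<in>carrier G. (x \<oplus>\<^bsub>fun_ring (carrier G) Q\<^esub> y) g) =
        (\<Otimes>\<^bsub>Q\<^esub>g\<in>carrier G. x g) \<oplus>\<^bsub>Q\<^esub> (\<Otimes>\<^bsub>Q\<^esub>g\<in>carrier G. y g) \<oplus>\<^bsub>Q\<^esub>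
        (\<Oplus>\<^bsub>Q\<^esub>k\<in>carrier G. (\<Oplus>\<^bsub>fun_ring (carrier G) Q\<^esub>U\<in>\<U>. \<Otimes>\<^bsub>fun_ring (carrier G) Q\<^esub>g\<in>carrier G. ?s U g) k)"
      using coind_nm_add[OF assms _ _ T, of x y] x y by simp
  next
    show "(\<Otimes>\<^bsub>Q\<^esub>x\<in>carrier G. \<zero>\<^bsub>fun_ring (carrier G) Q\<^esub> x) = \<zero>\<^bsub>Q\<^esub>"
    \<comment> \<open>The product vanishes because \<open>G\<close> is nonempty: the factor at the
      unit is split off.\<close>
    proof -
      have "(\<Otimes>\<^bsub>Q\<^esub>x\<in>carrier G. \<zero>\<^bsub>fun_ring (carrier G) Q\<^esub> x) = (\<Otimes>\<^bsub>Q\<^esub>x\<in>insert \<one> (carrier G - {\<one>}). \<zero>\<^bsub>Q\<^esub>)"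
        by (rule Q.finprod_cong') auto
      also have "\<dots> = \<zero>\<^bsub>Q\<^esub>"
        by (subst Q.finprod_insert) (use fc in \<open>auto intro!: Q.l_null Q.finprod_closed\<close>)
      finally show ?thesis .
    qed
    show "(\<Otimes>\<^bsub>Q\<^esub>x\<in>carrier G. \<one>\<^bsub>fun_ring (carrier G) Q\<^esub> x) = \<one>\<^bsub>Q\<^esub>"
      by (rule Q.finprod_one_eqI) auto
    show "(\<lambda>q. \<lambda>x\<in>carrier G. q) \<in> ring_hom Q (fun_ring (carrier G) Q)"
      by (rule ring_hom_memI) (auto intro!: restrict_ext)
  next
    fix x y assume x: "x \<in> carrier (fun_ring (carrier G) Q)" and y: "y \<in> carrier (fun_ring (carrier G) Q)"
    then have xy: "g \<in> carrier G \<Longrightarrow> x g \<in> carrier Q" "g \<in> carrier G \<Longrightarrow> y g \<in> carrier Q" for g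
      by auto
    show "(\<Oplus>\<^bsub>Q\<^esub>g\<in>carrier G. (x \<oplus>\<^bsub>fun_ring (carrier G) Q\<^esub> y) g) =
        (\<Oplus>\<^bsub>Q\<^esub>g\<in>carrier G. x g) \<oplus>\<^bsub>Q\<^esub> (\<Oplus>\<^bsub>Q\<^esub>g\<in>carrier G. y g)"
    proof -
      have "(\<Oplus>\<^bsub>Q\<^esub>g\<in>carrier G. (x \<oplus>\<^bsub>fun_ring (carrier G) Q\<^esub> y) g) = (\<Oplus>\<^bsub>Q\<^esub>g\<in>carrier G. x g \<oplus>\<^bsub>Q\<^esub> y g)"
        by (rule Q.finsum_cong') (use xy in auto)
      then show ?thesis using xy by (simp add: Q.finsum_addf Pi_def)
    qed
    show "(\<Otimes>\<^bsub>Q\<^esub>g\<in>carrier G. (x \<otimes>\<^bsub>fun_ring (carrier G) Q\<^esub> y) g) =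
        (\<Otimes>\<^bsub>Q\<^esub>g\<in>carrier G. x g) \<otimes>\<^bsub>Q\<^esub> (\<Otimes>\<^bsub>Q\<^esub>g\<in>carrier G. y g)"
    proof -
      have "(\<Otimes>\<^bsub>Q\<^esub>g\<in>carrier G. (x \<otimes>\<^bsub>fun_ring (carrier G) Q\<^esub> y) g) = (\<Otimes>\<^bsub>Q\<^esub>g\<in>carrier G. x g \<otimes>\<^bsub>Q\<^esub> y g)"
        by (rule Q.finprod_cong') (use xy in auto)
      then show ?thesis using xy by (simp add: Q.finprod_multf Pi_def)
    qed
  next
    fix x q assume x: "x \<in> carrier (fun_ring (carrier G) Q)" and q: "q \<in> carrier Q"
    then have xc: "g \<in> carrier G \<Longrightarrow> x g \<in> carrier Q" for g by auto
    show "(\<Oplus>\<^bsub>Q\<^esub>g\<in>carrier G. (x \<otimes>\<^bsub>fun_ring (carrier G) Q\<^esub> (\<lambda>x\<in>carrier G. q)) g) =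
        (\<Oplus>\<^bsub>Q\<^esub>g\<in>carrier G. x g) \<otimes>\<^bsub>Q\<^esub> q"
      by (subst Q.finsum_ldistr) (use xc q fc in \<open>auto intro!: Q.finsum_cong'\<close>)
  next
    fix g h x assume "g \<in> carrier G" "h \<in> carrier G" "x \<in> carrier (fun_ring (carrier G) Q)"
    then show "(\<lambda>y\<in>carrier G. x (y \<otimes> (g \<otimes> h))) = (\<lambda>y\<in>carrier G. (\<lambda>y\<in>carrier G. x (y \<otimes> h)) (y \<otimes> g))"
      by (auto simp: m_assoc intro!: restrict_ext)
  qed (use F.is_cring assms in \<open>auto intro!: Q.finsum_closed Q.finprod_closed\<close>)
qed

end

section \<open>The ghost and the unit\<close>

lemma RDirProd_simps [simp]:
  "carrier (RDirProd A B) = carrier A \<times> carrier B"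
  "(a, b) \<otimes>\<^bsub>RDirProd A B\<^esub> (c, d) = (a \<otimes>\<^bsub>A\<^esub> c, b \<otimes>\<^bsub>B\<^esub> d)"
  "(a, b) \<oplus>\<^bsub>RDirProd A B\<^esub> (c, d) = (a \<oplus>\<^bsub>A\<^esub> c, b \<oplus>\<^bsub>B\<^esub> d)"
  "\<one>\<^bsub>RDirProd A B\<^esub> = (\<one>\<^bsub>A\<^esub>, \<one>\<^bsub>B\<^esub>)"
  "\<zero>\<^bsub>RDirProd A B\<^esub> = (\<zero>\<^bsub>A\<^esub>, \<zero>\<^bsub>B\<^esub>)"
  by (simp_all add: RDirProd_def DirProd_def monoid.defs)

lemma cring_RDirProd:
  assumes "cring A" "cring B"
  shows "cring (RDirProd A B)"
proof -
  interpret A: cring A by fact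
  interpret B: cring B by fact
  have r: "ring (RDirProd A B)" by (rule RDirProd_ring) unfold_locales
  show ?thesis
  proof (rule cring.intro[OF r])
    interpret ring "RDirProd A B" by (rule r)
    show "comm_monoid (RDirProd A B)"
      by (rule monoid_comm_monoidI) (auto simp: A.m_comm B.m_comm)
  qed
qed

section \<open>Transfers, actions and restrictions as homomorphisms\<close>

context tambara_functor begin

lemma tr_zero: "tr R \<zero>\<^bsub>lev_e R\<^esub> = \<zero>\<^bsub>lev_G R\<^esub>"
proof -
  interpret A: cring "lev_e R" by (rule lev_e_cring)
  interpret B: cring "lev_G R" by (rule lev_G_cring)
  have "tr R \<zero>\<^bsub>lev_e R\<^esub> \<oplus>\<^bsub>lev_G R\<^esub> tr R \<zero>\<^bsub>lev_e R\<^esub> = tr R \<zero>\<^bsub>lev_e R\<^esub>"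
    using tr_add[of "\<zero>\<^bsub>lev_e R\<^esub>" "\<zero>\<^bsub>lev_e R\<^esub>"] by simp
  then show ?thesis using tr_closed[of "\<zero>\<^bsub>lev_e R\<^esub>"] B.add.l_cancel_one by simp
qed

lemma tr_group_hom: "group_hom (add_monoid (lev_e R)) (add_monoid (lev_G R)) (tr R)"
proof -
  interpret A: cring "lev_e R" by (rule lev_e_cring)
  interpret B: cring "lev_G R" by (rule lev_G_cring)
  show ?thesis
    using A.add.group_axioms B.add.group_axioms
    by (auto simp: group_hom_def group_hom_axioms_def hom_def tr_closed tr_add)
qed

lemma tr_finsum:
  assumes "f \<in> X \<rightarrow> carrier (lev_e R)"
  shows "tr R (\<Oplus>\<^bsub>lev_e R\<^esub>i\<in>X. f i) = (\<Oplus>\<^bsub>lev_G R\<^esub>i\<in>X. tr R (f i))"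
proof -
  interpret A: cring "lev_e R" by (rule lev_e_cring)
  interpret B: cring "lev_G R" by (rule lev_G_cring)
  show ?thesis using assms
    by (induction X rule: infinite_finite_induct)
      (auto simp: tr_zero tr_add tr_closed Pi_def A.finsum_closed)
qed

text \<open>Frobenius reciprocity: \<open>tr x\<close> times \<open>y\<close> is the transfer of
  \<open>x\<close> times \<open>res y\<close>.\<close>

lemma ideal_transfer_image: "ideal (transfer_image R) (lev_G R)"
proof -
  interpret A: cring "lev_e R" by (rule lev_e_cring)
  interpret B: cring "lev_G R" by (rule lev_G_cring)
  interpret h: group_hom "add_monoid (lev_e R)" "add_monoid (lev_G R)" "tr R" by (rule tr_group_hom)
  show ?thesis unfolding transfer_image_def
  proof (rule idealI)
    show "subgroup (tr R ` carrier (lev_e R)) (add_monoid (lev_G R))"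
      using h.img_is_subgroup by simp
  next
    fix a y assume a: "a \<in> tr R ` carrier (lev_e R)" and y: "y \<in> carrier (lev_G R)"
    then obtain x where x: "x \<in> carrier (lev_e R)" "a = tr R x" by auto
    have "tr R (x \<otimes>\<^bsub>lev_e R\<^esub> res R y) = a \<otimes>\<^bsub>lev_G R\<^esub> y" using frobenius[OF x(1) y] x(2) by simp
    then show 1: "a \<otimes>\<^bsub>lev_G R\<^esub> y \<in> tr R ` carrier (lev_e R)"
      using x y ring_hom_closed[OF res_hom] by (metis A.m_closed imageI)
    then show "y \<otimes>\<^bsub>lev_G R\<^esub> a \<in> tr R ` carrier (lev_e R)"
      using B.m_comm[of a y] x y tr_closed by simp
  qed (rule B.ring_axioms)
qed

lemma act_closed: "\<lbrakk>g \<in> carrier G; x \<in> carrier (lev_e R)\<rbrakk> \<Longrightarrow> act R g x \<in> carrier (lev_e R)"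
  using act_hom ring_hom_closed by metis

lemma act_cring_hom: "g \<in> carrier G \<Longrightarrow> ring_hom_cring (lev_e R) (lev_e R) (act R g)"
  using act_hom lev_e_cring by (simp add: ring_hom_cring_def ring_hom_cring_axioms_def)

lemma res_cring_hom: "ring_hom_cring (lev_G R) (lev_e R) (res R)"
  using res_hom lev_e_cring lev_G_cring by (simp add: ring_hom_cring_def ring_hom_cring_axioms_def)

end

section \<open>The ghost as a Tambara functor\<close>

locale prime_order_tambara = prime_order_group G + tambara_functor G R
  for G :: "'c monoid" (structure) and R :: "('c, 'e, 'g) tambara"
begin

abbreviation A where "A \<equiv> lev_e R"
abbreviation Q where "Q \<equiv> lev_G R Quot transfer_image R"
abbreviation cls where "cls y \<equiv> transfer_image R +>\<^bsub>lev_G R\<^esub> y"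

sublocale A: cring A by (rule lev_e_cring)
sublocale LG: cring "lev_G R" by (rule lev_G_cring)
sublocale T: ideal "transfer_image R" "lev_G R" by (rule ideal_transfer_image)
sublocale Q: cring Q by (rule T.quotient_is_cring) (rule LG.is_cring)
sublocale cls: ring_hom_cring "lev_G R" Q "\<lambda>y. cls y"
  by unfold_locales (use T.rcos_ring_hom in simp)
sublocale res: ring_hom_cring "lev_G R" A "res R" by (rule res_cring_hom)

lemma act_hom_simps [simp]:
  assumes "g \<in> carrier G"
  shows "act R g \<zero>\<^bsub>A\<^esub> = \<zero>\<^bsub>A\<^esub>" "act R g \<one>\<^bsub>A\<^esub> = \<one>\<^bsub>A\<^esub>"
    "x \<in> carrier A \<Longrightarrow> y \<in> carrier A \<Longrightarrow> act R g (x \<otimes>\<^bsub>A\<^esub> y) = act R g x \<otimes>\<^bsub>A\<^esub> act R g y"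
    "x \<in> carrier A \<Longrightarrow> y \<in> carrier A \<Longrightarrow> act R g (x \<oplus>\<^bsub>A\<^esub> y) = act R g x \<oplus>\<^bsub>A\<^esub> act R g y"
    "x \<in> carrier A \<Longrightarrow> act R g x \<in> carrier A"
proof -
  interpret h: ring_hom_cring A A "act R g" by (rule act_cring_hom[OF assms])
  show "act R g \<zero>\<^bsub>A\<^esub> = \<zero>\<^bsub>A\<^esub>" "act R g \<one>\<^bsub>A\<^esub> = \<one>\<^bsub>A\<^esub>"
    "x \<in> carrier A \<Longrightarrow> y \<in> carrier A \<Longrightarrow> act R g (x \<otimes>\<^bsub>A\<^esub> y) = act R g x \<otimes>\<^bsub>A\<^esub> act R g y"
    "x \<in> carrier A \<Longrightarrow> y \<in> carrier A \<Longrightarrow> act R g (x \<oplus>\<^bsub>A\<^esub> y) = act R g x \<oplus>\<^bsub>A\<^esub> act R g y"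
    "x \<in> carrier A \<Longrightarrow> act R g x \<in> carrier A"
    by simp_all
qed

lemma cls_transfer: "x \<in> carrier A \<Longrightarrow> cls (tr R x) = \<zero>\<^bsub>Q\<^esub>"
  using T.a_rcos_const[of "tr R x"] by (simp add: FactRing_def transfer_image_def)

definition fixed_set where "fixed_set = {x \<in> carrier A. \<forall>g\<in>carrier G. act R g x = x}"

lemma fixed_ring_simps [simp]:
  "carrier (fixed_ring G R) = fixed_set"
  "x \<otimes>\<^bsub>fixed_ring G R\<^esub> y = x \<otimes>\<^bsub>A\<^esub> y" "x \<oplus>\<^bsub>fixed_ring G R\<^esub> y = x \<oplus>\<^bsub>A\<^esub> y"
  "\<one>\<^bsub>fixed_ring G R\<^esub> = \<one>\<^bsub>A\<^esub>" "\<zero>\<^bsub>fixed_ring G R\<^esub> = \<zero>\<^bsub>A\<^esub>"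
  by (simp_all add: fixed_ring_def fixed_set_def)

lemma fixed_setD: "x \<in> fixed_set \<Longrightarrow> x \<in> carrier A" "x \<in> fixed_set \<Longrightarrow> g \<in> carrier G \<Longrightarrow> act R g x = x"
  by (auto simp: fixed_set_def)

lemma res_fixed: "y \<in> carrier (lev_G R) \<Longrightarrow> res R y \<in> fixed_set"
  by (auto simp: fixed_set_def act_res)

text \<open>Inherited from \<open>A\<close> along the inclusion; minus one is fixed because each
  \<open>act R g\<close> is a ring homomorphism.\<close>

lemma cring_fixed_ring: "cring (fixed_ring G R)"
proof (rule cring_subdirect[where F = "{(A, \<lambda>x::'e. x)}"])
  show "\<exists>m\<in>carrier (fixed_ring G R). \<forall>(S, \<phi>)\<in>{(A, \<lambda>x::'e. x)}. \<phi> m = \<ominus>\<^bsub>S\<^esub> \<one>\<^bsub>S\<^esub>"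
  proof (rule bexI)
    have "act R g (\<ominus>\<^bsub>A\<^esub> \<one>\<^bsub>A\<^esub>) = \<ominus>\<^bsub>A\<^esub> \<one>\<^bsub>A\<^esub>" if "g \<in> carrier G" for g
      using ring_hom_cring.hom_a_inv[OF act_cring_hom[OF that]] that by simp
    then show "\<ominus>\<^bsub>A\<^esub> \<one>\<^bsub>A\<^esub> \<in> carrier (fixed_ring G R)" by (simp add: fixed_set_def)
  qed auto
  fix S \<phi> assume "(S, \<phi>) \<in> {(A, \<lambda>x::'e. x)}"
  then have *: "S = A" "\<phi> = (\<lambda>x. x)" by auto
  show "cring S \<and> \<phi> \<in> ring_hom (fixed_ring G R) S \<and> \<phi> \<zero>\<^bsub>fixed_ring G R\<^esub> = \<zero>\<^bsub>S\<^esub>"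
    unfolding * using A.is_cring by (auto intro!: ring_hom_memI dest: fixed_setD)
qed (auto simp: fixed_set_def)

lemma ghost_simps [simp]:
  "lev_e (ghost G R) = A"
  "lev_G (ghost G R) = RDirProd (fixed_ring G R) Q"
  "act (ghost G R) = act R"
  "res (ghost G R) (a, b) = a"
  by (simp_all add: ghost_def)

text \<open>With \<open>ghost_nm\<close> this presents transfer and norm of the ghost as the images
  of those of \<open>R\<close> under \<open>y \<mapsto> (res y, cls y)\<close>, so that identities
  between them carry over from \<open>R\<close>.\<close>

lemma ghost_tr: "x \<in> carrier A \<Longrightarrow> tr (ghost G R) x = (res R (tr R x), \<zero>\<^bsub>Q\<^esub>)"
  by (simp add: ghost_def res_tr)

lemma ghost_nm: "x \<in> carrier A \<Longrightarrow> nm (ghost G R) x = (res R (nm R x), cls (nm R x))"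
  by (simp add: ghost_def res_nm)

text \<open>Frobenius reciprocity is checked by hand: the pair \<open>(a, b)\<close> need not come
  from \<open>R\<close>, and what counts is that \<open>a\<close> is fixed by \<open>G\<close>. In
  the norm of a sum the second component loses the cross term, since \<open>cls\<close> kills
  transfers.\<close>

proposition tambara_functor_ghost: "tambara_functor G (ghost G R)"
proof (rule tambara_functor.intro, unfold ghost_simps)
  show "cring (RDirProd (fixed_ring G R) Q)"
    by (rule cring_RDirProd[OF cring_fixed_ring Q.is_cring])
  show "res (ghost G R) \<in> ring_hom (RDirProd (fixed_ring G R) Q) A"
    by (rule ring_hom_memI) (auto dest: fixed_setD)
  fix x assume x: "x \<in> carrier A"
  show "tr (ghost G R) x \<in> carrier (RDirProd (fixed_ring G R) Q)"
    "nm (ghost G R) x \<in> carrier (RDirProd (fixed_ring G R) Q)"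
    using x tr_closed nm_closed res_fixed by (simp_all add: ghost_tr ghost_nm)
  show "res (ghost G R) (tr (ghost G R) x) = (\<Oplus>\<^bsub>A\<^esub>g\<in>carrier G. act R g x)"
    "res (ghost G R) (nm (ghost G R) x) = (\<Otimes>\<^bsub>A\<^esub>g\<in>carrier G. act R g x)"
    using x by (simp_all add: ghost_tr ghost_nm res_tr res_nm)
next
  fix x y assume xy: "x \<in> carrier A" "y \<in> carrier A"
  show "tr (ghost G R) (x \<oplus>\<^bsub>A\<^esub> y) = tr (ghost G R) x \<oplus>\<^bsub>RDirProd (fixed_ring G R) Q\<^esub> tr (ghost G R) y"
    using xy tr_closed by (simp add: ghost_tr tr_add)
  show "nm (ghost G R) (x \<otimes>\<^bsub>A\<^esub> y) = nm (ghost G R) x \<otimes>\<^bsub>RDirProd (fixed_ring G R) Q\<^esub> nm (ghost G R) y"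
    using xy nm_closed by (simp add: ghost_nm nm_mult)
next
  show "nm (ghost G R) \<zero>\<^bsub>A\<^esub> = \<zero>\<^bsub>RDirProd (fixed_ring G R) Q\<^esub>"
    "nm (ghost G R) \<one>\<^bsub>A\<^esub> = \<one>\<^bsub>RDirProd (fixed_ring G R) Q\<^esub>"
    by (simp_all add: ghost_nm nm_zero nm_one)
next
  fix g y assume "g \<in> carrier G" "y \<in> carrier (RDirProd (fixed_ring G R) Q)"
  then show "act R g (res (ghost G R) y) = res (ghost G R) y"
    by (cases y) (auto dest: fixed_setD)
next
  fix g x assume "g \<in> carrier G" "x \<in> carrier A"
  then show "tr (ghost G R) (act R g x) = tr (ghost G R) x" "nm (ghost G R) (act R g x) = nm (ghost G R) x"
    by (simp_all add: ghost_tr ghost_nm act_closed tr_act nm_act)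
next
  fix x y assume x: "x \<in> carrier A" and y: "y \<in> carrier (RDirProd (fixed_ring G R) Q)"
  obtain a b where ab: "y = (a, b)" by (cases y)
  then have a: "a \<in> fixed_set" "b \<in> carrier Q" using y by auto
  have "res R (tr R (x \<otimes>\<^bsub>A\<^esub> a)) = (\<Oplus>\<^bsub>A\<^esub>g\<in>carrier G. act R g (x \<otimes>\<^bsub>A\<^esub> a))"
    using x a by (simp add: res_tr fixed_setD)
  also have "\<dots> = (\<Oplus>\<^bsub>A\<^esub>g\<in>carrier G. act R g x \<otimes>\<^bsub>A\<^esub> a)"
    by (rule A.finsum_cong') (use x a fixed_setD in auto)
  also have "\<dots> = (\<Oplus>\<^bsub>A\<^esub>g\<in>carrier G. act R g x) \<otimes>\<^bsub>A\<^esub> a"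
    using x a by (intro A.finsum_ldistr[symmetric]) (auto simp: finite_carrier dest: fixed_setD)
  finally show "tr (ghost G R) (x \<otimes>\<^bsub>A\<^esub> res (ghost G R) y) =
      tr (ghost G R) x \<otimes>\<^bsub>RDirProd (fixed_ring G R) Q\<^esub> y"
    using x a by (simp add: ghost_tr ab fixed_setD res_tr)
next
  fix x y \<U> assume xy: "x \<in> carrier A" "y \<in> carrier A" and T: "subset_transversal G \<U>"
  define s where "s = (\<Oplus>\<^bsub>A\<^esub>U\<in>\<U>. \<Otimes>\<^bsub>A\<^esub>g\<in>carrier G. act R g (if g \<in> U then x else y))"
  have s: "s \<in> carrier A" unfolding s_def
    using xy by (intro A.finsum_closed Pi_I A.finprod_closed) auto
  have nm: "nm R (x \<oplus>\<^bsub>A\<^esub> y) = nm R x \<oplus>\<^bsub>lev_G R\<^esub> nm R y \<oplus>\<^bsub>lev_G R\<^esub> tr R s"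
    unfolding s_def by (rule nm_add[OF xy T])
  show "nm (ghost G R) (x \<oplus>\<^bsub>A\<^esub> y) =
    nm (ghost G R) x \<oplus>\<^bsub>RDirProd (fixed_ring G R) Q\<^esub> nm (ghost G R) y \<oplus>\<^bsub>RDirProd (fixed_ring G R) Q\<^esub>
    tr (ghost G R) (\<Oplus>\<^bsub>A\<^esub>U\<in>\<U>. \<Otimes>\<^bsub>A\<^esub>g\<in>carrier G. act R g (if g \<in> U then x else y))"
    unfolding s_def[symmetric]
    using xy s nm_closed tr_closed by (simp add: ghost_nm ghost_tr nm cls_transfer)
qed (simp_all add: A.is_cring act_hom act_one act_mult)

end

section \<open>The unit of coinduction\<close>

context tambara_functor begin

lemma coind_unit_simps [simp]:
  "fst (coind_unit G R) r = (\<lambda>x\<in>carrier G. act R x r)"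
  "snd (coind_unit G R) = res R"
  by (simp_all add: coind_unit_def)

end

context prime_order_group begin

text \<open>Compatibility with transfers and norms is the double coset formula of \<open>R\<close>;
  compatibility with the action is \<open>act_mult\<close>.\<close>

lemma tambara_hom_coind_unit:
  assumes "tambara_functor G R"
  shows "tambara_hom G R (coind G (lev_e R)) (coind_unit G R)"
proof -
  interpret tambara_functor G R by fact
  interpret A: cring "lev_e R" by (rule lev_e_cring)
  note hom_simps = ring_hom_closed[OF act_hom] ring_hom_mult[OF act_hom] ring_hom_add[OF act_hom]
    ring_hom_one[OF act_hom]
  have e: "fst (coind_unit G R) \<in> ring_hom (lev_e R) (fun_ring (carrier G) (lev_e R))"
    by (rule ring_hom_memI) (auto simp: hom_simps intro!: restrict_ext)
  show ?thesis unfolding tambara_hom_def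
  proof (intro conjI ballI)
    show "fst (coind_unit G R) (act R g x) = act (coind G (lev_e R)) g (fst (coind_unit G R) x)"
      if "g \<in> carrier G" "x \<in> carrier (lev_e R)" for g x
      using that by (auto simp: act_mult intro!: restrict_ext)
    show "fst (coind_unit G R) (res R y) = res (coind G (lev_e R)) (snd (coind_unit G R) y)"
      if "y \<in> carrier (lev_G R)" for y
      using that by (auto simp: act_res intro!: restrict_ext)
    show "snd (coind_unit G R) (tr R x) = tr (coind G (lev_e R)) (fst (coind_unit G R) x)"
      if "x \<in> carrier (lev_e R)" for x
      using that by (auto simp: res_tr hom_simps intro!: A.finsum_cong')
    show "snd (coind_unit G R) (nm R x) = nm (coind G (lev_e R)) (fst (coind_unit G R) x)"
      if "x \<in> carrier (lev_e R)" for x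
      using that by (auto simp: res_nm hom_simps intro!: A.finprod_cong')
  qed (use e in \<open>simp_all add: assms tambara_functor_coind lev_e_cring res_hom\<close>)
qed

end

section \<open>Free algebras\<close>

primrec eval_e ::
    "('c, 'a, 'b) tambara \<Rightarrow> ('e \<Rightarrow> 'a) \<times> ('g \<Rightarrow> 'b) \<Rightarrow> (nat \<Rightarrow> 'a) \<Rightarrow> (nat \<Rightarrow> 'b) \<Rightarrow> ('c, 'e, 'g) term_e \<Rightarrow> 'a"
  and eval_G ::
    "('c, 'a, 'b) tambara \<Rightarrow> ('e \<Rightarrow> 'a) \<times> ('g \<Rightarrow> 'b) \<Rightarrow> (nat \<Rightarrow> 'a) \<Rightarrow> (nat \<Rightarrow> 'b) \<Rightarrow> ('c, 'e, 'g) term_G \<Rightarrow> 'b" where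
  "eval_e T \<tau> \<xi> \<upsilon> (Var_e i) = \<xi> i"
| "eval_e T \<tau> \<xi> \<upsilon> (Const_e r) = fst \<tau> r"
| "eval_e T \<tau> \<xi> \<upsilon> (Add_e s t) = eval_e T \<tau> \<xi> \<upsilon> s \<oplus>\<^bsub>lev_e T\<^esub> eval_e T \<tau> \<xi> \<upsilon> t"
| "eval_e T \<tau> \<xi> \<upsilon> (Mul_e s t) = eval_e T \<tau> \<xi> \<upsilon> s \<otimes>\<^bsub>lev_e T\<^esub> eval_e T \<tau> \<xi> \<upsilon> t"
| "eval_e T \<tau> \<xi> \<upsilon> (Act g t) = act T g (eval_e T \<tau> \<xi> \<upsilon> t)"
| "eval_e T \<tau> \<xi> \<upsilon> (Res u) = res T (eval_G T \<tau> \<xi> \<upsilon> u)"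
| "eval_G T \<tau> \<xi> \<upsilon> (Var_G j) = \<upsilon> j"
| "eval_G T \<tau> \<xi> \<upsilon> (Const_G r) = snd \<tau> r"
| "eval_G T \<tau> \<xi> \<upsilon> (Add_G u v) = eval_G T \<tau> \<xi> \<upsilon> u \<oplus>\<^bsub>lev_G T\<^esub> eval_G T \<tau> \<xi> \<upsilon> v"
| "eval_G T \<tau> \<xi> \<upsilon> (Mul_G u v) = eval_G T \<tau> \<xi> \<upsilon> u \<otimes>\<^bsub>lev_G T\<^esub> eval_G T \<tau> \<xi> \<upsilon> v"
| "eval_G T \<tau> \<xi> \<upsilon> (Tr t) = tr T (eval_e T \<tau> \<xi> \<upsilon> t)"
| "eval_G T \<tau> \<xi> \<upsilon> (Nm t) = nm T (eval_e T \<tau> \<xi> \<upsilon> t)"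

text \<open>Values for the generators in an algebra \<open>T\<close>. Nothing is asked of the other
  indices, which no well-formed term mentions.\<close>

definition algebra_point ::
  "'c monoid \<Rightarrow> ('c, 'e, 'g) tambara \<Rightarrow> nat \<Rightarrow> nat \<Rightarrow>
   ('c, 'a, 'b) tambara \<Rightarrow> ('e \<Rightarrow> 'a) \<times> ('g \<Rightarrow> 'b) \<Rightarrow> (nat \<Rightarrow> 'a) \<Rightarrow> (nat \<Rightarrow> 'b) \<Rightarrow> bool" where
  "algebra_point G R m n T \<tau> \<xi> \<upsilon> \<longleftrightarrow>
     tambara_hom G R T \<tau> \<and> (\<forall>i<m. \<xi> i \<in> carrier (lev_e T)) \<and> (\<forall>j<n. \<upsilon> j \<in> carrier (lev_G T))"

lemma tambara_ops_homD:
  assumes "tambara_ops_hom G R S \<phi>"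
  shows "tambara_functor G S"
    "fst \<phi> \<in> ring_hom (lev_e R) (lev_e S)" "snd \<phi> \<in> ring_hom (lev_G R) (lev_G S)"
    "fst \<phi> \<zero>\<^bsub>lev_e R\<^esub> = \<zero>\<^bsub>lev_e S\<^esub>" "fst \<phi> \<one>\<^bsub>lev_e R\<^esub> = \<one>\<^bsub>lev_e S\<^esub>"
    "snd \<phi> \<zero>\<^bsub>lev_G R\<^esub> = \<zero>\<^bsub>lev_G S\<^esub>" "snd \<phi> \<one>\<^bsub>lev_G R\<^esub> = \<one>\<^bsub>lev_G S\<^esub>"
    "x \<in> carrier (lev_e R) \<Longrightarrow> fst \<phi> x \<in> carrier (lev_e S)"
    "y \<in> carrier (lev_G R) \<Longrightarrow> snd \<phi> y \<in> carrier (lev_G S)"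
    "\<lbrakk>x \<in> carrier (lev_e R); x' \<in> carrier (lev_e R)\<rbrakk> \<Longrightarrow> fst \<phi> (x \<oplus>\<^bsub>lev_e R\<^esub> x') = fst \<phi> x \<oplus>\<^bsub>lev_e S\<^esub> fst \<phi> x'"
    "\<lbrakk>x \<in> carrier (lev_e R); x' \<in> carrier (lev_e R)\<rbrakk> \<Longrightarrow> fst \<phi> (x \<otimes>\<^bsub>lev_e R\<^esub> x') = fst \<phi> x \<otimes>\<^bsub>lev_e S\<^esub> fst \<phi> x'"
    "\<lbrakk>y \<in> carrier (lev_G R); y' \<in> carrier (lev_G R)\<rbrakk> \<Longrightarrow> snd \<phi> (y \<oplus>\<^bsub>lev_G R\<^esub> y') = snd \<phi> y \<oplus>\<^bsub>lev_G S\<^esub> snd \<phi> y'"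
    "\<lbrakk>y \<in> carrier (lev_G R); y' \<in> carrier (lev_G R)\<rbrakk> \<Longrightarrow> snd \<phi> (y \<otimes>\<^bsub>lev_G R\<^esub> y') = snd \<phi> y \<otimes>\<^bsub>lev_G S\<^esub> snd \<phi> y'"
    "\<lbrakk>g \<in> carrier G; x \<in> carrier (lev_e R)\<rbrakk> \<Longrightarrow> fst \<phi> (act R g x) = act S g (fst \<phi> x)"
    "y \<in> carrier (lev_G R) \<Longrightarrow> fst \<phi> (res R y) = res S (snd \<phi> y)"
    "x \<in> carrier (lev_e R) \<Longrightarrow> snd \<phi> (tr R x) = tr S (fst \<phi> x)"
    "x \<in> carrier (lev_e R) \<Longrightarrow> snd \<phi> (nm R x) = nm S (fst \<phi> x)"
  using assms by (auto simp: tambara_ops_hom_def ring_hom_def)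

lemmas tambara_homD = tambara_ops_homD[OF tambara_hom_ops]

lemma (in tambara_functor) ops_closed: "tambara_ops_closed G R"
proof -
  interpret A: cring "lev_e R" by (rule lev_e_cring)
  interpret B: cring "lev_G R" by (rule lev_G_cring)
  show ?thesis
    by (auto simp: tambara_ops_closed_def tr_closed nm_closed ring_hom_closed[OF act_hom]
      ring_hom_closed[OF res_hom])
qed

lemma tambara_ops_closedD:
  assumes "tambara_ops_closed G T"
  shows "\<zero>\<^bsub>lev_e T\<^esub> \<in> carrier (lev_e T)" "\<one>\<^bsub>lev_e T\<^esub> \<in> carrier (lev_e T)"
     "\<zero>\<^bsub>lev_G T\<^esub> \<in> carrier (lev_G T)" "\<one>\<^bsub>lev_G T\<^esub> \<in> carrier (lev_G T)"
     "\<And>x y. \<lbrakk>x \<in> carrier (lev_e T); y \<in> carrier (lev_e T)\<rbrakk> \<Longrightarrow> x \<oplus>\<^bsub>lev_e T\<^esub> y \<in> carrier (lev_e T)"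
     "\<And>x y. \<lbrakk>x \<in> carrier (lev_e T); y \<in> carrier (lev_e T)\<rbrakk> \<Longrightarrow> x \<otimes>\<^bsub>lev_e T\<^esub> y \<in> carrier (lev_e T)"
     "\<And>x y. \<lbrakk>x \<in> carrier (lev_G T); y \<in> carrier (lev_G T)\<rbrakk> \<Longrightarrow> x \<oplus>\<^bsub>lev_G T\<^esub> y \<in> carrier (lev_G T)"
     "\<And>x y. \<lbrakk>x \<in> carrier (lev_G T); y \<in> carrier (lev_G T)\<rbrakk> \<Longrightarrow> x \<otimes>\<^bsub>lev_G T\<^esub> y \<in> carrier (lev_G T)"
     "\<And>g x. \<lbrakk>g \<in> carrier G; x \<in> carrier (lev_e T)\<rbrakk> \<Longrightarrow> act T g x \<in> carrier (lev_e T)"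
     "\<And>y. y \<in> carrier (lev_G T) \<Longrightarrow> res T y \<in> carrier (lev_e T)"
     "\<And>x. x \<in> carrier (lev_e T) \<Longrightarrow> tr T x \<in> carrier (lev_G T)"
     "\<And>x. x \<in> carrier (lev_e T) \<Longrightarrow> nm T x \<in> carrier (lev_G T)"
  using assms by (simp_all add: tambara_ops_closed_def)

lemma eval_closed:
  assumes "algebra_point G R m n T \<tau> \<xi> \<upsilon>"
  shows "wf_term_e G R m n t \<Longrightarrow> eval_e T \<tau> \<xi> \<upsilon> t \<in> carrier (lev_e T)"
    "wf_term_G G R m n u \<Longrightarrow> eval_G T \<tau> \<xi> \<upsilon> u \<in> carrier (lev_G T)"
proof -
  have h: "tambara_hom G R T \<tau>" and v: "\<And>i. i < m \<Longrightarrow> \<xi> i \<in> carrier (lev_e T)"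
    "\<And>j. j < n \<Longrightarrow> \<upsilon> j \<in> carrier (lev_G T)"
    using assms by (auto simp: algebra_point_def)
  note c = tambara_ops_closedD[OF tambara_functor.ops_closed[OF tambara_homD(1)[OF h]]]
  show "wf_term_e G R m n t \<Longrightarrow> eval_e T \<tau> \<xi> \<upsilon> t \<in> carrier (lev_e T)"
    "wf_term_G G R m n u \<Longrightarrow> eval_G T \<tau> \<xi> \<upsilon> u \<in> carrier (lev_G T)"
    by (induction t and u) (simp_all add: v c tambara_homD(8,9)[OF h])
qed

text \<open>Compatibility with the operations, split off from \<open>tambara_congruence\<close>: it
  makes the operations on classes well defined before the quotient is known to be a Tambara
  functor.\<close>

locale term_congruence =
  fixes G :: "'c monoid" and R :: "('c, 'e, 'g) tambara" and m n :: nat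
    and E :: "('c, 'e, 'g) term_e rel" and F :: "('c, 'e, 'g) term_G rel"
  assumes equiv_e: "equiv (terms_e G R m n) E" and equiv_G: "equiv (terms_G G R m n) F"
    and add_e: "\<lbrakk>(s, s') \<in> E; (t, t') \<in> E\<rbrakk> \<Longrightarrow> (Add_e s t, Add_e s' t') \<in> E"
    and mul_e: "\<lbrakk>(s, s') \<in> E; (t, t') \<in> E\<rbrakk> \<Longrightarrow> (Mul_e s t, Mul_e s' t') \<in> E"
    and add_G: "\<lbrakk>(u, u') \<in> F; (v, v') \<in> F\<rbrakk> \<Longrightarrow> (Add_G u v, Add_G u' v') \<in> F"
    and mul_G: "\<lbrakk>(u, u') \<in> F; (v, v') \<in> F\<rbrakk> \<Longrightarrow> (Mul_G u v, Mul_G u' v') \<in> F"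
    and act: "\<lbrakk>g \<in> carrier G; (t, t') \<in> E\<rbrakk> \<Longrightarrow> (Act g t, Act g t') \<in> E"
    and res: "(u, u') \<in> F \<Longrightarrow> (Res u, Res u') \<in> E"
    and tr: "(t, t') \<in> E \<Longrightarrow> (Tr t, Tr t') \<in> F"
    and nm: "(t, t') \<in> E \<Longrightarrow> (Nm t, Nm t') \<in> F"
begin

abbreviation T0 where "T0 \<equiv> term_quotient G R m n E F"
abbreviation wf_e where "wf_e \<equiv> wf_term_e G R m n"
abbreviation wf_G where "wf_G \<equiv> wf_term_G G R m n"

lemma refl: "wf_e t \<Longrightarrow> (t, t) \<in> E" "wf_G u \<Longrightarrow> (u, u) \<in> F"
  using equiv_e equiv_G by (auto simp: equiv_def refl_on_def)

lemma class_eq_iff: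
  "\<lbrakk>wf_e s; wf_e t\<rbrakk> \<Longrightarrow> E `` {s} = E `` {t} \<longleftrightarrow> (s, t) \<in> E"
  "\<lbrakk>wf_G u; wf_G v\<rbrakk> \<Longrightarrow> F `` {u} = F `` {v} \<longleftrightarrow> (u, v) \<in> F"
  using eq_equiv_class_iff[OF equiv_e] eq_equiv_class_iff[OF equiv_G] by auto

lemma carrier_e: "carrier (lev_e T0) = {E `` {t} | t. wf_e t}"
  and carrier_G: "carrier (lev_G T0) = {F `` {u} | u. wf_G u}"
  unfolding term_quotient_def quotient_def UNION_singleton_eq_range by (simp_all add: image_Collect)

lemma UN_class:
  assumes "(t, t) \<in> r" "\<And>t'. (t, t') \<in> r \<Longrightarrow> f t' = f t"
  shows "(\<Union>t'\<in>r `` {t}. f t') = f t"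
  using assms(1) by (intro UN_constant_eq[of t] ballI assms(2)) simp_all

lemma UN_class2:
  assumes "(s, s) \<in> r" "(t, t) \<in> q" "\<And>s' t'. \<lbrakk>(s, s') \<in> r; (t, t') \<in> q\<rbrakk> \<Longrightarrow> f s' t' = c"
  shows "(\<Union>s'\<in>r `` {s}. \<Union>t'\<in>q `` {t}. f s' t') = c"
  using assms(1,2) by (intro UN_constant_eq[of s] UN_constant_eq[of t] ballI assms(3)) simp_all

lemma quotient_zero_one:
  "\<zero>\<^bsub>lev_e T0\<^esub> = E `` {Const_e \<zero>\<^bsub>lev_e R\<^esub>}" "\<one>\<^bsub>lev_e T0\<^esub> = E `` {Const_e \<one>\<^bsub>lev_e R\<^esub>}"
  "\<zero>\<^bsub>lev_G T0\<^esub> = F `` {Const_G \<zero>\<^bsub>lev_G R\<^esub>}" "\<one>\<^bsub>lev_G T0\<^esub> = F `` {Const_G \<one>\<^bsub>lev_G R\<^esub>}"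
  by (simp_all add: term_quotient_def)

lemma quotient_ops_e:
  assumes "wf_e s" "wf_e t"
  shows "E `` {s} \<oplus>\<^bsub>lev_e T0\<^esub> E `` {t} = E `` {Add_e s t}"
    "E `` {s} \<otimes>\<^bsub>lev_e T0\<^esub> E `` {t} = E `` {Mul_e s t}"
proof -
  note st = refl(1)[OF assms(1)] refl(1)[OF assms(2)]
  have "(\<Union>s'\<in>E `` {s}. \<Union>t'\<in>E `` {t}. E `` {Add_e s' t'}) = E `` {Add_e s t}"
    by (rule UN_class2[OF st]) (rule equiv_class_eq[OF equiv_e, symmetric], rule add_e)
  then show "E `` {s} \<oplus>\<^bsub>lev_e T0\<^esub> E `` {t} = E `` {Add_e s t}" by (simp add: term_quotient_def)
  have "(\<Union>s'\<in>E `` {s}. \<Union>t'\<in>E `` {t}. E `` {Mul_e s' t'}) = E `` {Mul_e s t}"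
    by (rule UN_class2[OF st]) (rule equiv_class_eq[OF equiv_e, symmetric], rule mul_e)
  then show "E `` {s} \<otimes>\<^bsub>lev_e T0\<^esub> E `` {t} = E `` {Mul_e s t}" by (simp add: term_quotient_def)
qed

lemma quotient_unary_e:
  assumes "wf_e t"
  shows "g \<in> carrier G \<Longrightarrow> act T0 g (E `` {t}) = E `` {Act g t}"
    "tr T0 (E `` {t}) = F `` {Tr t}" "nm T0 (E `` {t}) = F `` {Nm t}"
proof -
  note st = refl(1)[OF assms] refl(1)[OF assms]
  show "g \<in> carrier G \<Longrightarrow> act T0 g (E `` {t}) = E `` {Act g t}"
    unfolding term_quotient_def tambara.simps
    by (rule UN_class[OF st(2)]) (rule equiv_class_eq[OF equiv_e, symmetric], rule act)
  show "tr T0 (E `` {t}) = F `` {Tr t}"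
    unfolding term_quotient_def tambara.simps
    by (rule UN_class[OF st(2)]) (rule equiv_class_eq[OF equiv_G, symmetric], rule tr)
  show "nm T0 (E `` {t}) = F `` {Nm t}"
    unfolding term_quotient_def tambara.simps
    by (rule UN_class[OF st(2)]) (rule equiv_class_eq[OF equiv_G, symmetric], rule nm)
qed

lemma quotient_ops_G:
  assumes "wf_G u" "wf_G v"
  shows "F `` {u} \<oplus>\<^bsub>lev_G T0\<^esub> F `` {v} = F `` {Add_G u v}"
    "F `` {u} \<otimes>\<^bsub>lev_G T0\<^esub> F `` {v} = F `` {Mul_G u v}"
proof -
  note uv = refl(2)[OF assms(1)] refl(2)[OF assms(2)]
  have "(\<Union>s'\<in>F `` {u}. \<Union>t'\<in>F `` {v}. F `` {Add_G s' t'}) = F `` {Add_G u v}"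
    by (rule UN_class2[OF uv]) (rule equiv_class_eq[OF equiv_G, symmetric], rule add_G)
  then show "F `` {u} \<oplus>\<^bsub>lev_G T0\<^esub> F `` {v} = F `` {Add_G u v}" by (simp add: term_quotient_def)
  have "(\<Union>s'\<in>F `` {u}. \<Union>t'\<in>F `` {v}. F `` {Mul_G s' t'}) = F `` {Mul_G u v}"
    by (rule UN_class2[OF uv]) (rule equiv_class_eq[OF equiv_G, symmetric], rule mul_G)
  then show "F `` {u} \<otimes>\<^bsub>lev_G T0\<^esub> F `` {v} = F `` {Mul_G u v}" by (simp add: term_quotient_def)
qed

lemma quotient_res:
  assumes "wf_G v"
  shows "res T0 (F `` {v}) = E `` {Res v}"
proof -
  note uv = refl(2)[OF assms] refl(2)[OF assms]
  show ?thesis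
    unfolding term_quotient_def tambara.simps
    by (rule UN_class[OF uv(2)]) (rule equiv_class_eq[OF equiv_e, symmetric], rule res)
qed

lemma quotient_ops_closed:
  assumes "tambara_functor G R"
  shows "tambara_ops_closed G T0"
proof -
  note c = tambara_ops_closedD[OF tambara_functor.ops_closed[OF assms]]
  have ce: "E `` {t} \<in> carrier (lev_e T0)" if "wf_e t" for t using that by (auto simp: carrier_e)
  have cG: "F `` {u} \<in> carrier (lev_G T0)" if "wf_G u" for u using that by (auto simp: carrier_G)
  have e: "\<exists>t. wf_e t \<and> x = E `` {t}" if "x \<in> carrier (lev_e T0)" for x using that by (auto simp: carrier_e)
  have G: "\<exists>u. wf_G u \<and> x = F `` {u}" if "x \<in> carrier (lev_G T0)" for x using that by (auto simp: carrier_G)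
  show ?thesis unfolding tambara_ops_closed_def
    by (auto dest!: e G simp: quotient_zero_one quotient_ops_e quotient_ops_G quotient_unary_e quotient_res c intro!: ce cG)
qed

text \<open>Induction on terms, one operation at a time. It exhibits each congruence as the kernel
  of an evaluation in its own quotient.\<close>

lemma eval_quotient:
  assumes "tambara_hom G R T0 (const_map E F)"
  shows "wf_e t \<Longrightarrow> eval_e T0 (const_map E F) (\<lambda>i. E `` {Var_e i}) (\<lambda>j. F `` {Var_G j}) t = E `` {t}"
    "wf_G u \<Longrightarrow> eval_G T0 (const_map E F) (\<lambda>i. E `` {Var_e i}) (\<lambda>j. F `` {Var_G j}) u = F `` {u}"
  by (induction t and u) (simp_all add: quotient_ops_e quotient_ops_G quotient_unary_e quotient_res const_map_def)

lemma algebra_point_quotient: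
  assumes "tambara_hom G R T0 (const_map E F)"
  shows "algebra_point G R m n T0 (const_map E F) (\<lambda>i. E `` {Var_e i}) (\<lambda>j. F `` {Var_G j})"
  using assms by (force simp: algebra_point_def carrier_e carrier_G)

end

lemma tambara_congruence_iff:
  "tambara_congruence G R m n (E, F) \<longleftrightarrow>
     term_congruence G R m n E F \<and> tambara_hom G R (term_quotient G R m n E F) (const_map E F)"
  unfolding tambara_congruence_def term_congruence_def by auto

text \<open>
  The relations holding in a family of algebras form a congruence. Both the least congruence (the family
  of all quotients) and the kernel of an evaluation (a single algebra) are of this kind.
\<close>

definition eval_cong_e where
  "eval_cong_e G R m n \<Phi> = {(s, t). wf_term_e G R m n s \<and> wf_term_e G R m n t \<and>
     (\<forall>T \<tau> \<xi> \<upsilon>. (T, \<tau>, \<xi>, \<upsilon>) \<in> \<Phi> \<longrightarrow> eval_e T \<tau> \<xi> \<upsilon> s = eval_e T \<tau> \<xi> \<upsilon> t)}"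

definition eval_cong_G where
  "eval_cong_G G R m n \<Phi> = {(s, t). wf_term_G G R m n s \<and> wf_term_G G R m n t \<and>
     (\<forall>T \<tau> \<xi> \<upsilon>. (T, \<tau>, \<xi>, \<upsilon>) \<in> \<Phi> \<longrightarrow> eval_G T \<tau> \<xi> \<upsilon> s = eval_G T \<tau> \<xi> \<upsilon> t)}"

definition class_eval :: "('t \<Rightarrow> 'a) \<Rightarrow> 't set \<Rightarrow> 'a" where
  "class_eval f C = f (SOME t. t \<in> C)"

lemma class_eval_class:
  assumes "(t, t) \<in> r" "\<And>t'. (t, t') \<in> r \<Longrightarrow> f t' = c"
  shows "class_eval f (r `` {t}) = c"
proof -
  have "(SOME t'. t' \<in> r `` {t}) \<in> r `` {t}" by (rule someI[of _ t]) (use assms(1) in simp)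
  then show ?thesis using assms(2) by (simp add: class_eval_def)
qed

lemma eval_cong_eD: "\<lbrakk>(s, t) \<in> eval_cong_e G R m n \<Phi>; (T, \<tau>, \<xi>, \<upsilon>) \<in> \<Phi>\<rbrakk> \<Longrightarrow> eval_e T \<tau> \<xi> \<upsilon> t = eval_e T \<tau> \<xi> \<upsilon> s"
  and eval_cong_GD: "\<lbrakk>(u, v) \<in> eval_cong_G G R m n \<Phi>; (T, \<tau>, \<xi>, \<upsilon>) \<in> \<Phi>\<rbrakk> \<Longrightarrow> eval_G T \<tau> \<xi> \<upsilon> v = eval_G T \<tau> \<xi> \<upsilon> u"
  by (cases \<tau>, simp add: eval_cong_e_def eval_cong_G_def)+

text \<open>Distinct classes are separated by some member of \<open>\<Phi>\<close>, so the quotient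
  is subdirect in the algebras of \<open>\<Phi>\<close> and inherits the axioms from them.\<close>

proposition tambara_congruence_eval_cong:
  fixes R :: "('c, 'e, 'g) tambara"
    and \<Phi> :: "(('c, 'a, 'b) tambara \<times> (('e \<Rightarrow> 'a) \<times> ('g \<Rightarrow> 'b)) \<times> (nat \<Rightarrow> 'a) \<times> (nat \<Rightarrow> 'b)) set"
  assumes "group G" "tambara_functor G R"
    and pt: "\<And>T \<tau> \<xi> \<upsilon>. (T, \<tau>, \<xi>, \<upsilon>) \<in> \<Phi> \<Longrightarrow> algebra_point G R m n T \<tau> \<xi> \<upsilon>"
  shows "tambara_congruence G R m n (eval_cong_e G R m n \<Phi>, eval_cong_G G R m n \<Phi>)"
proof -
  let ?E = "eval_cong_e G R m n \<Phi>" and ?F = "eval_cong_G G R m n \<Phi>"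
  interpret R: tambara_functor G R by fact
  interpret A: cring "lev_e R" by (rule R.lev_e_cring)
  interpret B: cring "lev_G R" by (rule R.lev_G_cring)
  interpret term_congruence G R m n ?E ?F
    by unfold_locales
      (auto simp: eval_cong_e_def eval_cong_G_def
        intro!: equivI refl_onI symI transI)
  have hom: "tambara_hom G R T \<tau>" if "(T, \<tau>, \<xi>, \<upsilon>) \<in> \<Phi>" for T \<tau> \<xi> \<upsilon>
    using pt[OF that] by (simp add: algebra_point_def)
  have ce: "class_eval (eval_e T \<tau> \<xi> \<upsilon>) (?E `` {t}) = eval_e T \<tau> \<xi> \<upsilon> t"
    if "(T, \<tau>, \<xi>, \<upsilon>) \<in> \<Phi>" "wf_e t" for T \<tau> \<xi> \<upsilon> t
    by (rule class_eval_class[OF refl(1)[OF that(2)]]) (rule eval_cong_eD[OF _ that(1)])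
  have cG: "class_eval (eval_G T \<tau> \<xi> \<upsilon>) (?F `` {u}) = eval_G T \<tau> \<xi> \<upsilon> u"
    if "(T, \<tau>, \<xi>, \<upsilon>) \<in> \<Phi>" "wf_G u" for T \<tau> \<xi> \<upsilon> u
    by (rule class_eval_class[OF refl(2)[OF that(2)]]) (rule eval_cong_GD[OF _ that(1)])
  have eq_e: "?E `` {s} = ?E `` {t}" if "wf_e s" "wf_e t"
    "\<And>T \<tau> \<xi> \<upsilon>. (T, \<tau>, \<xi>, \<upsilon>) \<in> \<Phi> \<Longrightarrow> eval_e T \<tau> \<xi> \<upsilon> s = eval_e T \<tau> \<xi> \<upsilon> t" for s t
    using that by (subst class_eq_iff) (auto simp: eval_cong_e_def)
  have eq_G: "?F `` {s} = ?F `` {t}" if "wf_G s" "wf_G t"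
    "\<And>T \<tau> \<xi> \<upsilon>. (T, \<tau>, \<xi>, \<upsilon>) \<in> \<Phi> \<Longrightarrow> eval_G T \<tau> \<xi> \<upsilon> s = eval_G T \<tau> \<xi> \<upsilon> t" for s t
    using that by (subst class_eq_iff) (auto simp: eval_cong_G_def)
  let ?Fam = "(\<lambda>(T, \<tau>, \<xi>, \<upsilon>). (T, class_eval (eval_e T \<tau> \<xi> \<upsilon>), class_eval (eval_G T \<tau> \<xi> \<upsilon>))) ` \<Phi>"
  note Rc = tambara_ops_closedD[OF R.ops_closed]
  have tf: "tambara_functor G T0"
  proof (rule tambara_functor_subdirect[where F = ?Fam])
    fix S \<phi> assume "(S, \<phi>) \<in> ?Fam"
    then obtain \<tau> \<xi> \<upsilon> where S: "(S, \<tau>, \<xi>, \<upsilon>) \<in> \<Phi>"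
      and \<phi>: "\<phi> = (class_eval (eval_e S \<tau> \<xi> \<upsilon>), class_eval (eval_G S \<tau> \<xi> \<upsilon>))" by auto
    note h = tambara_homD[OF hom[OF S]] and c = eval_closed[OF pt[OF S]] and e = ce[OF S] cG[OF S]
    show "tambara_ops_hom G T0 S \<phi>"
      unfolding tambara_ops_hom_def \<phi> fst_conv snd_conv
    proof (intro conjI ballI)
      show "class_eval (eval_e S \<tau> \<xi> \<upsilon>) \<in> ring_hom (lev_e T0) (lev_e S)"
        by (rule ring_hom_memI)
          (auto simp: carrier_e quotient_ops_e quotient_zero_one e c h Rc)
      show "class_eval (eval_G S \<tau> \<xi> \<upsilon>) \<in> ring_hom (lev_G T0) (lev_G S)"
        by (rule ring_hom_memI)
          (auto simp: carrier_G quotient_ops_G quotient_zero_one e c h Rc)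
    qed (auto simp: carrier_e carrier_G quotient_ops_e quotient_ops_G quotient_unary_e quotient_res quotient_zero_one e h Rc)
  next
    show "\<exists>m\<in>carrier (lev_e T0). \<forall>(S, \<phi>)\<in>?Fam. fst \<phi> m = \<ominus>\<^bsub>lev_e S\<^esub> \<one>\<^bsub>lev_e S\<^esub>"
    proof (intro bexI ballI)
      \<comment> \<open>Structure maps are ring homomorphisms, so the constant minus one evaluates
        to minus one in every member of \<open>\<Phi>\<close>.\<close>
      let ?m = "Const_e (\<ominus>\<^bsub>lev_e R\<^esub> \<one>\<^bsub>lev_e R\<^esub>)"
      show "?E `` {?m} \<in> carrier (lev_e T0)" by (force simp: carrier_e)
      fix x assume "x \<in> ?Fam"
      then obtain S \<tau> \<xi> \<upsilon> where S: "(S, \<tau>, \<xi>, \<upsilon>) \<in> \<Phi>"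
        and x: "x = (S, class_eval (eval_e S \<tau> \<xi> \<upsilon>), class_eval (eval_G S \<tau> \<xi> \<upsilon>))" by auto
      note h = tambara_homD[OF hom[OF S]]
      interpret h: ring_hom_cring "lev_e R" "lev_e S" "fst \<tau>"
        using h(2) tambara_functor.lev_e_cring[OF h(1)] R.lev_e_cring
        by (simp add: ring_hom_cring_def ring_hom_cring_axioms_def)
      show "case x of (S, \<phi>) \<Rightarrow> fst \<phi> (?E `` {?m}) = \<ominus>\<^bsub>lev_e S\<^esub> \<one>\<^bsub>lev_e S\<^esub>"
        by (simp add: x ce[OF S])
    qed
    show "\<exists>m\<in>carrier (lev_G T0). \<forall>(S, \<phi>)\<in>?Fam. snd \<phi> m = \<ominus>\<^bsub>lev_G S\<^esub> \<one>\<^bsub>lev_G S\<^esub>"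
    proof (intro bexI ballI)
      let ?m = "Const_G (\<ominus>\<^bsub>lev_G R\<^esub> \<one>\<^bsub>lev_G R\<^esub>)"
      show "?F `` {?m} \<in> carrier (lev_G T0)" by (force simp: carrier_G)
      fix x assume "x \<in> ?Fam"
      then obtain S \<tau> \<xi> \<upsilon> where S: "(S, \<tau>, \<xi>, \<upsilon>) \<in> \<Phi>"
        and x: "x = (S, class_eval (eval_e S \<tau> \<xi> \<upsilon>), class_eval (eval_G S \<tau> \<xi> \<upsilon>))" by auto
      note h = tambara_homD[OF hom[OF S]]
      interpret h: ring_hom_cring "lev_G R" "lev_G S" "snd \<tau>"
        using h(3) tambara_functor.lev_G_cring[OF h(1)] R.lev_G_cring
        by (simp add: ring_hom_cring_def ring_hom_cring_axioms_def)
      show "case x of (S, \<phi>) \<Rightarrow> snd \<phi> (?F `` {?m}) = \<ominus>\<^bsub>lev_G S\<^esub> \<one>\<^bsub>lev_G S\<^esub>"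
        by (simp add: x cG[OF S])
    qed
  next
    fix x y assume "x \<in> carrier (lev_e T0)" "y \<in> carrier (lev_e T0)"
      and *: "\<And>S \<phi>. (S, \<phi>) \<in> ?Fam \<Longrightarrow> fst \<phi> x = fst \<phi> y"
    then obtain s t where st: "wf_e s" "wf_e t" "x = ?E `` {s}" "y = ?E `` {t}" by (auto simp: carrier_e)
    show "x = y" unfolding st
    proof (rule eq_e)
      fix T \<tau> \<xi> \<upsilon> assume T: "(T, \<tau>, \<xi>, \<upsilon>) \<in> \<Phi>"
      then show "eval_e T \<tau> \<xi> \<upsilon> s = eval_e T \<tau> \<xi> \<upsilon> t"
        using *[of T "(class_eval (eval_e T \<tau> \<xi> \<upsilon>), class_eval (eval_G T \<tau> \<xi> \<upsilon>))"] st
        by (force simp: ce[OF T])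
    qed (use st in auto)
  next
    fix x y assume "x \<in> carrier (lev_G T0)" "y \<in> carrier (lev_G T0)"
      and *: "\<And>S \<phi>. (S, \<phi>) \<in> ?Fam \<Longrightarrow> snd \<phi> x = snd \<phi> y"
    then obtain s t where st: "wf_G s" "wf_G t" "x = ?F `` {s}" "y = ?F `` {t}" by (auto simp: carrier_G)
    show "x = y" unfolding st
    proof (rule eq_G)
      fix T \<tau> \<xi> \<upsilon> assume T: "(T, \<tau>, \<xi>, \<upsilon>) \<in> \<Phi>"
      then show "eval_G T \<tau> \<xi> \<upsilon> s = eval_G T \<tau> \<xi> \<upsilon> t"
        using *[of T "(class_eval (eval_e T \<tau> \<xi> \<upsilon>), class_eval (eval_G T \<tau> \<xi> \<upsilon>))"] st
        by (force simp: cG[OF T])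
    qed (use st in auto)
  qed (use assms quotient_ops_closed in auto)
  have cc: "?E `` {Const_e r} \<in> carrier (lev_e T0)" if "r \<in> carrier (lev_e R)" for r
    using that by (force simp: carrier_e)
  have cC: "?F `` {Const_G r} \<in> carrier (lev_G T0)" if "r \<in> carrier (lev_G R)" for r
    using that by (force simp: carrier_G)
  note ops = quotient_zero_one quotient_ops_e quotient_ops_G quotient_unary_e quotient_res
  have "tambara_hom G R T0 (const_map ?E ?F)"
    unfolding tambara_hom_def const_map_def fst_conv snd_conv
  proof (intro conjI ballI)
    show "(\<lambda>r. ?E `` {Const_e r}) \<in> ring_hom (lev_e R) (lev_e T0)"
      by (rule ring_hom_memI; (simp only: cc)?; simp add: ops; intro eq_e; simp add: Rc tambara_homD[OF hom])
    show "(\<lambda>r. ?F `` {Const_G r}) \<in> ring_hom (lev_G R) (lev_G T0)"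
      by (rule ring_hom_memI; (simp only: cC)?; simp add: ops; intro eq_G; simp add: Rc tambara_homD[OF hom])
    show "?E `` {Const_e (act R g x)} = act T0 g (?E `` {Const_e x})"
      if "g \<in> carrier G" "x \<in> carrier (lev_e R)" for g x
      using that by (simp add: ops) (intro eq_e; simp add: Rc tambara_homD[OF hom])
    show "?E `` {Const_e (res R y)} = res T0 (?F `` {Const_G y})" if "y \<in> carrier (lev_G R)" for y
      using that by (simp add: ops) (intro eq_e; simp add: Rc tambara_homD[OF hom])
    show "?F `` {Const_G (tr R x)} = tr T0 (?E `` {Const_e x})"
      "?F `` {Const_G (nm R x)} = nm T0 (?E `` {Const_e x})" if "x \<in> carrier (lev_e R)" for x
      using that by (simp add: ops, intro eq_G; simp add: Rc tambara_homD[OF hom])+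
  qed (rule assms tf)+
  then show ?thesis
    using term_congruence_axioms by (simp add: tambara_congruence_iff)
qed

section \<open>The universal property of free algebras\<close>

context
  fixes G :: "'c monoid" and R :: "('c, 'e, 'g) tambara" and m n :: nat
  assumes grp: "group G" and tf: "tambara_functor G R"
begin

text \<open>Intersecting relations does not visibly preserve the condition that the quotient is a
  Tambara functor. The intersection is therefore identified with an evaluation congruence: one
  inclusion is minimality, the other is \<open>eval_quotient\<close> in each quotient. All quotients
  live in the same types, so they do form a set \<open>\<Phi>\<close>.\<close>

lemma free_cong_congruence: "tambara_congruence G R m n (free_cong_e G R m n, free_cong_G G R m n)"
proof -
  define \<Phi> where "\<Phi> = {(term_quotient G R m n E F, const_map E F, (\<lambda>i. E `` {Var_e i}), (\<lambda>j. F `` {Var_G j}))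
    | E F. tambara_congruence G R m n (E, F)}"
  have C: "term_congruence G R m n E F" "tambara_hom G R (term_quotient G R m n E F) (const_map E F)"
    if "tambara_congruence G R m n (E, F)" for E F using that by (simp_all add: tambara_congruence_iff)
  have cong: "tambara_congruence G R m n (eval_cong_e G R m n \<Phi>, eval_cong_G G R m n \<Phi>)"
    by (rule tambara_congruence_eval_cong[OF grp tf])
      (auto simp: \<Phi>_def intro!: term_congruence.algebra_point_quotient C)
  have e: "free_cong_e G R m n = eval_cong_e G R m n \<Phi>"
  proof
    show "free_cong_e G R m n \<subseteq> eval_cong_e G R m n \<Phi>"
      unfolding free_cong_e_def
      by (rule Inter_lower, rule CollectI, rule exI[of _ "(eval_cong_e G R m n \<Phi>, eval_cong_G G R m n \<Phi>)"])
        (simp add: cong)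
    show "eval_cong_e G R m n \<Phi> \<subseteq> free_cong_e G R m n"
    proof clarify
      fix s t assume st: "(s, t) \<in> eval_cong_e G R m n \<Phi>"
      show "(s, t) \<in> free_cong_e G R m n" unfolding free_cong_e_def
      proof clarify
        fix E F assume EF: "tambara_congruence G R m n (E, F)"
        interpret term_congruence G R m n E F by (rule C(1)[OF EF])
        have "(T0, const_map E F, (\<lambda>i. E `` {Var_e i}), (\<lambda>j. F `` {Var_G j})) \<in> \<Phi>"
          using EF by (auto simp: \<Phi>_def)
        from eval_cong_eD[OF st this] have "eval_e T0 (const_map E F) (\<lambda>i. E `` {Var_e i}) (\<lambda>j. F `` {Var_G j}) t =
            eval_e T0 (const_map E F) (\<lambda>i. E `` {Var_e i}) (\<lambda>j. F `` {Var_G j}) s" .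
        moreover have "wf_e s" "wf_e t" using st by (simp_all add: eval_cong_e_def)
        ultimately show "(s, t) \<in> fst (E, F)"
          by (simp add: eval_quotient[OF C(2)[OF EF]] class_eq_iff[symmetric])
      qed
    qed
  qed
  have G: "free_cong_G G R m n = eval_cong_G G R m n \<Phi>"
  proof
    show "free_cong_G G R m n \<subseteq> eval_cong_G G R m n \<Phi>"
      unfolding free_cong_G_def
      by (rule Inter_lower, rule CollectI, rule exI[of _ "(eval_cong_e G R m n \<Phi>, eval_cong_G G R m n \<Phi>)"])
        (simp add: cong)
    show "eval_cong_G G R m n \<Phi> \<subseteq> free_cong_G G R m n"
    proof clarify
      fix s t assume st: "(s, t) \<in> eval_cong_G G R m n \<Phi>"
      show "(s, t) \<in> free_cong_G G R m n" unfolding free_cong_G_def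
      proof clarify
        fix E F assume EF: "tambara_congruence G R m n (E, F)"
        interpret term_congruence G R m n E F by (rule C(1)[OF EF])
        have "(T0, const_map E F, (\<lambda>i. E `` {Var_e i}), (\<lambda>j. F `` {Var_G j})) \<in> \<Phi>"
          using EF by (auto simp: \<Phi>_def)
        from eval_cong_GD[OF st this] have "eval_G T0 (const_map E F) (\<lambda>i. E `` {Var_e i}) (\<lambda>j. F `` {Var_G j}) t =
            eval_G T0 (const_map E F) (\<lambda>i. E `` {Var_e i}) (\<lambda>j. F `` {Var_G j}) s" .
        moreover have "wf_G s" "wf_G t" using st by (simp_all add: eval_cong_G_def)
        ultimately show "(s, t) \<in> snd (E, F)"
          by (simp add: eval_quotient[OF C(2)[OF EF]] class_eq_iff[symmetric])
      qed
    qed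
  qed
  show ?thesis unfolding e G by (rule cong)
qed

interpretation F: term_congruence G R m n "free_cong_e G R m n" "free_cong_G G R m n"
  using free_cong_congruence by (simp add: tambara_congruence_iff)

lemma free_unit_hom: "tambara_hom G R (free_algebra G R m n) (free_unit G R m n)"
  using free_cong_congruence by (simp add: tambara_congruence_iff free_algebra_def free_unit_def)

definition free_var_e where "free_var_e i = free_cong_e G R m n `` {Var_e i}"
definition free_var_G where "free_var_G j = free_cong_G G R m n `` {Var_G j}"

lemma free_var_closed:
  "i < m \<Longrightarrow> free_var_e i \<in> carrier (lev_e (free_algebra G R m n))"
  "j < n \<Longrightarrow> free_var_G j \<in> carrier (lev_G (free_algebra G R m n))"
  by (force simp: free_algebra_def F.carrier_e F.carrier_G free_var_e_def free_var_G_def)+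

text \<open>The kernel of the evaluation at the given point is itself a congruence, so it contains
  the least one and the evaluation is constant on classes.\<close>

proposition free_algebra_extend:
  assumes pt: "algebra_point G R m n T \<tau> \<xi> \<upsilon>"
  obtains \<phi> where "algebra_hom G R (free_algebra G R m n) (free_unit G R m n) T \<tau> \<phi>"
    "\<And>i. i < m \<Longrightarrow> fst \<phi> (free_var_e i) = \<xi> i" "\<And>j. j < n \<Longrightarrow> snd \<phi> (free_var_G j) = \<upsilon> j"
proof -
  let ?\<Phi> = "{(T, \<tau>, \<xi>, \<upsilon>)}"
  let ?fe = "free_cong_e G R m n" and ?fG = "free_cong_G G R m n"
  have cong: "tambara_congruence G R m n (eval_cong_e G R m n ?\<Phi>, eval_cong_G G R m n ?\<Phi>)"
    by (rule tambara_congruence_eval_cong[OF grp tf]) (use pt in auto)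
  have sub: "?fe \<subseteq> eval_cong_e G R m n ?\<Phi>" "?fG \<subseteq> eval_cong_G G R m n ?\<Phi>"
    unfolding free_cong_e_def free_cong_G_def
    by (rule Inter_lower, rule CollectI, rule exI[of _ "(eval_cong_e G R m n ?\<Phi>, eval_cong_G G R m n ?\<Phi>)"],
      simp add: cong)+
  define \<phi> where "\<phi> = (class_eval (eval_e T \<tau> \<xi> \<upsilon>), class_eval (eval_G T \<tau> \<xi> \<upsilon>))"
  have e: "fst \<phi> (?fe `` {t}) = eval_e T \<tau> \<xi> \<upsilon> t" if "F.wf_e t" for t
    unfolding \<phi>_def fst_conv by (rule class_eval_class[OF F.refl(1)[OF that]])
      (rule eval_cong_eD[OF subsetD[OF sub(1)]], auto)
  have G: "snd \<phi> (?fG `` {t}) = eval_G T \<tau> \<xi> \<upsilon> t" if "F.wf_G t" for t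
    unfolding \<phi>_def snd_conv by (rule class_eval_class[OF F.refl(2)[OF that]])
      (rule eval_cong_GD[OF subsetD[OF sub(2)]], auto)
  have \<tau>: "tambara_hom G R T \<tau>" using pt by (simp add: algebra_point_def)
  note h = tambara_homD[OF \<tau>] and c = eval_closed[OF pt]
  note Rc = tambara_ops_closedD[OF tambara_functor.ops_closed[OF tf]]
  have "tambara_hom G (free_algebra G R m n) T \<phi>"
    unfolding tambara_hom_def
  proof (intro conjI ballI)
    show "tambara_functor G (free_algebra G R m n)" using free_unit_hom by (simp add: tambara_hom_def)
    show "fst \<phi> \<in> ring_hom (lev_e (free_algebra G R m n)) (lev_e T)"
      by (rule ring_hom_memI)
        (auto simp: free_algebra_def F.carrier_e F.quotient_ops_e F.quotient_zero_one e c h Rc)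
    show "snd \<phi> \<in> ring_hom (lev_G (free_algebra G R m n)) (lev_G T)"
      by (rule ring_hom_memI)
        (auto simp: free_algebra_def F.carrier_G F.quotient_ops_G F.quotient_zero_one G c h Rc)
  qed (auto simp: free_algebra_def F.carrier_e F.carrier_G F.quotient_ops_e F.quotient_ops_G F.quotient_unary_e F.quotient_res e G h)
  moreover have "maps_agree R (map_comp2 \<phi> (free_unit G R m n)) \<tau>"
    by (auto simp: maps_agree_def map_comp2_def free_unit_def const_map_def e G)
  ultimately show thesis
    using that[of \<phi>] \<tau> free_unit_hom
    by (auto simp: algebra_hom_def free_var_e_def free_var_G_def e G)
qed

text \<open>Induction on terms: variables and constants generate, and both maps preserve the
  operations.\<close>

lemma free_algebra_ext:
  assumes \<phi>: "tambara_hom G (free_algebra G R m n) T \<phi>" and \<psi>: "tambara_hom G (free_algebra G R m n) T \<psi>"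
    and unit: "maps_agree R (map_comp2 \<phi> (free_unit G R m n)) (map_comp2 \<psi> (free_unit G R m n))"
    and var_e: "\<And>i. i < m \<Longrightarrow> fst \<phi> (free_var_e i) = fst \<psi> (free_var_e i)"
    and var_G: "\<And>j. j < n \<Longrightarrow> snd \<phi> (free_var_G j) = snd \<psi> (free_var_G j)"
  shows "maps_agree (free_algebra G R m n) \<phi> \<psi>"
proof -
  let ?fe = "free_cong_e G R m n" and ?fG = "free_cong_G G R m n"
  note h1 = tambara_homD[OF \<phi>, unfolded free_algebra_def] and h2 = tambara_homD[OF \<psi>, unfolded free_algebra_def]
  have ce: "?fe `` {t} \<in> carrier (lev_e F.T0)" if "F.wf_e t" for t using that by (auto simp: F.carrier_e)
  have cG: "?fG `` {u} \<in> carrier (lev_G F.T0)" if "F.wf_G u" for u using that by (auto simp: F.carrier_G)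
  have "F.wf_e t \<Longrightarrow> fst \<phi> (?fe `` {t}) = fst \<psi> (?fe `` {t})"
    and "F.wf_G u \<Longrightarrow> snd \<phi> (?fG `` {u}) = snd \<psi> (?fG `` {u})" for t u
    by (induction t and u)
      (use unit var_e var_G in \<open>simp_all add: free_var_e_def free_var_G_def maps_agree_def map_comp2_def
        free_unit_def const_map_def F.quotient_ops_e[symmetric] F.quotient_ops_G[symmetric]
        F.quotient_unary_e[symmetric] F.quotient_res[symmetric] ce cG h1 h2\<close>)
  then show ?thesis
    by (auto simp: maps_agree_def free_algebra_def F.carrier_e F.carrier_G)
qed

end

section \<open>Finite presentation\<close>

lemma tambara_hom_comp:
  assumes f: "tambara_hom G A B f" and g: "tambara_hom G B C g"
  shows "tambara_hom G A C (map_comp2 g f)"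
proof -
  note hf = tambara_homD[OF f] and hg = tambara_homD[OF g]
  show ?thesis
    unfolding tambara_hom_def map_comp2_def
  proof (intro conjI ballI)
    show "tambara_functor G A" using f by (simp add: tambara_hom_def)
    show "tambara_functor G C" by (rule hg(1))
  qed (use hf hg in \<open>auto intro: ring_hom_trans\<close>)
qed

text \<open>A single \<open>x\<close> is passed along the product and turns each factor
  \<open>w h\<close> into \<open>c h\<close>. In \<open>nm_ke\<close> this evaluates a product of
  translates against the idempotent \<open>x\<close>.\<close>

lemma (in cring) finprod_semiabsorb:
  assumes "finite H" "x \<in> carrier R" "w \<in> H \<rightarrow> carrier R" "c \<in> H \<rightarrow> carrier R"
    and "\<And>h. h \<in> H \<Longrightarrow> x \<otimes> w h = c h \<otimes> x"
  shows "x \<otimes> (\<Otimes>h\<in>H. w h) = (\<Otimes>h\<in>H. c h) \<otimes> x"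
  using assms
proof (induction H rule: finite_induct)
  case (insert h H)
  then have c: "w h \<in> carrier R" "c h \<in> carrier R" "w \<in> H \<rightarrow> carrier R" "c \<in> H \<rightarrow> carrier R"
    and e: "x \<otimes> w h = c h \<otimes> x" by auto
  then have pc: "(\<Otimes>h\<in>H. w h) \<in> carrier R" "(\<Otimes>h\<in>H. c h) \<in> carrier R" by auto
  have IH: "x \<otimes> (\<Otimes>h\<in>H. w h) = (\<Otimes>h\<in>H. c h) \<otimes> x" using insert c by auto
  have "x \<otimes> (\<Otimes>h\<in>insert h H. w h) = x \<otimes> (w h \<otimes> (\<Otimes>h\<in>H. w h))"
    using insert.hyps c by simp
  also have "\<dots> = (c h \<otimes> x) \<otimes> (\<Otimes>h\<in>H. w h)"
    unfolding e[symmetric] by (rule m_assoc[symmetric]) (use c pc insert.prems in auto)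
  also have "\<dots> = c h \<otimes> ((\<Otimes>h\<in>H. c h) \<otimes> x)"
    unfolding IH[symmetric] by (rule m_assoc) (use c pc insert.prems in auto)
  also have "\<dots> = (\<Otimes>h\<in>insert h H. c h) \<otimes> x"
    using insert c pc by (simp add: m_assoc)
  finally show ?case .
qed simp

section \<open>Functions supported at one point\<close>

context prime_order_tambara begin

abbreviation \<Gamma> where "\<Gamma> \<equiv> ghost G R"
abbreviation S where "S \<equiv> coind G A"
abbreviation \<eta> where "\<eta> \<equiv> coind_unit G \<Gamma>"
abbreviation FA where "FA \<equiv> fun_ring (carrier G) A"

sublocale \<Gamma>: tambara_functor G \<Gamma> by (rule tambara_functor_ghost)
sublocale S: tambara_functor G S by (rule tambara_functor_coind[OF A.is_cring])
sublocale FA: cring FA by (rule cring_fun_ring[OF A.is_cring])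

lemma unit_hom: "tambara_hom G \<Gamma> S \<eta>"
  using tambara_hom_coind_unit[OF tambara_functor_ghost] by simp

lemma eta_simps:
  "fst \<eta> r = (\<lambda>x\<in>carrier G. act R x r)" "snd \<eta> (a, b) = a"
  by (simp_all)

definition pt :: "'c \<Rightarrow> 'e \<Rightarrow> 'c \<Rightarrow> 'e" where
  "pt k a = (\<lambda>x\<in>carrier G. if x = k then a else \<zero>\<^bsub>A\<^esub>)"

lemma pt_closed [simp]: "a \<in> carrier A \<Longrightarrow> pt k a \<in> carrier G \<rightarrow>\<^sub>E carrier A"
  by (auto simp: pt_def)

lemma pt_apply: "x \<in> carrier G \<Longrightarrow> pt k a x = (if x = k then a else \<zero>\<^bsub>A\<^esub>)"
  by (simp add: pt_def)

lemma mult_inv_eq_iff: "\<lbrakk>x \<in> carrier G; y \<in> carrier G; z \<in> carrier G\<rbrakk> \<Longrightarrow> x = y \<otimes> inv z \<longleftrightarrow> x \<otimes> z = y"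
  by (auto simp: m_assoc)

lemma act_pt: "\<lbrakk>g \<in> carrier G; k \<in> carrier G\<rbrakk> \<Longrightarrow> act S g (pt k a) = pt (k \<otimes> inv g) a"
  by (auto simp: pt_def mult_inv_eq_iff intro!: restrict_ext)

lemma act_inv: "\<lbrakk>k \<in> carrier G; a \<in> carrier A\<rbrakk> \<Longrightarrow> act R k (act R (inv k) a) = a"
  "\<lbrakk>k \<in> carrier G; a \<in> carrier A\<rbrakk> \<Longrightarrow> act R (inv k) (act R k a) = a"
  by (simp_all add: act_mult[symmetric] act_one)

text \<open>At the point \<open>k\<close> the unit map takes the value \<open>act R k r\<close>; the
  twist by \<open>inv k\<close> makes this value \<open>a\<close>.\<close>

lemma pt_eta: "\<lbrakk>k \<in> carrier G; a \<in> carrier A\<rbrakk> \<Longrightarrow> pt k a = fst \<eta> (act R (inv k) a) \<otimes>\<^bsub>FA\<^esub> pt k \<one>\<^bsub>A\<^esub>"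
  by (auto simp: pt_def act_inv intro!: restrict_ext)

lemma mult_pt: "\<lbrakk>k \<in> carrier G; f \<in> carrier G \<rightarrow>\<^sub>E carrier A\<rbrakk> \<Longrightarrow> f \<otimes>\<^bsub>FA\<^esub> pt k \<one>\<^bsub>A\<^esub> = pt k (f k)"
  using PiE_mem[of f "carrier G" "\<lambda>_. carrier A"] by (auto simp: pt_def intro!: restrict_ext)

lemma sum_pt: "\<lbrakk>k \<in> carrier G; a \<in> carrier A\<rbrakk> \<Longrightarrow> (\<Oplus>\<^bsub>A\<^esub>x\<in>carrier G. pt k a x) = a"
proof -
  assume k: "k \<in> carrier G" and a: "a \<in> carrier A"
  have "(\<Oplus>\<^bsub>A\<^esub>x\<in>carrier G. pt k a x) = (\<Oplus>\<^bsub>A\<^esub>x\<in>carrier G. if k = x then a else \<zero>\<^bsub>A\<^esub>)"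
    by (rule A.finsum_cong') (use a in \<open>auto simp: pt_def\<close>)
  also have "\<dots> = a" by (rule A.finsum_singleton[where f = "\<lambda>_. a"]) (use k a finite_carrier in auto)
  finally show ?thesis .
qed

end

text \<open>The coinduced algebra is the universal algebra of this kind.\<close>

locale idempotent_algebra = prime_order_tambara G R
  for G :: "'c monoid" (structure) and R :: "('c, 'e, 'g) tambara" +
  fixes T :: "('c, 'a, 'b) tambara" and \<tau> :: "('e \<Rightarrow> 'a) \<times> ('e \<times> 'g set \<Rightarrow> 'b)" and x :: 'a
  assumes \<tau>: "tambara_hom G (ghost G R) T \<tau>" and x [simp]: "x \<in> carrier (lev_e T)"
    and orth: "g \<in> carrier G \<Longrightarrow> x \<otimes>\<^bsub>lev_e T\<^esub> act T g x = (if g = \<one> then x else \<zero>\<^bsub>lev_e T\<^esub>)"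
    and tr_x: "tr T x = \<one>\<^bsub>lev_G T\<^esub>"
begin

sublocale TT: prime_order_tambara G T
  using tambara_homD(1)[OF \<tau>] prime_order_group_axioms by (simp add: prime_order_tambara_def)

abbreviation Te where "Te \<equiv> lev_e T"
abbreviation TG where "TG \<equiv> lev_G T"

sublocale \<tau>: ring_hom_cring A Te "fst \<tau>"
  using tambara_homD(2)[OF \<tau>] A.is_cring TT.A.is_cring
  by (simp add: ring_hom_cring_def ring_hom_cring_axioms_def)

lemma tau_act: "\<lbrakk>g \<in> carrier G; a \<in> carrier A\<rbrakk> \<Longrightarrow> fst \<tau> (act R g a) = act T g (fst \<tau> a)"
  using tambara_homD(14)[OF \<tau>, of g a] by simp

text \<open>The counterpart of the indicator of \<open>k\<close>: by \<open>act_pt\<close>, acting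
  by \<open>inv k\<close> moves the support from the unit to \<open>k\<close>.\<close>

definition y where "y k = act T (inv k) x"

lemma y_closed [simp]: "k \<in> carrier G \<Longrightarrow> y k \<in> carrier Te"
  by (simp add: y_def)

lemma y_one: "y \<one> = x" by (simp add: y_def TT.act_one)

lemma act_y: "\<lbrakk>g \<in> carrier G; k \<in> carrier G\<rbrakk> \<Longrightarrow> act T g (y k) = y (k \<otimes> inv g)"
  by (simp add: y_def TT.act_mult[symmetric] inv_mult_group)

text \<open>The relation \<open>orth\<close> for the group element \<open>k \<otimes> inv l\<close>,
  acted on by \<open>inv k\<close>.\<close>

lemma y_orth: "\<lbrakk>k \<in> carrier G; l \<in> carrier G\<rbrakk> \<Longrightarrow> y k \<otimes>\<^bsub>Te\<^esub> y l = (if k = l then y l else \<zero>\<^bsub>Te\<^esub>)"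
proof -
  assume kl: "k \<in> carrier G" "l \<in> carrier G"
  have "y k \<otimes>\<^bsub>Te\<^esub> y l = act T (inv k) (x \<otimes>\<^bsub>Te\<^esub> act T (k \<otimes> inv l) x)"
    using kl by (simp add: y_def TT.act_mult TT.act_inv)
  moreover have "k \<otimes> inv l = \<one> \<longleftrightarrow> k = l"
    using kl mult_inv_eq_iff[of \<one> k l] by (auto simp: eq_commute)
  ultimately show ?thesis using kl by (simp add: orth y_def)
qed

text \<open>Since \<open>tr x\<close> is one, so is its restriction, which the double coset formula
  expresses as the sum of all translates of \<open>x\<close>.\<close>

lemma sum_y: "(\<Oplus>\<^bsub>Te\<^esub>k\<in>carrier G. y k) = \<one>\<^bsub>Te\<^esub>"
proof -
  have b: "bij_betw (\<lambda>k. inv k) (carrier G) (carrier G)"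
    by (rule bij_betwI[where g = "\<lambda>k. inv k"]) auto
  have "(\<Oplus>\<^bsub>Te\<^esub>k\<in>carrier G. y k) = (\<Oplus>\<^bsub>Te\<^esub>g\<in>carrier G. act T g x)"
    unfolding y_def by (rule TT.A.add.finprod_bij[OF b]) auto
  also have "\<dots> = res T (tr T x)" by (simp add: TT.res_tr)
  finally show ?thesis by (simp add: tr_x)
qed

text \<open>By \<open>sum_y\<close>, each element is the sum of its products with the idempotents
  \<open>y l\<close>.\<close>

lemma y_ext:
  assumes "z \<in> carrier Te" "w \<in> carrier Te" "\<And>l. l \<in> carrier G \<Longrightarrow> z \<otimes>\<^bsub>Te\<^esub> y l = w \<otimes>\<^bsub>Te\<^esub> y l"
  shows "z = w"
proof -
  have e: "u = (\<Oplus>\<^bsub>Te\<^esub>l\<in>carrier G. u \<otimes>\<^bsub>Te\<^esub> y l)" if "u \<in> carrier Te" for u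
  proof -
    have "u = u \<otimes>\<^bsub>Te\<^esub> (\<Oplus>\<^bsub>Te\<^esub>k\<in>carrier G. y k)" using that by (simp add: sum_y)
    also have "\<dots> = (\<Oplus>\<^bsub>Te\<^esub>l\<in>carrier G. u \<otimes>\<^bsub>Te\<^esub> y l)"
      by (rule TT.A.finsum_rdistr) (use that finite_carrier in auto)
    finally show ?thesis .
  qed
  have "z = (\<Oplus>\<^bsub>Te\<^esub>l\<in>carrier G. z \<otimes>\<^bsub>Te\<^esub> y l)" by (rule e[OF assms(1)])
  also have "\<dots> = (\<Oplus>\<^bsub>Te\<^esub>l\<in>carrier G. w \<otimes>\<^bsub>Te\<^esub> y l)"
    by (rule TT.A.finsum_cong') (use assms in auto)
  also have "\<dots> = w" by (rule e[OF assms(2), symmetric])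
  finally show ?thesis .
qed

text \<open>Forced by writing \<open>f\<close> as the sum of the
  \<open>fst \<eta> (act R (inv k) (f k))\<close> times indicators of \<open>k\<close>, see
  \<open>pt_eta\<close>: scalars go to their images under \<open>\<tau>\<close> and indicators to
  \<open>y k\<close>.\<close>

definition ke where
  "ke f = (\<Oplus>\<^bsub>Te\<^esub>k\<in>carrier G. fst \<tau> (act R (inv k) (f k)) \<otimes>\<^bsub>Te\<^esub> y k)"

text \<open>Forced as well: in \<open>S\<close> the element \<open>a\<close> is the transfer of the
  function with value \<open>a\<close> at the unit and zero elsewhere.\<close>

definition kG where "kG a = tr T (fst \<tau> a \<otimes>\<^bsub>Te\<^esub> x)"

lemma ke_closed [simp]: "f \<in> carrier G \<rightarrow>\<^sub>E carrier A \<Longrightarrow> ke f \<in> carrier Te"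
  unfolding ke_def using PiE_mem[of f "carrier G" "\<lambda>_. carrier A"] by (intro TT.A.finsum_closed) auto

lemma kG_closed [simp]: "a \<in> carrier A \<Longrightarrow> kG a \<in> carrier TG"
  unfolding kG_def by (rule TT.tr_closed) auto

lemma ke_y:
  assumes f: "f \<in> carrier G \<rightarrow>\<^sub>E carrier A" and l: "l \<in> carrier G"
  shows "ke f \<otimes>\<^bsub>Te\<^esub> y l = fst \<tau> (act R (inv l) (f l)) \<otimes>\<^bsub>Te\<^esub> y l"
proof -
  let ?c = "\<lambda>k. fst \<tau> (act R (inv k) (f k))"
  have c: "?c k \<in> carrier Te" if "k \<in> carrier G" for k using PiE_mem[OF f that] that by simp
  have "ke f \<otimes>\<^bsub>Te\<^esub> y l = (\<Oplus>\<^bsub>Te\<^esub>k\<in>carrier G. ?c k \<otimes>\<^bsub>Te\<^esub> y k \<otimes>\<^bsub>Te\<^esub> y l)"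
    unfolding ke_def by (rule TT.A.finsum_ldistr) (use c l finite_carrier in auto)
  also have "\<dots> = (\<Oplus>\<^bsub>Te\<^esub>k\<in>carrier G. if l = k then ?c k \<otimes>\<^bsub>Te\<^esub> y k else \<zero>\<^bsub>Te\<^esub>)"
    by (rule TT.A.finsum_cong') (use c l in \<open>auto simp: TT.A.m_assoc y_orth\<close>)
  also have "\<dots> = ?c l \<otimes>\<^bsub>Te\<^esub> y l"
    by (rule TT.A.finsum_singleton) (use c l finite_carrier in auto)
  finally show ?thesis .
qed

lemma x_ke: "f \<in> carrier G \<rightarrow>\<^sub>E carrier A \<Longrightarrow> x \<otimes>\<^bsub>Te\<^esub> ke f = fst \<tau> (f \<one>) \<otimes>\<^bsub>Te\<^esub> x"
  using ke_y[of f \<one>] PiE_mem[of f "carrier G" "\<lambda>_. carrier A" \<one>]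
  by (simp add: y_one act_one TT.A.m_comm[of x])

text \<open>Acting by \<open>g\<close> carries \<open>y (l \<otimes> g)\<close> to
  \<open>y l\<close>, which reduces the claim to \<open>ke_y\<close> at
  \<open>l \<otimes> g\<close>.\<close>

lemma act_ke_y:
  assumes f: "f \<in> carrier G \<rightarrow>\<^sub>E carrier A" and gl: "g \<in> carrier G" "l \<in> carrier G"
  shows "act T g (ke f) \<otimes>\<^bsub>Te\<^esub> y l = fst \<tau> (act R (inv l) (f (l \<otimes> g))) \<otimes>\<^bsub>Te\<^esub> y l"
proof -
  have "y l = act T g (y (l \<otimes> g))" using gl by (simp add: act_y m_assoc)
  then have "act T g (ke f) \<otimes>\<^bsub>Te\<^esub> y l = act T g (ke f \<otimes>\<^bsub>Te\<^esub> y (l \<otimes> g))" using gl f by simp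
  also have "\<dots> = act T g (fst \<tau> (act R (inv (l \<otimes> g)) (f (l \<otimes> g))) \<otimes>\<^bsub>Te\<^esub> y (l \<otimes> g))"
    using f gl by (simp add: ke_y)
  also have "\<dots> = fst \<tau> (act R g (act R (inv (l \<otimes> g)) (f (l \<otimes> g)))) \<otimes>\<^bsub>Te\<^esub> act T g (y (l \<otimes> g))"
  proof -
    have "f (l \<otimes> g) \<in> carrier A" using PiE_mem[OF f, of "l \<otimes> g"] gl by simp
    then show ?thesis using gl by (simp add: tau_act)
  qed
  also have "act R g (act R (inv (l \<otimes> g)) (f (l \<otimes> g))) = act R (inv l) (f (l \<otimes> g))"
  proof -
    have "f (l \<otimes> g) \<in> carrier A" using PiE_mem[OF f, of "l \<otimes> g"] gl by simp
    then show ?thesis using gl by (simp add: inv_mult_group act_mult act_inv)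
  qed
  also have "act T g (y (l \<otimes> g)) = y l" using gl by (simp add: act_y m_assoc)
  finally show ?thesis .
qed

text \<open>The double coset formula, with the sum over \<open>G\<close> reindexed by inversion to
  match the twists in \<open>ke\<close>.\<close>

lemma res_kG: "a \<in> carrier A \<Longrightarrow> res T (kG a) = ke (\<lambda>x\<in>carrier G. a)"
proof -
  assume a: "a \<in> carrier A"
  have b: "bij_betw (\<lambda>k. inv k) (carrier G) (carrier G)"
    by (rule bij_betwI[where g = "\<lambda>k. inv k"]) auto
  have "res T (kG a) = (\<Oplus>\<^bsub>Te\<^esub>g\<in>carrier G. act T g (fst \<tau> a \<otimes>\<^bsub>Te\<^esub> x))"
    using a by (simp add: kG_def TT.res_tr)
  also have "\<dots> = (\<Oplus>\<^bsub>Te\<^esub>k\<in>carrier G. act T (inv k) (fst \<tau> a \<otimes>\<^bsub>Te\<^esub> x))"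
    by (rule TT.A.add.finprod_bij[OF b, symmetric]) (use a in auto)
  also have "\<dots> = ke (\<lambda>x\<in>carrier G. a)"
    unfolding ke_def by (rule TT.A.finsum_cong') (use a in \<open>auto simp: tau_act y_def\<close>)
  finally show ?thesis .
qed

text \<open>Frobenius reciprocity moves the second factor inside as \<open>res T (kG b)\<close>, the
  image under \<open>ke\<close> of a constant function, and \<open>x\<close> sees only its value at
  the unit, which is \<open>b\<close>.\<close>

lemma kG_mult: "\<lbrakk>a \<in> carrier A; b \<in> carrier A\<rbrakk> \<Longrightarrow> kG (a \<otimes>\<^bsub>A\<^esub> b) = kG a \<otimes>\<^bsub>TG\<^esub> kG b"
proof -
  assume ab: "a \<in> carrier A" "b \<in> carrier A"
  have "kG a \<otimes>\<^bsub>TG\<^esub> kG b = tr T (fst \<tau> a \<otimes>\<^bsub>Te\<^esub> x \<otimes>\<^bsub>Te\<^esub> res T (kG b))"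
    unfolding kG_def[of a] by (rule TT.frobenius[symmetric]) (use ab in auto)
  also have "fst \<tau> a \<otimes>\<^bsub>Te\<^esub> x \<otimes>\<^bsub>Te\<^esub> res T (kG b) = fst \<tau> a \<otimes>\<^bsub>Te\<^esub> (fst \<tau> b \<otimes>\<^bsub>Te\<^esub> x)"
    using ab by (simp add: res_kG TT.A.m_assoc x_ke)
  finally show ?thesis using ab by (simp add: kG_def TT.A.m_assoc)
qed

lemma kG_add: "\<lbrakk>a \<in> carrier A; b \<in> carrier A\<rbrakk> \<Longrightarrow> kG (a \<oplus>\<^bsub>A\<^esub> b) = kG a \<oplus>\<^bsub>TG\<^esub> kG b"
  by (simp add: kG_def TT.A.l_distr TT.tr_add)

lemma kG_zero: "kG \<zero>\<^bsub>A\<^esub> = \<zero>\<^bsub>TG\<^esub>"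
  by (simp add: kG_def TT.tr_zero)

lemma kG_finsum:
  assumes "f \<in> X \<rightarrow> carrier A"
  shows "kG (\<Oplus>\<^bsub>A\<^esub>i\<in>X. f i) = (\<Oplus>\<^bsub>TG\<^esub>i\<in>X. kG (f i))"
  using assms
  by (induction X rule: infinite_finite_induct) (auto simp: kG_zero kG_add Pi_def A.finsum_closed)

text \<open>The \<open>k\<close>-th summand of \<open>ke f\<close> is a translate of
  \<open>fst \<tau> (f k)\<close> times \<open>x\<close>, and translates have equal
  transfers.\<close>

lemma tr_ke:
  assumes f: "f \<in> carrier G \<rightarrow>\<^sub>E carrier A"
  shows "tr T (ke f) = kG (\<Oplus>\<^bsub>A\<^esub>k\<in>carrier G. f k)"
proof -
  have fc: "f k \<in> carrier A" if "k \<in> carrier G" for k by (rule PiE_mem[OF f that])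
  have "tr T (ke f) = (\<Oplus>\<^bsub>TG\<^esub>k\<in>carrier G. tr T (fst \<tau> (act R (inv k) (f k)) \<otimes>\<^bsub>Te\<^esub> y k))"
    unfolding ke_def by (rule TT.tr_finsum) (use fc in auto)
  also have "\<dots> = (\<Oplus>\<^bsub>TG\<^esub>k\<in>carrier G. kG (f k))"
  proof (rule TT.LG.finsum_cong')
    fix k assume k: "k \<in> carrier G"
    have "fst \<tau> (act R (inv k) (f k)) \<otimes>\<^bsub>Te\<^esub> y k = act T (inv k) (fst \<tau> (f k) \<otimes>\<^bsub>Te\<^esub> x)"
      using k fc by (simp add: tau_act y_def)
    then show "tr T (fst \<tau> (act R (inv k) (f k)) \<otimes>\<^bsub>Te\<^esub> y k) = kG (f k)"
      using k fc TT.tr_act[of "inv k" "fst \<tau> (f k) \<otimes>\<^bsub>Te\<^esub> x"] by (simp only: kG_def inv_closed \<tau>.hom_closed x TT.A.m_closed)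
  qed (use fc in auto)
  also have "\<dots> = kG (\<Oplus>\<^bsub>A\<^esub>k\<in>carrier G. f k)"
    by (rule kG_finsum[symmetric]) (use fc in auto)
  finally show ?thesis .
qed

text \<open>The norm of a sum is never expanded: multiplying by \<open>tr x = 1\<close> and
  Frobenius reciprocity lead to the restriction of the norm, a product of translates of
  \<open>ke f\<close> whose factors \<open>x\<close> turns into the scalars
  \<open>fst \<tau> (f h)\<close>.\<close>

lemma nm_ke:
  assumes f: "f \<in> carrier G \<rightarrow>\<^sub>E carrier A"
  shows "nm T (ke f) = kG (\<Otimes>\<^bsub>A\<^esub>k\<in>carrier G. f k)"
proof -
  have fc: "f k \<in> carrier A" if "k \<in> carrier G" for k by (rule PiE_mem[OF f that])
  have n: "nm T (ke f) \<in> carrier TG" using f by (intro TT.nm_closed) simp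
  have "nm T (ke f) = tr T x \<otimes>\<^bsub>TG\<^esub> nm T (ke f)" using n by (simp add: tr_x)
  also have "\<dots> = tr T (x \<otimes>\<^bsub>Te\<^esub> res T (nm T (ke f)))" using n by (simp add: TT.frobenius)
  also have "res T (nm T (ke f)) = (\<Otimes>\<^bsub>Te\<^esub>h\<in>carrier G. act T h (ke f))"
    using f by (simp add: TT.res_nm)
  also have "x \<otimes>\<^bsub>Te\<^esub> \<dots> = (\<Otimes>\<^bsub>Te\<^esub>h\<in>carrier G. fst \<tau> (f h)) \<otimes>\<^bsub>Te\<^esub> x"
  proof (rule TT.A.finprod_semiabsorb)
    fix h assume h: "h \<in> carrier G"
    show "x \<otimes>\<^bsub>Te\<^esub> act T h (ke f) = fst \<tau> (f h) \<otimes>\<^bsub>Te\<^esub> x"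
      using act_ke_y[OF f h one_closed] h f fc[OF h] by (simp add: y_one act_one TT.A.m_comm[of x])
  qed (use f fc finite_carrier in auto)
  also have "(\<Otimes>\<^bsub>Te\<^esub>h\<in>carrier G. fst \<tau> (f h)) = fst \<tau> (\<Otimes>\<^bsub>A\<^esub>h\<in>carrier G. f h)"
    using fc by (subst \<tau>.hom_finprod) (auto simp: o_def)
  finally show ?thesis by (simp add: kG_def)
qed

lemma ke_ext:
  assumes "f \<in> carrier G \<rightarrow>\<^sub>E carrier A" "z \<in> carrier Te"
    and "\<And>l. l \<in> carrier G \<Longrightarrow> z \<otimes>\<^bsub>Te\<^esub> y l = fst \<tau> (act R (inv l) (f l)) \<otimes>\<^bsub>Te\<^esub> y l"
  shows "ke f = z"
  by (rule y_ext) (use assms ke_y in auto)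

lemma ke_one: "ke (\<lambda>k\<in>carrier G. \<one>\<^bsub>A\<^esub>) = \<one>\<^bsub>Te\<^esub>"
  by (rule ke_ext) auto

lemma kG_one: "kG \<one>\<^bsub>A\<^esub> = \<one>\<^bsub>TG\<^esub>"
  by (simp add: kG_def tr_x)

text \<open>By \<open>ke_ext\<close> both equations are tested against each \<open>y l\<close>,
  where \<open>ke f\<close> acts as a scalar.\<close>

lemma ke_ring_hom: "ke \<in> ring_hom FA Te"
proof (rule ring_hom_memI)
  fix f h assume "f \<in> carrier FA" "h \<in> carrier FA"
  then have f: "f \<in> carrier G \<rightarrow>\<^sub>E carrier A" and h: "h \<in> carrier G \<rightarrow>\<^sub>E carrier A" by auto
  have fc: "f l \<in> carrier A" "h l \<in> carrier A" if "l \<in> carrier G" for l by (rule PiE_mem[OF f that], rule PiE_mem[OF h that])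
  show "ke (f \<otimes>\<^bsub>FA\<^esub> h) = ke f \<otimes>\<^bsub>Te\<^esub> ke h"
  proof (rule ke_ext)
    fix l assume l: "l \<in> carrier G"
    let ?a = "fst \<tau> (act R (inv l) (f l))" and ?b = "fst \<tau> (act R (inv l) (h l))"
    have c: "?a \<in> carrier Te" "?b \<in> carrier Te" using fc l by auto
    have "ke f \<otimes>\<^bsub>Te\<^esub> ke h \<otimes>\<^bsub>Te\<^esub> y l = ke f \<otimes>\<^bsub>Te\<^esub> (?b \<otimes>\<^bsub>Te\<^esub> y l)"
      using f h l by (simp add: TT.A.m_assoc ke_y)
    also have "\<dots> = ?b \<otimes>\<^bsub>Te\<^esub> (ke f \<otimes>\<^bsub>Te\<^esub> y l)" using f c l by (simp add: TT.A.m_lcomm)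
    also have "\<dots> = ?a \<otimes>\<^bsub>Te\<^esub> ?b \<otimes>\<^bsub>Te\<^esub> y l"
      using f c l by (simp add: ke_y TT.A.m_assoc TT.A.m_lcomm)
    finally show "ke f \<otimes>\<^bsub>Te\<^esub> ke h \<otimes>\<^bsub>Te\<^esub> y l =
        fst \<tau> (act R (inv l) ((f \<otimes>\<^bsub>FA\<^esub> h) l)) \<otimes>\<^bsub>Te\<^esub> y l"
      using l fc by simp
  qed (use f h fc in auto)
  show "ke (f \<oplus>\<^bsub>FA\<^esub> h) = ke f \<oplus>\<^bsub>Te\<^esub> ke h"
    by (rule ke_ext) (use f h fc in \<open>auto simp: TT.A.l_distr ke_y\<close>)
qed (auto simp: ke_one)

lemma coind_extend_hom: "tambara_hom G S T (ke, kG)"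
  unfolding tambara_hom_def fst_conv snd_conv
proof (intro conjI ballI)
  show "ke \<in> ring_hom (lev_e S) Te" using ke_ring_hom by simp
  show "kG \<in> ring_hom (lev_G S) TG" by (rule ring_hom_memI) (auto simp: kG_mult kG_add kG_one)
  fix g f assume g: "g \<in> carrier G" and "f \<in> carrier (lev_e S)"
  then have f: "f \<in> carrier G \<rightarrow>\<^sub>E carrier A" by simp
  show "ke (act S g f) = act T g (ke f)"
    by (rule ke_ext) (use f g in \<open>auto simp: act_ke_y\<close>)
qed (auto simp: res_kG tr_ke nm_ke S.tambara_functor_axioms TT.tambara_functor_axioms)

text \<open>At level \<open>G/G\<close>, \<open>tr x\<close> times \<open>snd \<tau> y\<close> is by
  Frobenius reciprocity the transfer of \<open>x\<close> times a restriction. So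
  \<open>tr x = 1\<close> forces \<open>\<tau>\<close> to forget the second component of the
  ghost.\<close>

lemma coind_extend_unit: "maps_agree \<Gamma> (map_comp2 (ke, kG) \<eta>) \<tau>"
proof -
  have "ke (fst \<eta> r) = fst \<tau> r" if "r \<in> carrier A" for r
    by (rule ke_ext) (use that in \<open>auto simp: act_inv\<close>)
  moreover have "kG (res \<Gamma> y) = snd \<tau> y" if "y \<in> carrier (lev_G \<Gamma>)" for y
  proof -
    have c: "snd \<tau> y \<in> carrier TG" by (rule tambara_homD(9)[OF \<tau> that])
    have "kG (res \<Gamma> y) = tr T (x \<otimes>\<^bsub>Te\<^esub> res T (snd \<tau> y))"
      using c unfolding kG_def tambara_homD(15)[OF \<tau> that] by (simp add: TT.A.m_comm)
    also have "\<dots> = snd \<tau> y" using c by (subst TT.frobenius) (auto simp: tr_x)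
    finally show ?thesis .
  qed
  ultimately show ?thesis by (simp add: maps_agree_def map_comp2_def)
qed

lemma coind_extend_pt: "ke (pt \<one> \<one>\<^bsub>A\<^esub>) = x"
  by (rule ke_ext) (auto simp: pt_def y_orth[of \<one>, unfolded y_one])

text \<open>The image of the indicator of the unit determines those of all indicators by
  translation, then those of all \<open>pt l a\<close> by \<open>pt_eta\<close>, then level
  \<open>G/e\<close> through products with indicators; at level \<open>G/G\<close> every
  \<open>a\<close> is the transfer of \<open>pt \<one> a\<close>.\<close>

lemma coind_extend_unique:
  assumes k': "tambara_hom G S T k'" and unit: "maps_agree \<Gamma> (map_comp2 k' \<eta>) \<tau>"
    and pt: "fst k' (pt \<one> \<one>\<^bsub>A\<^esub>) = x"
  shows "maps_agree S k' (ke, kG)"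
proof -
  note h = tambara_homD[OF k', unfolded coind_simps(1,2)]
  have u: "fst k' (fst \<eta> r) = fst \<tau> r" if "r \<in> carrier A" for r
    using unit that by (simp add: maps_agree_def map_comp2_def)
  have yl: "fst k' (pt l \<one>\<^bsub>A\<^esub>) = y l" if l: "l \<in> carrier G" for l
  proof -
    have "pt l \<one>\<^bsub>A\<^esub> = act S (inv l) (pt \<one> \<one>\<^bsub>A\<^esub>)" using l by (simp only: act_pt inv_closed one_closed inv_inv l_one)
    then show ?thesis using h(14)[of "inv l" "pt \<one> \<one>\<^bsub>A\<^esub>"] l by (simp only: y_def pt fun_ring_simps pt_closed A.one_closed inv_closed)
  qed
  have kpt: "fst k' (pt l a) = fst \<tau> (act R (inv l) a) \<otimes>\<^bsub>Te\<^esub> y l" if l: "l \<in> carrier G" "a \<in> carrier A" for l a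
  proof -
    have "fst \<eta> (act R (inv l) a) \<in> carrier FA" using l by auto
    then have "fst k' (fst \<eta> (act R (inv l) a) \<otimes>\<^bsub>FA\<^esub> pt l \<one>\<^bsub>A\<^esub>) =
      fst k' (fst \<eta> (act R (inv l) a)) \<otimes>\<^bsub>Te\<^esub> fst k' (pt l \<one>\<^bsub>A\<^esub>)"
      by (intro h(11)) auto
    then show ?thesis using l by (simp only: pt_eta[symmetric] u yl act_hom_simps inv_closed)
  qed
  have "fst k' f = ke f" if f: "f \<in> carrier G \<rightarrow>\<^sub>E carrier A" for f
  proof (rule ke_ext[OF f, symmetric])
    show "fst k' f \<in> carrier Te" using h(8)[of f] f by simp
    fix l assume l: "l \<in> carrier G"
    have "fst k' f \<otimes>\<^bsub>Te\<^esub> fst k' (pt l \<one>\<^bsub>A\<^esub>) = fst k' (f \<otimes>\<^bsub>FA\<^esub> pt l \<one>\<^bsub>A\<^esub>)"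
      by (rule h(11)[symmetric]) (use f in auto)
    also have "\<dots> = fst k' (pt l (f l))" by (simp only: mult_pt[OF l f])
    finally show "fst k' f \<otimes>\<^bsub>Te\<^esub> y l = fst \<tau> (act R (inv l) (f l)) \<otimes>\<^bsub>Te\<^esub> y l"
      using f l by (simp add: yl kpt PiE_mem[OF f])
  qed
  moreover have "snd k' a = kG a" if a: "a \<in> carrier A" for a
  proof -
    have "snd k' (tr S (pt \<one> a)) = tr T (fst k' (pt \<one> a))" by (rule h(16)) (use a in auto)
    then show ?thesis using a by (simp add: sum_pt kpt kG_def y_one act_one)
  qed
  ultimately show ?thesis by (simp add: maps_agree_def)
qed

end

text \<open>Both maps are algebra maps, so only the variables are left to compare. This turns the
  coequalizer conditions into equations between elements.\<close>

lemma free_algebra_agree_iff: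
  assumes grp: "group G" and tf: "tambara_functor G R"
    and f: "algebra_hom G R (free_algebra G R m n) (free_unit G R m n) B \<beta> f"
    and g: "algebra_hom G R (free_algebra G R m n) (free_unit G R m n) B \<beta> g"
    and h: "tambara_hom G B T h"
  shows "maps_agree (free_algebra G R m n) (map_comp2 h f) (map_comp2 h g) \<longleftrightarrow>
    (\<forall>i<m. fst h (fst f (free_var_e G R m n i)) = fst h (fst g (free_var_e G R m n i))) \<and>
    (\<forall>j<n. snd h (snd f (free_var_G G R m n j)) = snd h (snd g (free_var_G G R m n j)))" (is "?L \<longleftrightarrow> ?R")
proof
  assume ?L
  then show ?R
    using free_var_closed[OF grp tf] by (simp add: maps_agree_def map_comp2_def)
next
  assume R: ?R
  have fh: "tambara_hom G (free_algebra G R m n) B f" "maps_agree R (map_comp2 f (free_unit G R m n)) \<beta>"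
    and gh: "tambara_hom G (free_algebra G R m n) B g" "maps_agree R (map_comp2 g (free_unit G R m n)) \<beta>"
    using f g by (auto simp: algebra_hom_def)
  show ?L
  proof (rule free_algebra_ext[OF grp tf])
    show "tambara_hom G (free_algebra G R m n) T (map_comp2 h f)"
      "tambara_hom G (free_algebra G R m n) T (map_comp2 h g)"
      by (rule tambara_hom_comp[OF fh(1) h], rule tambara_hom_comp[OF gh(1) h])
    show "maps_agree R (map_comp2 (map_comp2 h f) (free_unit G R m n)) (map_comp2 (map_comp2 h g) (free_unit G R m n))"
      using fh(2) gh(2) by (simp add: maps_agree_def map_comp2_def)
  qed (use R in \<open>auto simp: map_comp2_def\<close>)
qed

context prime_order_tambara begin

lemma coind_orth:
  assumes g: "g \<in> carrier G"
  shows "pt \<one> \<one>\<^bsub>A\<^esub> \<otimes>\<^bsub>FA\<^esub> act S g (pt \<one> \<one>\<^bsub>A\<^esub>) = (if g = \<one> then pt \<one> \<one>\<^bsub>A\<^esub> else \<zero>\<^bsub>FA\<^esub>)"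
proof -
  have "act S g (pt \<one> \<one>\<^bsub>A\<^esub>) = pt (inv g) \<one>\<^bsub>A\<^esub>"
    using g by (simp only: act_pt one_closed inv_closed l_one)
  moreover have "\<one> = inv g \<longleftrightarrow> g = \<one>" using g by (metis inv_inv inv_one)
  ultimately show ?thesis using g by (auto simp: pt_def intro!: restrict_ext simp del: coind_simps)
qed

text \<open>One generator \<open>X\<close> of level \<open>G/e\<close>; one relation of level
  \<open>G/e\<close> for each element of \<open>G\<close>, enumerated by \<open>e\<close>, and one
  of level \<open>G/G\<close>. The source of the pair has a generator for each relation, sent to its
  left side by \<open>f\<close> and to its right side by \<open>g\<close>.\<close>

proposition finitely_presented_coind:
  "finitely_presented TYPE('u) G \<Gamma> S \<eta>"
proof -
  obtain e where e: "bij_betw e {0..<card (carrier G)} (carrier G)"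
    using ex_bij_betw_nat_finite[OF finite_carrier] by blast
  define p where "p = card (carrier G)"
  \<comment> \<open>One is both the number of generators of level \<open>G/e\<close> and the number
    of relations of level \<open>G/G\<close>.\<close>
  define N :: nat where "N = 1"
  have N: "i < N \<longleftrightarrow> i = 0" for i by (auto simp: N_def)
  have e_in: "e i \<in> carrier G" if "i < p" for i using bij_betwE[OF e] that by (simp add: p_def)
  have e_ex: "\<exists>i<p. e i = g" if "g \<in> carrier G" for g
  proof -
    have "g \<in> e ` {0..<p}" using e that by (simp add: bij_betw_def p_def)
    then show ?thesis by auto
  qed
  note grp = group_axioms and tf = \<Gamma>.tambara_functor_axioms
  let ?F = "free_algebra G \<Gamma> N 0" and ?u = "free_unit G \<Gamma> N 0"
  let ?P = "free_algebra G \<Gamma> p N" and ?v = "free_unit G \<Gamma> p N"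
  define X where "X = free_var_e G \<Gamma> N 0 0"
  have uh: "tambara_hom G \<Gamma> ?F ?u" and vh: "tambara_hom G \<Gamma> ?P ?v"
    using free_unit_hom[OF grp tf] by auto
  interpret F: prime_order_tambara G ?F
    using tambara_homD(1)[OF uh] prime_order_group_axioms by (simp add: prime_order_tambara_def)
  have X: "X \<in> carrier (lev_e ?F)"
    unfolding X_def by (rule free_var_closed(1)[OF grp tf]) (simp add: N)
  obtain f where f: "algebra_hom G \<Gamma> ?P ?v ?F ?u f"
      and f_e: "\<And>i. i < p \<Longrightarrow> fst f (free_var_e G \<Gamma> p N i) = X \<otimes>\<^bsub>lev_e ?F\<^esub> act ?F (e i) X"
      and f_G: "snd f (free_var_G G \<Gamma> p N 0) = tr ?F X"
  proof (rule free_algebra_extend[OF grp tf])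
    show "algebra_point G \<Gamma> p N ?F ?u (\<lambda>i. X \<otimes>\<^bsub>lev_e ?F\<^esub> act ?F (e i) X) (\<lambda>_. tr ?F X)"
      using uh X e_in F.tr_closed by (auto simp: algebra_point_def)
  qed (auto simp: N)
  obtain g where g: "algebra_hom G \<Gamma> ?P ?v ?F ?u g"
      and g_e: "\<And>i. i < p \<Longrightarrow> fst g (free_var_e G \<Gamma> p N i) = (if e i = \<one> then X else \<zero>\<^bsub>lev_e ?F\<^esub>)"
      and g_G: "snd g (free_var_G G \<Gamma> p N 0) = \<one>\<^bsub>lev_G ?F\<^esub>"
  proof (rule free_algebra_extend[OF grp tf])
    show "algebra_point G \<Gamma> p N ?F ?u (\<lambda>i. if e i = \<one> then X else \<zero>\<^bsub>lev_e ?F\<^esub>) (\<lambda>_. \<one>\<^bsub>lev_G ?F\<^esub>)"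
      using uh X by (auto simp: algebra_point_def)
  qed (auto simp: N)
  obtain q where q: "algebra_hom G \<Gamma> ?F ?u S \<eta> q" and q_e: "fst q X = pt \<one> \<one>\<^bsub>A\<^esub>"
  proof (rule free_algebra_extend[OF grp tf])
    \<comment> \<open>\<open>undefined\<close> because there are no generators of level
      \<open>G/G\<close>.\<close>
    show "algebra_point G \<Gamma> N 0 S \<eta> (\<lambda>i. pt \<one> \<one>\<^bsub>A\<^esub>) undefined"
      using unit_hom by (auto simp: algebra_point_def)
  qed (auto simp: X_def N)
  have qh: "tambara_hom G ?F S q" using q by (auto simp: algebra_hom_def)
  note agree_iff = free_algebra_agree_iff[OF grp tf f g]
  have "is_coequalizer TYPE('u) G \<Gamma> ?P ?v ?F ?u S \<eta> f g q"
    unfolding is_coequalizer_def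
  proof (intro conjI allI impI f g q)
    show "maps_agree ?P (map_comp2 q f) (map_comp2 q g)"
      unfolding agree_iff[OF qh]
    proof (intro conjI allI impI)
      note h = tambara_homD[OF qh]
      fix i assume i: "i < p"
      have "fst q (fst f (free_var_e G \<Gamma> p N i)) = pt \<one> \<one>\<^bsub>A\<^esub> \<otimes>\<^bsub>FA\<^esub> act S (e i) (pt \<one> \<one>\<^bsub>A\<^esub>)"
        using X e_in[OF i] F.act_closed[OF e_in[OF i] X] by (simp only: f_e[OF i] h(11,14) q_e coind_simps(1))
      then show "fst q (fst f (free_var_e G \<Gamma> p N i)) = fst q (fst g (free_var_e G \<Gamma> p N i))"
        unfolding coind_orth[OF e_in[OF i]] by (simp add: g_e[OF i] h(4) q_e)
    next
      note h = tambara_homD[OF qh]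
      fix j assume "j < N"
      then have "j = 0" by (simp add: N)
      then show "snd q (snd f (free_var_G G \<Gamma> p N j)) = snd q (snd g (free_var_G G \<Gamma> p N j))"
        using X sum_pt[of \<one> "\<one>\<^bsub>A\<^esub>"] by (simp add: f_G g_G h q_e)
    qed
    fix T :: "('c, 'u, 'u) tambara" and \<tau> h
    assume h: "algebra_hom G \<Gamma> ?F ?u T \<tau> h \<and> maps_agree ?P (map_comp2 h f) (map_comp2 h g)"
    then have hh: "tambara_hom G \<Gamma> T \<tau>" "tambara_hom G ?F T h" "maps_agree \<Gamma> (map_comp2 h ?u) \<tau>"
      by (auto simp: algebra_hom_def)
    note th = tambara_homD[OF hh(2)]
    have rel: "i < p \<Longrightarrow> fst h (fst f (free_var_e G \<Gamma> p N i)) = fst h (fst g (free_var_e G \<Gamma> p N i))"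
      "snd h (snd f (free_var_G G \<Gamma> p N 0)) = snd h (snd g (free_var_G G \<Gamma> p N 0))" for i
      using h agree_iff[OF hh(2)] N by auto
    \<comment> \<open>A map \<open>h\<close> that coequalizes \<open>f\<close> and \<open>g\<close>
      amounts to an element satisfying the relations; the factorization and its uniqueness are those
      of the locale.\<close>
    interpret T: idempotent_algebra G R T \<tau> "fst h X"
    proof (rule idempotent_algebra.intro[OF prime_order_tambara_axioms], unfold_locales)
      show "fst h X \<in> carrier (lev_e T)" by (rule th(8)[OF X])
      show "tr T (fst h X) = \<one>\<^bsub>lev_G T\<^esub>"
        using rel(2) X by (simp add: f_G g_G th)
      fix a assume a: "a \<in> carrier G"
      then obtain i where i: "i < p" "e i = a" using e_ex by blast
      show "fst h X \<otimes>\<^bsub>lev_e T\<^esub> act T a (fst h X) = (if a = \<one> then fst h X else \<zero>\<^bsub>lev_e T\<^esub>)"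
        using rel(1)[OF i(1)] X a F.act_closed[OF a X] unfolding f_e[OF i(1)] g_e[OF i(1)] i(2)
        by (simp add: th split: if_splits)
    qed (rule hh(1))
    show "\<exists>k. algebra_hom G \<Gamma> S \<eta> T \<tau> k \<and> maps_agree ?F (map_comp2 k q) h \<and>
      (\<forall>k'. algebra_hom G \<Gamma> S \<eta> T \<tau> k' \<and> maps_agree ?F (map_comp2 k' q) h \<longrightarrow> maps_agree S k' k)"
    proof (intro exI[of _ "(T.ke, T.kG)"] conjI allI impI)
      show "algebra_hom G \<Gamma> S \<eta> T \<tau> (T.ke, T.kG)"
        unfolding algebra_hom_def
        using unit_hom hh(1) T.coind_extend_hom T.coind_extend_unit by blast
      show "maps_agree ?F (map_comp2 (T.ke, T.kG) q) h"
      proof (rule free_algebra_ext[OF grp tf])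
        show "tambara_hom G ?F T (map_comp2 (T.ke, T.kG) q)"
          by (rule tambara_hom_comp[OF qh T.coind_extend_hom])
        have "maps_agree \<Gamma> (map_comp2 q ?u) \<eta>" using q by (simp add: algebra_hom_def)
        then show "maps_agree \<Gamma> (map_comp2 (map_comp2 (T.ke, T.kG) q) ?u) (map_comp2 h ?u)"
          using T.coind_extend_unit hh(3) by (simp add: maps_agree_def map_comp2_def)
      qed (use hh(2) q_e T.coind_extend_pt in \<open>auto simp: map_comp2_def X_def[symmetric] N\<close>)
      fix k' assume k': "algebra_hom G \<Gamma> S \<eta> T \<tau> k' \<and> maps_agree ?F (map_comp2 k' q) h"
      show "maps_agree S k' (T.ke, T.kG)"
      proof (rule T.coind_extend_unique)
        show "fst k' (pt \<one> \<one>\<^bsub>A\<^esub>) = fst h X"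
          using k' X q_e by (auto simp: maps_agree_def map_comp2_def)
      qed (use k' in \<open>auto simp: algebra_hom_def\<close>)
    qed
  qed
  then show ?thesis unfolding finitely_presented_def by blast
qed

end

section \<open>Abelian groups by generators and relations\<close>

text \<open>\<open>frag_eval\<close> for arbitrary extensions of the ring record, so that modules
  are allowed as targets.\<close>

definition frag_value :: "('a, 'm) ring_scheme \<Rightarrow> ('x \<Rightarrow> 'a) \<Rightarrow> 'x frag \<Rightarrow> 'a" where
  "frag_value A f x = (\<Oplus>\<^bsub>A\<^esub>k\<in>Poly_Mapping.keys x. [Poly_Mapping.lookup x k] \<cdot>\<^bsub>A\<^esub> f k)"

lemma frag_eval_eq_value: "frag_eval A f = frag_value A f"
  by (simp add: fun_eq_iff frag_eval_def frag_value_def)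

context abelian_group begin

lemma minus_eq_zero_iff:
  assumes "x \<in> carrier G" "y \<in> carrier G"
  shows "x \<ominus> y = \<zero> \<longleftrightarrow> x = y"
proof
  assume "x \<ominus> y = \<zero>"
  then have "(x \<ominus> y) \<oplus> y = y" using assms by simp
  then show "x = y" using assms by (simp add: minus_eq a_assoc l_neg)
qed (use assms in \<open>simp add: minus_eq r_neg\<close>)

lemma frag_value_superset:
  assumes f: "f \<in> X \<rightarrow> carrier G" and K: "finite K" "Poly_Mapping.keys x \<subseteq> K" "K \<subseteq> X"
  shows "frag_value G f x = (\<Oplus>k\<in>K. add_pow G (Poly_Mapping.lookup x k) (f k))"
  unfolding frag_value_def
proof (rule add.finprod_mono_neutral_cong_left)
  fix k assume "k \<in> K - Poly_Mapping.keys x"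
  then have "Poly_Mapping.lookup x k = 0" by (simp add: in_keys_iff)
  then show "add_pow G (Poly_Mapping.lookup x k) (f k) = \<zero>" by (simp add: add_pow_def)
qed (use f K in \<open>auto intro!: add.int_pow_closed\<close>)

lemma frag_value_closed:
  assumes "f \<in> X \<rightarrow> carrier G" "Poly_Mapping.keys x \<subseteq> X"
  shows "frag_value G f x \<in> carrier G"
  unfolding frag_value_def using assms by (auto intro!: add.finprod_closed add.int_pow_closed)

lemma frag_value_zero [simp]: "frag_value G f 0 = \<zero>"
  by (simp add: frag_value_def)

lemma frag_value_of: "f x \<in> carrier G \<Longrightarrow> frag_value G f (frag_of x) = f x"
  by (simp add: frag_value_def keys_frag_of add.int_pow_1)

lemma frag_value_add:
  assumes f: "f \<in> X \<rightarrow> carrier G" and x: "Poly_Mapping.keys x \<subseteq> X" and y: "Poly_Mapping.keys y \<subseteq> X"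
  shows "frag_value G f (x + y) = frag_value G f x \<oplus> frag_value G f y"
proof -
  let ?K = "Poly_Mapping.keys x \<union> Poly_Mapping.keys y"
  have K: "finite ?K" "?K \<subseteq> X" using x y by auto
  have fc: "f k \<in> carrier G" if "k \<in> ?K" for k using f K that by auto
  have "frag_value G f (x + y) = (\<Oplus>k\<in>?K. add_pow G (Poly_Mapping.lookup (x + y) k) (f k))"
    by (rule frag_value_superset[OF f K(1) keys_add K(2)])
  also have "\<dots> = (\<Oplus>k\<in>?K. add_pow G (Poly_Mapping.lookup x k) (f k) \<oplus> add_pow G (Poly_Mapping.lookup y k) (f k))"
    by (rule finsum_cong') (use fc in \<open>auto simp: lookup_add add.int_pow_mult intro!: add.int_pow_closed\<close>)
  also have "\<dots> = (\<Oplus>k\<in>?K. add_pow G (Poly_Mapping.lookup x k) (f k)) \<oplus> (\<Oplus>k\<in>?K. add_pow G (Poly_Mapping.lookup y k) (f k))"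
    by (rule finsum_addf) (use fc in \<open>auto intro!: add.int_pow_closed\<close>)
  also have "\<dots> = frag_value G f x \<oplus> frag_value G f y"
    using frag_value_superset[OF f K(1) _ K(2), of x] frag_value_superset[OF f K(1) _ K(2), of y] by simp
  finally show ?thesis .
qed

lemma frag_value_diff:
  assumes f: "f \<in> X \<rightarrow> carrier G" and x: "Poly_Mapping.keys x \<subseteq> X" and y: "Poly_Mapping.keys y \<subseteq> X"
  shows "frag_value G f (x - y) = frag_value G f x \<ominus> frag_value G f y"
proof -
  have xy: "Poly_Mapping.keys (x - y) \<subseteq> X" using keys_diff[of x y] x y by auto
  note c = frag_value_closed[OF f x] frag_value_closed[OF f y] frag_value_closed[OF f xy]
  have "frag_value G f x = frag_value G f ((x - y) + y)" by simp
  also have "\<dots> = frag_value G f (x - y) \<oplus> frag_value G f y" by (rule frag_value_add[OF f xy y])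
  finally show ?thesis using c by (simp add: a_assoc minus_eq r_neg)
qed

lemma frag_value_sum:
  assumes f: "f \<in> X \<rightarrow> carrier G" and "finite I" and x: "\<And>i. i \<in> I \<Longrightarrow> Poly_Mapping.keys (x i) \<subseteq> X"
  shows "frag_value G f (\<Sum>i\<in>I. x i) = (\<Oplus>i\<in>I. frag_value G f (x i))"
  using assms(2,3)
proof (induction I rule: finite_induct)
  case (insert i I)
  have "(\<Sum>i\<in>I. x i) \<in> carrier (free_Abelian_group X)"
    by (rule sum_closed_free_Abelian_group) (use insert in auto)
  then show ?case
    using insert frag_value_closed[OF f] by (simp add: frag_value_add[OF f] Pi_def)
qed simp

end

lemma additive_hom_zero:
  assumes "abelian_group A" "abelian_group B" "F \<in> hom (add_monoid A) (add_monoid B)"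
  shows "F \<zero>\<^bsub>A\<^esub> = \<zero>\<^bsub>B\<^esub>"
  using hom_one[OF assms(3)] assms(1,2)[THEN abelian_group.a_group] by simp

lemma additive_hom_minus:
  assumes A: "abelian_group A" and B: "abelian_group B" and F: "F \<in> hom (add_monoid A) (add_monoid B)"
    and x: "x \<in> carrier A" and y: "y \<in> carrier A"
  shows "F (x \<ominus>\<^bsub>A\<^esub> y) = F x \<ominus>\<^bsub>B\<^esub> F y"
proof -
  interpret A: abelian_group A by fact
  interpret B: abelian_group B by fact
  interpret h: group_hom "add_monoid A" "add_monoid B" F
    using F A.add.group_axioms B.add.group_axioms
    by (simp add: group_hom_def group_hom_axioms_def)
  have "F (\<ominus>\<^bsub>A\<^esub> y) = \<ominus>\<^bsub>B\<^esub> F y" using h.hom_inv[of y] y by (simp add: a_inv_def)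
  then show ?thesis
    using h.hom_mult[of x "\<ominus>\<^bsub>A\<^esub> y"] x y by (simp add: A.minus_eq B.minus_eq)
qed

lemma additive_hom_finsum:
  assumes "abelian_group A" "abelian_group B" "F \<in> hom (add_monoid A) (add_monoid B)"
    "f \<in> I \<rightarrow> carrier A"
  shows "F (\<Oplus>\<^bsub>A\<^esub>i\<in>I. f i) = (\<Oplus>\<^bsub>B\<^esub>i\<in>I. F (f i))"
proof -
  interpret A: abelian_group A by fact
  interpret B: abelian_group B by fact
  have z: "F \<zero>\<^bsub>A\<^esub> = \<zero>\<^bsub>B\<^esub>" by (rule additive_hom_zero[OF assms(1-3)])
  have c: "F x \<in> carrier B" if "x \<in> carrier A" for x using assms(3) that by (auto simp: hom_def)
  have a: "F (x \<oplus>\<^bsub>A\<^esub> y) = F x \<oplus>\<^bsub>B\<^esub> F y" if "x \<in> carrier A" "y \<in> carrier A" for x y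
    using assms(3) that by (auto simp: hom_def)
  show ?thesis using assms(4)
    by (induction I rule: infinite_finite_induct) (auto simp: z c a Pi_def A.finsum_closed)
qed

text \<open>Both sides are additive in \<open>z\<close> and agree on the generators.\<close>

lemma frag_value_extend:
  assumes A: "abelian_group A" and B: "abelian_group B" and F: "F \<in> hom (add_monoid A) (add_monoid B)"
    and f: "f \<in> X \<rightarrow> carrier A" and f': "f' \<in> Y \<rightarrow> carrier B"
    and h: "\<And>x. x \<in> X \<Longrightarrow> Poly_Mapping.keys (h x) \<subseteq> Y" "\<And>x. x \<in> X \<Longrightarrow> frag_value B f' (h x) = F (f x)"
    and z: "Poly_Mapping.keys z \<subseteq> X"
  shows "frag_value B f' (frag_extend h z) = F (frag_value A f z)"
proof -
  interpret A: abelian_group A by fact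
  interpret B: abelian_group B by fact
  have "Poly_Mapping.keys z \<subseteq> X \<and> Poly_Mapping.keys (frag_extend h z) \<subseteq> Y \<and>
      frag_value B f' (frag_extend h z) = F (frag_value A f z)"
    using z
  proof (induction z rule: frag_induction)
    case zero
    show ?case using additive_hom_zero[OF A B F] by auto
  next
    case (one x)
    then show ?case using h f by (auto simp: A.frag_value_of keys_frag_of Pi_iff)
  next
    case (diff a b)
    then show ?case
      using keys_diff[of a b] keys_diff[of "frag_extend h a" "frag_extend h b"]
      by (auto simp: frag_extend_diff A.frag_value_diff[OF f] B.frag_value_diff[OF f']
        additive_hom_minus[OF A B F] A.frag_value_closed[OF f])
  qed
  then show ?thesis by simp
qed

lemma keys_frag_extend_subset:
  assumes "\<And>x. x \<in> X \<Longrightarrow> Poly_Mapping.keys (h x) \<subseteq> Y" "Poly_Mapping.keys z \<subseteq> X"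
  shows "Poly_Mapping.keys (frag_extend h z) \<subseteq> Y"
  using keys_frag_extend[of h z] assms by blast

subsection \<open>Subgroups and cosets\<close>

locale frag_subgroup =
  fixes K :: "'x frag set"
  assumes zero [simp]: "0 \<in> K" and diff: "\<lbrakk>x \<in> K; y \<in> K\<rbrakk> \<Longrightarrow> x - y \<in> K"
begin

lemma minus: "x \<in> K \<Longrightarrow> - x \<in> K"
  using diff[OF zero, of x] by simp

lemma add: "\<lbrakk>x \<in> K; y \<in> K\<rbrakk> \<Longrightarrow> x + y \<in> K"
  using diff[of x "- y"] minus by simp

lemma sum: "(\<And>i. i \<in> I \<Longrightarrow> x i \<in> K) \<Longrightarrow> (\<Sum>i\<in>I. x i) \<in> K"
  by (induction I rule: infinite_finite_induct) (auto intro: add)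

lemma trans: "\<lbrakk>x - y \<in> K; y - z \<in> K\<rbrakk> \<Longrightarrow> x - z \<in> K"
  using add[of "x - y" "y - z"] by simp

lemma sym: "x - y \<in> K \<Longrightarrow> y - x \<in> K"
  using minus[of "x - y"] by simp

lemma sum_cong: "(\<And>i. i \<in> I \<Longrightarrow> x i - y i \<in> K) \<Longrightarrow> (\<Sum>i\<in>I. x i) - (\<Sum>i\<in>I. y i) \<in> K"
  by (simp add: sum_subtractf[symmetric] sum)

lemma mem_coset_iff: "z \<in> frag_coset K x \<longleftrightarrow> z - x \<in> K"
proof
  assume "z - x \<in> K"
  then have "(z - x) + x \<in> frag_coset K x" unfolding frag_coset_def by (rule imageI)
  then show "z \<in> frag_coset K x" by simp
qed (auto simp: frag_coset_def)

lemma coset_eq_iff: "frag_coset K x = frag_coset K y \<longleftrightarrow> x - y \<in> K"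
proof
  assume "frag_coset K x = frag_coset K y"
  then show "x - y \<in> K" using mem_coset_iff[of x x] mem_coset_iff[of x y] by simp
next
  assume xy: "x - y \<in> K"
  show "frag_coset K x = frag_coset K y"
    using trans[OF _ xy] trans[OF _ sym[OF xy]] by (auto simp: mem_coset_iff)
qed

lemma coset_zero: "frag_coset K 0 = K"
  by (simp add: frag_coset_def)

end

lemma frag_subgroup_span: "frag_subgroup (frag_span A)"
proof -
  let ?G = "free_Abelian_group UNIV"
  interpret group ?G by simp
  have s: "subgroup (frag_span A) ?G"
    unfolding frag_span_def by (rule generate_is_subgroup) (auto simp: free_Abelian_group_def)
  show ?thesis
  proof
    show "0 \<in> frag_span A" using subgroup.one_closed[OF s] by simp
    fix x y assume xy: "x \<in> frag_span A" "y \<in> frag_span A"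
    have "x \<otimes>\<^bsub>?G\<^esub> inv\<^bsub>?G\<^esub> y \<in> frag_span A"
      using subgroup.m_closed[OF s xy(1) subgroup.m_inv_closed[OF s xy(2)]] .
    then show "x - y \<in> frag_span A" by simp
  qed
qed

lemma frag_span_base: "x \<in> A \<Longrightarrow> x \<in> frag_span A"
  unfolding frag_span_def by (rule generate.incl)

lemma frag_span_subset:
  assumes "A \<subseteq> P" "frag_subgroup P"
  shows "frag_span A \<subseteq> P"
proof
  interpret frag_subgroup P by fact
  fix x assume "x \<in> frag_span A"
  then show "x \<in> P" unfolding frag_span_def
    by (induction rule: generate.induct) (use assms(1) add minus in auto)
qed

text \<open>
  A presentation with generators \<open>X\<close> and subgroup of relations \<open>K\<close> of the abelian group \<open>A\<close>, with \<open>f\<close> the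
  images of the generators; \<open>s\<close> is a section that is additive modulo \<open>K\<close>.
\<close>

locale frag_presentation =
  A: abelian_group A for A :: "('a, 'm) ring_scheme" +
  fixes Rel :: "'x frag set" and X :: "'x set" and f :: "'x \<Rightarrow> 'a" and s :: "'a \<Rightarrow> 'x frag"
  assumes f_closed: "f \<in> X \<rightarrow> carrier A"
    and Rel_keys: "r \<in> Rel \<Longrightarrow> Poly_Mapping.keys r \<subseteq> X"
    and Rel_value: "r \<in> Rel \<Longrightarrow> frag_value A f r = \<zero>\<^bsub>A\<^esub>"
    and s_keys: "a \<in> carrier A \<Longrightarrow> Poly_Mapping.keys (s a) \<subseteq> X"
    and s_value: "a \<in> carrier A \<Longrightarrow> frag_value A f (s a) = a"
    and s_add: "\<lbrakk>a \<in> carrier A; b \<in> carrier A\<rbrakk> \<Longrightarrow> s (a \<oplus>\<^bsub>A\<^esub> b) - s a - s b \<in> frag_span Rel"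
    and s_gen: "x \<in> X \<Longrightarrow> frag_of x - s (f x) \<in> frag_span Rel"
begin

abbreviation K where "K \<equiv> frag_span Rel"
abbreviation val where "val \<equiv> frag_value A f"

sublocale frag_subgroup K by (rule frag_subgroup_span)

text \<open>The elements supported in \<open>X\<close> with value zero form a subgroup. The support
  is tracked because the span is formed in the free group on the whole type.\<close>

lemma K_value: "z \<in> K \<Longrightarrow> Poly_Mapping.keys z \<subseteq> X \<and> val z = \<zero>\<^bsub>A\<^esub>"
proof -
  have "K \<subseteq> {z. Poly_Mapping.keys z \<subseteq> X \<and> val z = \<zero>\<^bsub>A\<^esub>}"
  proof (rule frag_span_subset)
    show "frag_subgroup {z. Poly_Mapping.keys z \<subseteq> X \<and> val z = \<zero>\<^bsub>A\<^esub>}"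
    proof
      fix x y assume "x \<in> {z. Poly_Mapping.keys z \<subseteq> X \<and> val z = \<zero>\<^bsub>A\<^esub>}"
        "y \<in> {z. Poly_Mapping.keys z \<subseteq> X \<and> val z = \<zero>\<^bsub>A\<^esub>}"
      then show "x - y \<in> {z. Poly_Mapping.keys z \<subseteq> X \<and> val z = \<zero>\<^bsub>A\<^esub>}"
        using keys_diff[of x y] by (auto simp: A.frag_value_diff[OF f_closed] A.minus_eq)
    qed simp
  qed (use Rel_keys Rel_value in auto)
  then show "z \<in> K \<Longrightarrow> Poly_Mapping.keys z \<subseteq> X \<and> val z = \<zero>\<^bsub>A\<^esub>" by auto
qed

lemma val_closed: "Poly_Mapping.keys z \<subseteq> X \<Longrightarrow> val z \<in> carrier A"
  by (rule A.frag_value_closed[OF f_closed])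

text \<open>Modulo the relations every element lies in the image of the section; this is what makes
  the relations complete. The induction goes from generators to differences, where
  \<open>s_add\<close> is applied to \<open>val a\<close> as the sum of \<open>val (a - b)\<close>
  and \<open>val b\<close>.\<close>

lemma s_cong:
  assumes "Poly_Mapping.keys z \<subseteq> X"
  shows "z - s (val z) \<in> K"
proof -
  have "Poly_Mapping.keys z \<subseteq> X \<and> z - s (val z) \<in> K" using assms
  proof (induction z rule: frag_induction)
    case zero
    have "s (\<zero>\<^bsub>A\<^esub> \<oplus>\<^bsub>A\<^esub> \<zero>\<^bsub>A\<^esub>) - s \<zero>\<^bsub>A\<^esub> - s \<zero>\<^bsub>A\<^esub> \<in> K" by (rule s_add) auto
    then show ?case by simp
  next
    case (one x)
    then show ?case using s_gen f_closed by (auto simp: A.frag_value_of keys_frag_of Pi_iff)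
  next
    case (diff a b)
    have ab: "Poly_Mapping.keys (a - b) \<subseteq> X" using diff keys_diff[of a b] by auto
    have v: "val a = val (a - b) \<oplus>\<^bsub>A\<^esub> val b"
      using A.frag_value_add[OF f_closed ab, of b] diff by simp
    have "s (val a) - s (val (a - b)) - s (val b) \<in> K"
      unfolding v by (rule s_add) (use ab diff val_closed in auto)
    moreover have "(a - s (val a)) - (b - s (val b)) \<in> K" 
      by (rule frag_subgroup.diff[OF frag_subgroup_axioms]) (use diff in auto)
    ultimately have "(s (val a) - s (val (a - b)) - s (val b)) + ((a - s (val a)) - (b - s (val b))) \<in> K"
      by (rule add)
    then show ?case using ab by (simp add: algebra_simps)
  qed
  then show ?thesis ..
qed

text \<open>If the value of \<open>z\<close> is zero, then \<open>z\<close> is congruent to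
  \<open>s\<close> of zero, which lies in \<open>K\<close> because \<open>s\<close> is additive
  modulo \<open>K\<close>.\<close>

lemma K_iff: "Poly_Mapping.keys z \<subseteq> X \<Longrightarrow> z \<in> K \<longleftrightarrow> val z = \<zero>\<^bsub>A\<^esub>"
proof
  assume z: "Poly_Mapping.keys z \<subseteq> X" "val z = \<zero>\<^bsub>A\<^esub>"
  have "s (\<zero>\<^bsub>A\<^esub> \<oplus>\<^bsub>A\<^esub> \<zero>\<^bsub>A\<^esub>) - s \<zero>\<^bsub>A\<^esub> - s \<zero>\<^bsub>A\<^esub> \<in> K" by (rule s_add) auto
  then have "s \<zero>\<^bsub>A\<^esub> \<in> K" using minus by fastforce
  then show "z \<in> K" using s_cong[OF z(1)] z(2) add by fastforce
qed (use K_value in auto)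

lemma coset_eq_iff_val:
  assumes "Poly_Mapping.keys z \<subseteq> X" "Poly_Mapping.keys w \<subseteq> X"
  shows "frag_coset K z = frag_coset K w \<longleftrightarrow> val z = val w"
proof -
  have "Poly_Mapping.keys (z - w) \<subseteq> X" using keys_diff[of z w] assms by auto
  then have "z - w \<in> K \<longleftrightarrow> val z \<ominus>\<^bsub>A\<^esub> val w = \<zero>\<^bsub>A\<^esub>"
    using assms by (simp add: K_iff A.frag_value_diff[OF f_closed])
  then show ?thesis using val_closed assms by (simp add: coset_eq_iff A.minus_eq_zero_iff)
qed

definition cosets where "cosets = frag_coset K ` {z. Poly_Mapping.keys z \<subseteq> X}"

definition cval :: "'x frag set \<Rightarrow> 'a" where "cval C = val (SOME z. z \<in> C)"

lemma mem_coset_keys_val: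
  assumes "Poly_Mapping.keys z \<subseteq> X" "w \<in> frag_coset K z"
  shows "Poly_Mapping.keys w \<subseteq> X \<and> val w = val z"
proof -
  have k: "w - z \<in> K" using assms by (simp add: mem_coset_iff)
  then have "Poly_Mapping.keys ((w - z) + z) \<subseteq> X"
    using K_value keys_add[of "w - z" z] assms(1) by blast
  then show ?thesis using coset_eq_iff_val[of w z] k assms(1) by (simp add: coset_eq_iff)
qed

lemma cval_coset: "Poly_Mapping.keys z \<subseteq> X \<Longrightarrow> cval (frag_coset K z) = val z"
proof -
  assume z: "Poly_Mapping.keys z \<subseteq> X"
  have "(SOME w. w \<in> frag_coset K z) \<in> frag_coset K z"
    by (rule someI[of _ z]) (simp add: mem_coset_iff)
  then show ?thesis unfolding cval_def using mem_coset_keys_val[OF z] by blast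
qed

lemma coset_s: "a \<in> carrier A \<Longrightarrow> frag_coset K (s a) \<in> cosets \<and> cval (frag_coset K (s a)) = a"
  using s_keys s_value by (auto simp: cosets_def cval_coset)

lemma cosetsE:
  assumes "C \<in> cosets"
  obtains z where "Poly_Mapping.keys z \<subseteq> X" "C = frag_coset K z" "cval C = val z"
  using assms cval_coset by (auto simp: cosets_def)

lemma cval_bij: "bij_betw cval cosets (carrier A)"
proof (rule bij_betwI[where g = "\<lambda>a. frag_coset K (s a)"])
  show "cval \<in> cosets \<rightarrow> carrier A" by (auto simp: cosets_def cval_coset val_closed)
  show "(\<lambda>a. frag_coset K (s a)) \<in> carrier A \<rightarrow> cosets" using coset_s by auto
  show "frag_coset K (s (cval C)) = C" if "C \<in> cosets" for C
  proof -
    from that obtain z where z: "Poly_Mapping.keys z \<subseteq> X" "C = frag_coset K z" "cval C = val z"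
      by (rule cosetsE)
    then show ?thesis by (simp add: coset_eq_iff_val s_keys s_value val_closed)
  qed
qed (use coset_s in auto)

lemma zero_coset: "K \<in> cosets" "cval K = \<zero>\<^bsub>A\<^esub>"
  using cval_coset[of 0] coset_zero by (auto simp: cosets_def image_iff intro!: exI[of _ 0])

end

text \<open>Cosets are determined by their values, so the induced map is well defined as soon as
  \<open>h\<close> realizes \<open>F\<close> on generators.\<close>

lemma coset_map_coset:
  assumes "frag_presentation A Rel X f s" "frag_presentation A' Rel' X' f' s'"
    and F: "F \<in> hom (add_monoid A) (add_monoid A')"
    and h: "\<And>x. x \<in> X \<Longrightarrow> Poly_Mapping.keys (h x) \<subseteq> X'" "\<And>x. x \<in> X \<Longrightarrow> frag_value A' f' (h x) = F (f x)"
    and C: "C \<in> frag_presentation.cosets Rel X"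
  shows "coset_map (frag_span Rel') (frag_extend h) C \<in> frag_presentation.cosets Rel' X' \<and>
    frag_presentation.cval A' f' (coset_map (frag_span Rel') (frag_extend h) C) = F (frag_presentation.cval A f C)"
proof -
  interpret P: frag_presentation A Rel X f s by fact
  interpret P': frag_presentation A' Rel' X' f' s' by fact
  obtain z where z: "Poly_Mapping.keys z \<subseteq> X" "C = frag_coset P.K z" "P.cval C = P.val z"
    using C by (rule P.cosetsE)
  have k: "Poly_Mapping.keys (frag_extend h w) \<subseteq> X'" if "Poly_Mapping.keys w \<subseteq> X" for w
    by (rule keys_frag_extend_subset[OF h(1) that])
  have v: "P'.val (frag_extend h w) = F (P.val w)" if "Poly_Mapping.keys w \<subseteq> X" for w
    by (rule frag_value_extend[OF P.A.abelian_group_axioms P'.A.abelian_group_axioms F P.f_closed P'.f_closed h that])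
  have "coset_map P'.K (frag_extend h) C = frag_coset P'.K (frag_extend h z)"
    unfolding coset_map_def
  proof (rule UN_constant_eq)
    show "z \<in> C" by (simp add: z P.mem_coset_iff)
    show "\<forall>w\<in>C. frag_coset P'.K (frag_extend h w) = frag_coset P'.K (frag_extend h z)"
      using P.mem_coset_keys_val[OF z(1)] z k v by (auto simp: P'.coset_eq_iff_val)
  qed
  then show ?thesis
    using z k[OF z(1)] v[OF z(1)] by (simp add: P'.cval_coset) (simp add: P'.cosets_def)
qed

lemma coset_map2_coset:
  assumes "frag_presentation A Rel X f s"
    and F: "\<And>z w. \<lbrakk>Poly_Mapping.keys z \<subseteq> X; Poly_Mapping.keys w \<subseteq> X\<rbrakk> \<Longrightarrow>
      Poly_Mapping.keys (h z w) \<subseteq> X \<and> frag_value A f (h z w) = F (frag_value A f z) (frag_value A f w)"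
    and C: "C \<in> frag_presentation.cosets Rel X" "D \<in> frag_presentation.cosets Rel X"
  shows "coset_map2 (frag_span Rel) h C D \<in> frag_presentation.cosets Rel X \<and>
    frag_presentation.cval A f (coset_map2 (frag_span Rel) h C D) =
      F (frag_presentation.cval A f C) (frag_presentation.cval A f D)"
proof -
  interpret P: frag_presentation A Rel X f s by fact
  obtain z where z: "Poly_Mapping.keys z \<subseteq> X" "C = frag_coset P.K z" "P.cval C = P.val z"
    using C(1) by (rule P.cosetsE)
  obtain w where w: "Poly_Mapping.keys w \<subseteq> X" "D = frag_coset P.K w" "P.cval D = P.val w"
    using C(2) by (rule P.cosetsE)
  have "coset_map2 P.K h C D = frag_coset P.K (h z w)"
  proof -
    have *: "frag_coset P.K (h z' w') = frag_coset P.K (h z w)" if "z' \<in> C" "w' \<in> D" for z' w'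
      using P.mem_coset_keys_val[OF z(1), of z'] P.mem_coset_keys_val[OF w(1), of w'] that z(2) w(2)
        F[OF z(1) w(1)] F[of z' w'] by (simp add: P.coset_eq_iff_val)
    have "z \<in> C" "w \<in> D" by (simp_all add: z w P.mem_coset_iff)
    then show ?thesis unfolding coset_map2_def
      by (intro UN_constant_eq[of z] UN_constant_eq[of w] ballI *)
  qed
  then show ?thesis
    using z w F[OF z(1) w(1)] by (simp add: P.cval_coset) (simp add: P.cosets_def)
qed

text \<open>Exactness speaks of injectivity, images and the fibre over zero, so it passes along
  bijections that intertwine the maps; \<open>z\<close> and \<open>z'\<close> stand for the zeros of
  the third terms.\<close>

lemma exact_transport:
  assumes v1: "bij_betw v1 B1 C1" and v2: "bij_betw v2 B2 C2" and v3: "bij_betw v3 B3 C3"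
    and \<phi>: "\<And>b. b \<in> B1 \<Longrightarrow> \<phi> b \<in> B2 \<and> v2 (\<phi> b) = F (v1 b)"
    and \<psi>: "\<And>b. b \<in> B2 \<Longrightarrow> \<psi> b \<in> B3 \<and> v3 (\<psi> b) = H (v2 b)"
    and z: "z \<in> B3" "v3 z = z'"
    and ex: "inj_on F C1" "F ` C1 = {c \<in> C2. H c = z'}" "H ` C2 = C3"
  shows "inj_on \<phi> B1" "\<phi> ` B1 = {b \<in> B2. \<psi> b = z}" "\<psi> ` B2 = B3"
proof -
  have c1: "v1 b \<in> C1" if "b \<in> B1" for b using v1 that by (auto simp: bij_betw_def)
  have c2: "v2 b \<in> C2" if "b \<in> B2" for b using v2 that by (auto simp: bij_betw_def)
  have i1: "b = b'" if "v1 b = v1 b'" "b \<in> B1" "b' \<in> B1" for b b'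
    using v1 that by (auto simp: bij_betw_def inj_on_def)
  have i2: "b = b'" if "v2 b = v2 b'" "b \<in> B2" "b' \<in> B2" for b b'
    using v2 that by (auto simp: bij_betw_def inj_on_def)
  have i3: "b = b'" if "v3 b = v3 b'" "b \<in> B3" "b' \<in> B3" for b b'
    using v3 that by (auto simp: bij_betw_def inj_on_def)
  have s1: "\<exists>b\<in>B1. v1 b = c" if "c \<in> C1" for c using v1 that by (auto simp: bij_betw_def)
  have s2: "\<exists>b\<in>B2. v2 b = c" if "c \<in> C2" for c using v2 that by (auto simp: bij_betw_def)
  show "inj_on \<phi> B1"
  proof (rule inj_onI)
    fix b b' assume b: "b \<in> B1" "b' \<in> B1" "\<phi> b = \<phi> b'"
    then have "F (v1 b) = F (v1 b')" using \<phi> by metis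
    then have "v1 b = v1 b'" using ex(1) b c1 by (auto simp: inj_on_def)
    then show "b = b'" using i1 b by blast
  qed
  show "\<phi> ` B1 = {b \<in> B2. \<psi> b = z}"
  proof (intro equalityI subsetI)
    fix c assume "c \<in> \<phi> ` B1"
    then obtain b where b: "b \<in> B1" "c = \<phi> b" by auto
    have "F (v1 b) \<in> F ` C1" using c1 b by auto
    then have "H (F (v1 b)) = z'" using ex(2) by auto
    then have "v3 (\<psi> c) = v3 z" using \<phi> \<psi> b z by auto
    then show "c \<in> {b \<in> B2. \<psi> b = z}" using \<phi> \<psi> b z i3 by auto
  next
    fix c assume c: "c \<in> {b \<in> B2. \<psi> b = z}"
    then have "H (v2 c) = z'" using \<psi> z by auto
    then have "v2 c \<in> F ` C1" unfolding ex(2) using c c2 by auto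
    then obtain d where d: "d \<in> C1" "v2 c = F d" by auto
    then obtain b where b: "b \<in> B1" "v1 b = d" using s1 by blast
    have "v2 (\<phi> b) = v2 c" using \<phi> b d by auto
    then have "c = \<phi> b" using i2 \<phi> b c by auto
    then show "c \<in> \<phi> ` B1" using b by auto
  qed
  show "\<psi> ` B2 = B3"
  proof (intro equalityI subsetI)
    fix c assume "c \<in> B3"
    then have "v3 c \<in> H ` C2" using v3 ex(3) by (auto simp: bij_betw_def)
    then obtain d where d: "d \<in> C2" "v3 c = H d" by auto
    then obtain b where b: "b \<in> B2" "v2 b = d" using s2 by blast
    have "v3 (\<psi> b) = v3 c" using \<psi> b d by auto
    then have "c = \<psi> b" using i3 \<psi> b \<open>c \<in> B3\<close> by auto
    then show "c \<in> \<psi> ` B2" using b by auto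
  qed (use \<psi> in auto)
qed

section \<open>The relative box product with the coinduced algebra\<close>

context abelian_group begin

lemma frag_value_relation2:
  assumes f: "f \<in> X \<rightarrow> carrier G" and X: "a \<in> X" "b \<in> X" and eq: "f a = f b"
  shows "Poly_Mapping.keys (frag_of a - frag_of b) \<subseteq> X \<and> frag_value G f (frag_of a - frag_of b) = \<zero>"
proof
  show "Poly_Mapping.keys (frag_of a - frag_of b) \<subseteq> X"
    using keys_diff[of "frag_of a" "frag_of b"] X by (auto simp: keys_frag_of)
  have "f a \<in> carrier G" "f b \<in> carrier G" using f X by auto
  then show "frag_value G f (frag_of a - frag_of b) = \<zero>"
    using X eq by (simp add: frag_value_diff[OF f] frag_value_of keys_frag_of minus_eq_zero_iff)
qed

lemma frag_value_relation3:
  assumes f: "f \<in> X \<rightarrow> carrier G" and X: "a \<in> X" "b \<in> X" "c \<in> X" and eq: "f a = f b \<oplus> f c"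
  shows "Poly_Mapping.keys (frag_of a - frag_of b - frag_of c) \<subseteq> X \<and>
    frag_value G f (frag_of a - frag_of b - frag_of c) = \<zero>"
proof
  have k: "Poly_Mapping.keys (frag_of a - frag_of b) \<subseteq> X"
    using keys_diff[of "frag_of a" "frag_of b"] X by (auto simp: keys_frag_of)
  then show "Poly_Mapping.keys (frag_of a - frag_of b - frag_of c) \<subseteq> X"
    using keys_diff[of "frag_of a - frag_of b" "frag_of c"] X by (auto simp: keys_frag_of)
  have c: "f a \<in> carrier G" "f b \<in> carrier G" "f c \<in> carrier G" using f X by auto
  have "f b \<oplus> f c \<ominus> f b = f c" using c a_comm[of "f b" "f c"] by (simp add: minus_eq a_assoc r_neg)
  then show "frag_value G f (frag_of a - frag_of b - frag_of c) = \<zero>"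
    using X eq c k by (simp add: frag_value_diff[OF f] frag_value_of keys_frag_of minus_eq_zero_iff)
qed

end

text \<open>A function that is biadditive and balanced on the generators kills the relations,
  whatever the shape \<open>t\<close> of the generators; used with \<open>Pair\<close>,
  \<open>Ten\<close> and \<open>TrTen\<close>.\<close>

lemma tensor_relations_value:
  assumes D: "abelian_group D" and f: "f \<in> X \<rightarrow> carrier D"
    and t: "\<And>a b. \<lbrakk>a \<in> carrier A; b \<in> carrier B\<rbrakk> \<Longrightarrow> t a b \<in> X"
    and A: "\<And>a a'. \<lbrakk>a \<in> carrier A; a' \<in> carrier A\<rbrakk> \<Longrightarrow> a \<oplus>\<^bsub>A\<^esub> a' \<in> carrier A"
      "\<And>r a. \<lbrakk>r \<in> carrier k; a \<in> carrier A\<rbrakk> \<Longrightarrow> r \<odot>\<^bsub>A\<^esub> a \<in> carrier A"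
    and B: "\<And>b b'. \<lbrakk>b \<in> carrier B; b' \<in> carrier B\<rbrakk> \<Longrightarrow> b \<oplus>\<^bsub>B\<^esub> b' \<in> carrier B"
      "\<And>r b. \<lbrakk>r \<in> carrier k; b \<in> carrier B\<rbrakk> \<Longrightarrow> r \<odot>\<^bsub>B\<^esub> b \<in> carrier B"
    and bil: "\<And>a a' b. \<lbrakk>a \<in> carrier A; a' \<in> carrier A; b \<in> carrier B\<rbrakk> \<Longrightarrow>
        f (t (a \<oplus>\<^bsub>A\<^esub> a') b) = f (t a b) \<oplus>\<^bsub>D\<^esub> f (t a' b)"
      "\<And>a b b'. \<lbrakk>a \<in> carrier A; b \<in> carrier B; b' \<in> carrier B\<rbrakk> \<Longrightarrow>
        f (t a (b \<oplus>\<^bsub>B\<^esub> b')) = f (t a b) \<oplus>\<^bsub>D\<^esub> f (t a b')"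
      "\<And>r a b. \<lbrakk>r \<in> carrier k; a \<in> carrier A; b \<in> carrier B\<rbrakk> \<Longrightarrow> f (t (r \<odot>\<^bsub>A\<^esub> a) b) = f (t a (r \<odot>\<^bsub>B\<^esub> b))"
    and x: "x \<in> tensor_relations k A B t"
  shows "Poly_Mapping.keys x \<subseteq> X \<and> frag_value D f x = \<zero>\<^bsub>D\<^esub>"
  using x unfolding tensor_relations_def
  by (elim UnE CollectE exE conjE)
    (simp_all only:, (rule abelian_group.frag_value_relation3[OF D f] abelian_group.frag_value_relation2[OF D f],
      (assumption | rule t A B bil)+)+)

text \<open>For maps that are additive only modulo \<open>K\<close>. The empty sum needs
  \<open>F\<close> of zero in \<open>K\<close>, which is additivity for zero plus zero.\<close>

lemma (in frag_subgroup) additive_finsum: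
  assumes A: "abelian_group A" and a: "a \<in> I \<rightarrow> carrier A" and I: "finite I"
    and F: "\<And>x y. \<lbrakk>x \<in> carrier A; y \<in> carrier A\<rbrakk> \<Longrightarrow> F (x \<oplus>\<^bsub>A\<^esub> y) - F x - F y \<in> K"
  shows "F (\<Oplus>\<^bsub>A\<^esub>i\<in>I. a i) - (\<Sum>i\<in>I. F (a i)) \<in> K"
  using I a
proof (induction I rule: finite_induct)
  interpret A: abelian_group A by fact
  case empty
  have "F (\<zero>\<^bsub>A\<^esub> \<oplus>\<^bsub>A\<^esub> \<zero>\<^bsub>A\<^esub>) - F \<zero>\<^bsub>A\<^esub> - F \<zero>\<^bsub>A\<^esub> \<in> K" by (rule F) auto
  then have "- F \<zero>\<^bsub>A\<^esub> \<in> K" by simp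
  from minus[OF this] show ?case by simp
next
  interpret A: abelian_group A by fact
  case (insert i I)
  then have c: "a i \<in> carrier A" "(\<Oplus>\<^bsub>A\<^esub>i\<in>I. a i) \<in> carrier A" by (auto intro!: A.finsum_closed)
  have e: "(\<Oplus>\<^bsub>A\<^esub>i\<in>insert i I. a i) = a i \<oplus>\<^bsub>A\<^esub> (\<Oplus>\<^bsub>A\<^esub>i\<in>I. a i)"
    using insert by (auto intro!: A.finsum_insert)
  have "(F (a i \<oplus>\<^bsub>A\<^esub> (\<Oplus>\<^bsub>A\<^esub>i\<in>I. a i)) - F (a i) - F (\<Oplus>\<^bsub>A\<^esub>i\<in>I. a i)) +
      (F (\<Oplus>\<^bsub>A\<^esub>i\<in>I. a i) - (\<Sum>i\<in>I. F (a i))) \<in> K"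
    by (rule add) (use F c insert in auto)
  then show ?case unfolding e using insert by (simp add: algebra_simps)
qed

lemma truncate_simps [simp]:
  "carrier (ring.truncate N) = carrier N" "a \<oplus>\<^bsub>ring.truncate N\<^esub> b = a \<oplus>\<^bsub>N\<^esub> b" "\<zero>\<^bsub>ring.truncate N\<^esub> = \<zero>\<^bsub>N\<^esub>"
  by (simp_all add: ring.truncate_def)

lemma abelian_group_fun_ring:
  fixes Q :: "'q ring"
  assumes "abelian_group Q"
  shows "abelian_group (fun_ring X Q)"
proof -
  interpret abelian_group Q by fact
  have app: "s x \<in> carrier Q" if "s \<in> X \<rightarrow>\<^sub>E carrier Q" "x \<in> X" for s x by (rule PiE_mem[OF that])
  show ?thesis
  proof (rule abelian_groupI)
    fix s assume s: "s \<in> carrier (fun_ring X Q)"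
    show "\<exists>t\<in>carrier (fun_ring X Q). t \<oplus>\<^bsub>fun_ring X Q\<^esub> s = \<zero>\<^bsub>fun_ring X Q\<^esub>"
      by (rule bexI[of _ "\<lambda>x\<in>X. \<ominus>\<^bsub>Q\<^esub> s x"]) (use s app in \<open>auto simp: l_neg intro!: restrict_ext\<close>)
    show "\<zero>\<^bsub>fun_ring X Q\<^esub> \<oplus>\<^bsub>fun_ring X Q\<^esub> s = s"
      by (rule PiE_ext[where s = "\<lambda>_. carrier Q"]) (use s app in auto)
  qed (use app in \<open>auto simp: a_ac intro!: restrict_ext\<close>)
qed

lemma abelian_group_truncate: "abelian_group N \<Longrightarrow> abelian_group (ring.truncate N)"
proof -
  assume "abelian_group N"
  then interpret abelian_group N .
  show ?thesis by (rule abelian_groupI) (auto simp: a_ac intro: l_neg)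
qed

locale box_context = prime_order_tambara G R + N: tambara_module G "ghost G R" N
  for G :: "'c monoid" (structure) and R :: "('c, 'e, 'g) tambara"
    and N :: "('c, 'e, 'e \<times> 'g set, 'm, 'n) green_module"
begin

abbreviation Ne where "Ne \<equiv> mlev_e N"
abbreviation NG where "NG \<equiv> mlev_G N"
abbreviation M where "M \<equiv> algebra_module S \<eta>"
abbreviation NF where "NF \<equiv> fun_ring (carrier G) (ring.truncate Ne)"

sublocale Ne: Module.module A Ne using N.mlev_e_module by simp
sublocale NG: Module.module "lev_G \<Gamma>" NG by (rule N.mlev_G_module)

lemma NF_abelian: "abelian_group NF"
  by (intro abelian_group_fun_ring abelian_group_truncate Ne.abelian_group_axioms)

lemma M_simps [simp]:
  "carrier (mlev_e M) = carrier G \<rightarrow>\<^sub>E carrier A" "x \<oplus>\<^bsub>mlev_e M\<^esub> x' = x \<oplus>\<^bsub>FA\<^esub> x'"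
  "r \<odot>\<^bsub>mlev_e M\<^esub> x = fst \<eta> r \<otimes>\<^bsub>FA\<^esub> x"
  "carrier (mlev_G M) = carrier A" "a \<oplus>\<^bsub>mlev_G M\<^esub> a' = a \<oplus>\<^bsub>A\<^esub> a'"
  "r' \<odot>\<^bsub>mlev_G M\<^esub> a = snd \<eta> r' \<otimes>\<^bsub>A\<^esub> a"
  "mact M = act S" "mres M = res S" "mtr M = tr S"
  by (simp_all add: algebra_module_def ring.defs ring_def fun_ring_def)

lemma mact_simps [simp]:
  assumes g: "g \<in> carrier G"
  shows "y \<in> carrier Ne \<Longrightarrow> mact N g y \<in> carrier Ne"
    "y \<in> carrier Ne \<Longrightarrow> y' \<in> carrier Ne \<Longrightarrow> mact N g (y \<oplus>\<^bsub>Ne\<^esub> y') = mact N g y \<oplus>\<^bsub>Ne\<^esub> mact N g y'"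
    "r \<in> carrier A \<Longrightarrow> y \<in> carrier Ne \<Longrightarrow> mact N g (r \<odot>\<^bsub>Ne\<^esub> y) = act R g r \<odot>\<^bsub>Ne\<^esub> mact N g y"
  using N.mact_hom[OF g] N.mact_smult[OF g, of r y] by (auto simp: hom_def)

lemma mres_simps [simp]:
  "b \<in> carrier NG \<Longrightarrow> mres N b \<in> carrier Ne"
  "b \<in> carrier NG \<Longrightarrow> b' \<in> carrier NG \<Longrightarrow> mres N (b \<oplus>\<^bsub>NG\<^esub> b') = mres N b \<oplus>\<^bsub>Ne\<^esub> mres N b'"
  using N.mres_hom by (auto simp: hom_def)

lemma mtr_closed [simp]: "y \<in> carrier Ne \<Longrightarrow> mtr N y \<in> carrier NG"
  using N.mtr_hom by (auto simp: hom_def)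

lemma mact_inv: "\<lbrakk>g \<in> carrier G; y \<in> carrier Ne\<rbrakk> \<Longrightarrow> mact N g (mact N (inv g) y) = y"
  "\<lbrakk>g \<in> carrier G; y \<in> carrier Ne\<rbrakk> \<Longrightarrow> mact N (inv g) (mact N g y) = y"
  by (simp_all add: N.mact_mult[symmetric] N.mact_one)

text \<open>The identification of \<open>x \<otimes> y\<close> with a function on \<open>G\<close>.
  The twist by \<open>g\<close> makes it balanced, as \<open>fst \<eta> r\<close> has the value
  \<open>act R g r\<close> at \<open>g\<close>.\<close>

definition te :: "('c \<Rightarrow> 'e) \<times> 'm \<Rightarrow> 'c \<Rightarrow> 'm" where
  "te = (\<lambda>(x, y). \<lambda>g\<in>carrier G. x g \<odot>\<^bsub>Ne\<^esub> mact N g y)"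

text \<open>The inverse: a function is the sum of its values, each placed at its point
  \<open>g\<close> and with the twist by \<open>g\<close> undone.\<close>

definition se :: "('c \<Rightarrow> 'm) \<Rightarrow> (('c \<Rightarrow> 'e) \<times> 'm) frag" where
  "se F = (\<Sum>g\<in>carrier G. frag_of (pt g \<one>\<^bsub>A\<^esub>, mact N (inv g) (F g)))"

definition Rel_e :: "(('c \<Rightarrow> 'e) \<times> 'm) frag set" where
  "Rel_e = tensor_relations A (mlev_e M) Ne Pair"

lemma sum_of_pt: "x \<in> carrier G \<rightarrow>\<^sub>E carrier A \<Longrightarrow> (\<Oplus>\<^bsub>FA\<^esub>g\<in>carrier G. pt g (x g)) = x"
proof (rule PiE_ext[where s = "\<lambda>_. carrier A"])
  assume x: "x \<in> carrier G \<rightarrow>\<^sub>E carrier A"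
  have p: "(\<lambda>g. pt g (x g)) \<in> carrier G \<rightarrow> carrier G \<rightarrow>\<^sub>E carrier A"
    using PiE_mem[OF x] by auto
  show "(\<Oplus>\<^bsub>FA\<^esub>g\<in>carrier G. pt g (x g)) \<in> carrier G \<rightarrow>\<^sub>E carrier A"
    using FA.finsum_closed[of "\<lambda>g. pt g (x g)" "carrier G"] p by simp
  fix h assume h: "h \<in> carrier G"
  have "(\<Oplus>\<^bsub>FA\<^esub>g\<in>carrier G. pt g (x g)) h = (\<Oplus>\<^bsub>A\<^esub>g\<in>carrier G. pt g (x g) h)"
    by (rule fun_ring_finsum[OF A.is_cring h p])
  also have "\<dots> = (\<Oplus>\<^bsub>A\<^esub>g\<in>carrier G. if h = g then x g else \<zero>\<^bsub>A\<^esub>)"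
    by (rule A.finsum_cong') (use h PiE_mem[OF x] in \<open>auto simp: pt_apply\<close>)
  also have "\<dots> = x h"
    by (rule A.finsum_singleton) (use h PiE_mem[OF x] finite_carrier in auto)
  finally show "(\<Oplus>\<^bsub>FA\<^esub>g\<in>carrier G. pt g (x g)) h = x h" .
qed auto

lemma te_closed: "te \<in> box_gens_e M N \<rightarrow> carrier NF"
proof (rule Pi_I)
  fix z assume "z \<in> box_gens_e M N"
  then obtain x y where z: "z = (x, y)" "x \<in> carrier G \<rightarrow>\<^sub>E carrier A" "y \<in> carrier Ne"
    by (auto simp: box_gens_e_def)
  then show "te z \<in> carrier NF"
    using PiE_mem[OF z(2)] by (simp add: te_def)
qed

lemma finsum_delta_smult:
  assumes h: "h \<in> carrier G" and F: "\<And>g. g \<in> carrier G \<Longrightarrow> F g \<in> carrier Ne"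
  shows "(\<Oplus>\<^bsub>Ne\<^esub>g\<in>carrier G. pt g \<one>\<^bsub>A\<^esub> h \<odot>\<^bsub>Ne\<^esub> F g) = F h"
    "(\<Oplus>\<^bsub>Ne\<^esub>g\<in>carrier G. pt h \<one>\<^bsub>A\<^esub> g \<odot>\<^bsub>Ne\<^esub> F g) = F h"
proof -
  have "(\<Oplus>\<^bsub>Ne\<^esub>g\<in>carrier G. pt g \<one>\<^bsub>A\<^esub> h \<odot>\<^bsub>Ne\<^esub> F g) = (\<Oplus>\<^bsub>Ne\<^esub>g\<in>carrier G. if h = g then F g else \<zero>\<^bsub>Ne\<^esub>)"
    by (rule Ne.finsum_cong') (use h F in \<open>auto simp: pt_apply\<close>)
  also have "\<dots> = F h" by (rule Ne.finsum_singleton) (use h F finite_carrier in auto)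
  finally show "(\<Oplus>\<^bsub>Ne\<^esub>g\<in>carrier G. pt g \<one>\<^bsub>A\<^esub> h \<odot>\<^bsub>Ne\<^esub> F g) = F h" .
  have "(\<Oplus>\<^bsub>Ne\<^esub>g\<in>carrier G. pt h \<one>\<^bsub>A\<^esub> g \<odot>\<^bsub>Ne\<^esub> F g) = (\<Oplus>\<^bsub>Ne\<^esub>g\<in>carrier G. if h = g then F g else \<zero>\<^bsub>Ne\<^esub>)"
    by (rule Ne.finsum_cong') (use h F in \<open>auto simp: pt_apply\<close>)
  also have "\<dots> = F h" by (rule Ne.finsum_singleton) (use h F finite_carrier in auto)
  finally show "(\<Oplus>\<^bsub>Ne\<^esub>g\<in>carrier G. pt h \<one>\<^bsub>A\<^esub> g \<odot>\<^bsub>Ne\<^esub> F g) = F h" .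
qed

lemma NF_finsum:
  assumes "h \<in> carrier G" "f \<in> I \<rightarrow> carrier G \<rightarrow>\<^sub>E carrier Ne"
  shows "(\<Oplus>\<^bsub>NF\<^esub>i\<in>I. f i) h = (\<Oplus>\<^bsub>Ne\<^esub>i\<in>I. f i h)"
proof -
  have "(\<lambda>F. F h) \<in> hom (add_monoid NF) (add_monoid Ne)"
    using assms(1) by (simp add: hom_def Pi_def PiE_def)
  from additive_hom_finsum[OF NF_abelian Ne.abelian_group_axioms this, of f I] assms(2)
  show ?thesis by simp
qed

lemma keys_sum_frag_of: "(\<And>i. i \<in> I \<Longrightarrow> x i \<in> X) \<Longrightarrow> Poly_Mapping.keys (\<Sum>i\<in>I. frag_of (x i)) \<subseteq> X"
  using sum_closed_free_Abelian_group[of I "\<lambda>i. frag_of (x i)" X] by (simp add: keys_frag_of)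

text \<open>Stated for any constructor \<open>t\<close>, because \<open>Pair\<close> at level
  \<open>G/e\<close> and \<open>TrTen\<close> at level \<open>G/G\<close> obey the same
  relations.\<close>

lemma tensor_rel:
  assumes "x \<in> carrier G \<rightarrow>\<^sub>E carrier A" "y \<in> carrier Ne"
  shows "\<And>x'. x' \<in> carrier G \<rightarrow>\<^sub>E carrier A \<Longrightarrow>
      frag_of (t (x \<oplus>\<^bsub>FA\<^esub> x') y) - frag_of (t x y) - frag_of (t x' y) \<in> tensor_relations A (mlev_e M) Ne t"
    "\<And>y'. y' \<in> carrier Ne \<Longrightarrow>
      frag_of (t x (y \<oplus>\<^bsub>Ne\<^esub> y')) - frag_of (t x y) - frag_of (t x y') \<in> tensor_relations A (mlev_e M) Ne t"
    "\<And>r. r \<in> carrier A \<Longrightarrow>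
      frag_of (t (fst \<eta> r \<otimes>\<^bsub>FA\<^esub> x) y) - frag_of (t x (r \<odot>\<^bsub>Ne\<^esub> y)) \<in> tensor_relations A (mlev_e M) Ne t"
  unfolding tensor_relations_def M_simps
  by (rule UnI1, rule UnI1, rule CollectI, use assms in blast,
      rule UnI1, rule UnI2, rule CollectI, use assms in blast,
      rule UnI2, rule CollectI, use assms in blast)

lemma te_add_l:
  assumes that: "a \<in> carrier (mlev_e M)" "a' \<in> carrier (mlev_e M)" "b \<in> carrier Ne"
  shows "te (a \<oplus>\<^bsub>mlev_e M\<^esub> a', b) = te (a, b) \<oplus>\<^bsub>NF\<^esub> te (a', b)"
  unfolding te_def prod.case fun_ring_simps(3)
  proof (rule restrict_ext)
  fix g assume g: "g \<in> carrier G"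
  have "a g \<in> carrier A" "a' g \<in> carrier A" using that g PiE_mem[of _ "carrier G" "\<lambda>_. carrier A"] by simp_all
  then show "(a \<oplus>\<^bsub>mlev_e M\<^esub> a') g \<odot>\<^bsub>Ne\<^esub> mact N g b =
      (\<lambda>g\<in>carrier G. a g \<odot>\<^bsub>Ne\<^esub> mact N g b) g \<oplus>\<^bsub>ring.truncate Ne\<^esub>
      (\<lambda>g\<in>carrier G. a' g \<odot>\<^bsub>Ne\<^esub> mact N g b) g"
    using g that by (simp add: Ne.smult_l_distr)
  qed

lemma te_add_r:
  assumes that: "a \<in> carrier (mlev_e M)" "b \<in> carrier Ne" "b' \<in> carrier Ne"
  shows "te (a, b \<oplus>\<^bsub>Ne\<^esub> b') = te (a, b) \<oplus>\<^bsub>NF\<^esub> te (a, b')"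
  unfolding te_def prod.case fun_ring_simps(3)
  proof (rule restrict_ext)
  fix g assume g: "g \<in> carrier G"
  have "a g \<in> carrier A" using that g PiE_mem[of a "carrier G" "\<lambda>_. carrier A"] by simp
  then show "a g \<odot>\<^bsub>Ne\<^esub> mact N g (b \<oplus>\<^bsub>Ne\<^esub> b') =
      (\<lambda>g\<in>carrier G. a g \<odot>\<^bsub>Ne\<^esub> mact N g b) g \<oplus>\<^bsub>ring.truncate Ne\<^esub>
      (\<lambda>g\<in>carrier G. a g \<odot>\<^bsub>Ne\<^esub> mact N g b') g"
    using g that by (simp add: Ne.smult_r_distr)
  qed

lemma te_balanced:
  assumes that: "r \<in> carrier A" "a \<in> carrier (mlev_e M)" "b \<in> carrier Ne"
  shows "te (r \<odot>\<^bsub>mlev_e M\<^esub> a, b) = te (a, r \<odot>\<^bsub>Ne\<^esub> b)"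
  unfolding te_def prod.case
  proof (rule restrict_ext)
  fix g assume g: "g \<in> carrier G"
  have c: "a g \<in> carrier A" "act R g r \<in> carrier A"
    using that g PiE_mem[of a "carrier G" "\<lambda>_. carrier A"] by simp_all
  show "(r \<odot>\<^bsub>mlev_e M\<^esub> a) g \<odot>\<^bsub>Ne\<^esub> mact N g b = a g \<odot>\<^bsub>Ne\<^esub> mact N g (r \<odot>\<^bsub>Ne\<^esub> b)"
    using g that c by (simp add: Ne.smult_assoc1[symmetric] A.m_comm)
  qed

lemma M_add_closed: "\<lbrakk>a \<in> carrier (mlev_e M); a' \<in> carrier (mlev_e M)\<rbrakk> \<Longrightarrow> a \<oplus>\<^bsub>mlev_e M\<^esub> a' \<in> carrier (mlev_e M)"
  using FA.a_closed[of a a'] by (simp del: fun_ring_simps(3))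

lemma M_smult_closed: "\<lbrakk>r \<in> carrier A; a \<in> carrier (mlev_e M)\<rbrakk> \<Longrightarrow> r \<odot>\<^bsub>mlev_e M\<^esub> a \<in> carrier (mlev_e M)"
  using tambara_homD(8)[OF unit_hom, of r] FA.m_closed[of "fst \<eta> r" a] by (simp del: fun_ring_simps(2))

text \<open>The relations suffice because \<open>x \<otimes> y\<close> is the sum of the
  \<open>pt g (x g) \<otimes> y\<close>, and \<open>pt g (x g)\<close> is a scalar times the
  indicator of \<open>g\<close>; the scalar moves across to \<open>y\<close>.\<close>

lemma presentation_e: "frag_presentation NF Rel_e (box_gens_e M N) te se"
proof (rule frag_presentation.intro[OF NF_abelian], rule frag_presentation_axioms.intro)
  interpret NF: abelian_group NF by (rule NF_abelian)
  interpret frag_subgroup "frag_span Rel_e" by (rule frag_subgroup_span)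
  show "te \<in> box_gens_e M N \<rightarrow> carrier NF" by (rule te_closed)
  have rel: "Poly_Mapping.keys r \<subseteq> box_gens_e M N \<and> frag_value NF te r = \<zero>\<^bsub>NF\<^esub>" if "r \<in> Rel_e" for r
  proof (rule tensor_relations_value[OF NF_abelian te_closed _ _ _ _ _ _ _ _ that[unfolded Rel_e_def]])
    show "Pair a b \<in> box_gens_e M N" if "a \<in> carrier (mlev_e M)" "b \<in> carrier Ne" for a b
      using that by (simp add: box_gens_e_def)
    show "a \<oplus>\<^bsub>mlev_e M\<^esub> a' \<in> carrier (mlev_e M)" if "a \<in> carrier (mlev_e M)" "a' \<in> carrier (mlev_e M)" for a a'
      by (rule M_add_closed[OF that])
    show "r \<odot>\<^bsub>mlev_e M\<^esub> a \<in> carrier (mlev_e M)" if "r \<in> carrier A" "a \<in> carrier (mlev_e M)" for r a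
      by (rule M_smult_closed[OF that])
    show "te (a \<oplus>\<^bsub>mlev_e M\<^esub> a', b) = te (a, b) \<oplus>\<^bsub>NF\<^esub> te (a', b)"
      if "a \<in> carrier (mlev_e M)" "a' \<in> carrier (mlev_e M)" "b \<in> carrier Ne" for a a' b
      by (rule te_add_l[OF that])
    show "te (a, b \<oplus>\<^bsub>Ne\<^esub> b') = te (a, b) \<oplus>\<^bsub>NF\<^esub> te (a, b')"
      if "a \<in> carrier (mlev_e M)" "b \<in> carrier Ne" "b' \<in> carrier Ne" for a b b'
      by (rule te_add_r[OF that])
    show "te (r \<odot>\<^bsub>mlev_e M\<^esub> a, b) = te (a, r \<odot>\<^bsub>Ne\<^esub> b)"
      if "r \<in> carrier A" "a \<in> carrier (mlev_e M)" "b \<in> carrier Ne" for r a b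
      by (rule te_balanced[OF that])
  qed auto
  then show "Poly_Mapping.keys r \<subseteq> box_gens_e M N" "frag_value NF te r = \<zero>\<^bsub>NF\<^esub>" if "r \<in> Rel_e" for r
    using that by auto
  have gens: "(pt g \<one>\<^bsub>A\<^esub>, mact N (inv g) (F g)) \<in> box_gens_e M N"
    if "F \<in> carrier NF" "g \<in> carrier G" for F g
    using that PiE_mem[of F "carrier G" "\<lambda>_. carrier Ne"] by (simp add: box_gens_e_def)
  show keys: "Poly_Mapping.keys (se F) \<subseteq> box_gens_e M N" if "F \<in> carrier NF" for F
    unfolding se_def by (rule keys_sum_frag_of) (rule gens[OF that])
  show "frag_value NF te (se F) = F" if F: "F \<in> carrier NF" for F
  proof (rule PiE_ext[where s = "\<lambda>_. carrier Ne"])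
    have te': "te (pt g \<one>\<^bsub>A\<^esub>, mact N (inv g) (F g)) \<in> carrier G \<rightarrow>\<^sub>E carrier Ne" if "g \<in> carrier G" for g
      using te_closed gens[OF F that] by auto
    show "frag_value NF te (se F) \<in> carrier G \<rightarrow>\<^sub>E carrier Ne"
      using NF.frag_value_closed[OF te_closed keys[OF F]] by simp
    show "F \<in> carrier G \<rightarrow>\<^sub>E carrier Ne" using F by simp
    fix h assume h: "h \<in> carrier G"
    have Fc: "F g \<in> carrier Ne" if "g \<in> carrier G" for g using F that PiE_mem[of F "carrier G" "\<lambda>_. carrier Ne"] by simp
    have "frag_value NF te (se F) = (\<Oplus>\<^bsub>NF\<^esub>g\<in>carrier G. te (pt g \<one>\<^bsub>A\<^esub>, mact N (inv g) (F g)))"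
      unfolding se_def
      by (subst NF.frag_value_sum[OF te_closed finite_carrier])
        (use gens[OF F] te' in \<open>auto simp: keys_frag_of NF.frag_value_of intro!: NF.finsum_cong'\<close>)
    then have "frag_value NF te (se F) h = (\<Oplus>\<^bsub>Ne\<^esub>g\<in>carrier G. te (pt g \<one>\<^bsub>A\<^esub>, mact N (inv g) (F g)) h)"
      using te' by (simp add: NF_finsum[OF h])
    also have "\<dots> = (\<Oplus>\<^bsub>Ne\<^esub>g\<in>carrier G. pt g \<one>\<^bsub>A\<^esub> h \<odot>\<^bsub>Ne\<^esub> mact N h (mact N (inv g) (F g)))"
      by (rule Ne.finsum_cong') (use h Fc in \<open>auto simp: te_def pt_apply\<close>)
    also have "\<dots> = mact N h (mact N (inv h) (F h))"
      by (rule finsum_delta_smult(1)[OF h]) (use h Fc in auto)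
    finally show "frag_value NF te (se F) h = F h" using h Fc by (simp add: mact_inv)
  qed
  show "se (F \<oplus>\<^bsub>NF\<^esub> F') - se F - se F' \<in> frag_span Rel_e" if F: "F \<in> carrier NF" "F' \<in> carrier NF" for F F'
  proof -
    have Fc: "F g \<in> carrier Ne" "F' g \<in> carrier Ne" if "g \<in> carrier G" for g
      using F that PiE_mem[of _ "carrier G" "\<lambda>_. carrier Ne"] by simp_all
    have "(\<Sum>g\<in>carrier G. frag_of (pt g \<one>\<^bsub>A\<^esub>, mact N (inv g) ((F \<oplus>\<^bsub>NF\<^esub> F') g)) -
        frag_of (pt g \<one>\<^bsub>A\<^esub>, mact N (inv g) (F g)) - frag_of (pt g \<one>\<^bsub>A\<^esub>, mact N (inv g) (F' g))) \<in> frag_span Rel_e"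
    proof (rule sum)
      fix g assume g: "g \<in> carrier G"
      show "frag_of (pt g \<one>\<^bsub>A\<^esub>, mact N (inv g) ((F \<oplus>\<^bsub>NF\<^esub> F') g)) -
          frag_of (pt g \<one>\<^bsub>A\<^esub>, mact N (inv g) (F g)) - frag_of (pt g \<one>\<^bsub>A\<^esub>, mact N (inv g) (F' g)) \<in> frag_span Rel_e"
        using tensor_rel(2)[of "pt g \<one>\<^bsub>A\<^esub>" "mact N (inv g) (F g)" "mact N (inv g) (F' g)" Pair] g Fc
        by (intro frag_span_base) (simp add: Rel_e_def)
    qed
    then show ?thesis by (simp add: se_def sum_subtractf)
  qed
  show "frag_of z - se (te z) \<in> frag_span Rel_e" if z: "z \<in> box_gens_e M N" for z
  proof -
    obtain x y where xy: "z = (x, y)" "x \<in> carrier G \<rightarrow>\<^sub>E carrier A" "y \<in> carrier Ne"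
      using z by (auto simp: box_gens_e_def)
    have xc: "x g \<in> carrier A" if "g \<in> carrier G" for g by (rule PiE_mem[OF xy(2) that])
    have 1: "frag_of (\<Oplus>\<^bsub>FA\<^esub>g\<in>carrier G. pt g (x g), y) - (\<Sum>g\<in>carrier G. frag_of (pt g (x g), y)) \<in> frag_span Rel_e"
    proof (rule additive_finsum[where A = FA])
      show "abelian_group FA" by (rule FA.abelian_group_axioms)
      fix a b assume "a \<in> carrier FA" "b \<in> carrier FA"
      then show "frag_of (a \<oplus>\<^bsub>FA\<^esub> b, y) - frag_of (a, y) - frag_of (b, y) \<in> frag_span Rel_e"
        using tensor_rel(1)[of a y b Pair] xy by (intro frag_span_base) (simp add: Rel_e_def)
    qed (use xc finite_carrier in auto)
    have 2: "(\<Sum>g\<in>carrier G. frag_of (pt g (x g), y)) - se (te z) \<in> frag_span Rel_e"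
      unfolding se_def
    proof (rule sum_cong)
      fix g assume g: "g \<in> carrier G"
      have "mact N (inv g) (te z g) = act R (inv g) (x g) \<odot>\<^bsub>Ne\<^esub> y"
        using g xy xc by (simp add: te_def mact_inv)
      then show "frag_of (pt g (x g), y) - frag_of (pt g \<one>\<^bsub>A\<^esub>, mact N (inv g) (te z g)) \<in> frag_span Rel_e"
        using tensor_rel(3)[of "pt g \<one>\<^bsub>A\<^esub>" y "act R (inv g) (x g)" Pair] g xc xy
        unfolding pt_eta[OF g xc[OF g], symmetric]
        by (intro frag_span_base) (simp add: Rel_e_def)
    qed
    show ?thesis using trans[OF 1 2] xy by (simp add: sum_of_pt)
  qed
qed

text \<open>\<open>Ten a b\<close> becomes a multiple of a restriction, and \<open>TrTen x y\<close>
  the sum of the values of \<open>te (x, y)\<close>, as for the transfer of a coinduced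
  module.\<close>

definition tG :: "('e, 'n, 'c \<Rightarrow> 'e, 'm) box_gen \<Rightarrow> 'm" where
  "tG u = (case u of Ten a b \<Rightarrow> a \<odot>\<^bsub>Ne\<^esub> mres N b | TrTen x y \<Rightarrow> \<Oplus>\<^bsub>Ne\<^esub>g\<in>carrier G. te (x, y) g)"

text \<open>The formal transfer from the copy of \<open>N(G/e)\<close> supported at the unit of
  \<open>G\<close>.\<close>

definition sG :: "'m \<Rightarrow> ('e, 'n, 'c \<Rightarrow> 'e, 'm) box_gen frag" where
  "sG n = frag_of (TrTen (pt \<one> \<one>\<^bsub>A\<^esub>) n)"

definition Rel_G :: "('e, 'n, 'c \<Rightarrow> 'e, 'm) box_gen frag set" where
  "Rel_G = tensor_relations (lev_G \<Gamma>) (mlev_G M) NG Ten \<union>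
      tensor_relations A (mlev_e M) Ne TrTen \<union>
      {frag_of (TrTen (mact M g x) (mact N g y)) - frag_of (TrTen x y) | g x y.
         g \<in> carrier G \<and> x \<in> carrier (mlev_e M) \<and> y \<in> carrier Ne} \<union>
      {frag_of (Ten (mtr M x) b) - frag_of (TrTen x (mres N b)) | x b.
         x \<in> carrier (mlev_e M) \<and> b \<in> carrier NG} \<union>
      {frag_of (Ten a (mtr N y)) - frag_of (TrTen (mres M a) y) | a y.
         a \<in> carrier (mlev_G M) \<and> y \<in> carrier Ne}"

lemma box_kernel_eq: "box_kernel_e \<Gamma> M N = frag_span Rel_e" "box_kernel_G G \<Gamma> M N = frag_span Rel_G"
  by (simp_all only: box_kernel_e_def box_kernel_G_def Rel_e_def Rel_G_def ghost_simps(1))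

lemma te_apply: "g \<in> carrier G \<Longrightarrow> te (x, y) g = x g \<odot>\<^bsub>Ne\<^esub> mact N g y"
  by (simp add: te_def)

lemma te_in:
  assumes "x \<in> carrier G \<rightarrow>\<^sub>E carrier A" "y \<in> carrier Ne"
  shows "te (x, y) \<in> carrier G \<rightarrow>\<^sub>E carrier Ne" "\<And>g. g \<in> carrier G \<Longrightarrow> te (x, y) g \<in> carrier Ne"
proof -
  show "te (x, y) \<in> carrier G \<rightarrow>\<^sub>E carrier Ne"
    using te_closed assms by (auto simp: box_gens_e_def)
  then show "\<And>g. g \<in> carrier G \<Longrightarrow> te (x, y) g \<in> carrier Ne" by (rule PiE_mem)
qed

lemma tG_simps [simp]:
  "tG (Ten a b) = a \<odot>\<^bsub>Ne\<^esub> mres N b" "tG (TrTen x y) = (\<Oplus>\<^bsub>Ne\<^esub>g\<in>carrier G. te (x, y) g)"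
  by (simp_all add: tG_def)

lemma gens_G_iff [simp]:
  "Ten a b \<in> box_gens_G M N \<longleftrightarrow> a \<in> carrier A \<and> b \<in> carrier NG"
  "TrTen x y \<in> box_gens_G M N \<longleftrightarrow> x \<in> carrier G \<rightarrow>\<^sub>E carrier A \<and> y \<in> carrier Ne"
  by (auto simp: box_gens_G_def)

lemma NF_sum_add:
  assumes "\<And>g. g \<in> carrier G \<Longrightarrow> F g \<in> carrier Ne" "\<And>g. g \<in> carrier G \<Longrightarrow> F' g \<in> carrier Ne"
  shows "(\<Oplus>\<^bsub>Ne\<^esub>g\<in>carrier G. (F \<oplus>\<^bsub>NF\<^esub> F') g) = (\<Oplus>\<^bsub>Ne\<^esub>g\<in>carrier G. F g) \<oplus>\<^bsub>Ne\<^esub> (\<Oplus>\<^bsub>Ne\<^esub>g\<in>carrier G. F' g)"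
proof -
  have "(\<Oplus>\<^bsub>Ne\<^esub>g\<in>carrier G. (F \<oplus>\<^bsub>NF\<^esub> F') g) = (\<Oplus>\<^bsub>Ne\<^esub>g\<in>carrier G. F g \<oplus>\<^bsub>Ne\<^esub> F' g)"
    by (rule Ne.finsum_cong') (use assms in auto)
  then show ?thesis using assms by (simp add: Ne.finsum_addf Pi_def)
qed

lemma tG_closed: "tG \<in> box_gens_G M N \<rightarrow> carrier Ne"
proof (rule Pi_I)
  fix u assume "u \<in> box_gens_G M N"
  then show "tG u \<in> carrier Ne"
    by (cases u) (auto intro!: Ne.finsum_closed te_in(2))
qed

lemma smult_finsum_left:
  assumes "f \<in> I \<rightarrow> carrier A" "y \<in> carrier Ne"
  shows "(\<Oplus>\<^bsub>A\<^esub>i\<in>I. f i) \<odot>\<^bsub>Ne\<^esub> y = (\<Oplus>\<^bsub>Ne\<^esub>i\<in>I. f i \<odot>\<^bsub>Ne\<^esub> y)"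
proof -
  have "(\<lambda>a. a \<odot>\<^bsub>Ne\<^esub> y) \<in> hom (add_monoid A) (add_monoid Ne)"
    using assms(2) by (auto simp: hom_def Ne.smult_l_distr)
  from additive_hom_finsum[OF A.abelian_group_axioms Ne.abelian_group_axioms this assms(1)] show ?thesis .
qed

text \<open>One case for each family of relations. Invariance of transfers is the substitution
  \<open>h \<mapsto> h \<otimes> g\<close>; the two Frobenius families use that restrictions are
  fixed and the double coset formula of \<open>N\<close>.\<close>

lemma Rel_G_value:
  assumes r: "r \<in> Rel_G"
  shows "Poly_Mapping.keys r \<subseteq> box_gens_G M N \<and> frag_value Ne tG r = \<zero>\<^bsub>Ne\<^esub>"
proof -
  have Mapp: "x g \<in> carrier A" if "x \<in> carrier (mlev_e M)" "g \<in> carrier G" for x g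
    using that PiE_mem[of x "carrier G" "\<lambda>_. carrier A"] by simp
  have eta: "snd \<eta> s \<in> carrier A" if "s \<in> carrier (lev_G \<Gamma>)" for s
    using tambara_homD(9)[OF unit_hom that] by simp
  have te2: "te (x, y) g \<in> carrier Ne" if "x \<in> carrier (mlev_e M)" "y \<in> carrier Ne" "g \<in> carrier G" for x y g
    using te_in(2)[of x y g] that by simp
  consider "r \<in> tensor_relations (lev_G \<Gamma>) (mlev_G M) NG Ten" | "r \<in> tensor_relations A (mlev_e M) Ne TrTen"
    | g x y where "r = frag_of (TrTen (mact M g x) (mact N g y)) - frag_of (TrTen x y)"
        "g \<in> carrier G" "x \<in> carrier (mlev_e M)" "y \<in> carrier Ne"
    | x b where "r = frag_of (Ten (mtr M x) b) - frag_of (TrTen x (mres N b))"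
        "x \<in> carrier (mlev_e M)" "b \<in> carrier NG"
    | a y where "r = frag_of (Ten a (mtr N y)) - frag_of (TrTen (mres M a) y)"
        "a \<in> carrier (mlev_G M)" "y \<in> carrier Ne"
    using r unfolding Rel_G_def by blast
  then show ?thesis
  proof cases
    case 1
    show ?thesis
    proof (rule tensor_relations_value[OF Ne.abelian_group_axioms tG_closed _ _ _ _ _ _ _ _ 1])
      show "tG (Ten (s \<odot>\<^bsub>mlev_G M\<^esub> a) b) = tG (Ten a (s \<odot>\<^bsub>NG\<^esub> b))"
        if "s \<in> carrier (lev_G \<Gamma>)" "a \<in> carrier (mlev_G M)" "b \<in> carrier NG" for s a b
      proof -
        have "mres N (s \<odot>\<^bsub>NG\<^esub> b) = snd \<eta> s \<odot>\<^bsub>Ne\<^esub> mres N b"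
          using N.mres_smult[OF that(1,3)] by simp
        then show ?thesis
          using that eta[OF that(1)] by (simp add: Ne.smult_assoc1[symmetric] A.m_comm del: \<Gamma>.coind_unit_simps)
      qed
      show "s \<odot>\<^bsub>mlev_G M\<^esub> a \<in> carrier (mlev_G M)" if "s \<in> carrier (lev_G \<Gamma>)" "a \<in> carrier (mlev_G M)" for s a
        using that eta[OF that(1)] by (simp del: \<Gamma>.coind_unit_simps)
      show "s \<odot>\<^bsub>NG\<^esub> b \<in> carrier NG" if "s \<in> carrier (lev_G \<Gamma>)" "b \<in> carrier NG" for s b
        by (rule NG.smult_closed[OF that])
    qed (simp_all add: Ne.smult_l_distr Ne.smult_r_distr del: ghost_simps)
  next
    case 2
    show ?thesis
    proof (rule tensor_relations_value[OF Ne.abelian_group_axioms tG_closed _ _ _ _ _ _ _ _ 2])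
      show "tG (TrTen (a \<oplus>\<^bsub>mlev_e M\<^esub> a') b) = tG (TrTen a b) \<oplus>\<^bsub>Ne\<^esub> tG (TrTen a' b)"
        if "a \<in> carrier (mlev_e M)" "a' \<in> carrier (mlev_e M)" "b \<in> carrier Ne" for a a' b
        unfolding tG_simps te_add_l[OF that] using te2[OF that(1,3)] te2[OF that(2,3)]
        by (intro NF_sum_add) auto
      show "tG (TrTen a (b \<oplus>\<^bsub>Ne\<^esub> b')) = tG (TrTen a b) \<oplus>\<^bsub>Ne\<^esub> tG (TrTen a b')"
        if "a \<in> carrier (mlev_e M)" "b \<in> carrier Ne" "b' \<in> carrier Ne" for a b b'
        unfolding tG_simps te_add_r[OF that] using te2[OF that(1,2)] te2[OF that(1,3)]
        by (intro NF_sum_add) auto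
      show "tG (TrTen (s \<odot>\<^bsub>mlev_e M\<^esub> a) b) = tG (TrTen a (s \<odot>\<^bsub>Ne\<^esub> b))"
        if "s \<in> carrier A" "a \<in> carrier (mlev_e M)" "b \<in> carrier Ne" for s a b
        unfolding tG_simps te_balanced[OF that] ..
      show "TrTen a b \<in> box_gens_G M N" if "a \<in> carrier (mlev_e M)" "b \<in> carrier Ne" for a b
        using that by simp
    qed (rule M_add_closed M_smult_closed Ne.a_closed Ne.smult_closed; assumption)+
  next
    case (3 g x y)
    have x: "x \<in> carrier G \<rightarrow>\<^sub>E carrier A" using 3 by simp
    have sx: "act S g x \<in> carrier G \<rightarrow>\<^sub>E carrier A"
      using S.act_closed[OF 3(2), of x] x by (simp del: coind_simps(3))
    have "(\<Oplus>\<^bsub>Ne\<^esub>h\<in>carrier G. te (act S g x, mact N g y) h) = (\<Oplus>\<^bsub>Ne\<^esub>h\<in>carrier G. te (x, y) (h \<otimes> g))"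
    proof (rule Ne.finsum_cong')
      show "(\<lambda>h. te (x, y) (h \<otimes> g)) \<in> carrier G \<rightarrow> carrier Ne"
        using te_in(2)[OF x 3(4)] 3(2) by simp
      show "te (act S g x, mact N g y) h = te (x, y) (h \<otimes> g)" if "h \<in> carrier G" for h
        using 3 that by (simp add: te_apply N.mact_mult)
    qed simp
    also have "\<dots> = (\<Oplus>\<^bsub>Ne\<^esub>h\<in>carrier G. te (x, y) h)"
      by (rule Ne.add.finprod_bij[OF bij_right_mult[OF 3(2)]]) (use te_in(2)[OF x 3(4)] in auto)
    finally have eq: "tG (TrTen (act S g x) (mact N g y)) = tG (TrTen x y)" by simp
    show ?thesis unfolding 3(1) M_simps
      by (rule Ne.frag_value_relation2[OF tG_closed _ _ eq]) (use 3 x sx in \<open>simp_all del: coind_simps(3)\<close>)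
  next
    case (4 x b)
    have x: "x \<in> carrier G \<rightarrow>\<^sub>E carrier A" using 4 by simp
    have "(\<Oplus>\<^bsub>A\<^esub>g\<in>carrier G. x g) \<odot>\<^bsub>Ne\<^esub> mres N b = (\<Oplus>\<^bsub>Ne\<^esub>g\<in>carrier G. x g \<odot>\<^bsub>Ne\<^esub> mres N b)"
      by (rule smult_finsum_left) (use 4 PiE_mem[OF x] in auto)
    also have "\<dots> = (\<Oplus>\<^bsub>Ne\<^esub>g\<in>carrier G. te (x, mres N b) g)"
      by (rule Ne.finsum_cong') (use 4 PiE_mem[OF x] in \<open>auto simp: te_apply N.mact_mres\<close>)
    finally have eq: "tG (Ten (tr S x) b) = tG (TrTen x (mres N b))" by simp
    show ?thesis unfolding 4(1) M_simps
      by (rule Ne.frag_value_relation2[OF tG_closed _ _ eq])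
        (use 4 x PiE_mem[OF x] in \<open>auto intro!: A.finsum_closed\<close>)
  next
    case (5 a y)
    have "a \<odot>\<^bsub>Ne\<^esub> mres N (mtr N y) = (\<Oplus>\<^bsub>Ne\<^esub>g\<in>carrier G. a \<odot>\<^bsub>Ne\<^esub> mact N g y)"
      using 5 finite_carrier by (simp add: N.mres_mtr) (rule Ne.finsum_smult_ldistr, auto)
    also have "\<dots> = (\<Oplus>\<^bsub>Ne\<^esub>g\<in>carrier G. te (res S a, y) g)"
      by (rule Ne.finsum_cong') (use 5 in \<open>auto simp: te_apply\<close>)
    finally have eq: "tG (Ten a (mtr N y)) = tG (TrTen (res S a) y)" by simp
    show ?thesis unfolding 5(1) M_simps
      by (rule Ne.frag_value_relation2[OF tG_closed _ _ eq]) (use 5 in auto)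
  qed
qed

lemma Rel_G_act:
  "\<lbrakk>g \<in> carrier G; x \<in> carrier (mlev_e M); y \<in> carrier Ne\<rbrakk> \<Longrightarrow>
    frag_of (TrTen (mact M g x) (mact N g y)) - frag_of (TrTen x y) \<in> Rel_G"
  unfolding Rel_G_def by blast

lemma Rel_G_frobenius:
  "\<lbrakk>x \<in> carrier (mlev_e M); b \<in> carrier NG\<rbrakk> \<Longrightarrow>
    frag_of (Ten (mtr M x) b) - frag_of (TrTen x (mres N b)) \<in> Rel_G"
  unfolding Rel_G_def by blast

text \<open>Every generator is brought to the form \<open>sG n\<close>: tensors become formal
  transfers, formal transfers are split into functions supported at one point, and invariance moves
  the support to the unit.\<close>

lemma presentation_G: "frag_presentation Ne Rel_G (box_gens_G M N) tG sG"
proof (rule frag_presentation.intro[OF Ne.abelian_group_axioms], rule frag_presentation_axioms.intro)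
  interpret frag_subgroup "frag_span Rel_G" by (rule frag_subgroup_span)
  show "tG \<in> box_gens_G M N \<rightarrow> carrier Ne" by (rule tG_closed)
  show "Poly_Mapping.keys r \<subseteq> box_gens_G M N" "frag_value Ne tG r = \<zero>\<^bsub>Ne\<^esub>" if "r \<in> Rel_G" for r
    using Rel_G_value[OF that] by auto
  have pt1: "pt \<one> a \<in> carrier G \<rightarrow>\<^sub>E carrier A" if "a \<in> carrier A" for a using that by simp
  have T: "tensor_relations A (mlev_e M) Ne TrTen \<subseteq> frag_span Rel_G"
    using frag_span_base[of _ Rel_G] by (auto simp: Rel_G_def)
  show "Poly_Mapping.keys (sG n) \<subseteq> box_gens_G M N" if "n \<in> carrier Ne" for n
    using that by (simp add: sG_def keys_frag_of)
  show "frag_value Ne tG (sG n) = n" if n: "n \<in> carrier Ne" for n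
  proof -
    have "tG (TrTen (pt \<one> \<one>\<^bsub>A\<^esub>) n) = (\<Oplus>\<^bsub>Ne\<^esub>g\<in>carrier G. pt \<one> \<one>\<^bsub>A\<^esub> g \<odot>\<^bsub>Ne\<^esub> mact N g n)"
      unfolding tG_simps by (rule Ne.finsum_cong') (use n in \<open>auto simp: te_apply pt_apply\<close>)
    also have "\<dots> = mact N \<one> n"
      by (rule finsum_delta_smult(2)) (use n in auto)
    finally have "tG (TrTen (pt \<one> \<one>\<^bsub>A\<^esub>) n) = n" using n by (simp add: N.mact_one)
    then show ?thesis using n Ne.frag_value_of[of tG "TrTen (pt \<one> \<one>\<^bsub>A\<^esub>) n"] by (simp add: sG_def)
  qed
  show "sG (a \<oplus>\<^bsub>Ne\<^esub> b) - sG a - sG b \<in> frag_span Rel_G" if "a \<in> carrier Ne" "b \<in> carrier Ne" for a b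
    using subsetD[OF T tensor_rel(2)[of "pt \<one> \<one>\<^bsub>A\<^esub>" a b TrTen]] that by (simp add: sG_def)
  have scal: "frag_of (TrTen (pt \<one> a) y) - frag_of (TrTen (pt \<one> \<one>\<^bsub>A\<^esub>) (a \<odot>\<^bsub>Ne\<^esub> y)) \<in> frag_span Rel_G"
    if "a \<in> carrier A" "y \<in> carrier Ne" for a y
    using subsetD[OF T tensor_rel(3)[of "pt \<one> \<one>\<^bsub>A\<^esub>" y a TrTen]] that pt_eta[of \<one> a]
    by (simp only: pt_closed A.one_closed one_closed inv_one act_one)
  show "frag_of u - sG (tG u) \<in> frag_span Rel_G" if u: "u \<in> box_gens_G M N" for u
  proof (cases u)
    case (Ten a b)
    then have ab: "a \<in> carrier A" "b \<in> carrier NG" using u by auto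
    \<comment> \<open>Every \<open>a\<close> is a transfer in \<open>S\<close>, which makes the
      Frobenius relation applicable to \<open>Ten a b\<close>.\<close>
    have "tr S (pt \<one> a) = a" using ab by (simp add: sum_pt)
    then have 1: "frag_of (Ten a b) - frag_of (TrTen (pt \<one> a) (mres N b)) \<in> frag_span Rel_G"
      using frag_span_base[OF Rel_G_frobenius[of "pt \<one> a" b]] ab pt1[OF ab(1)] by (simp only: M_simps)
    have 2: "frag_of (TrTen (pt \<one> a) (mres N b)) - sG (a \<odot>\<^bsub>Ne\<^esub> mres N b) \<in> frag_span Rel_G"
      unfolding sG_def by (rule scal) (use ab in auto)
    show ?thesis using trans[OF 1 2] by (simp add: Ten)
  next
    case (TrTen x y)
    then have xy: "x \<in> carrier G \<rightarrow>\<^sub>E carrier A" "y \<in> carrier Ne" using u by auto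
    have xc: "x g \<in> carrier A" if "g \<in> carrier G" for g by (rule PiE_mem[OF xy(1) that])
    have 1: "frag_of (TrTen (\<Oplus>\<^bsub>FA\<^esub>g\<in>carrier G. pt g (x g)) y) - (\<Sum>g\<in>carrier G. frag_of (TrTen (pt g (x g)) y)) \<in> frag_span Rel_G"
    proof (rule additive_finsum[where A = FA and F = "\<lambda>x. frag_of (TrTen x y)"])
      show "abelian_group FA" by (rule FA.abelian_group_axioms)
      fix a b assume "a \<in> carrier FA" "b \<in> carrier FA"
      then show "frag_of (TrTen (a \<oplus>\<^bsub>FA\<^esub> b) y) - frag_of (TrTen a y) - frag_of (TrTen b y) \<in> frag_span Rel_G"
        using subsetD[OF T tensor_rel(1)[of a y b TrTen]] xy by simp
    qed (use xc finite_carrier in auto)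
    have 2: "(\<Sum>g\<in>carrier G. frag_of (TrTen (pt g (x g)) y)) -
        (\<Sum>g\<in>carrier G. sG (te (x, y) g)) \<in> frag_span Rel_G"
    proof (rule sum_cong)
      fix g assume g: "g \<in> carrier G"
      \<comment> \<open>Acting by \<open>g\<close> moves the support from \<open>g\<close> to the
        unit, at the price of replacing \<open>y\<close> by \<open>mact N g y\<close>.\<close>
      have e: "act S g (pt g (x g)) = pt \<one> (x g)" using g by (simp only: act_pt r_inv)
      have "pt g (x g) \<in> carrier (mlev_e M)" using xc[OF g] by simp
      from sym[OF frag_span_base[OF Rel_G_act[OF g this xy(2)]]]
      have "frag_of (TrTen (pt g (x g)) y) - frag_of (TrTen (pt \<one> (x g)) (mact N g y)) \<in> frag_span Rel_G"
        unfolding M_simps e .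
      moreover have "frag_of (TrTen (pt \<one> (x g)) (mact N g y)) - sG (te (x, y) g) \<in> frag_span Rel_G"
        unfolding sG_def te_apply[OF g] by (rule scal) (use g xc xy in auto)
      ultimately show "frag_of (TrTen (pt g (x g)) y) - sG (te (x, y) g) \<in> frag_span Rel_G"
        by (rule trans)
    qed
    have 3: "sG (\<Oplus>\<^bsub>Ne\<^esub>g\<in>carrier G. te (x, y) g) - (\<Sum>g\<in>carrier G. sG (te (x, y) g)) \<in> frag_span Rel_G"
    proof (rule additive_finsum[where A = Ne and F = sG])
      show "sG (a \<oplus>\<^bsub>Ne\<^esub> b) - sG a - sG b \<in> frag_span Rel_G" if "a \<in> carrier Ne" "b \<in> carrier Ne" for a b
        using subsetD[OF T tensor_rel(2)[of "pt \<one> \<one>\<^bsub>A\<^esub>" a b TrTen]] that by (simp add: sG_def)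
    qed (use te_in(2)[OF xy] finite_carrier Ne.abelian_group_axioms in auto)
    show ?thesis using trans[OF 1 trans[OF 2 sym[OF 3]]] xy by (simp add: TrTen sum_of_pt)
  qed
qed

sublocale Pe: frag_presentation NF Rel_e "box_gens_e M N" te se by (rule presentation_e)
sublocale PG: frag_presentation Ne Rel_G "box_gens_G M N" tG sG by (rule presentation_G)

lemma box_carriers:
  "carrier (mlev_e (box G \<Gamma> M N)) = Pe.cosets" "carrier (mlev_G (box G \<Gamma> M N)) = PG.cosets"
  "\<zero>\<^bsub>mlev_e (box G \<Gamma> M N)\<^esub> = Pe.K" "\<zero>\<^bsub>mlev_G (box G \<Gamma> M N)\<^esub> = PG.K"
  by (simp_all only: box_def green_module.simps frag_quotient_def box_kernel_eq Pe.cosets_def PG.cosets_def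
    partial_object.simps ring.simps)

end

section \<open>Exactness of the box product\<close>

definition postcompose :: "'x set \<Rightarrow> ('a \<Rightarrow> 'b) \<Rightarrow> ('x \<Rightarrow> 'a) \<Rightarrow> 'x \<Rightarrow> 'b" where
  "postcompose X K u = (\<lambda>x\<in>X. K (u x))"

lemma postcompose_apply: "x \<in> X \<Longrightarrow> postcompose X K u x = K (u x)"
  by (simp add: postcompose_def)

text \<open>A product of copies of an exact sequence is exact; preimages are chosen pointwise and
  restricted to \<open>X\<close>.\<close>

lemma PiE_postcompose_exact:
  fixes X :: "'x set"
  assumes ex: "inj_on F C1" "F ` C1 = {c \<in> C2. H c = z}" "H ` C2 = C3"
  shows "inj_on (postcompose X F) (X \<rightarrow>\<^sub>E C1)"
    "postcompose X F ` (X \<rightarrow>\<^sub>E C1) = {v \<in> (X \<rightarrow>\<^sub>E C2). postcompose X H v = (\<lambda>x\<in>X. z)}"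
    "postcompose X H ` (X \<rightarrow>\<^sub>E C2) = (X \<rightarrow>\<^sub>E C3)"
proof -
  have F: "F a \<in> C2" "H (F a) = z" if "a \<in> C1" for a using ex(2) that by auto
  show "inj_on (postcompose X F) (X \<rightarrow>\<^sub>E C1)"
  proof (rule inj_onI)
    fix u v assume uv: "u \<in> (X \<rightarrow>\<^sub>E C1)" "v \<in> (X \<rightarrow>\<^sub>E C1)" "postcompose X F u = postcompose X F v"
    show "u = v"
    proof (rule PiE_ext[OF uv(1,2)])
      fix x assume x: "x \<in> X"
      have "F (u x) = F (v x)" using postcompose_apply[OF x] uv(3) by metis
      then show "u x = v x" using inj_onD[OF ex(1)] PiE_mem[OF uv(1) x] PiE_mem[OF uv(2) x] by blast
    qed
  qed
  show "postcompose X F ` (X \<rightarrow>\<^sub>E C1) = {v \<in> (X \<rightarrow>\<^sub>E C2). postcompose X H v = (\<lambda>x\<in>X. z)}"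
  proof (intro equalityI subsetI)
    fix v assume "v \<in> postcompose X F ` (X \<rightarrow>\<^sub>E C1)"
    then obtain u where u: "u \<in> (X \<rightarrow>\<^sub>E C1)" "v = postcompose X F u" by auto
    then show "v \<in> {v \<in> (X \<rightarrow>\<^sub>E C2). postcompose X H v = (\<lambda>x\<in>X. z)}"
      using F PiE_mem[OF u(1)] by (auto simp: postcompose_def intro!: restrict_ext)
  next
    fix v assume v: "v \<in> {v \<in> (X \<rightarrow>\<^sub>E C2). postcompose X H v = (\<lambda>x\<in>X. z)}"
    have "\<exists>a\<in>C1. F a = v x" if x: "x \<in> X" for x
    proof -
      have "H (v x) = z" using v postcompose_apply[OF x, of H v] x by simp
      then have "v x \<in> F ` C1" unfolding ex(2) using v PiE_mem[of v X "\<lambda>_. C2" x] x by simp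
      then show ?thesis by auto
    qed
    then obtain a where a: "\<And>x. x \<in> X \<Longrightarrow> a x \<in> C1 \<and> F (a x) = v x" by metis
    have 1: "restrict a X \<in> (X \<rightarrow>\<^sub>E C1)" using a by simp
    have "v = postcompose X F (restrict a X)"
    proof (rule PiE_ext)
      show "v \<in> (X \<rightarrow>\<^sub>E C2)" using v by simp
      show "postcompose X F (restrict a X) \<in> (X \<rightarrow>\<^sub>E C2)" 
        using a v PiE_mem[of v X "\<lambda>_. C2"] by (simp add: postcompose_def)
    qed (use a in \<open>simp add: postcompose_apply\<close>)
    then show "v \<in> postcompose X F ` (X \<rightarrow>\<^sub>E C1)" using 1 by auto
  qed
  show "postcompose X H ` (X \<rightarrow>\<^sub>E C2) = (X \<rightarrow>\<^sub>E C3)"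
  proof (intro equalityI subsetI)
    fix v assume "v \<in> postcompose X H ` (X \<rightarrow>\<^sub>E C2)"
    then obtain u where u: "u \<in> (X \<rightarrow>\<^sub>E C2)" "v = postcompose X H u" by auto
    then show "v \<in> (X \<rightarrow>\<^sub>E C3)" using ex(3) PiE_mem[OF u(1)] by (auto simp: postcompose_def)
  next
    fix v assume v: "v \<in> (X \<rightarrow>\<^sub>E C3)"
    have "\<exists>a\<in>C2. H a = v x" if x: "x \<in> X" for x
      using PiE_mem[OF v x] unfolding ex(3)[symmetric] by auto
    then obtain a where a: "\<And>x. x \<in> X \<Longrightarrow> a x \<in> C2 \<and> H (a x) = v x" by metis
    have 1: "restrict a X \<in> (X \<rightarrow>\<^sub>E C2)" using a by simp
    have "v = postcompose X H (restrict a X)"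
    proof (rule PiE_ext[OF v])
      show "postcompose X H (restrict a X) \<in> (X \<rightarrow>\<^sub>E C3)" 
        using a PiE_mem[OF v] by (simp add: postcompose_def)
    qed (use a in \<open>simp add: postcompose_apply\<close>)
    then show "v \<in> postcompose X H ` (X \<rightarrow>\<^sub>E C2)" using 1 by auto
  qed
qed

locale box_context_hom = N1: box_context G R N1 + N2: box_context G R N2
  for G :: "'c monoid" (structure) and R :: "('c, 'e, 'g) tambara"
    and N1 :: "('c, 'e, 'e \<times> 'g set, 'm, 'n) green_module"
    and N2 :: "('c, 'e, 'e \<times> 'g set, 'k, 'l) green_module" +
  fixes f :: "('m \<Rightarrow> 'k) \<times> ('n \<Rightarrow> 'l)"
  assumes f: "tambara_module_hom G (ghost G R) N1 N2 f"
begin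

lemma f_simps:
  "y \<in> carrier N1.Ne \<Longrightarrow> fst f y \<in> carrier N2.Ne"
  "b \<in> carrier N1.NG \<Longrightarrow> snd f b \<in> carrier N2.NG"
  "r \<in> carrier N1.A \<Longrightarrow> y \<in> carrier N1.Ne \<Longrightarrow> fst f (r \<odot>\<^bsub>N1.Ne\<^esub> y) = r \<odot>\<^bsub>N2.Ne\<^esub> fst f y"
  "g \<in> carrier G \<Longrightarrow> y \<in> carrier N1.Ne \<Longrightarrow> fst f (mact N1 g y) = mact N2 g (fst f y)"
  "b \<in> carrier N1.NG \<Longrightarrow> fst f (mres N1 b) = mres N2 (snd f b)"
  "y \<in> carrier N1.Ne \<Longrightarrow> y' \<in> carrier N1.Ne \<Longrightarrow> fst f (y \<oplus>\<^bsub>N1.Ne\<^esub> y') = fst f y \<oplus>\<^bsub>N2.Ne\<^esub> fst f y'"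
  using f by (auto simp: tambara_module_hom_def hom_def)

lemma f_hom: "fst f \<in> hom (add_monoid N1.Ne) (add_monoid N2.Ne)"
  using f by (simp add: tambara_module_hom_def)

definition post where "post u = (\<lambda>g\<in>carrier G. fst f (u g))"

lemma te_map:
  assumes "x \<in> carrier G \<rightarrow>\<^sub>E carrier N1.A" "y \<in> carrier N1.Ne"
  shows "N2.te (x, fst f y) = post (N1.te (x, y))"
  unfolding post_def
proof (rule PiE_ext[where s = "\<lambda>_. carrier N2.Ne"])
  show "N2.te (x, fst f y) \<in> carrier G \<rightarrow>\<^sub>E carrier N2.Ne" by (rule N2.te_in(1)) (use assms f_simps in auto)
  show "(\<lambda>g\<in>carrier G. fst f (N1.te (x, y) g)) \<in> carrier G \<rightarrow>\<^sub>E carrier N2.Ne"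
    using N1.te_in(2)[OF assms] f_simps(1) by simp
  show "N2.te (x, fst f y) g = (\<lambda>g\<in>carrier G. fst f (N1.te (x, y) g)) g" if "g \<in> carrier G" for g
    using that assms PiE_mem[OF assms(1) that] by (simp add: N1.te_apply N2.te_apply f_simps)
qed

text \<open>On generators this is \<open>te_map\<close>, as \<open>f\<close> commutes with scalars
  and with the action.\<close>

lemma box_map_e:
  assumes C: "C \<in> N1.Pe.cosets"
  shows "fst (box_map G N1.\<Gamma> N1.M N2 f) C \<in> N2.Pe.cosets \<and>
    N2.Pe.cval (fst (box_map G N1.\<Gamma> N1.M N2 f) C) = post (N1.Pe.cval C)"
  unfolding box_map_def fst_conv N2.box_kernel_eq
proof (rule coset_map_coset[OF N1.presentation_e N2.presentation_e _ _ _ C])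
  show "post \<in> hom (add_monoid N1.NF) (add_monoid N2.NF)"
  proof (rule homI)
    fix u v assume "u \<in> carrier (add_monoid N1.NF)" "v \<in> carrier (add_monoid N1.NF)"
    then have uv: "u g \<in> carrier N1.Ne" "v g \<in> carrier N1.Ne" if "g \<in> carrier G" for g
      using that PiE_mem[of _ "carrier G" "\<lambda>_. carrier N1.Ne"] by simp_all
    show "post (u \<otimes>\<^bsub>add_monoid N1.NF\<^esub> v) = post u \<otimes>\<^bsub>add_monoid N2.NF\<^esub> post v"
      using uv by (auto simp: post_def f_simps intro!: restrict_ext)
    show "post u \<in> carrier (add_monoid N2.NF)" using uv by (simp add: post_def f_simps)
  qed
  fix z assume "z \<in> box_gens_e N1.M N1"
  then obtain x y where z: "z = (x, y)" "x \<in> carrier G \<rightarrow>\<^sub>E carrier N1.A" "y \<in> carrier N1.Ne"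
    by (auto simp: box_gens_e_def)
  show "Poly_Mapping.keys (case z of (x, y) \<Rightarrow> frag_of (x, fst f y)) \<subseteq> box_gens_e N2.M N2"
    using z f_simps(1) by (simp add: keys_frag_of box_gens_e_def)
  have "N2.te (x, fst f y) \<in> carrier N2.NF" using N2.te_in(1)[of x "fst f y"] z f_simps(1) by simp
  then show "frag_value N2.NF N2.te (case z of (x, y) \<Rightarrow> frag_of (x, fst f y)) = post (N1.te z)"
    using z by (simp add: abelian_group.frag_value_of[OF N2.NF_abelian] te_map)
qed

text \<open>On tensors \<open>f\<close> commutes with restriction, on formal transfers with the sum
  over \<open>G\<close>.\<close>

lemma box_map_G:
  assumes C: "C \<in> N1.PG.cosets"
  shows "snd (box_map G N1.\<Gamma> N1.M N2 f) C \<in> N2.PG.cosets \<and>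
    N2.PG.cval (snd (box_map G N1.\<Gamma> N1.M N2 f) C) = fst f (N1.PG.cval C)"
  unfolding box_map_def snd_conv N2.box_kernel_eq
proof (rule coset_map_coset[OF N1.presentation_G N2.presentation_G f_hom _ _ C])
  fix u assume u: "u \<in> box_gens_G N1.M N1"
  let ?h = "case u of Ten a b \<Rightarrow> frag_of (Ten a (snd f b)) | TrTen x y \<Rightarrow> frag_of (TrTen x (fst f y))"
  show "Poly_Mapping.keys ?h \<subseteq> box_gens_G N2.M N2"
    using u by (cases u) (simp_all add: keys_frag_of f_simps)
  show "frag_value N2.Ne N2.tG ?h = fst f (N1.tG u)"
  proof (cases u)
    case (Ten a b)
    then have "a \<in> carrier N1.A" "b \<in> carrier N1.NG" using u by auto
    then show ?thesis using Ten by (simp add: N2.Ne.frag_value_of f_simps)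
  next
    case (TrTen x y)
    then have xy: "x \<in> carrier G \<rightarrow>\<^sub>E carrier N1.A" "y \<in> carrier N1.Ne" using u by auto
    have c: "N2.te (x, fst f y) g \<in> carrier N2.Ne" if "g \<in> carrier G" for g
      by (rule N2.te_in(2)[OF xy(1) f_simps(1)[OF xy(2)] that])
    have "fst f (\<Oplus>\<^bsub>N1.Ne\<^esub>g\<in>carrier G. N1.te (x, y) g) = (\<Oplus>\<^bsub>N2.Ne\<^esub>g\<in>carrier G. fst f (N1.te (x, y) g))"
      by (rule additive_hom_finsum[OF N1.Ne.abelian_group_axioms N2.Ne.abelian_group_axioms f_hom])
        (use N1.te_in(2)[OF xy] in auto)
    also have "\<dots> = (\<Oplus>\<^bsub>N2.Ne\<^esub>g\<in>carrier G. N2.te (x, fst f y) g)"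
      by (rule N2.Ne.finsum_cong') (use c in \<open>auto simp: te_map[OF xy] post_def\<close>)
    finally show ?thesis using TrTen c by (simp add: N2.Ne.frag_value_of N2.Ne.finsum_closed Pi_def)
  qed
qed

end

context prime_order_tambara begin

proposition flat_coind: "flat TYPE('u) G \<Gamma> (algebra_module S \<eta>)"
  unfolding flat_def
proof (intro allI impI, elim conjE)
  fix N1 N2 N3 :: "('c, 'e, 'e \<times> 'g set, 'u, 'u) green_module" and f g
  assume N: "tambara_module G \<Gamma> N1" "tambara_module G \<Gamma> N2" "tambara_module G \<Gamma> N3"
    and f: "tambara_module_hom G \<Gamma> N1 N2 f" and g: "tambara_module_hom G \<Gamma> N2 N3 g"
    and ex: "short_exact N1 N2 N3 f g"
  interpret f: box_context_hom G R N1 N2 f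
    using N f prime_order_tambara_axioms
    by (simp add: box_context_hom_def box_context_hom_axioms_def box_context_def)
  interpret g: box_context_hom G R N2 N3 g
    using N g prime_order_tambara_axioms
    by (simp add: box_context_hom_def box_context_hom_axioms_def box_context_def)
  have e: "inj_on (fst f) (carrier f.N1.Ne)"
    "fst f ` carrier f.N1.Ne = {x \<in> carrier f.N2.Ne. fst g x = \<zero>\<^bsub>g.N2.Ne\<^esub>}"
    "fst g ` carrier f.N2.Ne = carrier g.N2.Ne"
    using ex by (simp_all add: short_exact_def)
  have e': "inj_on f.post (carrier f.N1.NF)"
    "f.post ` carrier f.N1.NF = {v \<in> carrier f.N2.NF. g.post v = \<zero>\<^bsub>g.N2.NF\<^esub>}"
    "g.post ` carrier f.N2.NF = carrier g.N2.NF"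
    using PiE_postcompose_exact[OF e, of "carrier G"]
    unfolding f.post_def[abs_def] g.post_def[abs_def] postcompose_def[abs_def] by simp_all
  \<comment> \<open>The zero of a box product is the subgroup of relations itself, a coset of value
    zero.\<close>
  note te = exact_transport[OF f.N1.Pe.cval_bij f.N2.Pe.cval_bij g.N2.Pe.cval_bij
    f.box_map_e g.box_map_e g.N2.Pe.zero_coset e']
  note tG = exact_transport[OF f.N1.PG.cval_bij f.N2.PG.cval_bij g.N2.PG.cval_bij
    f.box_map_G g.box_map_G g.N2.PG.zero_coset e]
  show "short_exact (box G \<Gamma> (algebra_module S \<eta>) N1) (box G \<Gamma> (algebra_module S \<eta>) N2)
      (box G \<Gamma> (algebra_module S \<eta>) N3)
      (box_map G \<Gamma> (algebra_module S \<eta>) N2 f) (box_map G \<Gamma> (algebra_module S \<eta>) N3 g)"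
    unfolding short_exact_def f.N1.box_carriers f.N2.box_carriers g.N2.box_carriers
    by (intro conjI) ((rule te tG; assumption)+)
qed

end

section \<open>Tambara ideals and the Nakaoka spectrum\<close>

lemma tambara_idealD:
  assumes "tambara_ideal G R I"
  shows "ideal (fst I) (lev_e R)" "ideal (snd I) (lev_G R)"
    "\<lbrakk>g \<in> carrier G; x \<in> fst I\<rbrakk> \<Longrightarrow> act R g x \<in> fst I"
    "y \<in> snd I \<Longrightarrow> res R y \<in> fst I" "x \<in> fst I \<Longrightarrow> tr R x \<in> snd I" "x \<in> fst I \<Longrightarrow> nm R x \<in> snd I"
    "x \<in> fst I \<Longrightarrow> x \<in> carrier (lev_e R)" "y \<in> snd I \<Longrightarrow> y \<in> carrier (lev_G R)"
  using assms ideal.Icarr[of "fst I" "lev_e R" x] ideal.Icarr[of "snd I" "lev_G R" y]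
  unfolding tambara_ideal_def by (auto simp: image_subset_iff)

lemma gen_tambara_ideal_superset: "subset2 A (gen_tambara_ideal G R A)"
  by (auto simp: gen_tambara_ideal_def subset2_def)

lemma gen_tambara_ideal_least:
  assumes "tambara_ideal G R J" "subset2 A J"
  shows "subset2 (gen_tambara_ideal G R A) J"
proof -
  have "fst J \<in> {fst J | J. tambara_ideal G R J \<and> subset2 A J}"
    "snd J \<in> {snd J | J. tambara_ideal G R J \<and> subset2 A J}" using assms by blast+
  then show ?thesis by (simp add: gen_tambara_ideal_def subset2_def Inter_lower)
qed

lemma subset2_trans: "\<lbrakk>subset2 I J; subset2 J K\<rbrakk> \<Longrightarrow> subset2 I K"
  by (auto simp: subset2_def)

context tambara_functor begin

lemma tambara_ideal_whole: "tambara_ideal G R (carrier (lev_e R), carrier (lev_G R))"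
proof -
  interpret A: cring "lev_e R" by (rule lev_e_cring)
  interpret B: cring "lev_G R" by (rule lev_G_cring)
  show ?thesis
    by (auto simp: tambara_ideal_def A.oneideal B.oneideal act_closed ring_hom_closed[OF res_hom]
      tr_closed nm_closed)
qed

text \<open>An intersection of Tambara ideals, over a family that is nonempty because it contains
  the whole functor.\<close>

lemma tambara_ideal_gen:
  assumes A: "fst A \<subseteq> carrier (lev_e R)" "snd A \<subseteq> carrier (lev_G R)"
  shows "tambara_ideal G R (gen_tambara_ideal G R A)"
proof -
  interpret Ae: cring "lev_e R" by (rule lev_e_cring)
  interpret B: cring "lev_G R" by (rule lev_G_cring)
  define F where "F = {J. tambara_ideal G R J \<and> subset2 A J}"
  have FD: "tambara_ideal G R J" if "J \<in> F" for J using that by (simp add: F_def)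
  have ne: "(carrier (lev_e R), carrier (lev_G R)) \<in> F"
    using tambara_ideal_whole A by (simp add: subset2_def F_def)
  have g: "gen_tambara_ideal G R A = (\<Inter>(fst ` F), \<Inter>(snd ` F))"
    unfolding gen_tambara_ideal_def F_def by (rule prod_eqI) (auto simp: image_iff)
  have "ideal (\<Inter>(fst ` F)) (lev_e R)"
    by (rule Ae.i_Intersect) (use ne tambara_idealD(1)[OF FD] in auto)
  moreover have "ideal (\<Inter>(snd ` F)) (lev_G R)"
    by (rule B.i_Intersect) (use ne tambara_idealD(2)[OF FD] in auto)
  ultimately show ?thesis
    unfolding tambara_ideal_def g fst_conv snd_conv
  proof (intro conjI ballI subsetI)
    fix k z assume k: "k \<in> carrier G" and z: "z \<in> act R k ` \<Inter>(fst ` F)"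
    then obtain x where x: "z = act R k x" "\<forall>J\<in>F. x \<in> fst J" by auto
    show "z \<in> \<Inter>(fst ` F)" unfolding x(1)
      by (rule INT_I) (use k x(2) tambara_idealD(3)[OF FD] in blast)
  next
    fix z assume z: "z \<in> res R ` \<Inter>(snd ` F)"
    then obtain x where x: "z = res R x" "\<forall>J\<in>F. x \<in> snd J" by auto
    show "z \<in> \<Inter>(fst ` F)" unfolding x(1)
      by (rule INT_I) (use x(2) tambara_idealD(4)[OF FD] in blast)
  next
    fix z assume z: "z \<in> tr R ` \<Inter>(fst ` F)"
    then obtain x where x: "z = tr R x" "\<forall>J\<in>F. x \<in> fst J" by auto
    show "z \<in> \<Inter>(snd ` F)" unfolding x(1)
      by (rule INT_I) (use x(2) tambara_idealD(5)[OF FD] in blast)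
  next
    fix z assume z: "z \<in> nm R ` \<Inter>(fst ` F)"
    then obtain x where x: "z = nm R x" "\<forall>J\<in>F. x \<in> fst J" by auto
    show "z \<in> \<Inter>(snd ` F)" unfolding x(1)
      by (rule INT_I) (use x(2) tambara_idealD(6)[OF FD] in blast)
  qed
qed

lemma tambara_ideal_prod:
  assumes I: "tambara_ideal G R I" and J: "tambara_ideal G R J"
  shows "tambara_ideal G R (tambara_ideal_prod G R I J)"
    "subset2 (tambara_ideal_prod G R I J) I" "subset2 (tambara_ideal_prod G R I J) J"
proof -
  interpret A: cring "lev_e R" by (rule lev_e_cring)
  interpret B: cring "lev_G R" by (rule lev_G_cring)
  have e: "ideal_prod (lev_e R) (fst I) (fst J) \<subseteq> fst I \<inter> fst J"
    by (rule A.ideal_prod_inter[OF tambara_idealD(1)[OF I] tambara_idealD(1)[OF J]])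
  have g: "ideal_prod (lev_G R) (snd I) (snd J) \<subseteq> snd I \<inter> snd J"
    by (rule B.ideal_prod_inter[OF tambara_idealD(2)[OF I] tambara_idealD(2)[OF J]])
  show "tambara_ideal G R (tambara_ideal_prod G R I J)"
    unfolding tambara_ideal_prod_def
    by (rule tambara_ideal_gen) (use e g tambara_idealD(7,8)[OF I] in auto)
  show "subset2 (tambara_ideal_prod G R I J) I" "subset2 (tambara_ideal_prod G R I J) J"
    unfolding tambara_ideal_prod_def
    by (rule gen_tambara_ideal_least[OF I]; use e g in \<open>auto simp: subset2_def\<close>)
      (rule gen_tambara_ideal_least[OF J]; use e g in \<open>auto simp: subset2_def\<close>)
qed

lemma mult_in_tambara_ideal_prod:
  assumes "y \<in> snd I" "z \<in> snd J"
  shows "y \<otimes>\<^bsub>lev_G R\<^esub> z \<in> snd (tambara_ideal_prod G R I J)"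
  using gen_tambara_ideal_superset[of "(ideal_prod (lev_e R) (fst I) (fst J), ideal_prod (lev_G R) (snd I) (snd J))" G R]
    ideal_prod.prod[OF assms, of "lev_G R"]
  unfolding tambara_ideal_prod_def subset2_def by auto

text \<open>An elementwise criterion: every ideal not inside \<open>P\<close> shows an element of
  level \<open>G/G\<close> outside \<open>K\<close>. Products of two such elements avoid
  \<open>P\<close>, so the product ideal is not inside \<open>P\<close>.\<close>

lemma prime_tambara_idealI:
  assumes P: "tambara_ideal G R P" and one: "\<one>\<^bsub>lev_G R\<^esub> \<notin> snd P"
    and K: "\<And>y z. \<lbrakk>y \<in> carrier (lev_G R); z \<in> carrier (lev_G R); y \<notin> K; z \<notin> K\<rbrakk> \<Longrightarrow> y \<otimes>\<^bsub>lev_G R\<^esub> z \<notin> snd P"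
    and det: "\<And>I. \<lbrakk>tambara_ideal G R I; \<not> subset2 I P\<rbrakk> \<Longrightarrow> \<exists>y\<in>snd I. y \<notin> K"
  shows "prime_tambara_ideal G R P"
  unfolding prime_tambara_ideal_def
proof (intro conjI allI impI)
  interpret B: cring "lev_G R" by (rule lev_G_cring)
  show "P \<noteq> (carrier (lev_e R), carrier (lev_G R))" using one by auto
  fix I J assume IJ: "tambara_ideal G R I \<and> tambara_ideal G R J \<and> subset2 (tambara_ideal_prod G R I J) P"
  show "subset2 I P \<or> subset2 J P"
  proof (rule ccontr)
    assume "\<not> (subset2 I P \<or> subset2 J P)"
    then obtain y z where yz: "y \<in> snd I" "y \<notin> K" "z \<in> snd J" "z \<notin> K" using det IJ by meson
    have "y \<otimes>\<^bsub>lev_G R\<^esub> z \<in> snd P"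
      using mult_in_tambara_ideal_prod[OF yz(1,3)] IJ by (auto simp: subset2_def)
    then show False using K yz IJ tambara_idealD(8) by metis
  qed
qed (rule P)

abbreviation primes where "primes \<equiv> {P. prime_tambara_ideal G R P}"

text \<open>Intersections of open sets are given by product ideals, thanks to primality, and unions
  by generated ideals.\<close>

lemma istopology_nakaoka:
  "istopology (\<lambda>U. \<exists>I. tambara_ideal G R I \<and> U = primes - vanishing_set G R I)"
  unfolding istopology_def
proof (intro conjI allI impI)
  fix U V assume "\<exists>I. tambara_ideal G R I \<and> U = primes - vanishing_set G R I"
    "\<exists>I. tambara_ideal G R I \<and> V = primes - vanishing_set G R I"
  then obtain I J where I: "tambara_ideal G R I" "U = primes - vanishing_set G R I"
    and J: "tambara_ideal G R J" "V = primes - vanishing_set G R J" by auto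
  have "U \<inter> V = primes - vanishing_set G R (tambara_ideal_prod G R I J)"
  proof -
    have "subset2 (tambara_ideal_prod G R I J) P \<longleftrightarrow> subset2 I P \<or> subset2 J P"
      if P: "prime_tambara_ideal G R P" for P
    proof
      assume "subset2 (tambara_ideal_prod G R I J) P"
      then show "subset2 I P \<or> subset2 J P" using P I(1) J(1) unfolding prime_tambara_ideal_def by blast
    next
      assume "subset2 I P \<or> subset2 J P"
      then show "subset2 (tambara_ideal_prod G R I J) P" using subset2_trans[OF tambara_ideal_prod(2)[OF I(1) J(1)], of P]
        subset2_trans[OF tambara_ideal_prod(3)[OF I(1) J(1)], of P] by blast
    qed
    then show ?thesis unfolding I(2) J(2) vanishing_set_def by auto
  qed
  then show "\<exists>I. tambara_ideal G R I \<and> U \<inter> V = primes - vanishing_set G R I"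
    using tambara_ideal_prod(1)[OF I(1) J(1)] by blast
next
  fix \<K> assume K: "\<forall>U\<in>\<K>. \<exists>I. tambara_ideal G R I \<and> U = primes - vanishing_set G R I"
  \<comment> \<open>All ideals defining a member of \<open>\<K>\<close> are taken at once, which
    saves choosing one for each member.\<close>
  define Is where "Is = {I. tambara_ideal G R I \<and> primes - vanishing_set G R I \<in> \<K>}"
  define A where "A = (\<Union>(fst ` Is), \<Union>(snd ` Is))"
  have A: "tambara_ideal G R (gen_tambara_ideal G R A)"
  proof (rule tambara_ideal_gen)
    show "fst A \<subseteq> carrier (lev_e R)" "snd A \<subseteq> carrier (lev_G R)"
      using tambara_idealD(7,8)[of G R] by (auto simp: A_def Is_def)
  qed
  have "subset2 (gen_tambara_ideal G R A) P \<longleftrightarrow> (\<forall>I\<in>Is. subset2 I P)" if P: "prime_tambara_ideal G R P" for P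
  proof -
    have "tambara_ideal G R P" using P by (simp add: prime_tambara_ideal_def)
    then have "subset2 (gen_tambara_ideal G R A) P \<longleftrightarrow> subset2 A P"
      using gen_tambara_ideal_least[of G R P A]
        subset2_trans[OF gen_tambara_ideal_superset[of A G R], of P] by blast
    then show ?thesis by (auto simp: A_def subset2_def)
  qed
  then have "primes - vanishing_set G R (gen_tambara_ideal G R A) = (\<Union>I\<in>Is. primes - vanishing_set G R I)"
    by (auto simp: vanishing_set_def)
  also have "\<dots> = \<Union>\<K>"
  proof (intro equalityI subsetI)
    fix P assume "P \<in> \<Union>\<K>"
    then obtain U where U: "U \<in> \<K>" "P \<in> U" by auto
    then obtain I where I: "tambara_ideal G R I" "U = primes - vanishing_set G R I" using K by auto
    then have "I \<in> Is" using U by (simp add: Is_def)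
    then show "P \<in> (\<Union>I\<in>Is. primes - vanishing_set G R I)" using U I by blast
  next
    fix P assume "P \<in> (\<Union>I\<in>Is. primes - vanishing_set G R I)"
    then show "P \<in> \<Union>\<K>" unfolding Is_def by blast
  qed
  finally show "\<exists>I. tambara_ideal G R I \<and> \<Union>\<K> = primes - vanishing_set G R I"
    by (intro exI[of _ "gen_tambara_ideal G R A"] conjI A) simp
qed

lemma openin_nakaoka:
  "openin (nakaoka_spectrum G R) U \<longleftrightarrow> (\<exists>I. tambara_ideal G R I \<and> U = primes - vanishing_set G R I)"
  unfolding nakaoka_spectrum_def by (subst topology_inverse'[OF istopology_nakaoka]) simp

lemma openin_nakaoka_primes: "openin (nakaoka_spectrum G R) primes"
proof -
  interpret A: cring "lev_e R" by (rule lev_e_cring)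
  interpret B: cring "lev_G R" by (rule lev_G_cring)
  have "P = (carrier (lev_e R), carrier (lev_G R))"
    if "prime_tambara_ideal G R P" "subset2 (carrier (lev_e R), carrier (lev_G R)) P" for P
  proof -
    have P: "tambara_ideal G R P" using that by (simp add: prime_tambara_ideal_def)
    show ?thesis using that(2) tambara_idealD(7,8)[OF P] by (intro prod_eqI) (auto simp: subset2_def)
  qed
  then have "vanishing_set G R (carrier (lev_e R), carrier (lev_G R)) = {}"
    unfolding vanishing_set_def using prime_tambara_ideal_def by blast
  then have "primes = primes - vanishing_set G R (carrier (lev_e R), carrier (lev_G R))" by blast
  then show ?thesis unfolding openin_nakaoka using tambara_ideal_whole by blast
qed

end

section \<open>The map of spectra is not open\<close>

lemma (in ring) ideal_Union_chain:
  assumes ne: "C \<noteq> {}" and id: "\<And>I. I \<in> C \<Longrightarrow> ideal I R"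
    and chain: "\<And>I J. \<lbrakk>I \<in> C; J \<in> C\<rbrakk> \<Longrightarrow> I \<subseteq> J \<or> J \<subseteq> I"
  shows "ideal (\<Union>C) R"
proof (rule idealI[OF ring_axioms])
  note sub = additive_subgroup.a_closed[OF ideal.axioms(1)[OF id]]
    ideal.Icarr[OF id] additive_subgroup.zero_closed[OF ideal.axioms(1)[OF id]]
  show "subgroup (\<Union>C) (add_monoid R)"
  proof (rule subgroup.intro)
    show "\<Union>C \<subseteq> carrier (add_monoid R)" using sub(2) by auto
    show "\<one>\<^bsub>add_monoid R\<^esub> \<in> \<Union>C" using sub(3) ne by auto
    fix x assume "x \<in> \<Union>C"
    then obtain I where I: "I \<in> C" "x \<in> I" by blast
    show "inv\<^bsub>add_monoid R\<^esub> x \<in> \<Union>C"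
      using additive_subgroup.a_inv_closed[OF ideal.axioms(1)[OF id[OF I(1)]] I(2)] I(1) unfolding a_inv_def by blast
    fix y assume "y \<in> \<Union>C"
    then obtain J where J: "J \<in> C" "y \<in> J" by blast
    obtain L where L: "L \<in> C" "x \<in> L" "y \<in> L" using chain[OF I(1) J(1)] I J by blast
    show "x \<otimes>\<^bsub>add_monoid R\<^esub> y \<in> \<Union>C" using sub(1)[OF L] L(1) by auto
  qed
qed (use ideal.I_l_closed[OF id] ideal.I_r_closed[OF id] in blast)+

text \<open>Zorn's lemma for the ideals without one: a maximal member is a maximal ideal, hence
  prime.\<close>

lemma (in cring) exists_primeideal:
  assumes "\<one> \<noteq> \<zero>"
  shows "\<exists>P. primeideal P R"
proof -
  let ?A = "{I. ideal I R \<and> \<one> \<notin> I}"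
  have "\<exists>M\<in>?A. \<forall>X\<in>?A. M \<subseteq> X \<longrightarrow> X = M"
  proof (rule subset_Zorn_nonempty)
    show "?A \<noteq> {}" using zeroideal assms by auto
    fix C assume C: "C \<noteq> {}" "subset.chain ?A C"
    have "ideal (\<Union>C) R"
      by (rule ideal_Union_chain[OF C(1)]) (use C(2) in \<open>unfold subset.chain_def, blast+\<close>)
    then show "\<Union>C \<in> ?A" using C by (auto simp: subset.chain_def)
  qed
  then obtain M where M: "ideal M R" "\<one> \<notin> M" and max: "\<And>X. \<lbrakk>ideal X R; \<one> \<notin> X; M \<subseteq> X\<rbrakk> \<Longrightarrow> X = M" by auto
  have "maximalideal M R"
  proof (rule maximalidealI[OF M(1)])
    show "carrier R \<noteq> M" using M(2) by auto
    show "J = M \<or> J = carrier R" if J: "ideal J R" "M \<subseteq> J" "J \<subseteq> carrier R" for J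
      using max[OF J(1) _ J(2)] ideal.one_imp_carrier[OF J(1)] by auto
  qed
  from maximalideal_prime[OF this] show ?thesis by blast
qed

context prime_order_group begin

text \<open>\<open>nm_add\<close> speaks about transversals, so to apply it one has to exist. The
  representative is chosen from the orbit as a set, hence equal orbits get equal
  representatives.\<close>

lemma exists_subset_transversal: "\<exists>\<U>. subset_transversal G \<U>"
proof -
  define orb where "orb U = {g <# U | g. g \<in> carrier G}" for U
  have self: "U \<in> orb U" if "U \<subseteq> carrier G" for U
    using lcos_mult_one[OF that] by (force simp: orb_def)
  have sub: "V \<subseteq> carrier G" if "V \<in> orb U" "U \<subseteq> carrier G" for U V
    using l_coset_subset_G that by (auto simp: orb_def)
  have orb_sub: "orb V \<subseteq> orb U" if V: "V \<in> orb U" and U: "U \<subseteq> carrier G" for U V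
  proof
    fix W assume "W \<in> orb V"
    then obtain g where g: "g \<in> carrier G" "W = g <# V" by (auto simp: orb_def)
    obtain h where h: "h \<in> carrier G" "V = h <# U" using V by (auto simp: orb_def)
    have "W = (g \<otimes> h) <# U" using g h U by (simp add: lcos_m_assoc)
    then show "W \<in> orb U" using g h by (auto simp: orb_def)
  qed
  have orb_eq: "orb V = orb U" if V: "V \<in> orb U" and U: "U \<subseteq> carrier G" for U V
  proof
    obtain h where h: "h \<in> carrier G" "V = h <# U" using V by (auto simp: orb_def)
    have "U = inv h <# V" using h U by (simp add: lcos_m_assoc lcos_mult_one)
    then have "U \<in> orb V" using h by (auto simp: orb_def)
    then show "orb U \<subseteq> orb V" using orb_sub sub[OF V U] by blast
  qed (rule orb_sub[OF that])
  define rep where "rep U = (SOME V. V \<in> orb U)" for U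
  have rep: "rep U \<in> orb U" if "U \<subseteq> carrier G" for U
    unfolding rep_def by (rule someI[of _ U]) (rule self[OF that])
  have "subset_transversal G (rep ` {U. U \<noteq> {} \<and> U \<subset> carrier G})"
    unfolding subset_transversal_def
  proof (intro conjI ballI allI impI)
    fix V assume "V \<in> rep ` {U. U \<noteq> {} \<and> U \<subset> carrier G}"
    then obtain U where U: "U \<noteq> {}" "U \<subset> carrier G" "V = rep U" by auto
    then have V: "V \<in> orb U" using rep[of U] by auto
    then have Vc: "V \<subseteq> carrier G" using sub U by auto
    then obtain h where h: "h \<in> carrier G" "V = h <# U" using V by (auto simp: orb_def)
    have "V = (\<lambda>x. h \<otimes> x) ` U" unfolding h(2) l_coset_def by blast
    moreover have "inj_on (\<lambda>x. h \<otimes> x) U"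
      using inj_on_subset[OF inj_on_cmult[OF h(1)]] U(2) by blast
    \<comment> \<open>Translation preserves cardinality, so a translate of a proper subset is
      proper.\<close>
    ultimately have card: "card V = card U" by (simp add: card_image)
    have "card U < card (carrier G)" using U finite_carrier by (intro psubset_card_mono)
    then have "V \<noteq> carrier G" using card by auto
    then show "V \<subset> carrier G" using Vc by blast
    show "V \<noteq> {}" unfolding h(2) l_coset_def using U(1) by blast
  next
    fix U assume U: "U \<noteq> {} \<and> U \<subset> carrier G"
    have orb: "(\<exists>g\<in>carrier G. V = g <# U) \<longleftrightarrow> V \<in> orb U" for V by (auto simp: orb_def)
    show "\<exists>!V. V \<in> rep ` {U. U \<noteq> {} \<and> U \<subset> carrier G} \<and> (\<exists>g\<in>carrier G. V = g <# U)"
      unfolding orb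
    proof (rule ex1I[of _ "rep U"])
      show "rep U \<in> rep ` {U. U \<noteq> {} \<and> U \<subset> carrier G} \<and> rep U \<in> orb U" using rep U by auto
      fix V assume V: "V \<in> rep ` {U. U \<noteq> {} \<and> U \<subset> carrier G} \<and> V \<in> orb U"
      then obtain U' where U': "U' \<subset> carrier G" "V = rep U'" by auto
      then have "orb V = orb U'" using orb_eq[OF rep[of U']] by (simp add: psubset_eq)
      moreover have "orb V = orb U" by (rule orb_eq) (use V U in \<open>simp_all add: psubset_eq\<close>)
      ultimately have "orb U' = orb U" by simp
      then show "V = rep U" unfolding U'(2) rep_def by simp
    qed
  qed
  then show ?thesis by (rule exI)
qed

end

section \<open>A prime of the ghost outside the image\<close>

context prime_order_tambara begin

text \<open>In the norm of a sum the cross terms form a transfer, which vanishes in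
  \<open>Q\<close>.\<close>

lemma nm_mod_transfer_hom: "(\<lambda>x. cls (nm R x)) \<in> ring_hom A Q"
proof (rule ring_hom_memI)
  fix x y assume xy: "x \<in> carrier A" "y \<in> carrier A"
  show "cls (nm R (x \<otimes>\<^bsub>A\<^esub> y)) = cls (nm R x) \<otimes>\<^bsub>Q\<^esub> cls (nm R y)"
    using xy nm_closed by (simp add: nm_mult)
  obtain \<U> where U: "subset_transversal G \<U>" using exists_subset_transversal by blast
  define s where "s = (\<Oplus>\<^bsub>A\<^esub>U\<in>\<U>. \<Otimes>\<^bsub>A\<^esub>g\<in>carrier G. act R g (if g \<in> U then x else y))"
  have s: "s \<in> carrier A" unfolding s_def
    using xy by (intro A.finsum_closed Pi_I A.finprod_closed) auto
  have "nm R (x \<oplus>\<^bsub>A\<^esub> y) = nm R x \<oplus>\<^bsub>lev_G R\<^esub> nm R y \<oplus>\<^bsub>lev_G R\<^esub> tr R s"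
    unfolding s_def by (rule nm_add[OF xy U])
  then show "cls (nm R (x \<oplus>\<^bsub>A\<^esub> y)) = cls (nm R x) \<oplus>\<^bsub>Q\<^esub> cls (nm R y)"
    using xy s nm_closed tr_closed by (simp add: cls_transfer)
next
  fix x assume "x \<in> carrier A"
  then show "cls (nm R x) \<in> carrier Q" by (intro cls.hom_closed nm_closed)
next
  show "cls (nm R \<one>\<^bsub>A\<^esub>) = \<one>\<^bsub>Q\<^esub>" unfolding nm_one by (rule cls.hom_one)
qed

theorem spectrum_map_coind_not_open:
  assumes proper: "tr R ` carrier A \<noteq> carrier (lev_G R)"
  shows "\<not> open_map (nakaoka_spectrum G S) (nakaoka_spectrum G \<Gamma>) (spectrum_map \<Gamma> \<eta>)"
proof
  assume op: "open_map (nakaoka_spectrum G S) (nakaoka_spectrum G \<Gamma>) (spectrum_map \<Gamma> \<eta>)"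
  have "\<one>\<^bsub>Q\<^esub> \<noteq> \<zero>\<^bsub>Q\<^esub>"
  \<comment> \<open>Otherwise one is a transfer, and the ideal of transfers is everything.\<close>
  proof
    assume "\<one>\<^bsub>Q\<^esub> = \<zero>\<^bsub>Q\<^esub>"
    then have "cls \<one>\<^bsub>lev_G R\<^esub> = transfer_image R" unfolding FactRing_def by (simp only: ring.simps monoid.simps)
    then have "\<one>\<^bsub>lev_G R\<^esub> \<in> transfer_image R" by (rule T.rcos_const_imp_mem[rotated]) (rule LG.one_closed)
    then have "transfer_image R = carrier (lev_G R)" by (rule T.one_imp_carrier)
    then show False using proper by (simp add: transfer_image_def)
  qed
  then obtain K where K: "primeideal K Q" using Q.exists_primeideal by blast
  note K_prime = primeideal.I_prime[OF K] and K_ideal = primeideal.axioms(1)[OF K]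
  note K_zero = additive_subgroup.zero_closed[OF ideal.axioms(1)[OF K_ideal]]
  have one_K: "\<one>\<^bsub>Q\<^esub> \<notin> K" using ideal.one_imp_carrier[OF K_ideal] primeideal.I_notcarr[OF K] by blast
  \<comment> \<open>\<open>q\<close> is the norm modulo transfers; what is retained is that it is an
    invariant ring homomorphism and the second component of the ghost norm.\<close>
  obtain q where q: "q \<in> ring_hom A Q" and q_act: "\<And>g x. \<lbrakk>g \<in> carrier G; x \<in> carrier A\<rbrakk> \<Longrightarrow> q (act R g x) = q x"
    and q_nm: "\<And>x. x \<in> carrier A \<Longrightarrow> nm \<Gamma> x = (res R (nm R x), q x)"
  proof
    show "(\<lambda>x. cls (nm R x)) \<in> ring_hom A Q" by (rule nm_mod_transfer_hom)
  qed (simp_all only: nm_act ghost_nm)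
  define M where "M = {x \<in> carrier A. q x \<in> K}"
  have MA: "x \<in> carrier A" if "x \<in> M" for x using that by (simp add: M_def)
  have idM: "ideal M A"
    unfolding M_def by (rule ring_hom_ring.ideal_vimage[OF ring_hom_ringI2[OF A.ring_axioms Q.ring_axioms q] K_ideal])
  note M_zero = additive_subgroup.zero_closed[OF ideal.axioms(1)[OF idM]]
    and M_add = additive_subgroup.a_closed[OF ideal.axioms(1)[OF idM]]
  have M_prime: "x \<otimes>\<^bsub>A\<^esub> y \<notin> M" if "x \<in> carrier A" "y \<in> carrier A" "x \<notin> M" "y \<notin> M" for x y
  proof
    assume "x \<otimes>\<^bsub>A\<^esub> y \<in> M"
    then have "q x \<otimes>\<^bsub>Q\<^esub> q y \<in> K" unfolding M_def ring_hom_mult[OF q that(1,2), symmetric] by blast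
    then have "q x \<in> K \<or> q y \<in> K" by (rule K_prime[OF ring_hom_closed[OF q that(1)] ring_hom_closed[OF q that(2)]])
    then show False using that unfolding M_def by blast
  qed
  have one_M: "\<one>\<^bsub>A\<^esub> \<notin> M" using one_K unfolding M_def ring_hom_one[OF q, symmetric] by blast
  have M_act: "act R g x \<in> M" if "g \<in> carrier G" "x \<in> M" for g x
    unfolding M_def mem_Collect_eq q_act[OF that(1) MA[OF that(2)]]
    using that(2) act_closed[OF that(1) MA[OF that(2)]] unfolding M_def by blast
  have M_sum: "(\<Oplus>\<^bsub>A\<^esub>i\<in>I. f i) \<in> M" if "\<And>i. i \<in> I \<Longrightarrow> f i \<in> M" for I :: "'c set" and f
    using that
  proof (induction I rule: infinite_finite_induct)
    case (insert i I)
    have "(\<Oplus>\<^bsub>A\<^esub>i\<in>insert i I. f i) = f i \<oplus>\<^bsub>A\<^esub> (\<Oplus>\<^bsub>A\<^esub>i\<in>I. f i)"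
      by (rule A.finsum_insert) (use insert MA in auto)
    then show ?case using insert M_add by simp
  qed (use M_zero in simp_all)
  have M_prod: "(\<Otimes>\<^bsub>A\<^esub>g\<in>carrier G. f g) \<in> M" if f: "\<And>g. g \<in> carrier G \<Longrightarrow> f g \<in> M" for f
  proof -
    have "(\<Otimes>\<^bsub>A\<^esub>g\<in>insert \<one> (carrier G - {\<one>}). f g) = f \<one> \<otimes>\<^bsub>A\<^esub> (\<Otimes>\<^bsub>A\<^esub>g\<in>carrier G - {\<one>}. f g)"
      by (rule A.finprod_insert) (use f MA finite_carrier in auto)
    moreover have "insert \<one> (carrier G - {\<one>}) = carrier G" by auto
    moreover have "f \<one> \<otimes>\<^bsub>A\<^esub> (\<Otimes>\<^bsub>A\<^esub>g\<in>carrier G - {\<one>}. f g) \<in> M"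
      by (rule ideal.I_r_closed[OF idM f]) (use f MA in \<open>auto intro!: A.finprod_closed\<close>)
    ultimately show ?thesis by simp
  qed
  note \<Gamma>G = cring_RDirProd[OF cring_fixed_ring Q.is_cring]
  interpret \<Gamma>G: cring "RDirProd (fixed_ring G R) Q" by (rule \<Gamma>G)
  interpret r1: ring_hom_cring "RDirProd (fixed_ring G R) Q" A "res \<Gamma>"
    using \<Gamma>.res_cring_hom by simp
  interpret r2: ring_hom_cring "RDirProd (fixed_ring G R) Q" Q snd
    by unfold_locales (rule ring_hom_memI, auto)
  define P where "P = (M, {y \<in> carrier (lev_G \<Gamma>). res \<Gamma> y \<in> M} \<inter> {y \<in> carrier (lev_G \<Gamma>). snd y \<in> K})"
  have idP: "tambara_ideal G \<Gamma> P"
    unfolding tambara_ideal_def P_def fst_conv snd_conv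
  proof (intro conjI ballI subsetI)
    show "ideal M (lev_e \<Gamma>)" using idM by simp
    show "ideal ({y \<in> carrier (lev_G \<Gamma>). res \<Gamma> y \<in> M} \<inter> {y \<in> carrier (lev_G \<Gamma>). snd y \<in> K}) (lev_G \<Gamma>)"
      using \<Gamma>G.i_intersect[OF r1.ring.ideal_vimage[OF idM] r2.ring.ideal_vimage[OF K_ideal]]
      by (simp only: ghost_simps)
    fix z assume "z \<in> tr \<Gamma> ` M"
    then obtain x where x: "x \<in> M" "z = tr \<Gamma> x" by blast
    have z: "z \<in> carrier (lev_G \<Gamma>)"
      unfolding x(2) by (rule \<Gamma>.tr_closed) (simp only: ghost_simps MA[OF x(1)])
    have "res R (tr R x) \<in> M"
      unfolding res_tr[OF MA[OF x(1)]] by (rule M_sum) (rule M_act[OF _ x(1)])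
    then show "z \<in> {y \<in> carrier (lev_G \<Gamma>). res \<Gamma> y \<in> M} \<inter> {y \<in> carrier (lev_G \<Gamma>). snd y \<in> K}"
      using z K_zero unfolding x(2) ghost_tr[OF MA[OF x(1)]] by (simp only: ghost_simps) simp
  next
    fix z assume "z \<in> nm \<Gamma> ` M"
    then obtain x where x: "x \<in> M" "z = nm \<Gamma> x" by blast
    have z: "z \<in> carrier (lev_G \<Gamma>)"
      unfolding x(2) by (rule \<Gamma>.nm_closed) (simp only: ghost_simps MA[OF x(1)])
    have "q x \<in> K" using x(1) by (simp add: M_def)
    moreover have "res R (nm R x) \<in> M"
      unfolding res_nm[OF MA[OF x(1)]] by (rule M_prod) (rule M_act[OF _ x(1)])
    ultimately show "z \<in> {y \<in> carrier (lev_G \<Gamma>). res \<Gamma> y \<in> M} \<inter> {y \<in> carrier (lev_G \<Gamma>). snd y \<in> K}"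
      using z unfolding x(2) q_nm[OF MA[OF x(1)]] by (simp only: ghost_simps) simp
  qed (use M_act in auto)
  have prime_P: "prime_tambara_ideal G \<Gamma> P"
  \<comment> \<open>Elements are judged by their second component. If level \<open>G/e\<close> of
    \<open>I\<close> leaves \<open>M\<close>, the norm of a witness has second component outside
    \<open>K\<close>; otherwise restrictions from level \<open>G/G\<close> lie in \<open>M\<close>,
    and an element outside \<open>P\<close> must fail in the second component.\<close>
  proof (rule \<Gamma>.prime_tambara_idealI[OF idP, where K = "{y. snd y \<in> K}"])
    show "\<one>\<^bsub>lev_G \<Gamma>\<^esub> \<notin> snd P" using one_K by (simp add: P_def)
    fix y z assume yz: "y \<in> carrier (lev_G \<Gamma>)" "z \<in> carrier (lev_G \<Gamma>)" "y \<notin> {y. snd y \<in> K}" "z \<notin> {y. snd y \<in> K}"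
    then show "y \<otimes>\<^bsub>lev_G \<Gamma>\<^esub> z \<notin> snd P"
      using K_prime[of "snd y" "snd z"] by (cases y; cases z) (auto simp: P_def)
  next
    fix I assume I: "tambara_ideal G \<Gamma> I" "\<not> subset2 I P"
    note ID = tambara_idealD[OF I(1)]
    show "\<exists>y\<in>snd I. y \<notin> {y. snd y \<in> K}"
    proof (cases "fst I \<subseteq> M")
      case True
      then obtain y where y: "y \<in> snd I" "y \<notin> snd P" using I(2) by (auto simp: subset2_def P_def)
      have "res \<Gamma> y \<in> M" "y \<in> carrier (lev_G \<Gamma>)" using ID(4)[OF y(1)] ID(8)[OF y(1)] True by auto
      then have "snd y \<notin> K" using y(2) by (simp add: P_def)
      then show ?thesis using y(1) by auto
    next
      case False
      then obtain x where x: "x \<in> fst I" "x \<notin> M" by auto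
      then have xA: "x \<in> carrier A" using ID(7) by simp
      then have "snd (nm \<Gamma> x) \<notin> K" using x by (simp add: q_nm M_def)
      then show ?thesis using ID(6)[OF x(1)] by auto
    qed
  qed
  define P' where "P' = (carrier G \<rightarrow>\<^sub>E M, M)"
  have idP': "tambara_ideal G S P'"
    unfolding tambara_ideal_def P'_def fst_conv snd_conv
  proof (intro conjI ballI subsetI)
    have eq: "carrier G \<rightarrow>\<^sub>E M = \<Inter>((\<lambda>g. {s \<in> carrier FA. s g \<in> M}) ` carrier G)"
    proof (intro equalityI subsetI INT_I)
      fix s assume s: "s \<in> \<Inter>((\<lambda>g. {s \<in> carrier FA. s g \<in> M}) ` carrier G)"
      then have "s \<in> extensional (carrier G)" using one_closed by (auto simp: PiE_def)
      then show "s \<in> carrier G \<rightarrow>\<^sub>E M" using s by (simp add: PiE_def)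
    qed (use MA in \<open>auto simp: PiE_iff\<close>)
    have vim: "ideal {s \<in> carrier FA. s g \<in> M} FA" if g: "g \<in> carrier G" for g
      by (rule ring_hom_ring.ideal_vimage[OF ring_hom_ringI2[OF FA.ring_axioms A.ring_axioms fun_ring_eval_hom[OF g]] idM])
    show "ideal (carrier G \<rightarrow>\<^sub>E M) (lev_e S)"
      unfolding coind_simps eq by (rule FA.i_Intersect) (use vim one_closed in auto)
    show "ideal M (lev_G S)" using idM by simp
    fix z assume "z \<in> tr S ` (carrier G \<rightarrow>\<^sub>E M)"
    then show "z \<in> M" using M_sum[of "carrier G"] by auto
  next
    fix z assume "z \<in> nm S ` (carrier G \<rightarrow>\<^sub>E M)"
    then show "z \<in> M" using M_prod by auto
  qed auto
  have prime_P': "prime_tambara_ideal G S P'"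
  \<comment> \<open>A function with a value outside \<open>M\<close> is cut down to that one point
    by an indicator; its transfer is then this value.\<close>
  proof (rule S.prime_tambara_idealI[OF idP', where K = M])
    fix I assume I: "tambara_ideal G S I" "\<not> subset2 I P'"
    note ID = tambara_idealD[OF I(1)]
    show "\<exists>y\<in>snd I. y \<notin> M"
    proof (cases "snd I \<subseteq> M")
      case True
      then obtain s where s: "s \<in> fst I" "s \<notin> carrier G \<rightarrow>\<^sub>E M" using I(2) by (auto simp: subset2_def P'_def)
      have sc: "s \<in> carrier G \<rightarrow>\<^sub>E carrier A" using ID(7)[OF s(1)] by simp
      then obtain g where g: "g \<in> carrier G" "s g \<notin> M" using s(2) by (auto simp: PiE_iff)
      have "s \<otimes>\<^bsub>FA\<^esub> pt g \<one>\<^bsub>A\<^esub> \<in> fst I"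
        using ideal.I_r_closed[OF ID(1) s(1), of "pt g \<one>\<^bsub>A\<^esub>"] by (simp only: coind_simps fun_ring_simps(1) pt_closed A.one_closed)
      then have "tr S (pt g (s g)) \<in> snd I" unfolding mult_pt[OF g(1) sc] by (rule ID(5))
      then show ?thesis using g PiE_mem[OF sc g(1)] by (auto simp: sum_pt)
    qed auto
  qed (use one_M M_prime in \<open>auto simp: P'_def\<close>)
  have "openin (nakaoka_spectrum G \<Gamma>) (spectrum_map \<Gamma> \<eta> ` S.primes)"
    using op S.openin_nakaoka_primes by (simp add: open_map_def)
  then obtain I where I: "spectrum_map \<Gamma> \<eta> ` S.primes = \<Gamma>.primes - vanishing_set G \<Gamma> I"
    unfolding \<Gamma>.openin_nakaoka by auto
  \<comment> \<open>The unit map sends \<open>M\<close> to functions with values in \<open>M\<close>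
    because \<open>M\<close> is stable under \<open>G\<close>.\<close>
  have "subset2 P (spectrum_map \<Gamma> \<eta> P')"
    using M_act MA by (auto simp: subset2_def spectrum_map_def P_def P'_def)
  moreover have "\<not> subset2 I (spectrum_map \<Gamma> \<eta> P')"
    using I prime_P' by (auto simp: vanishing_set_def)
  \<comment> \<open>An ideal not inside a prime is not inside any smaller one either.\<close>
  ultimately have "P \<in> \<Gamma>.primes - vanishing_set G \<Gamma> I"
    using prime_P subset2_trans[of I P "spectrum_map \<Gamma> \<eta> P'"] unfolding vanishing_set_def by blast
  then obtain P'' where P'': "prime_tambara_ideal G S P''" "P = spectrum_map \<Gamma> \<eta> P''"
    unfolding I[symmetric] by blast
  \<comment> \<open>The unit map sends the pair of zero and one to zero, which every ideal contains;
    so every prime in the image contains this pair, and \<open>P\<close> does not.\<close>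
  have "ideal (snd P'') A" using P''(1) by (simp add: prime_tambara_ideal_def tambara_ideal_def)
  then have "(\<zero>\<^bsub>A\<^esub>, \<one>\<^bsub>Q\<^esub>) \<in> snd P"
    unfolding P''(2) by (simp add: spectrum_map_def fixed_set_def ideal_def additive_subgroup.zero_closed)
  then show False using one_K by (simp add: P_def)
qed

end

section \<open>The square of the coinduced algebra\<close>

lemma algebra_module_simps:
  "carrier (mlev_e (algebra_module S \<phi>)) = carrier (lev_e S)"
  "x \<oplus>\<^bsub>mlev_e (algebra_module S \<phi>)\<^esub> x' = x \<oplus>\<^bsub>lev_e S\<^esub> x'"
  "\<zero>\<^bsub>mlev_e (algebra_module S \<phi>)\<^esub> = \<zero>\<^bsub>lev_e S\<^esub>"
  "r \<odot>\<^bsub>mlev_e (algebra_module S \<phi>)\<^esub> x = fst \<phi> r \<otimes>\<^bsub>lev_e S\<^esub> x"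
  "carrier (mlev_G (algebra_module S \<phi>)) = carrier (lev_G S)"
  "y \<oplus>\<^bsub>mlev_G (algebra_module S \<phi>)\<^esub> y' = y \<oplus>\<^bsub>lev_G S\<^esub> y'"
  "\<zero>\<^bsub>mlev_G (algebra_module S \<phi>)\<^esub> = \<zero>\<^bsub>lev_G S\<^esub>"
  "s \<odot>\<^bsub>mlev_G (algebra_module S \<phi>)\<^esub> y = snd \<phi> s \<otimes>\<^bsub>lev_G S\<^esub> y"
  "mact (algebra_module S \<phi>) = act S" "mres (algebra_module S \<phi>) = res S" "mtr (algebra_module S \<phi>) = tr S"
  by (simp_all add: algebra_module_def ring.defs)

lemma module_restrict_scalars:
  fixes M :: "('r, 'a) module" and B :: "'a ring"
  assumes "cring R" "cring B" and \<phi>: "\<phi> \<in> ring_hom R B"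
    and M: "carrier M = carrier B" "\<And>x y. x \<oplus>\<^bsub>M\<^esub> y = x \<oplus>\<^bsub>B\<^esub> y" "\<zero>\<^bsub>M\<^esub> = \<zero>\<^bsub>B\<^esub>"
      "\<And>r x. r \<odot>\<^bsub>M\<^esub> x = \<phi> r \<otimes>\<^bsub>B\<^esub> x"
  shows "Module.module R M"
proof -
  interpret R: cring R by fact
  interpret B: cring B by fact
  have "abelian_group M"
    by (rule abelian_groupI) (auto simp: M B.a_ac intro: B.l_neg)
  then show ?thesis
    using ring_hom_closed[OF \<phi>] ring_hom_add[OF \<phi>] ring_hom_mult[OF \<phi>] ring_hom_one[OF \<phi>]
    by (intro Module.module.intro Module.module_axioms.intro R.is_cring)
      (simp_all add: M B.l_distr B.r_distr B.m_assoc)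
qed

text \<open>The module axioms are algebra axioms of \<open>S\<close>, with scalars passed through
  \<open>\<phi>\<close>; both Frobenius laws come from the one of \<open>S\<close>.\<close>

lemma tambara_module_algebra:
  assumes h: "tambara_hom G R S \<phi>"
  shows "tambara_module G R (algebra_module S \<phi>)"
proof -
  interpret R: tambara_functor G R using h by (simp add: tambara_hom_def)
  interpret S: tambara_functor G S using h by (simp add: tambara_hom_def)
  interpret Re: cring "lev_e R" by (rule R.lev_e_cring)
  interpret RG: cring "lev_G R" by (rule R.lev_G_cring)
  interpret Se: cring "lev_e S" by (rule S.lev_e_cring)
  interpret SG: cring "lev_G S" by (rule S.lev_G_cring)
  have \<phi>: "fst \<phi> \<in> ring_hom (lev_e R) (lev_e S)" "snd \<phi> \<in> ring_hom (lev_G R) (lev_G S)"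
    and \<phi>_act: "\<And>g x. \<lbrakk>g \<in> carrier G; x \<in> carrier (lev_e R)\<rbrakk> \<Longrightarrow> fst \<phi> (act R g x) = act S g (fst \<phi> x)"
    and \<phi>_res: "\<And>y. y \<in> carrier (lev_G R) \<Longrightarrow> fst \<phi> (res R y) = res S (snd \<phi> y)"
    and \<phi>_tr: "\<And>x. x \<in> carrier (lev_e R) \<Longrightarrow> snd \<phi> (tr R x) = tr S (fst \<phi> x)"
    using h by (simp_all add: tambara_hom_def)
  note cl = ring_hom_closed[OF \<phi>(1)] ring_hom_closed[OF \<phi>(2)] S.act_closed ring_hom_closed[OF S.res_hom] S.tr_closed
  have Me: "Module.module (lev_e R) (mlev_e (algebra_module S \<phi>))"
    by (rule module_restrict_scalars[OF R.lev_e_cring S.lev_e_cring \<phi>(1)]) (simp_all only: algebra_module_simps)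
  interpret Me: Module.module "lev_e R" "mlev_e (algebra_module S \<phi>)" by (rule Me)
  show ?thesis
  proof (intro tambara_module.intro R.tambara_functor_axioms tambara_module_axioms.intro Me)
    show "Module.module (lev_G R) (mlev_G (algebra_module S \<phi>))"
      by (rule module_restrict_scalars[OF R.lev_G_cring S.lev_G_cring \<phi>(2)]) (simp_all only: algebra_module_simps)
    fix g assume "g \<in> carrier G"
    then show "mact (algebra_module S \<phi>) g \<in> hom (add_monoid (mlev_e (algebra_module S \<phi>))) (add_monoid (mlev_e (algebra_module S \<phi>)))"
      using ring_hom_add[OF S.act_hom] S.act_closed by (simp add: hom_def algebra_module_simps)
  next
    fix x assume x: "x \<in> carrier (mlev_e (algebra_module S \<phi>))"
    have "(\<Oplus>\<^bsub>lev_e S\<^esub>g\<in>carrier G. act S g x) = (\<Oplus>\<^bsub>mlev_e (algebra_module S \<phi>)\<^esub>g\<in>carrier G. act S g x)"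
      by (rule additive_hom_finsum[OF Se.abelian_group_axioms Me.abelian_group_axioms, of "\<lambda>x. x"])
        (use x S.act_closed in \<open>simp_all add: hom_def algebra_module_simps\<close>)
    then show "mres (algebra_module S \<phi>) (mtr (algebra_module S \<phi>) x) =
        (\<Oplus>\<^bsub>mlev_e (algebra_module S \<phi>)\<^esub>g\<in>carrier G. mact (algebra_module S \<phi>) g x)"
      using x by (simp add: algebra_module_simps S.res_tr)
  next
    fix r y assume "r \<in> carrier (lev_e R)" "y \<in> carrier (mlev_G (algebra_module S \<phi>))"
    then show "mtr (algebra_module S \<phi>) (r \<odot>\<^bsub>mlev_e (algebra_module S \<phi>)\<^esub> mres (algebra_module S \<phi>) y) =
        tr R r \<odot>\<^bsub>mlev_G (algebra_module S \<phi>)\<^esub> y"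
      by (simp add: algebra_module_simps \<phi>_tr cl S.frobenius)
  next
    fix s x assume "s \<in> carrier (lev_G R)" "x \<in> carrier (mlev_e (algebra_module S \<phi>))"
    then show "mtr (algebra_module S \<phi>) (res R s \<odot>\<^bsub>mlev_e (algebra_module S \<phi>)\<^esub> x) =
        s \<odot>\<^bsub>mlev_G (algebra_module S \<phi>)\<^esub> mtr (algebra_module S \<phi>) x"
      using S.frobenius[of x "snd \<phi> s"] by (simp add: algebra_module_simps \<phi>_res cl Se.m_comm SG.m_comm)
  qed (simp_all add: algebra_module_simps hom_def cl S.act_one S.act_mult S.act_res S.tr_act S.tr_add \<phi>_act \<phi>_res
      ring_hom_add[OF S.res_hom] ring_hom_mult[OF S.act_hom] ring_hom_mult[OF S.res_hom])
qed

text \<open>Extension from generators, in the second argument for a fixed generator and then in the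
  first.\<close>

lemma frag_value_bilinear:
  fixes B :: "'a ring"
  assumes "ring B" and f: "f \<in> X \<rightarrow> carrier B"
    and h: "\<And>x y. \<lbrakk>x \<in> X; y \<in> X\<rbrakk> \<Longrightarrow>
      Poly_Mapping.keys (h x y) \<subseteq> X \<and> frag_value B f (h x y) = f x \<otimes>\<^bsub>B\<^esub> f y"
    and z: "Poly_Mapping.keys z \<subseteq> X" and w: "Poly_Mapping.keys w \<subseteq> X"
  shows "Poly_Mapping.keys (frag_bilinear h z w) \<subseteq> X \<and>
    frag_value B f (frag_bilinear h z w) = frag_value B f z \<otimes>\<^bsub>B\<^esub> frag_value B f w"
proof -
  interpret B: ring B by fact
  note B.abelian_group_axioms [simp]
  have fc: "f x \<in> carrier B" if "x \<in> X" for x using f that by auto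
  have wc: "frag_value B f w \<in> carrier B" by (rule B.frag_value_closed[OF f w])
  have k: "Poly_Mapping.keys (frag_extend (h x) w) \<subseteq> X" if "x \<in> X" for x
    by (rule keys_frag_extend_subset[OF _ w]) (use h that in blast)
  have v: "frag_value B f (frag_extend (h x) w) = f x \<otimes>\<^bsub>B\<^esub> frag_value B f w" if x: "x \<in> X" for x
    by (rule frag_value_extend[OF _ _ _ f f, where F = "\<lambda>b. f x \<otimes>\<^bsub>B\<^esub> b"])
      (use h[OF x] w fc[OF x] in \<open>auto simp: hom_def B.r_distr\<close>)
  show ?thesis unfolding frag_bilinear_def
  proof
    show "Poly_Mapping.keys (frag_extend (\<lambda>i. frag_extend (h i) w) z) \<subseteq> X"
      by (rule keys_frag_extend_subset[OF k z])
    show "frag_value B f (frag_extend (\<lambda>i. frag_extend (h i) w) z) = frag_value B f z \<otimes>\<^bsub>B\<^esub> frag_value B f w"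
    proof (rule frag_value_extend[where F = "\<lambda>b. b \<otimes>\<^bsub>B\<^esub> frag_value B f w" and A = B and B = B, OF _ _ _ f f _ _ z])
      show "(\<lambda>b. b \<otimes>\<^bsub>B\<^esub> frag_value B f w) \<in> hom (add_monoid B) (add_monoid B)"
        using wc by (auto simp: hom_def B.l_distr)
    qed (simp_all add: k v)
  qed
qed

text \<open>All representatives of a coset have the same value, so the image is a singleton.\<close>

lemma (in frag_presentation) the_elem_frag_eval:
  fixes B :: "'b ring"
  assumes B: "abelian_group B" and F: "F \<in> hom (add_monoid A) (add_monoid B)"
    and m: "\<And>x. x \<in> X \<Longrightarrow> m x = F (f x)" and C: "C \<in> cosets"
  shows "the_elem (frag_eval B m ` C) = F (cval C)"
proof -
  obtain z where z: "Poly_Mapping.keys z \<subseteq> X" "C = frag_coset K z" "cval C = val z"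
    using C by (rule cosetsE)
  have m': "m \<in> X \<rightarrow> carrier B" using F f_closed m by (auto simp: hom_def)
  have v: "frag_value B m w = F (val w)" if w: "Poly_Mapping.keys w \<subseteq> X" for w
  proof -
    have "frag_value B m (frag_extend frag_of w) = F (val w)"
    proof (rule frag_value_extend[OF A.abelian_group_axioms B F f_closed m' _ _ w])
      fix x assume x: "x \<in> X"
      have "m x \<in> carrier B" using m' x by (rule funcset_mem)
      then show "frag_value B m (frag_of x) = F (f x)"
        unfolding m[OF x, symmetric] by (rule abelian_group.frag_value_of[OF B])
    qed (simp add: keys_frag_of)
    then show ?thesis by (simp add: frag_expansion[symmetric])
  qed
  have "frag_eval B m w = F (cval C)" if "w \<in> C" for w
    using mem_coset_keys_val[OF z(1) that[unfolded z(2)]] v[of w] unfolding z(3) frag_eval_eq_value by simp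
  moreover have "z \<in> C" unfolding z(2) by (simp add: mem_coset_iff)
  ultimately have "frag_eval B m ` C = {F (cval C)}" by (auto intro!: image_eqI[of _ _ z])
  then show ?thesis by simp
qed

text \<open>The case \<open>N = S\<close>. Both computed levels are now rings, namely the levels of
  the coinduction \<open>W\<close> of \<open>FA\<close>, and \<open>S \<boxtimes> S\<close> is
  matched with \<open>W\<close> in all operations.\<close>

locale coind_square =
  box_context G R "algebra_module (coind G (lev_e R)) (coind_unit G (ghost G R))"
  for G :: "'c monoid" (structure) and R :: "('c, 'e, 'g) tambara"
begin

abbreviation WE where "WE \<equiv> fun_ring (carrier G) FA"
abbreviation W where "W \<equiv> coind G FA"

sublocale W: tambara_functor G W by (rule tambara_functor_coind[OF FA.is_cring])
sublocale WE: cring WE by (rule cring_fun_ring[OF FA.is_cring])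

declare coind_simps [simp del] fun_ring_simps [simp del] M_simps [simp del] \<Gamma>.coind_unit_simps [simp del]

lemma gens_e_iff: "(x, y) \<in> box_gens_e M M \<longleftrightarrow> x \<in> carrier FA \<and> y \<in> carrier FA"
  by (simp add: box_gens_e_def M_simps fun_ring_simps)

lemma gens_G_simps:
  "Ten a b \<in> box_gens_G M M \<longleftrightarrow> a \<in> carrier A \<and> b \<in> carrier A"
  "TrTen x y \<in> box_gens_G M M \<longleftrightarrow> x \<in> carrier FA \<and> y \<in> carrier FA"
  by (simp_all add: M_simps fun_ring_simps)

declare gens_G_iff [simp del] tG_simps [simp del]

lemma eta_hom: "fst \<eta> \<in> ring_hom A FA"
  using unit_hom unfolding tambara_hom_def ghost_simps coind_simps by blast

lemma eta_closed: "r \<in> carrier A \<Longrightarrow> fst \<eta> r \<in> carrier FA"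
  by (rule ring_hom_closed[OF eta_hom])

lemma S_act_hom: "g \<in> carrier G \<Longrightarrow> act S g \<in> ring_hom FA FA"
  using S.act_hom by (simp only: coind_simps(1))

lemma S_act_closed: "\<lbrakk>g \<in> carrier G; y \<in> carrier FA\<rbrakk> \<Longrightarrow> act S g y \<in> carrier FA"
  by (rule ring_hom_closed[OF S_act_hom])

lemma S_res_hom: "res S \<in> ring_hom A FA" using S.res_hom by (simp only: coind_simps(1,2))

lemma S_res_closed: "b \<in> carrier A \<Longrightarrow> res S b \<in> carrier FA" by (rule ring_hom_closed[OF S_res_hom])

lemma FA_app: "\<lbrakk>x \<in> carrier FA; g \<in> carrier G\<rbrakk> \<Longrightarrow> x g \<in> carrier A"
  by (auto simp: fun_ring_simps)

lemma WE_app: "\<lbrakk>x \<in> carrier WE; g \<in> carrier G\<rbrakk> \<Longrightarrow> x g \<in> carrier FA"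
  by (rule PiE_mem) (simp only: fun_ring_simps(1)[of _ FA])

lemma WE_ext:
  assumes "s \<in> carrier WE" "t \<in> carrier WE" "\<And>g. g \<in> carrier G \<Longrightarrow> s g = t g"
  shows "s = t"
  using assms by (intro PiE_ext[of s "carrier G" "\<lambda>_. carrier FA" t]) (simp_all only: fun_ring_simps(1)[of _ FA])

lemma fun_ring_app:
  assumes "g \<in> X"
  shows "(s \<otimes>\<^bsub>fun_ring X B\<^esub> t) g = s g \<otimes>\<^bsub>B\<^esub> t g" "(s \<oplus>\<^bsub>fun_ring X B\<^esub> t) g = s g \<oplus>\<^bsub>B\<^esub> t g"
    "\<one>\<^bsub>fun_ring X B\<^esub> g = \<one>\<^bsub>B\<^esub>" "\<zero>\<^bsub>fun_ring X B\<^esub> g = \<zero>\<^bsub>B\<^esub>"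
  using assms by (simp_all add: fun_ring_simps)

lemma te_eq: "g \<in> carrier G \<Longrightarrow> te (x, y) g = fst \<eta> (x g) \<otimes>\<^bsub>FA\<^esub> act S g y"
  by (simp only: te_apply M_simps)

lemma te_WE: "\<lbrakk>x \<in> carrier FA; y \<in> carrier FA\<rbrakk> \<Longrightarrow> te (x, y) \<in> carrier WE"
  using te_in(1)[of x y] by (simp only: fun_ring_simps(1) M_simps)

lemma tG_Ten: "tG (Ten a b) = fst \<eta> a \<otimes>\<^bsub>FA\<^esub> res S b"
  by (simp only: tG_simps M_simps)

lemma tG_Ten_closed: "\<lbrakk>a \<in> carrier A; b \<in> carrier A\<rbrakk> \<Longrightarrow> tG (Ten a b) \<in> carrier FA"
  unfolding tG_Ten by (intro FA.m_closed eta_closed S_res_closed)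

lemma Ne_hom: "(\<lambda>x. x) \<in> hom (add_monoid Ne) (add_monoid FA)"
  by (simp add: hom_def M_simps fun_ring_simps)

lemma tG_TrTen: "\<lbrakk>x \<in> carrier FA; y \<in> carrier FA\<rbrakk> \<Longrightarrow> tG (TrTen x y) = tr W (te (x, y))"
  unfolding tG_simps coind_simps
  by (rule additive_hom_finsum[OF Ne.abelian_group_axioms FA.abelian_group_axioms Ne_hom])
    (use te_in(2)[of x y] in \<open>auto simp: fun_ring_simps M_simps\<close>)

lemma FA_mult4:
  "\<lbrakk>a \<in> carrier FA; b \<in> carrier FA; c \<in> carrier FA; d \<in> carrier FA\<rbrakk> \<Longrightarrow>
    (a \<otimes>\<^bsub>FA\<^esub> b) \<otimes>\<^bsub>FA\<^esub> (c \<otimes>\<^bsub>FA\<^esub> d) = (a \<otimes>\<^bsub>FA\<^esub> c) \<otimes>\<^bsub>FA\<^esub> (b \<otimes>\<^bsub>FA\<^esub> d)"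
  by (simp add: FA.m_ac)

lemma te_mult:
  assumes x: "x \<in> carrier FA" "x' \<in> carrier FA" and y: "y \<in> carrier FA" "y' \<in> carrier FA"
  shows "te (x \<otimes>\<^bsub>FA\<^esub> x', y \<otimes>\<^bsub>FA\<^esub> y') = te (x, y) \<otimes>\<^bsub>WE\<^esub> te (x', y')"
proof (rule WE_ext)
  fix g assume g: "g \<in> carrier G"
  have "te (x \<otimes>\<^bsub>FA\<^esub> x', y \<otimes>\<^bsub>FA\<^esub> y') g =
      (fst \<eta> (x g) \<otimes>\<^bsub>FA\<^esub> fst \<eta> (x' g)) \<otimes>\<^bsub>FA\<^esub> (act S g y \<otimes>\<^bsub>FA\<^esub> act S g y')"
    using g x y by (simp add: te_eq fun_ring_app ring_hom_mult[OF eta_hom] ring_hom_mult[OF S_act_hom] FA_app)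
  also have "\<dots> = te (x, y) g \<otimes>\<^bsub>FA\<^esub> te (x', y') g"
    unfolding te_eq[OF g] by (intro FA_mult4 eta_closed S_act_closed FA_app g x y)
  finally show "te (x \<otimes>\<^bsub>FA\<^esub> x', y \<otimes>\<^bsub>FA\<^esub> y') g = (te (x, y) \<otimes>\<^bsub>WE\<^esub> te (x', y')) g"
    by (simp add: fun_ring_app g)
qed (intro te_WE WE.m_closed FA.m_closed x y)+

lemma te_act:
  assumes g: "g \<in> carrier G" and x: "x \<in> carrier FA" and y: "y \<in> carrier FA"
  shows "te (act S g x, act S g y) = act W g (te (x, y))"
proof (rule WE_ext)
  show "act W g (te (x, y)) \<in> carrier WE"
    using W.act_closed[OF g, of "te (x, y)"] te_WE[OF x y] by (simp only: coind_simps(1))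
  fix k assume k: "k \<in> carrier G"
  have "act S k (act S g y) = act S (k \<otimes> g) y"
    by (rule S.act_mult[symmetric]) (use k g y in \<open>simp_all add: coind_simps\<close>)
  then show "te (act S g x, act S g y) k = act W g (te (x, y)) k"
    using k g by (simp only: te_eq m_closed) (simp add: coind_simps te_eq)
qed (intro te_WE S_act_closed g x y)

lemma te_res:
  assumes a: "a \<in> carrier A" and b: "b \<in> carrier A"
  shows "te (res S a, res S b) = res W (tG (Ten a b))"
proof (rule WE_ext)
  show "res W (tG (Ten a b)) \<in> carrier WE"
    using ring_hom_closed[OF W.res_hom, of "tG (Ten a b)"] tG_Ten_closed[OF a b] by (simp only: coind_simps(1,2))
  fix k assume k: "k \<in> carrier G"
  have "act S k (res S b) = res S b" by (rule S.act_res) (use k b in \<open>simp_all add: coind_simps\<close>)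
  then show "te (res S a, res S b) k = res W (tG (Ten a b)) k"
    unfolding te_eq[OF k] tG_Ten by (simp add: k coind_simps)
qed (intro te_WE S_res_closed a b)

lemma tG_Ten_mult:
  assumes "a \<in> carrier A" "a' \<in> carrier A" "b \<in> carrier A" "b' \<in> carrier A"
  shows "tG (Ten (a \<otimes>\<^bsub>A\<^esub> a') (b \<otimes>\<^bsub>A\<^esub> b')) = tG (Ten a b) \<otimes>\<^bsub>FA\<^esub> tG (Ten a' b')"
  unfolding tG_Ten ring_hom_mult[OF eta_hom assms(1,2)] ring_hom_mult[OF S_res_hom assms(3,4)]
  by (intro FA_mult4 eta_closed S_res_closed assms)

lemma tG_Ten_one: "tG (Ten \<one>\<^bsub>A\<^esub> \<one>\<^bsub>A\<^esub>) = \<one>\<^bsub>FA\<^esub>"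
  unfolding tG_Ten ring_hom_one[OF eta_hom] ring_hom_one[OF S_res_hom] by simp

lemma te_one: "te (\<one>\<^bsub>FA\<^esub>, \<one>\<^bsub>FA\<^esub>) = \<one>\<^bsub>WE\<^esub>"
proof (rule WE_ext)
  fix g assume g: "g \<in> carrier G"
  show "te (\<one>\<^bsub>FA\<^esub>, \<one>\<^bsub>FA\<^esub>) g = \<one>\<^bsub>WE\<^esub> g"
    by (simp add: g te_eq fun_ring_app(3) ring_hom_one[OF eta_hom] ring_hom_one[OF S_act_hom])
qed (intro te_WE FA.one_closed WE.one_closed)+

text \<open>The product over \<open>k\<close> of \<open>fst \<eta> (x k)\<close> times
  \<open>act S k y\<close> splits into the image of the norm of \<open>x\<close> and, by the double
  coset formula, the restricted norm of \<open>y\<close>. Hence the norm of \<open>W\<close> has the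
  value on tensors that \<open>box_norm\<close> demands.\<close>

lemma tG_nm:
  assumes x: "x \<in> carrier FA" and y: "y \<in> carrier FA"
  shows "tG (Ten (nm S x) (nm S y)) = nm W (te (x, y))"
proof -
  interpret e: ring_hom_cring A FA "fst \<eta>"
    by (intro ring_hom_cring.intro ring_hom_cring_axioms.intro A.is_cring FA.is_cring eta_hom)
  have "nm W (te (x, y)) = (\<Otimes>\<^bsub>FA\<^esub>k\<in>carrier G. fst \<eta> (x k) \<otimes>\<^bsub>FA\<^esub> act S k y)"
    unfolding coind_simps by (rule FA.finprod_cong') (auto simp: te_eq[unfolded coind_simps] intro!: FA.m_closed eta_closed FA_app[OF x] S_act_closed[OF _ y, unfolded coind_simps])
  also have "\<dots> = (\<Otimes>\<^bsub>FA\<^esub>k\<in>carrier G. fst \<eta> (x k)) \<otimes>\<^bsub>FA\<^esub> (\<Otimes>\<^bsub>FA\<^esub>k\<in>carrier G. act S k y)"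
    by (rule FA.finprod_multf) (auto intro!: eta_closed FA_app[OF x] S_act_closed[OF _ y])
  also have "(\<Otimes>\<^bsub>FA\<^esub>k\<in>carrier G. fst \<eta> (x k)) = fst \<eta> (nm S x)"
    using e.hom_finprod[of x "carrier G"] FA_app[OF x] by (simp add: coind_simps(6) o_def Pi_def)
  also have "(\<Otimes>\<^bsub>FA\<^esub>k\<in>carrier G. act S k y) = res S (nm S y)"
    using S.res_nm[of y] y by (simp only: coind_simps(1))
  finally show ?thesis unfolding tG_Ten by simp
qed

lemma truncate_M: "ring.truncate Ne = FA"
  by (simp add: algebra_module_def ring.defs fun_ring_def coind_simps)

lemma presentation_WE: "frag_presentation WE Rel_e (box_gens_e M M) te se"
  using presentation_e unfolding truncate_M .

text \<open>The same presentation with the ring \<open>FA\<close> as target in place of the module;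
  carriers, sums and zeros agree.\<close>

lemma presentation_FA: "frag_presentation FA Rel_G (box_gens_G M M) tG sG"
proof (rule frag_presentation.intro[OF FA.abelian_group_axioms], rule frag_presentation_axioms.intro)
  have c: "carrier Ne = carrier FA" "\<And>a b. a \<oplus>\<^bsub>Ne\<^esub> b = a \<oplus>\<^bsub>FA\<^esub> b" "\<zero>\<^bsub>Ne\<^esub> = \<zero>\<^bsub>FA\<^esub>"
    by (simp_all add: algebra_module_simps coind_simps)
  show f: "tG \<in> box_gens_G M M \<rightarrow> carrier FA" using PG.f_closed by (simp only: c)
  have v: "frag_value FA tG z = frag_value Ne tG z" if z: "Poly_Mapping.keys z \<subseteq> box_gens_G M M" for z
  proof -
    have "frag_value FA tG (frag_extend frag_of z) = frag_value Ne tG z"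
    proof (rule frag_value_extend[OF Ne.abelian_group_axioms FA.abelian_group_axioms Ne_hom PG.f_closed f _ _ z])
      show "frag_value FA tG (frag_of u) = tG u" if "u \<in> box_gens_G M M" for u
        using f that by (intro FA.frag_value_of) auto
    qed (simp add: keys_frag_of)
    then show ?thesis by (simp add: frag_expansion[symmetric])
  qed
  show "frag_value FA tG r = \<zero>\<^bsub>FA\<^esub>" if "r \<in> Rel_G" for r
    using v[OF PG.Rel_keys[OF that]] PG.Rel_value[OF that] by (simp only: c)
  show "frag_value FA tG (sG a) = a" if "a \<in> carrier FA" for a
    using v[OF PG.s_keys] PG.s_value that by (simp only: c)
qed (use PG.Rel_keys PG.s_keys PG.s_add PG.s_gen in \<open>simp_all add: algebra_module_simps coind_simps\<close>)

sublocale PE: frag_presentation WE Rel_e "box_gens_e M M" te se by (rule presentation_WE)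
sublocale PF: frag_presentation FA Rel_G "box_gens_G M M" tG sG by (rule presentation_FA)

lemma PE_of: "u \<in> box_gens_e M M \<Longrightarrow>
    Poly_Mapping.keys (frag_of u) \<subseteq> box_gens_e M M \<and> frag_value WE te (frag_of u) = te u"
  using WE.frag_value_of[of te u] funcset_mem[OF PE.f_closed, of u] by (simp add: keys_frag_of)

lemma PF_of: "u \<in> box_gens_G M M \<Longrightarrow>
    Poly_Mapping.keys (frag_of u) \<subseteq> box_gens_G M M \<and> frag_value FA tG (frag_of u) = tG u"
  using FA.frag_value_of[of tG u] funcset_mem[OF PF.f_closed, of u] by (simp add: keys_frag_of)

lemma W_hom:
  "res W \<in> ring_hom FA WE" "g \<in> carrier G \<Longrightarrow> act W g \<in> ring_hom WE WE"
  using W.res_hom W.act_hom[of g] by (simp_all only: coind_simps(1,2))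

lemma W_add_hom:
  "res W \<in> hom (add_monoid FA) (add_monoid WE)"
  "g \<in> carrier G \<Longrightarrow> act W g \<in> hom (add_monoid WE) (add_monoid WE)"
  "tr W \<in> hom (add_monoid WE) (add_monoid FA)"
  using W_hom W.tr_closed W.tr_add by (simp_all add: ring_hom_def hom_def coind_simps(1,2))

lemma W_act_closed: "\<lbrakk>g \<in> carrier G; s \<in> carrier WE\<rbrakk> \<Longrightarrow> act W g s \<in> carrier WE"
  by (rule ring_hom_closed[OF W_hom(2)])

lemma W_tr_closed: "s \<in> carrier WE \<Longrightarrow> tr W s \<in> carrier FA"
  using W.tr_closed by (simp only: coind_simps(1,2))

lemma W_frobenius: "\<lbrakk>s \<in> carrier WE; f \<in> carrier FA\<rbrakk> \<Longrightarrow> tr W (s \<otimes>\<^bsub>WE\<^esub> res W f) = tr W s \<otimes>\<^bsub>FA\<^esub> f"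
  using W.frobenius by (simp only: coind_simps(1,2))

lemma W_res_tr: "s \<in> carrier WE \<Longrightarrow> res W (tr W s) = (\<Oplus>\<^bsub>WE\<^esub>g\<in>carrier G. act W g s)"
  using W.res_tr by (simp only: coind_simps(1,2))

lemma box_mult_e_value:
  assumes "u \<in> box_gens_e M M" "v \<in> box_gens_e M M"
  shows "Poly_Mapping.keys (box_mult_e S u v) \<subseteq> box_gens_e M M \<and>
    frag_value WE te (box_mult_e S u v) = te u \<otimes>\<^bsub>WE\<^esub> te v"
proof -
  obtain x y x' y' where uv: "u = (x, y)" "v = (x', y')" by (cases u, cases v)
  have c: "x \<in> carrier FA" "y \<in> carrier FA" "x' \<in> carrier FA" "y' \<in> carrier FA"
    using assms unfolding uv gens_e_iff by auto
  show ?thesis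
    using PE_of[of "(x \<otimes>\<^bsub>FA\<^esub> x', y \<otimes>\<^bsub>FA\<^esub> y')"] c
    unfolding uv box_mult_e.simps coind_simps(1) te_mult[OF c(1,3,2,4)] gens_e_iff by simp
qed

lemma tG_tr_mult:
  assumes "x \<in> carrier FA" "y \<in> carrier FA" "a \<in> carrier A" "b \<in> carrier A"
  shows "tG (TrTen (x \<otimes>\<^bsub>FA\<^esub> res S a) (y \<otimes>\<^bsub>FA\<^esub> res S b)) = tG (TrTen x y) \<otimes>\<^bsub>FA\<^esub> tG (Ten a b)"
  using assms by (simp only: tG_TrTen FA.m_closed S_res_closed te_mult te_res W_frobenius te_WE tG_Ten_closed)

text \<open>In each case the formula on generators is an identity in \<open>W\<close>. For two
  formal transfers, \<open>tr W s\<close> times \<open>tr W t\<close> is the transfer of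
  \<open>s\<close> times the restriction of \<open>tr W t\<close>, which the double coset formula
  turns into a sum over \<open>G\<close>.\<close>

lemma box_mult_G_value:
  assumes u: "u \<in> box_gens_G M M" and v: "v \<in> box_gens_G M M"
  shows "Poly_Mapping.keys (box_mult_G G S u v) \<subseteq> box_gens_G M M \<and>
    frag_value FA tG (box_mult_G G S u v) = tG u \<otimes>\<^bsub>FA\<^esub> tG v"
proof (cases u)
  case u: (Ten a b)
  then have ab: "a \<in> carrier A" "b \<in> carrier A" using assms(1) gens_G_simps(1) by blast+
  show ?thesis
  proof (cases v)
    case v: (Ten a' b')
    then have ab': "a' \<in> carrier A" "b' \<in> carrier A" using assms(2) gens_G_simps(1) by blast+
    show ?thesis
      using PF_of[of "Ten (a \<otimes>\<^bsub>A\<^esub> a') (b \<otimes>\<^bsub>A\<^esub> b')"] ab ab'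
      unfolding u v box_mult_G.simps coind_simps(2) tG_Ten_mult[OF ab(1) ab'(1) ab(2) ab'(2)] gens_G_simps by simp
  next
    case v: (TrTen x y)
    then have xy: "x \<in> carrier FA" "y \<in> carrier FA" using assms(2) gens_G_simps(2) by blast+
    have "tG (TrTen (res S a \<otimes>\<^bsub>FA\<^esub> x) (res S b \<otimes>\<^bsub>FA\<^esub> y)) = tG (Ten a b) \<otimes>\<^bsub>FA\<^esub> tG (TrTen x y)"
      using tG_tr_mult[OF xy ab] xy ab
      by (simp add: FA.m_comm S_res_closed tG_Ten_closed tG_TrTen W_tr_closed te_WE)
    then show ?thesis
      using PF_of[of "TrTen (res S a \<otimes>\<^bsub>FA\<^esub> x) (res S b \<otimes>\<^bsub>FA\<^esub> y)"] xy ab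
      unfolding u v box_mult_G.simps coind_simps(1) gens_G_simps by (simp add: S_res_closed)
  qed
next
  case u: (TrTen x y)
  then have xy: "x \<in> carrier FA" "y \<in> carrier FA" using assms(1) gens_G_simps(2) by blast+
  show ?thesis
  proof (cases v)
    case v: (Ten a b)
    then have ab: "a \<in> carrier A" "b \<in> carrier A" using assms(2) gens_G_simps(1) by blast+
    show ?thesis
      using PF_of[of "TrTen (x \<otimes>\<^bsub>FA\<^esub> res S a) (y \<otimes>\<^bsub>FA\<^esub> res S b)"] tG_tr_mult[OF xy ab] xy ab
      unfolding u v box_mult_G.simps coind_simps(1) gens_G_simps by (simp add: S_res_closed)
  next
    case v: (TrTen x' y')
    then have xy': "x' \<in> carrier FA" "y' \<in> carrier FA" using assms(2) gens_G_simps(2) by blast+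
    note t = te_WE[OF xy] and t' = te_WE[OF xy']
    define w :: "'c \<Rightarrow> ('e, 'e, 'c \<Rightarrow> 'e, 'c \<Rightarrow> 'e) box_gen" where "w g = TrTen (x \<otimes>\<^bsub>FA\<^esub> act S g x') (y \<otimes>\<^bsub>FA\<^esub> act S g y')" for g
    have w: "w g \<in> box_gens_G M M" if "g \<in> carrier G" for g
      unfolding w_def gens_G_simps by (intro conjI FA.m_closed S_act_closed xy xy' that)
    have tw: "tG (w g) = tr W (te (x, y) \<otimes>\<^bsub>WE\<^esub> act W g (te (x', y')))" if "g \<in> carrier G" for g
      unfolding w_def
      by (simp only: tG_TrTen FA.m_closed S_act_closed te_mult te_act xy xy' that)
    have m: "te (x, y) \<otimes>\<^bsub>WE\<^esub> act W g (te (x', y')) \<in> carrier WE" if "g \<in> carrier G" for g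
      by (intro WE.m_closed W_act_closed t t' that)
    have "frag_value FA tG (\<Sum>g\<in>carrier G. frag_of (w g)) = (\<Oplus>\<^bsub>FA\<^esub>g\<in>carrier G. frag_value FA tG (frag_of (w g)))"
      by (rule FA.frag_value_sum[OF PF.f_closed finite_carrier]) (use PF_of[OF w] in blast)
    also have "\<dots> = (\<Oplus>\<^bsub>FA\<^esub>g\<in>carrier G. tr W (te (x, y) \<otimes>\<^bsub>WE\<^esub> act W g (te (x', y'))))"
      by (rule FA.finsum_cong') (use PF_of[OF w] tw m W_tr_closed in auto)
    also have "\<dots> = tr W (\<Oplus>\<^bsub>WE\<^esub>g\<in>carrier G. te (x, y) \<otimes>\<^bsub>WE\<^esub> act W g (te (x', y')))"
      by (rule additive_hom_finsum[OF WE.abelian_group_axioms FA.abelian_group_axioms W_add_hom(3), symmetric])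
        (use m in auto)
    also have "(\<Oplus>\<^bsub>WE\<^esub>g\<in>carrier G. te (x, y) \<otimes>\<^bsub>WE\<^esub> act W g (te (x', y'))) =
        te (x, y) \<otimes>\<^bsub>WE\<^esub> (\<Oplus>\<^bsub>WE\<^esub>g\<in>carrier G. act W g (te (x', y')))"
      by (rule WE.finsum_rdistr[symmetric]) (use t t' W_act_closed finite_carrier in auto)
    also have "tr W \<dots> = tG u \<otimes>\<^bsub>FA\<^esub> tG v"
      unfolding W_res_tr[OF t', symmetric] W_frobenius[OF t W_tr_closed[OF t']] u v tG_TrTen[OF xy] tG_TrTen[OF xy'] ..
    finally show ?thesis
      using keys_sum_frag_of[of "carrier G" w "box_gens_G M M"] w
      unfolding u v box_mult_G.simps coind_simps(1) w_def by simp
  qed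
qed

definition res_gen where
  "res_gen u = (case u of Ten a b \<Rightarrow> frag_of (res S a, res S b)
     | TrTen x y \<Rightarrow> \<Sum>g\<in>carrier G. frag_of (act S g x, act S g y))"

lemma res_gen_value:
  assumes u: "u \<in> box_gens_G M M"
  shows "Poly_Mapping.keys (res_gen u) \<subseteq> box_gens_e M M \<and> frag_value WE te (res_gen u) = res W (tG u)"
proof (cases u)
  case (Ten a b)
  then have ab: "a \<in> carrier A" "b \<in> carrier A" using assms gens_G_simps(1) by blast+
  show ?thesis using PE_of[of "(res S a, res S b)"] ab te_res[OF ab]
    by (simp add: res_gen_def Ten gens_e_iff S_res_closed del: tG_simps)
next
  case (TrTen x y)
  then have xy: "x \<in> carrier FA" "y \<in> carrier FA" using assms gens_G_simps(2) by blast+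
  have g: "(act S g x, act S g y) \<in> box_gens_e M M" if "g \<in> carrier G" for g
    unfolding gens_e_iff by (intro conjI S_act_closed xy that)
  have "frag_value WE te (\<Sum>g\<in>carrier G. frag_of (act S g x, act S g y)) =
      (\<Oplus>\<^bsub>WE\<^esub>g\<in>carrier G. frag_value WE te (frag_of (act S g x, act S g y)))"
    by (rule WE.frag_value_sum[OF PE.f_closed finite_carrier]) (use PE_of[OF g] in blast)
  also have "\<dots> = (\<Oplus>\<^bsub>WE\<^esub>h\<in>carrier G. act W h (te (x, y)))"
    by (rule WE.finsum_cong') (use PE_of[OF g] te_act xy W_act_closed[OF _ te_WE[OF xy]] in auto)
  also have "\<dots> = res W (tG u)"
    unfolding TrTen tG_TrTen[OF xy] W_res_tr[OF te_WE[OF xy]] ..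
  finally show ?thesis
    using keys_sum_frag_of[of "carrier G" "\<lambda>g. (act S g x, act S g y)" "box_gens_e M M"] g
    unfolding res_gen_def TrTen by simp
qed

end

lemma (in frag_presentation) coset_add:
  assumes "C \<in> cosets" "D \<in> cosets"
  shows "coset_map2 K (+) C D \<in> cosets \<and> cval (coset_map2 K (+) C D) = cval C \<oplus>\<^bsub>A\<^esub> cval D"
proof (rule coset_map2_coset[OF frag_presentation_axioms _ assms])
  fix z w :: "'x frag" assume zw: "Poly_Mapping.keys z \<subseteq> X" "Poly_Mapping.keys w \<subseteq> X"
  then show "Poly_Mapping.keys (z + w) \<subseteq> X \<and> val (z + w) = val z \<oplus>\<^bsub>A\<^esub> val w"
    using keys_add[of z w] A.frag_value_add[OF f_closed zw] by auto
qed

lemma (in frag_presentation) cval_closed: "C \<in> cosets \<Longrightarrow> cval C \<in> carrier A"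
  using cval_bij by (auto simp: bij_betw_def)

lemma (in frag_presentation) cval_inj: "\<lbrakk>C \<in> cosets; D \<in> cosets; cval C = cval D\<rbrakk> \<Longrightarrow> C = D"
  using cval_bij by (auto simp: bij_betw_def inj_on_def)

lemma (in frag_presentation) coset_gen:
  assumes "x \<in> X"
  shows "frag_coset K (frag_of x) \<in> cosets \<and> cval (frag_coset K (frag_of x)) = f x"
  using assms cval_coset[of "frag_of x"] A.frag_value_of[of f x] funcset_mem[OF f_closed, of x]
  by (simp add: cosets_def keys_frag_of)

section \<open>The square as a Tambara functor\<close>

context coind_square begin

abbreviation square where "square \<nu> \<equiv> box_with_norm G \<Gamma> S \<eta> \<nu>"

lemma square_simps:
  "carrier (lev_e (square \<nu>)) = PE.cosets" "carrier (lev_G (square \<nu>)) = PF.cosets"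
  "C \<oplus>\<^bsub>lev_e (square \<nu>)\<^esub> D = coset_map2 PE.K (+) C D"
  "C' \<oplus>\<^bsub>lev_G (square \<nu>)\<^esub> D' = coset_map2 PF.K (+) C' D'"
  "C \<otimes>\<^bsub>lev_e (square \<nu>)\<^esub> D = coset_map2 PE.K (frag_bilinear (box_mult_e S)) C D"
  "C' \<otimes>\<^bsub>lev_G (square \<nu>)\<^esub> D' = coset_map2 PF.K (frag_bilinear (box_mult_G G S)) C' D'"
  "\<zero>\<^bsub>lev_e (square \<nu>)\<^esub> = PE.K" "\<zero>\<^bsub>lev_G (square \<nu>)\<^esub> = PF.K"
  "\<one>\<^bsub>lev_e (square \<nu>)\<^esub> = frag_coset PE.K (frag_of (\<one>\<^bsub>FA\<^esub>, \<one>\<^bsub>FA\<^esub>))"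
  "\<one>\<^bsub>lev_G (square \<nu>)\<^esub> = frag_coset PF.K (frag_of (Ten \<one>\<^bsub>A\<^esub> \<one>\<^bsub>A\<^esub>))"
  "act (square \<nu>) g = coset_map PE.K (frag_extend (\<lambda>(x, y). frag_of (act S g x, act S g y)))"
  "res (square \<nu>) = coset_map PE.K (frag_extend res_gen)"
  "tr (square \<nu>) = coset_map PF.K (frag_extend (\<lambda>(x, y). frag_of (TrTen x y)))"
  "nm (square \<nu>) = \<nu>"
  by (simp_all add: box_with_norm_def Let_def box_def frag_quotient_def box_kernel_eq PE.cosets_def PF.cosets_def
    M_simps(7-9) coind_simps(1,2) ring.defs res_gen_def[abs_def])

lemma square_mult_e:
  "\<lbrakk>C \<in> PE.cosets; D \<in> PE.cosets\<rbrakk> \<Longrightarrow>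
    C \<otimes>\<^bsub>lev_e (square \<nu>)\<^esub> D \<in> PE.cosets \<and> PE.cval (C \<otimes>\<^bsub>lev_e (square \<nu>)\<^esub> D) = PE.cval C \<otimes>\<^bsub>WE\<^esub> PE.cval D"
  unfolding square_simps
  by (rule coset_map2_coset[OF presentation_WE])
    (use frag_value_bilinear[OF WE.ring_axioms PE.f_closed box_mult_e_value] in blast)+

lemma square_mult_G:
  "\<lbrakk>C \<in> PF.cosets; D \<in> PF.cosets\<rbrakk> \<Longrightarrow>
    C \<otimes>\<^bsub>lev_G (square \<nu>)\<^esub> D \<in> PF.cosets \<and> PF.cval (C \<otimes>\<^bsub>lev_G (square \<nu>)\<^esub> D) = PF.cval C \<otimes>\<^bsub>FA\<^esub> PF.cval D"
  unfolding square_simps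
  by (rule coset_map2_coset[OF presentation_FA])
    (use frag_value_bilinear[OF FA.ring_axioms PF.f_closed box_mult_G_value] in blast)+

lemma square_res:
  "D \<in> PF.cosets \<Longrightarrow> res (square \<nu>) D \<in> PE.cosets \<and> PE.cval (res (square \<nu>) D) = res W (PF.cval D)"
  unfolding square_simps
  by (rule coset_map_coset[OF presentation_FA presentation_WE W_add_hom(1)]) (use res_gen_value in blast)+

lemma square_act:
  assumes "g \<in> carrier G"
  shows "C \<in> PE.cosets \<Longrightarrow> act (square \<nu>) g C \<in> PE.cosets \<and> PE.cval (act (square \<nu>) g C) = act W g (PE.cval C)"
  unfolding square_simps
proof (rule coset_map_coset[OF presentation_WE presentation_WE W_add_hom(2)[OF assms]])
  fix u assume "u \<in> box_gens_e M M"
  then obtain x y where u: "u = (x, y)" "x \<in> carrier FA" "y \<in> carrier FA" using gens_e_iff by (cases u) auto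
  have "(act S g x, act S g y) \<in> box_gens_e M M"
    unfolding gens_e_iff by (intro conjI S_act_closed assms u)
  from PE_of[OF this]
  show "Poly_Mapping.keys (case u of (x, y) \<Rightarrow> frag_of (act S g x, act S g y)) \<subseteq> box_gens_e M M"
    "frag_value WE te (case u of (x, y) \<Rightarrow> frag_of (act S g x, act S g y)) = act W g (te u)"
    unfolding u(1) prod.case te_act[OF assms u(2,3)] by blast+
qed

lemma square_tr:
  "C \<in> PE.cosets \<Longrightarrow> tr (square \<nu>) C \<in> PF.cosets \<and> PF.cval (tr (square \<nu>) C) = tr W (PE.cval C)"
  unfolding square_simps
proof (rule coset_map_coset[OF presentation_WE presentation_FA W_add_hom(3)])
  fix u assume "u \<in> box_gens_e M M"
  then obtain x y where u: "u = (x, y)" "x \<in> carrier FA" "y \<in> carrier FA" using gens_e_iff by (cases u) auto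
  have "TrTen x y \<in> box_gens_G M M" unfolding gens_G_simps by (intro conjI u)
  from PF_of[OF this]
  show "Poly_Mapping.keys (case u of (x, y) \<Rightarrow> frag_of (TrTen x y)) \<subseteq> box_gens_G M M"
    "frag_value FA tG (case u of (x, y) \<Rightarrow> frag_of (TrTen x y)) = tr W (te u)"
    unfolding u(1) prod.case tG_TrTen[OF u(2,3)] by blast+
qed

lemma square_one:
  "\<one>\<^bsub>lev_e (square \<nu>)\<^esub> \<in> PE.cosets \<and> PE.cval \<one>\<^bsub>lev_e (square \<nu>)\<^esub> = \<one>\<^bsub>WE\<^esub>"
  "\<one>\<^bsub>lev_G (square \<nu>)\<^esub> \<in> PF.cosets \<and> PF.cval \<one>\<^bsub>lev_G (square \<nu>)\<^esub> = \<one>\<^bsub>FA\<^esub>"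
proof -
  have "(\<one>\<^bsub>FA\<^esub>, \<one>\<^bsub>FA\<^esub>) \<in> box_gens_e M M" by (simp add: gens_e_iff)
  from PE.coset_gen[OF this] show "\<one>\<^bsub>lev_e (square \<nu>)\<^esub> \<in> PE.cosets \<and> PE.cval \<one>\<^bsub>lev_e (square \<nu>)\<^esub> = \<one>\<^bsub>WE\<^esub>"
    unfolding square_simps te_one .
  have "Ten \<one>\<^bsub>A\<^esub> \<one>\<^bsub>A\<^esub> \<in> box_gens_G M M" unfolding gens_G_simps by simp
  from PF.coset_gen[OF this] show "\<one>\<^bsub>lev_G (square \<nu>)\<^esub> \<in> PF.cosets \<and> PF.cval \<one>\<^bsub>lev_G (square \<nu>)\<^esub> = \<one>\<^bsub>FA\<^esub>"
    unfolding square_simps tG_Ten_one .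
qed

lemmas square_carrier = square_simps(1,2)
lemma square_zero:
  "\<zero>\<^bsub>lev_e (square \<nu>)\<^esub> \<in> PE.cosets \<and> PE.cval \<zero>\<^bsub>lev_e (square \<nu>)\<^esub> = \<zero>\<^bsub>WE\<^esub>"
  "\<zero>\<^bsub>lev_G (square \<nu>)\<^esub> \<in> PF.cosets \<and> PF.cval \<zero>\<^bsub>lev_G (square \<nu>)\<^esub> = \<zero>\<^bsub>FA\<^esub>"
  unfolding square_simps by (intro conjI PE.zero_coset PF.zero_coset)+

lemma square_add:
  "\<lbrakk>C \<in> PE.cosets; D \<in> PE.cosets\<rbrakk> \<Longrightarrow>
    C \<oplus>\<^bsub>lev_e (square \<nu>)\<^esub> D \<in> PE.cosets \<and> PE.cval (C \<oplus>\<^bsub>lev_e (square \<nu>)\<^esub> D) = PE.cval C \<oplus>\<^bsub>WE\<^esub> PE.cval D"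
  "\<lbrakk>C' \<in> PF.cosets; D' \<in> PF.cosets\<rbrakk> \<Longrightarrow>
    C' \<oplus>\<^bsub>lev_G (square \<nu>)\<^esub> D' \<in> PF.cosets \<and> PF.cval (C' \<oplus>\<^bsub>lev_G (square \<nu>)\<^esub> D') = PF.cval C' \<oplus>\<^bsub>FA\<^esub> PF.cval D'"
  unfolding square_simps by (rule PE.coset_add PF.coset_add; assumption)+

text \<open>The values of cosets map the square bijectively onto \<open>W\<close>, and any
  \<open>\<nu>\<close> that corresponds to the norm of \<open>W\<close> completes the
  structure.\<close>

lemma tambara_functor_square:
  assumes \<nu>: "\<And>C. C \<in> PE.cosets \<Longrightarrow> \<nu> C \<in> PF.cosets \<and> PF.cval (\<nu> C) = nm W (PE.cval C)"
  shows "tambara_functor G (square \<nu>)"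
proof (rule tambara_functor_subdirect[where F = "{(W, (PE.cval, PF.cval))}", OF is_group])
  show "tambara_ops_closed G (square \<nu>)"
    unfolding tambara_ops_closed_def square_carrier
    by (simp add: square_zero square_one square_add square_mult_e square_mult_G square_act square_res square_tr
      square_simps(14) \<nu>)
  fix S' \<phi> assume "(S', \<phi>) \<in> {(W, (PE.cval, PF.cval))}"
  then have eq: "S' = W" "\<phi> = (PE.cval, PF.cval)" by auto
  show "tambara_ops_hom G (square \<nu>) S' \<phi>"
    unfolding tambara_ops_hom_def eq fst_conv snd_conv square_carrier coind_simps(1,2)
  proof (intro conjI ballI W.tambara_functor_axioms)
    show "PE.cval \<in> ring_hom (lev_e (square \<nu>)) WE" "PF.cval \<in> ring_hom (lev_G (square \<nu>)) FA"
      by (rule ring_hom_memI, simp_all add: square_carrier square_add square_mult_e square_mult_G square_one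
        PE.cval_closed PF.cval_closed)+
  qed (simp_all add: square_zero square_act square_res square_tr square_simps(14) \<nu>)
next
  have "\<ominus>\<^bsub>WE\<^esub> \<one>\<^bsub>WE\<^esub> \<in> carrier WE" "\<ominus>\<^bsub>FA\<^esub> \<one>\<^bsub>FA\<^esub> \<in> carrier FA" by simp_all
  note n = PE.coset_s[OF this(1)] PF.coset_s[OF this(2)]
  show "\<exists>m\<in>carrier (lev_e (square \<nu>)). \<forall>(S', \<phi>)\<in>{(W, (PE.cval, PF.cval))}. fst \<phi> m = \<ominus>\<^bsub>lev_e S'\<^esub> \<one>\<^bsub>lev_e S'\<^esub>"
    unfolding square_carrier using n(1) by (intro bexI[of _ "frag_coset PE.K (se (\<ominus>\<^bsub>WE\<^esub> \<one>\<^bsub>WE\<^esub>))"]) (simp_all add: coind_simps(1,2))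
  show "\<exists>m\<in>carrier (lev_G (square \<nu>)). \<forall>(S', \<phi>)\<in>{(W, (PE.cval, PF.cval))}. snd \<phi> m = \<ominus>\<^bsub>lev_G S'\<^esub> \<one>\<^bsub>lev_G S'\<^esub>"
    unfolding square_carrier using n(2) by (intro bexI[of _ "frag_coset PF.K (sG (\<ominus>\<^bsub>FA\<^esub> \<one>\<^bsub>FA\<^esub>))"]) (simp_all add: coind_simps(1,2))
qed (use PE.cval_inj PF.cval_inj in \<open>simp_all add: square_carrier\<close>)

text \<open>\<open>box_norm\<close> is a choice, so its defining property has to be shown
  satisfiable: the norm of \<open>W\<close>, pulled back by the section, is a witness by
  \<open>tG_nm\<close>. Whatever the choice returns is then the norm of a Tambara functor.\<close>

lemma tambara_functor_box: "tambara_functor G (box_tambara G \<Gamma> S \<eta>)"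
proof -
  define \<nu> where "\<nu> C = frag_coset PF.K (sG (nm W (PE.cval C)))" for C
  have \<nu>: "\<nu> C \<in> PF.cosets \<and> PF.cval (\<nu> C) = nm W (PE.cval C)" if "C \<in> PE.cosets" for C
    unfolding \<nu>_def using W.nm_closed[of "PE.cval C"] PE.cval_closed[OF that]
    by (intro PF.coset_s) (simp only: coind_simps(1,2))
  have "\<nu> (frag_coset PE.K (frag_of (x, y))) = frag_coset PF.K (frag_of (Ten (nm S x) (nm S y)))"
    if "x \<in> carrier (lev_e S)" "y \<in> carrier (lev_e S)" for x y
  proof -
    have xy: "x \<in> carrier FA" "y \<in> carrier FA" using that by (simp_all only: coind_simps(1))
    have "(x, y) \<in> box_gens_e M M" by (simp add: gens_e_iff xy)
    note 1 = PE.coset_gen[OF this]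
    have "Ten (nm S x) (nm S y) \<in> box_gens_G M M"
      unfolding gens_G_simps using S.nm_closed[OF that(1)] S.nm_closed[OF that(2)] by (simp only: coind_simps(2))
    note 2 = PF.coset_gen[OF this]
    show ?thesis
      by (rule PF.cval_inj) (use 1 2 \<nu>[of "frag_coset PE.K (frag_of (x, y))"] in \<open>simp_all only: tG_nm[OF xy]\<close>)
  qed
  then have "tambara_functor G (square \<nu>) \<and> (\<forall>x\<in>carrier (lev_e S). \<forall>y\<in>carrier (lev_e S).
      \<nu> (frag_coset PE.K (frag_of (x, y))) = frag_coset PF.K (frag_of (Ten (nm S x) (nm S y))))"
    using tambara_functor_square[OF \<nu>] by blast
  from someI[where P = "\<lambda>\<nu>. tambara_functor G (square \<nu>) \<and> (\<forall>x\<in>carrier (lev_e S). \<forall>y\<in>carrier (lev_e S).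
      \<nu> (frag_coset PE.K (frag_of (x, y))) = frag_coset PF.K (frag_of (Ten (nm S x) (nm S y))))", OF this]
  show ?thesis unfolding box_tambara_def box_norm_def Let_def box_kernel_eq by (rule conjunct1)
qed

end

text \<open>Needed for the generated ideal to be a Tambara ideal. By equivariance a point over a
  non-fixed point is not fixed, and no point in the orbit of a non-fixed point is fixed, in
  particular not the chosen one.\<close>

lemma (in tambara_functor) higher_norms_closed:
  assumes I: "fst I \<subseteq> carrier (lev_e R)" "snd I \<subseteq> carrier (lev_G R)"
  shows "fst (higher_norms G R I) \<subseteq> carrier (lev_e R)" "snd (higher_norms G R I) \<subseteq> carrier (lev_G R)"
proof -
  interpret Re: cring "lev_e R" by (rule lev_e_cring)
  interpret RG: cring "lev_G R" by (rule lev_G_cring)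
  have fixedI: "fixed_point G \<alpha> x" if "\<And>g. g \<in> carrier G \<Longrightarrow> \<alpha> g x = x" for \<alpha> x
    using that by (auto simp: fixed_point_def stabilizer_def)
  have fixedD: "\<alpha> g x = x" if "fixed_point G \<alpha> x" "g \<in> carrier G" for \<alpha> x g
    using that unfolding fixed_point_def stabilizer_def by blast
  have sec: "(fixed_point G \<alpha> x \<longrightarrow> snd a x \<in> carrier (lev_G R)) \<and>
      (\<not> fixed_point G \<alpha> x \<longrightarrow> fst a x \<in> carrier (lev_e R))"
    if "a \<in> gset_sections G R I X \<alpha>" "x \<in> X" for a X \<alpha> x
    using that I unfolding gset_sections_def by (auto split: if_splits)
  show "fst (higher_norms G R I) \<subseteq> carrier (lev_e R)"
  proof
    fix z assume "z \<in> fst (higher_norms G R I)"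
    then obtain X \<alpha> Y \<beta> h a y where z: "z = gset_norm_e R X h a y"
      and h: "gset_map G X \<alpha> Y \<beta> h" and a: "a \<in> gset_sections G R I X \<alpha>" and y: "\<not> fixed_point G \<beta> y"
      unfolding higher_norms_def fst_conv mem_Collect_eq by (elim exE conjE) (rule that)
    have "fst a x \<in> carrier (lev_e R)" if x: "x \<in> X" "h x = y" for x
    proof -
      have "\<not> fixed_point G \<alpha> x"
      proof
        assume "fixed_point G \<alpha> x"
        then have "\<beta> g y = y" if "g \<in> carrier G" for g
          using h that x fixedD[of \<alpha> x g] unfolding gset_map_def by metis
        then show False using fixedI[of \<beta> y] y by blast
      qed
      then show ?thesis using sec[OF a x(1)] by blast
    qed
    then show "z \<in> carrier (lev_e R)" unfolding z gset_norm_e_def by (intro Re.finprod_closed) auto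
  qed
  show "snd (higher_norms G R I) \<subseteq> carrier (lev_G R)"
  proof
    fix z assume "z \<in> snd (higher_norms G R I)"
    then obtain X \<alpha> Y \<beta> h a y where z: "z = gset_norm_G G R X \<alpha> h a y"
      and X: "finite_gset G X \<alpha>" and a: "a \<in> gset_sections G R I X \<alpha>"
      unfolding higher_norms_def snd_conv mem_Collect_eq by (elim exE conjE) (rule that)
    interpret X: group_action G X \<alpha> using X by (simp add: finite_gset_def)
    interpret G: group G using X.group_hom by (simp add: group_hom_def)
    have "fst a (SOME x. x \<in> Z) \<in> carrier (lev_e R)"
      if Z: "Z \<in> orbits G {x \<in> {x \<in> X. h x = y}. \<not> fixed_point G \<alpha> x} \<alpha>" for Z
    proof -
      obtain x where x: "x \<in> X" "\<not> fixed_point G \<alpha> x" "Z = orbit G \<alpha> x" using Z unfolding orbits_def by blast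
      have "\<alpha> \<one>\<^bsub>G\<^esub> x \<in> Z" using G.one_closed unfolding x(3) orbit_def by blast
      then have "(SOME x. x \<in> Z) \<in> Z" by (rule someI)
      then obtain g where g: "g \<in> carrier G" "(SOME x. x \<in> Z) = \<alpha> g x" unfolding x(3) orbit_def by blast
      have s: "\<alpha> g x \<in> X" by (rule X.element_image[OF g(1) x(1) refl])
      have "\<not> fixed_point G \<alpha> (\<alpha> g x)"
      proof
        assume f: "fixed_point G \<alpha> (\<alpha> g x)"
        have "\<alpha> (inv\<^bsub>G\<^esub> g) (\<alpha> g x) = x" by (rule X.orbit_sym_aux[OF g(1) x(1) refl])
        then have "\<alpha> g x = x" using fixedD[OF f G.inv_closed[OF g(1)]] by simp
        then show False using f x(2) by simp
      qed
      then show ?thesis using sec[OF a s] unfolding g(2) by blast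
    qed
    then show "z \<in> carrier (lev_G R)" unfolding z gset_norm_G_def Let_def
      using sec[OF a] by (intro RG.m_closed RG.finprod_closed Pi_I nm_closed) auto
  qed
qed

text \<open>The product of two elements is their norm along the fold map \<open>G/G \<squnion> G/G \<rightarrow> G/G\<close>.\<close>

lemma (in tambara_functor) mult_in_higher_norms:
  assumes G: "group G" and I: "snd I \<subseteq> carrier (lev_G R)" and uv: "u \<in> snd I" "v \<in> snd I"
  shows "u \<otimes>\<^bsub>lev_G R\<^esub> v \<in> snd (higher_norms G R I)"
proof -
  interpret RG: cring "lev_G R" by (rule lev_G_cring)
  \<comment> \<open>Trivial actions; the identity is cut off outside \<open>X\<close> because it has
    to be the unit of \<open>BijGroup X\<close>.\<close>
  define \<alpha> :: "nat set \<Rightarrow> 'c \<Rightarrow> nat \<Rightarrow> nat" where "\<alpha> X = (\<lambda>g. \<lambda>x\<in>X. x)" for X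
  have act: "group_action G X (\<alpha> X)" for X
  proof -
    have "(\<lambda>x\<in>X. x) = \<one>\<^bsub>BijGroup X\<^esub>" by (simp add: BijGroup_def)
    then have "\<alpha> X \<in> hom G (BijGroup X)"
      using group.is_monoid[OF group_BijGroup[of X]] by (simp add: \<alpha>_def hom_def monoid.l_one monoid.one_closed)
    then show ?thesis using G group_BijGroup[of X] by (simp add: group_action_def group_hom_def group_hom_axioms_def)
  qed
  have fp: "fixed_point G (\<alpha> X) x" if "x \<in> X" for X x
    using that by (simp add: fixed_point_def stabilizer_def \<alpha>_def)
  \<comment> \<open>The first component is arbitrary as both points are fixed.\<close>
  define a :: "(nat \<Rightarrow> 'e) \<times> (nat \<Rightarrow> 'g)" where "a = (undefined, \<lambda>x. if x = 0 then u else v)"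
  have n: "gset_norm_G G R {0, 1} (\<alpha> {0, 1}) (\<lambda>x. 0) a 0 = u \<otimes>\<^bsub>lev_G R\<^esub> v"
  proof -
    have F1: "{x \<in> {0, 1::nat}. (0::nat) = 0} = {0, 1}" by blast
    have "fixed_point G (\<alpha> {0, 1}) x" if "x \<in> {0, 1}" for x using that by (rule fp)
    then have F: "{x \<in> {0, 1}. fixed_point G (\<alpha> {0, 1}) x} = {0, 1}"
      "{x \<in> {0, 1}. \<not> fixed_point G (\<alpha> {0, 1}) x} = {}" by blast+
    have c: "u \<in> carrier (lev_G R)" "v \<in> carrier (lev_G R)" using I uv by auto
    have "(\<Otimes>\<^bsub>lev_G R\<^esub>x\<in>{0, 1}. snd a x) = u \<otimes>\<^bsub>lev_G R\<^esub> v"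
      using c by (subst RG.finprod_insert) (auto simp: a_def)
    then show ?thesis unfolding gset_norm_G_def Let_def F1 F using c by (simp add: orbits_def)
  qed
  have sec: "a \<in> gset_sections G R I {0, 1} (\<alpha> {0, 1})"
    using uv fp by (simp add: gset_sections_def a_def)
  have map: "gset_map G {0, 1} (\<alpha> {0, 1}) {0} (\<alpha> {0}) (\<lambda>x. 0)"
    by (simp add: gset_map_def \<alpha>_def)
  have "{x \<in> {0, 1::nat}. (0::nat) = 0} = {0, 1}" by blast
  then have card: "\<forall>z\<in>{0::nat}. 2 \<le> card {x \<in> {0, 1::nat}. (0::nat) = z}" unfolding ball_simps by simp
  have fin: "finite_gset G {0, 1} (\<alpha> {0, 1})" "finite_gset G {0} (\<alpha> {0})"
    using act by (simp_all add: finite_gset_def)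
  have "0 \<in> {0::nat}" and fp0: "fixed_point G (\<alpha> {0}) 0" using fp by simp_all
  then show ?thesis
    unfolding higher_norms_def snd_conv
    by (intro CollectI exI[of _ "{0, 1}"] exI[of _ "\<alpha> {0, 1}"] exI[of _ "{0}"] exI[of _ "\<alpha> {0}"]
      exI[of _ "\<lambda>x. 0"] exI[of _ a] exI[of _ 0] conjI n[symmetric] fin map card sec)
qed

text \<open>The coset of each element of \<open>I\<close> is \<open>H\<close> itself, so the
  quotient consists of the single class \<open>H\<close>.\<close>

lemma trivial_group_quotient:
  fixes B :: "'a ring"
  assumes "ring B" and H: "ideal H B" and I: "I \<subseteq> H" "I \<noteq> {}"
  shows "trivial_group ((B\<lparr>carrier := I\<rparr>) A_Mod H)"
proof -
  interpret B: ring B by fact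
  interpret H: ideal H B by (rule H)
  have coset: "(\<Union>h\<in>H. {h \<oplus>\<^bsub>B\<^esub> a}) = H" if a: "a \<in> H" for a
  proof (intro equalityI subsetI)
    fix h assume h: "h \<in> H"
    have "h = (h \<ominus>\<^bsub>B\<^esub> a) \<oplus>\<^bsub>B\<^esub> a"
      using H.Icarr[OF h] H.Icarr[OF a] by (simp add: B.minus_eq B.a_assoc B.l_neg)
    moreover have "h \<ominus>\<^bsub>B\<^esub> a \<in> H" unfolding B.minus_eq by (intro H.a_closed H.a_inv_closed h a)
    ultimately show "h \<in> (\<Union>h\<in>H. {h \<oplus>\<^bsub>B\<^esub> a})" by blast
  qed (use H.a_closed a in blast)
  have mult: "(\<Union>h\<in>H. \<Union>k\<in>H. {h \<oplus>\<^bsub>B\<^esub> k}) = H"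
  proof -
    have "(\<Union>h\<in>H. \<Union>k\<in>H. {h \<oplus>\<^bsub>B\<^esub> k}) = (\<Union>k\<in>H. \<Union>h\<in>H. {h \<oplus>\<^bsub>B\<^esub> k})" by blast
    also have "\<dots> = (\<Union>k\<in>H. H)" by (rule SUP_cong[OF refl coset])
    also have "\<dots> = H" using H.zero_closed by blast
    finally show ?thesis .
  qed
  have B': "carrier (B\<lparr>carrier := I\<rparr>) = I" "add (B\<lparr>carrier := I\<rparr>) = add B" by simp_all
  have "carrier ((B\<lparr>carrier := I\<rparr>) A_Mod H) = (\<Union>a\<in>I. {\<Union>h\<in>H. {h \<oplus>\<^bsub>B\<^esub> a}})"
    unfolding A_FactGroup_def FactGroup_def RCOSETS_def r_coset_def partial_object.select_convs monoid.select_convs B' ..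
  also have "\<dots> = (\<Union>a\<in>I. {H})" by (rule SUP_cong[OF refl]) (use coset I in blast)
  also have "\<dots> = {H}" using I(2) by blast
  finally have car: "carrier ((B\<lparr>carrier := I\<rparr>) A_Mod H) = {H}" .
  have one: "\<one>\<^bsub>(B\<lparr>carrier := I\<rparr>) A_Mod H\<^esub> = H"
    unfolding A_FactGroup_def FactGroup_def monoid.select_convs ..
  have mul: "H \<otimes>\<^bsub>(B\<lparr>carrier := I\<rparr>) A_Mod H\<^esub> H = H"
    unfolding A_FactGroup_def FactGroup_def set_mult_def monoid.select_convs B' by (rule mult)
  have "trivial_group X" if "carrier X = {x}" "\<one>\<^bsub>X\<^esub> = x" "x \<otimes>\<^bsub>X\<^esub> x = x" for X :: "'a set monoid" and x
    using that by (auto simp: trivial_group_def intro!: groupI)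
  from this[OF car one mul] show ?thesis .
qed

section \<open>Vanishing of the Kaehler differentials\<close>

context coind_square begin

lemma eta_app: "\<lbrakk>r \<in> carrier A; g \<in> carrier G\<rbrakk> \<Longrightarrow> fst \<eta> r g = act R g r"
  by (simp add: eta_simps)

text \<open>At the unit of \<open>G\<close>, \<open>act S g y\<close> takes the value
  \<open>y g\<close> and \<open>fst \<eta> (x g)\<close> the value \<open>x g\<close>. This is why
  multiplication becomes an evaluation.\<close>

lemma te_app_one:
  assumes x: "x \<in> carrier FA" and y: "y \<in> carrier FA" and g: "g \<in> carrier G"
  shows "te (x, y) g \<one> = x g \<otimes>\<^bsub>A\<^esub> y g"
proof -
  have "act S g y \<one> = y g" using g by (simp add: coind_simps(3))
  then show ?thesis
    unfolding te_eq[OF g] fun_ring_app(1)[OF one_closed] using FA_app[OF x g] by (simp add: eta_app act_one)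
qed

lemma box_multiplication_e:
  assumes C: "C \<in> PE.cosets"
  shows "fst (box_multiplication S) C = (\<lambda>g\<in>carrier G. PE.cval C g \<one>)"
  unfolding box_multiplication_def fst_conv coind_simps(1)
proof (rule PE.the_elem_frag_eval[where F = "\<lambda>s. \<lambda>g\<in>carrier G. s g \<one>", OF FA.abelian_group_axioms _ _ C])
  show "(\<lambda>s. \<lambda>g\<in>carrier G. s g \<one>) \<in> hom (add_monoid WE) (add_monoid FA)"
    using FA_app[OF WE_app] fun_ring_app(2)[of _ "carrier G" FA] fun_ring_app(2)[OF one_closed, of A]
    by (auto simp: hom_def fun_ring_simps(1,3)[of _ A] intro!: restrict_ext)
  fix u assume "u \<in> box_gens_e M M"
  then obtain x y where u: "u = (x, y)" "x \<in> carrier FA" "y \<in> carrier FA" using gens_e_iff by (cases u) auto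
  show "(case u of (x, y) \<Rightarrow> x \<otimes>\<^bsub>FA\<^esub> y) = (\<lambda>g\<in>carrier G. te u g \<one>)"
    unfolding u(1) prod.case fun_ring_simps(2) by (rule restrict_ext) (simp add: te_app_one u(2,3))
qed

lemma box_multiplication_G:
  assumes C: "C \<in> PF.cosets"
  shows "snd (box_multiplication S) C = PF.cval C \<one>"
  unfolding box_multiplication_def snd_conv coind_simps(2)
proof (rule PF.the_elem_frag_eval[where F = "\<lambda>f. f \<one>", OF A.abelian_group_axioms _ _ C])
  show "(\<lambda>f. f \<one>) \<in> hom (add_monoid FA) (add_monoid A)"
    using fun_ring_eval_hom[OF one_closed, of A] by (simp add: hom_def ring_hom_def)
  fix u assume u: "u \<in> box_gens_G M M"
  show "(case u of Ten a b \<Rightarrow> a \<otimes>\<^bsub>A\<^esub> b | TrTen x y \<Rightarrow> tr S (x \<otimes>\<^bsub>lev_e S\<^esub> y)) = tG u \<one>"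
  proof (cases u)
    case (Ten a b)
    then have ab: "a \<in> carrier A" "b \<in> carrier A" using u gens_G_simps(1) by blast+
    show ?thesis unfolding Ten tG_Ten fun_ring_app(1)[OF one_closed] using ab
      by (simp add: eta_app act_one coind_simps(4))
  next
    case (TrTen x y)
    then have xy: "x \<in> carrier FA" "y \<in> carrier FA" using u gens_G_simps(2) by blast+
    have "tG u \<one> = (\<Oplus>\<^bsub>A\<^esub>g\<in>carrier G. te (x, y) g \<one>)"
      unfolding TrTen tG_TrTen[OF xy] coind_simps(5)
      by (rule fun_ring_finsum[OF A.is_cring one_closed])
        (use WE_app[OF te_WE[OF xy]] in \<open>simp add: fun_ring_simps(1)\<close>)
    also have "\<dots> = tr S (x \<otimes>\<^bsub>FA\<^esub> y)"
      unfolding coind_simps(5)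
      by (rule A.finsum_cong') (simp_all add: te_app_one xy fun_ring_app FA_app)
    finally show ?thesis unfolding TrTen by (simp add: coind_simps(1))
  qed
qed

text \<open>
  The idempotent \<open>\<epsilon>\<close> below generates the kernel; as \<open>u = u \<cdot> \<epsilon>\<close> for \<open>u\<close> in the kernel, \<open>u\<close> is a higher norm.
\<close>

proposition kaehler_trivial:
  "trivial_group (kaehler_e G \<Gamma> S \<eta>)" "trivial_group (kaehler_G G \<Gamma> S \<eta>)"
proof -
  define B where "B = box_tambara G \<Gamma> S \<eta>"
  obtain \<nu> where B: "B = square \<nu>" unfolding B_def box_tambara_def by blast
  interpret B: tambara_functor G B unfolding B_def by (rule tambara_functor_box)
  interpret Be: cring "lev_e B" by (rule B.lev_e_cring)
  interpret BG: cring "lev_G B" by (rule B.lev_G_cring)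
  define I where "I = tambara_kernel B S (box_multiplication S)"
  have Ie: "v \<in> fst I \<longleftrightarrow> v \<in> PE.cosets \<and> (\<lambda>g\<in>carrier G. PE.cval v g \<one>) = \<zero>\<^bsub>FA\<^esub>" for v
    using box_multiplication_e[of v] by (auto simp: I_def tambara_kernel_def B square_carrier coind_simps(1))
  have IG: "u \<in> snd I \<longleftrightarrow> u \<in> PF.cosets \<and> PF.cval u \<one> = \<zero>\<^bsub>A\<^esub>" for u
    using box_multiplication_G[of u] by (auto simp: I_def tambara_kernel_def B square_carrier coind_simps(2))
  have Ic: "fst I \<subseteq> carrier (lev_e B)" "snd I \<subseteq> carrier (lev_G B)"
    using Ie IG by (auto simp: B square_carrier)
  \<comment> \<open>The indicator of the complement of the unit, a neutral element for the functions
    vanishing at the unit.\<close>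
  define e where "e = (\<lambda>g\<in>carrier G. if g = \<one> then \<zero>\<^bsub>A\<^esub> else \<one>\<^bsub>A\<^esub>)"
  have e: "e \<in> carrier FA" by (simp add: e_def fun_ring_simps)
  have mult_e: "f \<otimes>\<^bsub>FA\<^esub> e = f" if f: "f \<in> carrier FA" "f \<one> = \<zero>\<^bsub>A\<^esub>" for f
  proof
    fix g
    show "(f \<otimes>\<^bsub>FA\<^esub> e) g = f g"
    proof (cases "g \<in> carrier G")
      case True
      then show ?thesis using f FA_app[OF f(1) True] by (simp add: fun_ring_app e_def)
    next
      case False
      then show ?thesis using f(1) by (auto simp: fun_ring_simps PiE_def extensional_def)
    qed
  qed
  define \<epsilon> where "\<epsilon> = frag_coset PF.K (sG e)"
  have \<epsilon>: "\<epsilon> \<in> PF.cosets" "PF.cval \<epsilon> = e" using PF.coset_s[OF e] by (simp_all add: \<epsilon>_def)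
  have \<epsilon>I: "\<epsilon> \<in> snd I" unfolding IG using \<epsilon> by (simp add: e_def)
  have u\<epsilon>: "u \<otimes>\<^bsub>lev_G B\<^esub> \<epsilon> = u" if u: "u \<in> snd I" for u
  proof -
    have u: "u \<in> PF.cosets" "PF.cval u \<one> = \<zero>\<^bsub>A\<^esub>" using u IG by auto
    note m = square_mult_G[OF u(1) \<epsilon>(1), of \<nu>]
    show ?thesis unfolding B
      by (rule PF.cval_inj) (use m u mult_e[OF PF.cval_closed[OF u(1)] u(2)] \<epsilon>(2) in auto)
  qed
  \<comment> \<open>At level \<open>G/e\<close> the kernel consists of families of functions that
    all vanish at the unit; the restriction of \<open>\<epsilon>\<close>, the constant family
    \<open>e\<close>, fixes them.\<close>
  have v\<epsilon>: "v \<otimes>\<^bsub>lev_e B\<^esub> res B \<epsilon> = v" if v: "v \<in> fst I" for v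
  proof -
    have v: "v \<in> PE.cosets" "(\<lambda>g\<in>carrier G. PE.cval v g \<one>) = \<zero>\<^bsub>FA\<^esub>" using v Ie by auto
    note vc = PE.cval_closed[OF v(1)]
    have v1: "PE.cval v g \<one> = \<zero>\<^bsub>A\<^esub>" if "g \<in> carrier G" for g
      using fun_cong[OF v(2), of g] that by (simp add: fun_ring_app)
    note r = square_res[OF \<epsilon>(1), of \<nu>]
    note m = square_mult_e[OF v(1) conjunct1[OF r], of \<nu>]
    have rW: "res W e \<in> carrier WE" by (rule ring_hom_closed[OF W_hom(1) e])
    have "PE.cval v \<otimes>\<^bsub>WE\<^esub> res W e = PE.cval v"
    proof (rule WE_ext)
      fix g assume g: "g \<in> carrier G"
      have "res W e g = e" using g by (simp add: coind_simps(4))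
      then show "(PE.cval v \<otimes>\<^bsub>WE\<^esub> res W e) g = PE.cval v g"
        unfolding fun_ring_app(1)[OF g] using mult_e[OF WE_app[OF vc g] v1[OF g]] by simp
    qed (intro WE.m_closed vc rW)+
    then show ?thesis unfolding B
      by (intro PE.cval_inj conjunct1[OF m] v(1)) (use m r \<epsilon>(2) in auto)
  qed
  define H where "H = higher_ideal G B I"
  have H: "tambara_ideal G B H"
    unfolding H_def higher_ideal_def by (rule B.tambara_ideal_gen[OF B.higher_norms_closed[OF Ic]])
  have sup: "subset2 (higher_norms G B I) H"
    unfolding H_def higher_ideal_def by (rule gen_tambara_ideal_superset)
  have HG: "snd I \<subseteq> snd H"
  proof
    fix u assume u: "u \<in> snd I"
    have "u \<otimes>\<^bsub>lev_G B\<^esub> \<epsilon> \<in> snd H"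
      using B.mult_in_higher_norms[OF is_group Ic(2) u \<epsilon>I] sup unfolding subset2_def by blast
    then show "u \<in> snd H" unfolding u\<epsilon>[OF u] .
  qed
  have He: "fst I \<subseteq> fst H"
  proof
    fix v assume v: "v \<in> fst I"
    \<comment> \<open>Level \<open>G/e\<close> follows from level \<open>G/G\<close> by restricting
      the idempotent.\<close>
    have "res B \<epsilon> \<in> fst H" using HG \<epsilon>I by (intro tambara_idealD(4)[OF H]) blast
    then have "v \<otimes>\<^bsub>lev_e B\<^esub> res B \<epsilon> \<in> fst H"
      using v Ic(1) by (intro ideal.I_l_closed[OF tambara_idealD(1)[OF H]]) blast+
    then show "v \<in> fst H" unfolding v\<epsilon>[OF v] .
  qed
  have "PE.K \<in> fst I" unfolding Ie using PE.zero_coset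
    by (auto simp: fun_ring_app fun_ring_simps(5)[of _ A] intro!: restrict_ext)
  then have ne: "fst I \<noteq> {}" "snd I \<noteq> {}" using \<epsilon>I by blast+
  show "trivial_group (kaehler_e G \<Gamma> S \<eta>)"
    using trivial_group_quotient[OF Be.ring_axioms tambara_idealD(1)[OF H] He ne(1)]
    by (simp only: kaehler_e_def Let_def B_def I_def H_def)
  show "trivial_group (kaehler_G G \<Gamma> S \<eta>)"
    using trivial_group_quotient[OF BG.ring_axioms tambara_idealD(2)[OF H] HG ne(2)]
    by (simp only: kaehler_G_def Let_def B_def I_def H_def)
qed

end

lemma (in prime_order_tambara) coind_square: "coind_square G R"
proof -
  have "tambara_module G \<Gamma> (algebra_module S \<eta>)" by (rule tambara_module_algebra[OF unit_hom])
  then show ?thesis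
    by (intro coind_square.intro box_context.intro prime_order_tambara_axioms)
qed

theorem theoremE:
  fixes p :: nat and G :: "'c monoid" and R :: "('c, 'e, 'g) tambara"
  assumes "prime p"
    and "group G" and "order G = p"
    and "tambara_functor G R"
    and "tr R ` carrier (lev_e R) \<noteq> carrier (lev_G R)"
  shows "etale TYPE('u) G (ghost G R) (coind G (lev_e R)) (coind_unit G (ghost G R)) \<and>
    \<not> open_map (nakaoka_spectrum G (coind G (lev_e R))) (nakaoka_spectrum G (ghost G R))
        (spectrum_map (ghost G R) (coind_unit G (ghost G R)))"
proof -
  interpret prime_order_tambara G R
    using assms(1-4)
    by (intro prime_order_tambara.intro prime_order_group.intro prime_order_group_axioms.intro) simp_all
  interpret sq: coind_square G R by (rule coind_square)
  have "etale TYPE('u) G \<Gamma> S \<eta>"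
    unfolding etale_def
    by (intro conjI unit_hom finitely_presented_coind flat_coind sq.kaehler_trivial)
  then show ?thesis using spectrum_map_coind_not_open[OF assms(5)] by (rule conjI)
qed

end
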